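(* Let $1<p\le\infty$, let $\Omega\subset\mathbb{R}^N$ be a domain of class $C^{0,\omega}$ (with associated radius $r>0$) and boundary $\Gamma$, and set $\psi(t)=\min_{0\le s\le r}\sqrt{s^2+[t-\omega(s)]^2}$. Let $h:\Gamma\times(0,\infty)\to\mathbb{R}$ satisfy $\underline h\le h\le\overline h$ on $\Gamma\times(0,\infty)$ for some positive numbers $\underline h,\overline h$, and let $w$ be the bounded viscosity solution of $w_t=\Delta_p^Gw$ in $\Omega\times(0,\infty)$, $w=0$ on $\Omega\times\{0\}$, $w=h$ on $\Gamma\times(0,\infty)$. Then $$4t\log w(x,t)=-p'\,d_\Gamma(x)^2+O(t\log\psi(t))\quad\text{as }t\to0^+,$$ uniformly on every compact subset of $\overline\Omega$.
   Context: $N\ge2$; $\Omega$ is not necessarily bounded. $p'=p/(p-1)$, with $p'=1$ if $p=\infty$. $d_\Gamma(x)=\min_{y\in\Gamma}|x-y|$. Class $C^{0,\omega}$: let $\omega:(0,\infty)\to(0,\infty)$ be strictly increasing and continuous with $\omega(\tau)\to0$ as $\tau\to0^+$ (set $\omega(0)=0$). $\Omega$ is of class $C^{0,\omega}$ if there is $r>0$ such that for every $x\in\Gamma$ there are a coordinate system $(y',y_N)\in\mathbb{R}^{N-1}\times\mathbb{R}$ and a function $\phi:\mathbb{R}^{N-1}\to\mathbb{R}$ with: (i) $B_r(x)\cap\Omega=\{(y',y_N)\in B_r(x):y_N<\phi(y')\}$; (ii) $B_r(x)\cap\Gamma=\{(y',y_N)\in B_r(x):y_N=\phi(y')\}$;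 (iii) $|\phi(y')-\phi(z')|\le\omega(|y'-z'|)$ for all $(y',\phi(y')),(z',\phi(z'))\in B_r(x)\cap\Gamma$. The game-theoretic (normalized) $p$-Laplacian is $\Delta_p^Gu=\frac1p\Big\{\Delta u+(p-2)\frac{\langle\nabla^2u\,\nabla u,\nabla u\rangle}{|\nabla u|^2}\Big\}$, and $\Delta_\infty^G$ is its limit as $p\to\infty$, i.e. $\Delta_\infty^Gu=\frac{\langle\nabla^2u\,\nabla u,\nabla u\rangle}{|\nabla u|^2}$. Put $F(\xi,X)=\frac1p\mathrm{tr}X+(1-\frac2p)\frac{\langle X\xi,\xi\rangle}{|\xi|^2}$ for $\xi\in\mathbb{R}^N\setminus\{0\}$ and $X$ real symmetric $N\times N$ (with $1/p=0$ if $p=\infty$), $F_*(\xi,X)=\lim_{\rho\to0^+}\inf\{F(\eta,Y):\eta\ne0,|\eta-\xi|<\rho,|Y-X|<\rho\}$ and $F^*=-(-F)_*$. A function $u\in C(\Omega\times(0,\infty))$ is a viscosity solution of $u_t=\Delta_p^Gu$ if at every $(x,t)\in\Omega\times(0,\infty)$: for every $\varphi\in C^2(\Omega\times(0,\infty))$ such that $u-\varphi$ attains its maximum at $(x,t)$, $\varphi_t-F^*(\nabla\varphi,\nabla^2\varphi)\le0$ at $(x,t)$; and for every $\varphi\in C^2(\Omega\times(0,\infty))$ such that $u-\varphi$ attains its minimum at $(x,t)$, $\varphi_t-F_*(\nabla\varphi,\nabla^2\varphi)\ge0$ at $(x,t)$. The initial and boundary conditions are meant classically: the solution is continuous on $\overline\Omega\times[0,\infty)$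 away from $\Gamma\times\{0\}$. *)

theory Defs
  imports "HOL-Analysis.Analysis"
begin

section \<open>Domains of class \<open>C\<^sup>0\<^sup>,\<^sup>\<omega>\<close>\<close>

definition modulus_of_continuity :: "(real \<Rightarrow> real) \<Rightarrow> bool" where
  "modulus_of_continuity \<omega> \<longleftrightarrow>
     \<omega> 0 = 0 \<and> (\<forall>\<tau>>0. 0 < \<omega> \<tau>) \<and> strict_mono_on {0<..} \<omega> \<and>
     continuous_on {0<..} \<omega> \<and> (\<omega> \<longlongrightarrow> 0) (at_right 0)"

text \<open>
  A Cartesian coordinate system \<open>(y', y\<^sub>N)\<close> is given by the unit vector \<open>e\<close> of the \<open>y\<^sub>N\<close>-axis:
  the coordinates of \<open>y\<close> are \<open>y\<^sub>N = y \<bullet> e\<close> and \<open>y' = horizontal e y\<close>, an element of the hyperplane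
  \<open>{v. v \<bullet> e = 0}\<close>, which any orthonormal basis of it identifies isometrically with the Euclidean
  space of dimension \<open>N - 1\<close>.  The point with coordinates \<open>(y', y\<^sub>N)\<close> is \<open>y' + y\<^sub>N *\<^sub>R e\<close>.
  A shift of the origin only replaces the function \<open>\<phi>\<close> below by a translate of it; only the values
  of \<open>\<phi>\<close> on the hyperplane are used.
\<close>

definition horizontal :: "'a::real_inner \<Rightarrow> 'a \<Rightarrow> 'a" where
  "horizontal e y = y - (y \<bullet> e) *\<^sub>R e"

definition class_C0 :: "(real \<Rightarrow> real) \<Rightarrow> real \<Rightarrow> 'a::euclidean_space set \<Rightarrow> bool" where
  "class_C0 \<omega> r \<Omega> \<longleftrightarrow>
     (\<forall>x\<in>frontier \<Omega>. \<exists>e (\<phi> :: 'a \<Rightarrow> real). norm e = 1 \<and>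
        ball x r \<inter> \<Omega> = {y \<in> ball x r. y \<bullet> e < \<phi> (horizontal e y)} \<and>
        ball x r \<inter> frontier \<Omega> = {y \<in> ball x r. y \<bullet> e = \<phi> (horizontal e y)} \<and>
        (\<forall>y' z'. y' \<bullet> e = 0 \<longrightarrow> z' \<bullet> e = 0 \<longrightarrow>
           y' + \<phi> y' *\<^sub>R e \<in> ball x r \<inter> frontier \<Omega> \<longrightarrow>
           z' + \<phi> z' *\<^sub>R e \<in> ball x r \<inter> frontier \<Omega> \<longrightarrow>
           \<bar>\<phi> y' - \<phi> z'\<bar> \<le> \<omega> (norm (y' - z'))))"

text \<open>The infimum is a minimum when \<open>\<omega>\<close> is a modulus of continuity and \<open>0 \<le> r\<close>.\<close>

definition psi :: "(real \<Rightarrow> real) \<Rightarrow> real \<Rightarrow> real \<Rightarrow> real" where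
  "psi \<omega> r t = (INF s\<in>{0..r}. sqrt (s\<^sup>2 + (t - \<omega> s)\<^sup>2))"

section \<open>The game-theoretic \<open>p\<close>-Laplacian\<close>

definition conj_exponent :: "ereal \<Rightarrow> real" where
  "conj_exponent p = (if p = \<infinity> then 1 else real_of_ereal p / (real_of_ereal p - 1))"

text \<open>In the extended reals \<open>1 / \<infinity> = 0\<close>, so \<open>p = \<infinity>\<close> needs no separate case.\<close>

definition game_F :: "ereal \<Rightarrow> real^'n \<Rightarrow> real^'n^'n \<Rightarrow> real" where
  "game_F p \<xi> X =
     real_of_ereal (1 / p) * trace X +
     (1 - 2 * real_of_ereal (1 / p)) * (((X *v \<xi>) \<bullet> \<xi>) / (norm \<xi>)\<^sup>2)"

text \<open>
  Semicontinuous envelopes of a function defined for nonzero vectors and symmetric matrices.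
  The real \<open>Inf\<close> and \<open>Lim\<close> are genuine for \<open>G = game_F p\<close> and its negative, which are bounded on
  bounded sets; the choice of the matrix norm is immaterial.
\<close>

definition lower_env ::
    "(real^'n \<Rightarrow> real^'n^'n \<Rightarrow> real) \<Rightarrow> real^'n \<Rightarrow> real^'n^'n \<Rightarrow> real" where
  "lower_env G \<xi> X =
     Lim (at_right 0) (\<lambda>\<rho>. Inf {G \<eta> Y |\<eta> Y. \<eta> \<noteq> 0 \<and> transpose Y = Y \<and>
                                     norm (\<eta> - \<xi>) < \<rho> \<and> norm (Y - X) < \<rho>})"

definition upper_env ::
    "(real^'n \<Rightarrow> real^'n^'n \<Rightarrow> real) \<Rightarrow> real^'n \<Rightarrow> real^'n^'n \<Rightarrow> real" where
  "upper_env G \<xi> X = - lower_env (\<lambda>\<eta> Y. - G \<eta> Y) \<xi> X"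

section \<open>Viscosity solutions\<close>

text \<open>Twice continuous (Frechet) differentiability; meant for open \<open>S\<close>.\<close>

definition C2_on :: "'a::real_normed_vector set \<Rightarrow> ('a \<Rightarrow> real) \<Rightarrow> bool" where
  "C2_on S f \<longleftrightarrow>
     (\<exists>(D :: 'a \<Rightarrow> 'a \<Rightarrow>\<^sub>L real) (D2 :: 'a \<Rightarrow> 'a \<Rightarrow>\<^sub>L 'a \<Rightarrow>\<^sub>L real).
        (\<forall>z\<in>S. (f has_derivative blinfun_apply (D z)) (at z)) \<and>
        (\<forall>z\<in>S. (D has_derivative blinfun_apply (D2 z)) (at z)) \<and>
        continuous_on S D2)"

definition partial_deriv :: "'n \<Rightarrow> (real^'n \<Rightarrow> real) \<Rightarrow> real^'n \<Rightarrow> real" where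
  "partial_deriv i f x = deriv (\<lambda>s. f (x + s *\<^sub>R axis i 1)) 0"

definition gradient :: "(real^'n \<Rightarrow> real) \<Rightarrow> real^'n \<Rightarrow> real^'n" where
  "gradient f x = (\<chi> i. partial_deriv i f x)"

definition hessian :: "(real^'n \<Rightarrow> real) \<Rightarrow> real^'n \<Rightarrow> real^'n^'n" where
  "hessian f x = (\<chi> i j. partial_deriv i (partial_deriv j f) x)"

text \<open>
  Functions of space and time are functions of pairs \<open>(x, t)\<close>; \<open>\<nabla>\<close> and \<open>\<nabla>\<^sup>2\<close> act on the space
  variable only.
\<close>

definition game_viscosity_solution ::
    "ereal \<Rightarrow> (real^'n) set \<Rightarrow> ((real^'n) \<times> real \<Rightarrow> real) \<Rightarrow> bool" where
  "game_viscosity_solution p \<Omega> u \<longleftrightarrow>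
     continuous_on (\<Omega> \<times> {0<..}) u \<and>
     (\<forall>x\<in>\<Omega>. \<forall>t>0. \<forall>\<phi>. C2_on (\<Omega> \<times> {0<..}) \<phi> \<longrightarrow>
        ((\<forall>z\<in>\<Omega> \<times> {0<..}. u z - \<phi> z \<le> u (x, t) - \<phi> (x, t)) \<longrightarrow>
           deriv (\<lambda>s. \<phi> (x, s)) t -
             upper_env (game_F p) (gradient (\<lambda>y. \<phi> (y, t)) x) (hessian (\<lambda>y. \<phi> (y, t)) x) \<le> 0) \<and>
        ((\<forall>z\<in>\<Omega> \<times> {0<..}. u z - \<phi> z \<ge> u (x, t) - \<phi> (x, t)) \<longrightarrow>
           deriv (\<lambda>s. \<phi> (x, s)) t -
             lower_env (game_F p) (gradient (\<lambda>y. \<phi> (y, t)) x) (hessian (\<lambda>y. \<phi> (y, t)) x) \<ge> 0))"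

text \<open>
  Bounded solutions of the initial-boundary value problem with zero initial data and boundary data
  \<open>h\<close>.  Nothing is required on \<open>frontier \<Omega> \<times> {0}\<close>, where the data are discontinuous.
\<close>

definition bounded_IBVP_solution ::
    "ereal \<Rightarrow> (real^'n) set \<Rightarrow> ((real^'n) \<times> real \<Rightarrow> real) \<Rightarrow> ((real^'n) \<times> real \<Rightarrow> real) \<Rightarrow> bool" where
  "bounded_IBVP_solution p \<Omega> h w \<longleftrightarrow>
     game_viscosity_solution p \<Omega> w \<and>
     bounded (w ` (\<Omega> \<times> {0<..})) \<and>
     continuous_on (closure \<Omega> \<times> {0..} - frontier \<Omega> \<times> {0}) w \<and>
     (\<forall>x\<in>\<Omega>. w (x, 0) = 0) \<and>
     (\<forall>x\<in>frontier \<Omega>. \<forall>t>0. w (x, t) = h (x, t))"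

end

theory Submission
  imports Defs
begin
text \<open>
  Write \<open>\<alpha> = 1 / p\<close>, \<open>\<kappa> = 1 - \<alpha> = 1 / p'\<close> and \<open>\<kappa> n = \<alpha> N + 1 - 2 \<alpha>\<close>.  On radial functions with nonzero
  gradient the operator is \<open>\<kappa>\<close> times the Laplacian in the (possibly fractional) dimension \<open>n\<close>, so
  the heat kernel of that dimension and its spherical averages are explicit solutions, with the
  Gaussian \<open>exp (- \<rho>\<^sup>2 / (4 \<kappa> t))\<close> that appears in the claim.  The estimate follows from two barriers.

  Upper bound.  On the ball of radius about \<open>d\<^sub>\<Gamma>(x)\<close> around \<open>x\<close>, which lies in the domain and where the
  solution vanishes initially, a radial barrier gives \<open>w \<le> M t\<^sup>-\<^sup>c exp (- d\<^sup>2 / (4 \<kappa> t))\<close>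
  (\<open>ball_lower\<close>, applied to \<open>- w\<close>); powers of \<open>t\<close> only cost \<open>O(t log t)\<close>, and \<open>\<psi>(t) \<le> t\<close>.

  Lower bound.  At a nearest boundary point \<open>y\<close> the point \<open>z = y + t e\<close> (with \<open>e\<close> the outward axis of the
  local chart) has distance at least \<open>\<psi>(t)\<close> from the closed domain (\<open>exterior_point\<close>).  The heat kernel
  centred at \<open>z\<close> and scaled to stay below the boundary data is a subsolution (\<open>exterior_lower\<close>); the
  scaling factor is a power of \<open>\<psi>(t)\<close>, which is the source of the error term.

  The second argument needs \<open>w \<ge> 0\<close> for small times.  This is the delicate point, because nothing
  but boundedness is known near the corner where the boundary meets the initial time, so the maximum
  principle cannot be applied directly.  It is obtained by contraction: if \<open>w \<ge> - M\<close> on \<open>(0, T)\<close>, then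
  \<open>w \<ge> - \<theta> M\<close> there with a fixed \<open>\<theta> < 1\<close>.

  For \<open>p = \<infinity>\<close> an explicit barrier with a conical singularity at a boundary point
  (\<open>near_boundary_inf\<close>) gives the contraction at distance \<open>O(\<surd>t)\<close> from the boundary, and the ball
  barrier gives it elsewhere.  For \<open>p < \<infinity>\<close> a single boundary point need not carry such a barrier.
  Instead \<open>v = min w 0\<close>, extended by zero, is a supersolution in the whole space, and one studies
  \<open>v(x, t) + v(y, t + \<eta>)\<close>.  For \<open>x = y\<close> and small \<open>t\<close> this is at least \<open>- 1\<close> up to a small error (with
  \<open>v \<ge> - 1\<close>), since one of the two terms is small: the second one near the boundary and the first one
  away from it.  The Ishii--Lions method, with reflection coupling, turns the bound on the diagonal
  at times in \<open>[\<tau>/2, \<tau>]\<close> into a Hoelder bound off the diagonal at time \<open>\<tau>\<close> (\<open>ishii_lions\<close>); doubling of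
  variables with synchronous coupling then carries the bound on the diagonal from \<open>\<tau>\<close> to \<open>2 \<tau>\<close>
  (\<open>sync_step\<close>), the errors forming a geometric series.  Letting \<open>\<eta> \<rightarrow> 0\<close> gives \<open>2 v \<ge> - 5/4\<close>.

  Both steps rest on the theorem on sums of viscosity supersolutions at points with nonzero gradients
  (\<open>theorem_on_sums\<close>).  It is proved without the theorem of Alexandrov: inf-convolution makes the
  gradient nearly constant near the contact point, so that each supersolution is, up to a small error, a
  supersolution of a linear equation with constant coefficients; there one compares with
  exact solutions built from trigonometric polynomials.
\<close>

section \<open>Parabolic second order jets\<close>

text \<open>
 A second order Taylor expansion in space and first order in time at one point.  The error allowed
 in time is quadratic, which suffices because test functions are used only through the
 first derivative in time; no smoothness away from the point is required.
\<close>

definition pjet :: "('a::real_inner \<times> real => real) => 'a => real => real => 'a => ('a => real) => bool" where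
 "pjet phi x t a xi q \<longleftrightarrow> (\<exists>B. \<forall>v. \<bar>q v\<bar> <= B * (norm v)\<^sup>2) \<and>
   (\<forall>eps>0. \<exists>C. \<exists>dlt>0. \<forall>v s. norm v < dlt --> \<bar>s\<bar> < dlt -->
    \<bar>phi (x + v, t + s) - (phi (x, t) + a * s + xi \<bullet> v + q v / 2)\<bar> <= eps * (norm v)\<^sup>2 + C * s\<^sup>2)"

lemma pjetD:
 fixes x :: "'a::real_inner"
 assumes "pjet phi x t a xi q" "0 < eps"
 obtains C dlt where "0 < dlt" "dlt <= 1" "0 <= C"
  "\<And>v s. norm v < dlt ==> \<bar>s\<bar> < dlt ==>
    \<bar>phi (x + v, t + s) - (phi (x, t) + a * s + xi \<bullet> v + q v / 2)\<bar> <= eps * (norm v)\<^sup>2 + C * s\<^sup>2"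
proof -
 obtain C d where d: "d > 0" and *: "\<And>v s. norm v < d ==> \<bar>s\<bar> < d ==>
    \<bar>phi (x + v, t + s) - (phi (x, t) + a * s + xi \<bullet> v + q v / 2)\<bar> <= eps * (norm v)\<^sup>2 + C * s\<^sup>2"
  using assms unfolding pjet_def by meson
 show ?thesis
 proof (rule that[of "min d 1" "\<bar>C\<bar>"])
  fix v :: 'a and s :: real assume "norm v < min d 1" "\<bar>s\<bar> < min d (1::real)"
  then have "\<bar>phi (x + v, t + s) - (phi (x, t) + a * s + xi \<bullet> v + q v / 2)\<bar> <= eps * (norm v)\<^sup>2 + C * s\<^sup>2"
   using * by simp
  also have "C * s\<^sup>2 <= \<bar>C\<bar> * s\<^sup>2" by (intro mult_right_mono) auto
  finally show "\<bar>phi (x + v, t + s) - (phi (x, t) + a * s + xi \<bullet> v + q v / 2)\<bar> <= eps * (norm v)\<^sup>2 + \<bar>C\<bar> * s\<^sup>2"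
   by simp
 qed (use d in auto)
qed

lemma pjetI_exact:
 assumes "\<And>v. \<bar>q v\<bar> <= B * (norm v)\<^sup>2"
  and "\<And>v s. phi (x + v, t + s) = phi (x, t) + a * s + xi \<bullet> v + q v / 2"
 shows "pjet phi x t a xi q"
 unfolding pjet_def
proof (intro conjI allI impI)
 show "\<exists>B. \<forall>v. \<bar>q v\<bar> <= B * (norm v)\<^sup>2" using assms(1) by blast
 fix e :: real assume "e > 0"
 then show "\<exists>C. \<exists>dlt>0. \<forall>v s. norm v < dlt --> \<bar>s\<bar> < dlt -->
    \<bar>phi (x + v, t + s) - (phi (x, t) + a * s + xi \<bullet> v + q v / 2)\<bar> <= e * (norm v)\<^sup>2 + C * s\<^sup>2"
  by (rule_tac exI[of _ 0], rule_tac exI[of _ 1]) (auto simp: assms(2))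
qed

lemma pjet_const: "pjet (\<lambda>z. c) x t 0 0 (\<lambda>v. 0)"
 by (rule pjetI_exact[where B=0]) auto

lemma pjet_linear: "pjet (\<lambda>z. k \<bullet> fst z) x t 0 k (\<lambda>v. 0)"
 by (rule pjetI_exact[where B=0]) (auto simp: inner_add_right)

lemma pjet_snd: "pjet (\<lambda>z. snd z) x t 1 0 (\<lambda>v. 0)"
 by (rule pjetI_exact[where B=0]) auto

lemma pjet_norm2: "pjet (\<lambda>z. (norm (fst z - z0))\<^sup>2) x t 0 (2 *\<^sub>R (x - z0)) (\<lambda>v. 2 * (norm v)\<^sup>2)"
 by (rule pjetI_exact[where B=2])
  (auto simp: power2_norm_eq_inner inner_add_left inner_add_right inner_diff_left inner_diff_right inner_commute algebra_simps)

lemma pjet_add: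
 fixes x :: "'a::real_inner"
 assumes "pjet f x t a xi q" "pjet g x t b eta r"
 shows "pjet (\<lambda>z. f z + g z) x t (a + b) (xi + eta) (\<lambda>v. q v + r v)"
 unfolding pjet_def
proof (intro conjI allI impI)
 obtain B where B: "\<And>v. \<bar>q v\<bar> <= B * (norm v)\<^sup>2" using assms(1) unfolding pjet_def by blast
 obtain B' where B': "\<And>v. \<bar>r v\<bar> <= B' * (norm v)\<^sup>2" using assms(2) unfolding pjet_def by blast
 have "\<bar>q v + r v\<bar> <= (B + B') * (norm v)\<^sup>2" for v
  using B[of v] B'[of v] by (simp add: distrib_right)
 then show "\<exists>B. \<forall>v. \<bar>q v + r v\<bar> <= B * (norm v)\<^sup>2" by blast
 fix e :: real assume e: "e > 0"
 obtain C d where C: "0 < d" "0 <= C" "\<And>v s. norm v < d ==> \<bar>s\<bar> < d ==>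
    \<bar>f (x + v, t + s) - (f (x, t) + a * s + xi \<bullet> v + q v / 2)\<bar> <= (e/2) * (norm v)\<^sup>2 + C * s\<^sup>2"
  using pjetD[OF assms(1), of "e/2"] e by (metis half_gt_zero)
 obtain C' d' where C': "0 < d'" "0 <= C'" "\<And>v s. norm v < d' ==> \<bar>s\<bar> < d' ==>
    \<bar>g (x + v, t + s) - (g (x, t) + b * s + eta \<bullet> v + r v / 2)\<bar> <= (e/2) * (norm v)\<^sup>2 + C' * s\<^sup>2"
  using pjetD[OF assms(2), of "e/2"] e by (metis half_gt_zero)
 show "\<exists>C. \<exists>dlt>0. \<forall>v s. norm v < dlt --> \<bar>s\<bar> < dlt -->
    \<bar>f (x + v, t + s) + g (x + v, t + s) - (f (x, t) + g (x, t) + (a + b) * s + (xi + eta) \<bullet> v + (q v + r v) / 2)\<bar> <= e * (norm v)\<^sup>2 + C * s\<^sup>2"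
 proof (rule exI[of _ "C + C'"], rule exI[of _ "min d d'"], intro conjI allI impI)
  fix v :: 'a and s :: real assume *: "norm v < min d d'" "\<bar>s\<bar> < min d d'"
  have "\<bar>f (x + v, t + s) + g (x + v, t + s) - (f (x, t) + g (x, t) + (a + b) * s + (xi + eta) \<bullet> v + (q v + r v) / 2)\<bar>
   <= \<bar>f (x + v, t + s) - (f (x, t) + a * s + xi \<bullet> v + q v / 2)\<bar> + \<bar>g (x + v, t + s) - (g (x, t) + b * s + eta \<bullet> v + r v / 2)\<bar>"
   by (simp add: inner_add_left algebra_simps add_divide_distrib)
  also have "\<dots> <= ((e/2) * (norm v)\<^sup>2 + C * s\<^sup>2) + ((e/2) * (norm v)\<^sup>2 + C' * s\<^sup>2)"
   using * by (intro add_mono C C') auto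
  also have "\<dots> = e * (norm v)\<^sup>2 + (C + C') * s\<^sup>2" by (simp add: algebra_simps)
  finally show "\<bar>f (x + v, t + s) + g (x + v, t + s) - (f (x, t) + g (x, t) + (a + b) * s + (xi + eta) \<bullet> v + (q v + r v) / 2)\<bar> <= e * (norm v)\<^sup>2 + (C + C') * s\<^sup>2" .
 qed (use C C' in auto)
qed

text \<open>
 Peano expansion of order two of a function of one variable: the form in which outer functions enter the chain rule for jets.
\<close>

definition peano2 :: "(real => real) => real => real => real => bool" where
 "peano2 g y g1 g2 \<longleftrightarrow> (\<forall>eps>0. \<exists>dlt>0. \<forall>h. \<bar>h\<bar> < dlt --> \<bar>g (y + h) - (g y + g1 * h + g2 * h\<^sup>2 / 2)\<bar> <= eps * h\<^sup>2)"

lemma peano2I: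
 assumes d: "d > 0" and g': "\<And>z. \<bar>z - y\<bar> < d ==> (g has_real_derivative g' z) (at z)"
  and g2: "(g' has_real_derivative g2) (at y)"
 shows "peano2 g y (g' y) g2"
 unfolding peano2_def
proof (intro allI impI)
 fix e :: real assume e: "e > 0"
 have "((\<lambda>h. (g' (y + h) - g' y) / h) \<longlongrightarrow> g2) (at 0)"
  using g2 unfolding DERIV_def .
 then have "\<forall>\<^sub>F h in at 0. dist ((g' (y + h) - g' y) / h) g2 < e" using e tendstoD by blast
 then obtain r where r: "r > 0" "\<And>h. h \<noteq> 0 ==> \<bar>h\<bar> < r ==> \<bar>(g' (y + h) - g' y) / h - g2\<bar> < e"
  unfolding eventually_at by (auto simp: dist_real_def)
 have r': "\<bar>g' (y + h) - g' y - g2 * h\<bar> <= e * \<bar>h\<bar>" if "\<bar>h\<bar> < r" for h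
 proof (cases "h = 0")
  case False
  have "\<bar>g' (y + h) - g' y - g2 * h\<bar> = \<bar>(g' (y + h) - g' y) / h - g2\<bar> * \<bar>h\<bar>"
  proof -
   have "g' (y + h) - g' y - g2 * h = ((g' (y + h) - g' y) / h - g2) * h" using False by (simp add: left_diff_distrib del: left_diff_distrib_numeral) (simp add: diff_divide_distrib)
   then show ?thesis by (simp add: abs_mult)
  qed
  also have "\<dots> <= e * \<bar>h\<bar>" using r(2)[OF False that] by (intro mult_right_mono) auto
  finally show ?thesis .
 qed auto
 show "\<exists>dlt>0. \<forall>h. \<bar>h\<bar> < dlt --> \<bar>g (y + h) - (g y + g' y * h + g2 * h\<^sup>2 / 2)\<bar> <= e * h\<^sup>2"
 proof (intro exI[of _ "min d r"] conjI allI impI)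
  show "0 < min d r" using d r by auto
  fix h :: real assume h: "\<bar>h\<bar> < min d r"
  define k where "k = (\<lambda>tht. g (y + tht * h) - (g y + g' y * (tht * h) + g2 * (tht * h)\<^sup>2 / 2))"
  have dk: "(k has_real_derivative (g' (y + tht * h) - g' y - g2 * (tht * h)) * h) (at tht)" if "0 <= tht" "tht <= 1" for tht
  proof -
   have "\<bar>tht * h\<bar> <= \<bar>h\<bar>" using that by (simp add: abs_mult mult_left_le_one_le)
   then have "\<bar>(y + tht * h) - y\<bar> < d" using h by auto
   from g'[OF this] show ?thesis unfolding k_def
    by (auto intro!: derivative_eq_intros DERIV_chain2[where f=g] simp: algebra_simps power2_eq_square)
  qed
  obtain tht where th: "0 < tht" "tht < 1" "k 1 - k 0 = (1 - 0) * ((g' (y + tht * h) - g' y - g2 * (tht * h)) * h)"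
   using MVT2[of 0 1 k "\<lambda>tht. (g' (y + tht * h) - g' y - g2 * (tht * h)) * h"] dk by auto
  have a: "\<bar>tht * h\<bar> <= \<bar>h\<bar>" using th by (simp add: abs_mult mult_left_le_one_le)
  have "\<bar>k 1 - k 0\<bar> <= (e * \<bar>tht * h\<bar>) * \<bar>h\<bar>"
   using th(3) r'[of "tht * h"] a h by (auto simp: abs_mult intro!: mult_right_mono)
  also have "\<dots> <= e * \<bar>h\<bar> * \<bar>h\<bar>" using a e by (intro mult_right_mono mult_left_mono) auto
  also have "\<dots> = e * h\<^sup>2" by (simp add: power2_eq_square)
  finally show "\<bar>g (y + h) - (g y + g' y * h + g2 * h\<^sup>2 / 2)\<bar> <= e * h\<^sup>2"
   by (simp add: k_def)
 qed
qed

text \<open>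
 Chain rule; the square of the linear part is where the second derivative of the outer function acts.
\<close>

lemma pjet_comp:
 fixes x :: "'a::real_inner"
 assumes j: "pjet f x t a xi q" and g: "peano2 g (f (x, t)) g1 g2"
 shows "pjet (\<lambda>z. g (f z)) x t (g1 * a) (g1 *\<^sub>R xi) (\<lambda>v. g1 * q v + g2 * (xi \<bullet> v)\<^sup>2)"
 unfolding pjet_def
proof (intro conjI allI impI)
 obtain B0 where B0: "\<And>v. \<bar>q v\<bar> <= B0 * (norm v)\<^sup>2" using j unfolding pjet_def by blast
 define B where "B = \<bar>B0\<bar>"
 have B: "\<bar>q v\<bar> <= B * (norm v)\<^sup>2" "B \<ge> 0" for v
  using order_trans[OF B0 mult_right_mono[of B0 "\<bar>B0\<bar>"]] by (auto simp: B_def)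
 have xi: "\<bar>xi \<bullet> v\<bar> <= norm xi * norm v" for v by (rule Cauchy_Schwarz_ineq2)
 have "\<bar>g1 * q v + g2 * (xi \<bullet> v)\<^sup>2\<bar> <= (\<bar>g1\<bar> * B + \<bar>g2\<bar> * (norm xi)\<^sup>2) * (norm v)\<^sup>2" for v
 proof -
  have "(xi \<bullet> v)\<^sup>2 <= (norm xi)\<^sup>2 * (norm v)\<^sup>2"
   using power_mono[OF xi[of v], of 2] by (simp add: power_mult_distrib)
  then have "\<bar>g2 * (xi \<bullet> v)\<^sup>2\<bar> <= \<bar>g2\<bar> * ((norm xi)\<^sup>2 * (norm v)\<^sup>2)" by (simp add: abs_mult mult_left_mono)
  moreover have "\<bar>g1 * q v\<bar> <= \<bar>g1\<bar> * (B * (norm v)\<^sup>2)" using B(1)[of v] by (simp add: abs_mult mult_left_mono)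
  ultimately show ?thesis by (simp add: algebra_simps)
 qed
 then show "\<exists>B. \<forall>v. \<bar>g1 * q v + g2 * (xi \<bullet> v)\<^sup>2\<bar> <= B * (norm v)\<^sup>2" by blast
 fix e :: real assume e: "e > 0"
 obtain C1 d1 where C1: "0 < d1" "d1 <= 1" "0 <= C1" and P1: "\<And>v s. norm v < d1 ==> \<bar>s\<bar> < d1 ==>
    \<bar>f (x + v, t + s) - (f (x, t) + a * s + xi \<bullet> v + q v / 2)\<bar> <= 1 * (norm v)\<^sup>2 + C1 * s\<^sup>2"
  using pjetD[OF j, of 1] by (metis zero_less_one)
 define D where "D = 1 + \<bar>a\<bar> + norm xi"
 define K where "K = B / 2 + 1 + C1"
 have D: "D \<ge> 1" and K: "K \<ge> 1" using B C1 by (auto simp: D_def K_def)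
 define e1 where "e1 = e / 4 / (2 * (D + K)\<^sup>2)"
 have DK: "(D + K)\<^sup>2 > 0" using D K by (simp add: zero_less_power)
 have e1: "e1 > 0" using e DK by (simp add: e1_def)
 obtain d2 where d2: "d2 > 0" and P2: "\<And>h. \<bar>h\<bar> < d2 ==> \<bar>g (f (x,t) + h) - (g (f (x,t)) + g1 * h + g2 * h\<^sup>2 / 2)\<bar> <= e1 * h\<^sup>2"
  using g e1 unfolding peano2_def by blast
 define e3 where "e3 = e / 4 / (\<bar>g1\<bar> + 1)"
 have e3: "e3 > 0" using e by (simp add: e3_def)
 obtain C3 d3 where C3: "0 < d3" "0 <= C3" and P3: "\<And>v s. norm v < d3 ==> \<bar>s\<bar> < d3 ==>
    \<bar>f (x + v, t + s) - (f (x, t) + a * s + xi \<bullet> v + q v / 2)\<bar> <= e3 * (norm v)\<^sup>2 + C3 * s\<^sup>2"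
  using pjetD[OF j e3] by metis
 define M where "M = \<bar>g2\<bar> + 1"
 have M: "M \<ge> 1" by (simp add: M_def)
 define d where "d = Min {d1, d3, d2 / (2 * (D + K)), e / 4 / (2 * (2 * D + K) * K * M)}"
 have pos: "D + K > 0" "2 * (2 * D + K) * K * M > 0" using D K M by auto
 have d: "d > 0" using C1 C3 d2 e pos by (auto simp: d_def)
 have dle: "d <= d1" "d <= d3" "d <= d2 / (2 * (D + K))" "d <= e / 4 / (2 * (2 * D + K) * K * M)"
  by (auto simp: d_def)
 define kappa where "kappa = e / 4 / (2 * \<bar>a\<bar> * norm xi * M + 1)"
 have kden: "2 * \<bar>a\<bar> * norm xi * M + 1 > 0" using M by (simp add: add_nonneg_pos)
 have k: "kappa > 0" using e kden by (simp add: kappa_def)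
 define C where "C = e + (\<bar>g1\<bar> + 1) * C3 + M * (2 * \<bar>a\<bar> * norm xi / (4 * kappa) + a\<^sup>2) + e"
 show "\<exists>C. \<exists>dlt>0. \<forall>v s. norm v < dlt --> \<bar>s\<bar> < dlt -->
    \<bar>g (f (x + v, t + s)) - (g (f (x, t)) + g1 * a * s + (g1 *\<^sub>R xi) \<bullet> v + (g1 * q v + g2 * (xi \<bullet> v)\<^sup>2) / 2)\<bar> <= e * (norm v)\<^sup>2 + C * s\<^sup>2"
 proof (rule exI[of _ C], rule exI[of _ d], intro conjI allI impI d)
  fix v :: 'a and s :: real assume vs: "norm v < d" "\<bar>s\<bar> < d"
  define n where "n = norm v"
  define N where "N = n\<^sup>2 + s\<^sup>2"
  have n0: "n \<ge> 0" and N0: "N \<ge> 0" by (auto simp: n_def N_def)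
  have nd: "n < d" using vs by (simp add: n_def)
  define h where "h = f (x + v, t + s) - f (x, t)"
  define L where "L = a * s + xi \<bullet> v"
  define rho where "rho = h - L"
  have R1: "\<bar>rho - q v / 2\<bar> <= n\<^sup>2 + C1 * s\<^sup>2"
   using P1[of v s] vs dle by (simp add: rho_def h_def L_def n_def algebra_simps)
  have R3: "\<bar>rho - q v / 2\<bar> <= e3 * n\<^sup>2 + C3 * s\<^sup>2"
   using P3[of v s] vs dle by (simp add: rho_def h_def L_def n_def algebra_simps)
  have rho: "\<bar>rho\<bar> <= K * N"
  proof -
   have "\<bar>rho\<bar> <= \<bar>q v\<bar> / 2 + (n\<^sup>2 + C1 * s\<^sup>2)" using R1 by linarith
   also have "\<dots> <= B * n\<^sup>2 / 2 + (n\<^sup>2 + C1 * s\<^sup>2)" using B(1)[of v] by (simp add: n_def)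
   also have "\<dots> <= K * N"
   proof -
    have "0 <= C1 * n\<^sup>2" "0 <= B * s\<^sup>2" using B C1 by auto
    then show ?thesis by (simp add: K_def N_def algebra_simps)
   qed
   finally show ?thesis .
  qed
  have L: "\<bar>L\<bar> <= D * (n + \<bar>s\<bar>)"
  proof -
   have "\<bar>L\<bar> <= \<bar>a\<bar> * \<bar>s\<bar> + norm xi * n" using xi[of v] by (simp add: L_def n_def abs_mult[symmetric])
   also have "\<dots> <= D * (n + \<bar>s\<bar>)"
   proof -
    have "D * (n + \<bar>s\<bar>) - (\<bar>a\<bar> * \<bar>s\<bar> + norm xi * n) = \<bar>a\<bar> * n + norm xi * \<bar>s\<bar> + (n + \<bar>s\<bar>)"
     by (simp add: D_def algebra_simps)
    moreover have "0 <= \<bar>a\<bar> * n + norm xi * \<bar>s\<bar> + (n + \<bar>s\<bar>)" using n0 by simp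
    ultimately show ?thesis by linarith
   qed
   finally show ?thesis .
  qed
  have d1: "d <= 1" using dle C1 by simp
  have N1: "N <= n + \<bar>s\<bar>"
  proof -
   have "n * n <= 1 * n" using nd d1 n0 by (intro mult_right_mono) auto
   moreover have "\<bar>s\<bar> * \<bar>s\<bar> <= 1 * \<bar>s\<bar>" using vs d1 by (intro mult_right_mono) auto
   ultimately show ?thesis by (simp add: N_def power2_eq_square)
  qed
  have KN: "K * N <= K * (n + \<bar>s\<bar>)" using N1 K by (intro mult_left_mono) auto
  have hh: "\<bar>h\<bar> <= (D + K) * (n + \<bar>s\<bar>)"
  proof -
   have "\<bar>h\<bar> <= \<bar>L\<bar> + \<bar>rho\<bar>" by (simp add: rho_def)
   also have "\<dots> <= D * (n + \<bar>s\<bar>) + K * (n + \<bar>s\<bar>)"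
    using L rho KN by linarith
   finally show ?thesis by (simp add: distrib_right)
  qed
  have sq: "(n + \<bar>s\<bar>)\<^sup>2 <= 2 * N"
   using sum_squares_bound[of n "\<bar>s\<bar>"] by (simp add: N_def power2_sum)
  have h2: "h\<^sup>2 <= 2 * (D + K)\<^sup>2 * N"
  proof -
   have "h\<^sup>2 <= ((D + K) * (n + \<bar>s\<bar>))\<^sup>2" using power_mono[OF hh, of 2] by simp
   also have "\<dots> <= (D + K)\<^sup>2 * (2 * N)" using sq by (simp add: power_mult_distrib mult_left_mono)
   finally show ?thesis by (simp add: algebra_simps)
  qed
  have hd: "\<bar>h\<bar> < d2"
  proof -
   have "(D + K) * (n + \<bar>s\<bar>) < (D + K) * (2 * d)" using nd vs pos by (intro mult_strict_left_mono) auto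
   also have "\<dots> <= d2" using dle(3) pos by (simp add: field_simps)
   finally show ?thesis using hh by linarith
  qed
  have T1: "\<bar>g (f (x,t) + h) - (g (f (x,t)) + g1 * h + g2 * h\<^sup>2 / 2)\<bar> <= e / 4 * N"
  proof -
   have "e1 * h\<^sup>2 <= e1 * (2 * (D + K)\<^sup>2 * N)" using h2 e1 by (intro mult_left_mono) auto
   also have "\<dots> = e / 4 * N" using DK by (simp add: e1_def)
   finally show ?thesis using P2[OF hd] by linarith
  qed
  have T2: "\<bar>g1 * (h - L - q v / 2)\<bar> <= e / 4 * n\<^sup>2 + (\<bar>g1\<bar> + 1) * C3 * s\<^sup>2"
  proof -
   have "\<bar>g1 * (h - L - q v / 2)\<bar> <= (\<bar>g1\<bar> + 1) * (e3 * n\<^sup>2 + C3 * s\<^sup>2)"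
    using R3 unfolding rho_def abs_mult by (intro mult_mono) auto
   also have "\<dots> = ((\<bar>g1\<bar> + 1) * e3) * n\<^sup>2 + (\<bar>g1\<bar> + 1) * C3 * s\<^sup>2" by (simp add: algebra_simps)
   also have "(\<bar>g1\<bar> + 1) * e3 = e / 4"
   proof -
    have "c \<noteq> 0 ==> c * (e / 4 / c) = e / 4" for c :: real by simp
    moreover have "\<bar>g1\<bar> + 1 \<noteq> 0" by linarith
    ultimately show ?thesis unfolding e3_def by blast
   qed
   finally show ?thesis .
  qed
  have T3: "\<bar>h\<^sup>2 - (xi \<bullet> v)\<^sup>2\<bar> * M <= e / 4 * n\<^sup>2 + M * (2 * \<bar>a\<bar> * norm xi / (4 * kappa) + a\<^sup>2) * s\<^sup>2 + e / 4 * N"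
  proof -
   have eq: "h\<^sup>2 - (xi \<bullet> v)\<^sup>2 = (2 * a * s * (xi \<bullet> v) + a\<^sup>2 * s\<^sup>2) + (2 * L + rho) * rho"
    unfolding rho_def L_def by (simp add: power2_eq_square algebra_simps)
   have a1: "\<bar>2 * a * s * (xi \<bullet> v)\<bar> <= 2 * \<bar>a\<bar> * norm xi * (kappa * n\<^sup>2 + s\<^sup>2 / (4 * kappa))"
   proof -
    have "\<bar>s\<bar> * n <= kappa * n\<^sup>2 + s\<^sup>2 / (4 * kappa)"
    proof -
     have "0 <= (2 * kappa * n - \<bar>s\<bar>)\<^sup>2 / (4 * kappa)" using k by simp
     also have "\<dots> = kappa * n\<^sup>2 + s\<^sup>2 / (4 * kappa) - \<bar>s\<bar> * n"
      using k by (simp add: power2_diff field_simps power2_eq_square)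
     finally show ?thesis by simp
    qed
    moreover have "\<bar>2 * a * s * (xi \<bullet> v)\<bar> <= 2 * \<bar>a\<bar> * norm xi * (\<bar>s\<bar> * n)"
    proof -
     have "\<bar>2 * a * s * (xi \<bullet> v)\<bar> = (2 * \<bar>a\<bar> * \<bar>s\<bar>) * \<bar>xi \<bullet> v\<bar>" by (simp add: abs_mult)
     also have "\<dots> <= (2 * \<bar>a\<bar> * \<bar>s\<bar>) * (norm xi * n)" using xi[of v] by (intro mult_left_mono) (auto simp: n_def)
     finally show ?thesis by (simp add: algebra_simps)
    qed
    ultimately show ?thesis
     by (smt (verit) mult_left_mono mult_nonneg_nonneg norm_ge_zero)
   qed
   have a2: "\<bar>(2 * L + rho) * rho\<bar> <= (2 * (2 * D + K) * d) * (K * N)"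
   proof -
    have "\<bar>2 * L + rho\<bar> <= 2 * (D * (n + \<bar>s\<bar>)) + K * (n + \<bar>s\<bar>)"
     using L rho KN by linarith
    also have "\<dots> = (2 * D + K) * (n + \<bar>s\<bar>)" by (simp add: algebra_simps)
    also have "\<dots> <= (2 * D + K) * (2 * d)" using nd vs D K by (intro mult_left_mono) auto
    finally have "\<bar>2 * L + rho\<bar> <= 2 * (2 * D + K) * d" by (simp only: mult.left_commute mult.assoc)
    then show ?thesis unfolding abs_mult using rho by (intro mult_mono) auto
   qed
   have a3: "(2 * (2 * D + K) * d) * (K * N) * M <= e / 4 * N"
   proof -
    have "2 * (2 * D + K) * K * M * d <= e / 4" using dle(4) pos by (simp add: field_simps)
    then have "2 * (2 * D + K) * K * M * d * N <= e / 4 * N" using N0 by (intro mult_right_mono)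
    then show ?thesis by (simp add: algebra_simps)
   qed
   have a4: "2 * \<bar>a\<bar> * norm xi * kappa * M * n\<^sup>2 <= e / 4 * n\<^sup>2"
   proof -
    have "2 * \<bar>a\<bar> * norm xi * kappa * M <= (2 * \<bar>a\<bar> * norm xi * M + 1) * kappa" using k by (simp add: algebra_simps)
    also have "\<dots> = e / 4"
    proof -
     have "c \<noteq> 0 ==> c * (e / 4 / c) = e / 4" for c :: real by simp
     then show ?thesis unfolding kappa_def using kden by (metis less_irrefl)
    qed
    finally show ?thesis by (intro mult_right_mono) auto
   qed
   have "\<bar>h\<^sup>2 - (xi \<bullet> v)\<^sup>2\<bar> * M <= (2 * \<bar>a\<bar> * norm xi * (kappa * n\<^sup>2 + s\<^sup>2 / (4 * kappa)) + a\<^sup>2 * s\<^sup>2 + (2 * (2 * D + K) * d) * (K * N)) * M"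
   proof (rule mult_right_mono)
    have "0 <= a\<^sup>2 * s\<^sup>2" by simp
    then show "\<bar>h\<^sup>2 - (xi \<bullet> v)\<^sup>2\<bar> <= 2 * \<bar>a\<bar> * norm xi * (kappa * n\<^sup>2 + s\<^sup>2 / (4 * kappa)) + a\<^sup>2 * s\<^sup>2 + (2 * (2 * D + K) * d) * (K * N)"
     unfolding eq using a1 a2 by linarith
   qed (use M in auto)
   also have "\<dots> = 2 * \<bar>a\<bar> * norm xi * kappa * M * n\<^sup>2 + M * (2 * \<bar>a\<bar> * norm xi / (4 * kappa) + a\<^sup>2) * s\<^sup>2 + (2 * (2 * D + K) * d) * (K * N) * M"
    using k by (simp add: field_simps)
   also have "\<dots> <= e / 4 * n\<^sup>2 + M * (2 * \<bar>a\<bar> * norm xi / (4 * kappa) + a\<^sup>2) * s\<^sup>2 + e / 4 * N"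
    using a3 a4 by linarith
   finally show ?thesis .
  qed
  have T3': "\<bar>g2 / 2 * (h\<^sup>2 - (xi \<bullet> v)\<^sup>2)\<bar> <= \<bar>h\<^sup>2 - (xi \<bullet> v)\<^sup>2\<bar> * M"
  proof -
   have "\<bar>g2 / 2\<bar> <= M" by (simp add: M_def)
   then have "\<bar>g2 / 2\<bar> * \<bar>h\<^sup>2 - (xi \<bullet> v)\<^sup>2\<bar> <= M * \<bar>h\<^sup>2 - (xi \<bullet> v)\<^sup>2\<bar>" by (intro mult_right_mono) auto
   then show ?thesis by (simp add: abs_mult mult.commute)
  qed
  have split: "g (f (x + v, t + s)) - (g (f (x, t)) + g1 * a * s + (g1 *\<^sub>R xi) \<bullet> v + (g1 * q v + g2 * (xi \<bullet> v)\<^sup>2) / 2)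
   = (g (f (x,t) + h) - (g (f (x,t)) + g1 * h + g2 * h\<^sup>2 / 2)) + g1 * (h - L - q v / 2) + g2 / 2 * (h\<^sup>2 - (xi \<bullet> v)\<^sup>2)"
   by (simp add: h_def L_def algebra_simps add_divide_distrib diff_divide_distrib)
  have "\<bar>g (f (x + v, t + s)) - (g (f (x, t)) + g1 * a * s + (g1 *\<^sub>R xi) \<bullet> v + (g1 * q v + g2 * (xi \<bullet> v)\<^sup>2) / 2)\<bar>
   <= e / 4 * N + (e / 4 * n\<^sup>2 + (\<bar>g1\<bar> + 1) * C3 * s\<^sup>2) + (e / 4 * n\<^sup>2 + M * (2 * \<bar>a\<bar> * norm xi / (4 * kappa) + a\<^sup>2) * s\<^sup>2 + e / 4 * N)"
   unfolding split using T1 T2 T3 T3' by linarith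
  also have "\<dots> = e * n\<^sup>2 + (e / 2 + (\<bar>g1\<bar> + 1) * C3 + M * (2 * \<bar>a\<bar> * norm xi / (4 * kappa) + a\<^sup>2)) * s\<^sup>2"
   by (simp add: N_def algebra_simps)
  also have "\<dots> <= e * n\<^sup>2 + C * s\<^sup>2"
   using e by (intro add_left_mono mult_right_mono) (auto simp: C_def)
  finally show "\<bar>g (f (x + v, t + s)) - (g (f (x, t)) + g1 * a * s + (g1 *\<^sub>R xi) \<bullet> v + (g1 * q v + g2 * (xi \<bullet> v)\<^sup>2) / 2)\<bar> <= e * (norm v)\<^sup>2 + C * s\<^sup>2"
   by (simp add: n_def)
 qed
qed

lemma pjet_cong:
 assumes "pjet f x t a xi q" "a = b" "xi = eta" "\<And>v. q v = r v" "\<And>z. f z = g z"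
 shows "pjet g x t b eta r"
proof -
 have "q = r" "f = g" using assms by auto
 then show ?thesis using assms by simp
qed

lemma pjet_cmult:
 assumes "pjet f x t a xi q"
 shows "pjet (\<lambda>z. c * f z) x t (c * a) (c *\<^sub>R xi) (\<lambda>v. c * q v)"
proof -
 have "peano2 (\<lambda>y. c * y) (f (x, t)) c 0"
  unfolding peano2_def by (auto simp: algebra_simps intro!: exI[of _ 1])
 from pjet_comp[OF assms this] show ?thesis by simp
qed

lemma pjet_minus:
 assumes "pjet f x t a xi q"
 shows "pjet (\<lambda>z. - f z) x t (- a) (- xi) (\<lambda>v. - q v)"
 using pjet_cmult[OF assms, of "-1"] by simp

lemma pjet_mult:
 assumes f: "pjet f x t a xi q" and g: "pjet g x t b eta r"
 shows "pjet (\<lambda>z. f z * g z) x t (f (x,t) * b + g (x,t) * a) (f (x,t) *\<^sub>R eta + g (x,t) *\<^sub>R xi)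
   (\<lambda>v. f (x,t) * r v + g (x,t) * q v + 2 * (xi \<bullet> v) * (eta \<bullet> v))"
proof -
 have P: "peano2 (\<lambda>y. y\<^sup>2) y (2 * y) 2" for y
  unfolding peano2_def by (auto simp: algebra_simps power2_eq_square intro!: exI[of _ 1])
 note s = pjet_comp[OF pjet_add[OF f g] P]
 note s1 = pjet_cmult[OF pjet_comp[OF f P], of "-1"]
 note s2 = pjet_cmult[OF pjet_comp[OF g P], of "-1"]
 note s3 = pjet_cmult[OF pjet_add[OF pjet_add[OF s s1] s2], of "1/2"]
 show ?thesis
  by (rule pjet_cong[OF s3]) (simp_all add: algebra_simps power2_eq_square inner_add_left scaleR_add_left scaleR_half_double flip: scaleR_2)
qed

section \<open>From viscosity solutions to jet inequalities\<close>

definition isqf :: "(real^'n => real) => bool" where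
 "isqf q \<longleftrightarrow> (\<exists>X :: real^'n^'n. transpose X = X \<and> (\<forall>v. q v = (X *v v) \<bullet> v))"

definition Fq :: "real => real^'n => (real^'n => real) => real" where
 "Fq alpha eta q = alpha * (\<Sum>i\<in>UNIV. q (axis i 1)) + (1 - 2 * alpha) * (q eta / (norm eta)\<^sup>2)"

text \<open>
 The supersolution inequality with the lower envelope spelt out: if \<open>m\<close> bounds the operator from below at
 all nonzero gradients near \<open>xi\<close>, then \<open>m\<close> bounds the time derivative.
\<close>

definition super_at :: "real => ((real^'n) \<times> real => real) => real^'n => real => bool" where
 "super_at alpha u x t \<longleftrightarrow> (\<forall>phi a xi q m. pjet phi x t a xi q --> isqf q -->
   (\<exists>dlt>0. \<forall>v s. norm v < dlt --> \<bar>s\<bar> < dlt -->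
    u (x, t) - phi (x, t) <= u (x + v, t + s) - phi (x + v, t + s)) -->
   (\<exists>rho>0. \<forall>eta. eta \<noteq> 0 --> norm (eta - xi) < rho --> m <= Fq alpha eta q) --> m <= a)"

subsection \<open>Twice continuously differentiable functions\<close>

lemma C2_onI:
 assumes "\<And>z. z \<in> S ==> (f has_derivative blinfun_apply (D z)) (at z)"
  "\<And>z. z \<in> S ==> (D has_derivative blinfun_apply (DD z)) (at z)" "continuous_on S DD"
 shows "C2_on S f"
 using assms unfolding C2_on_def by blast

lemma C2_on_const: "C2_on S (\<lambda>z. c)"
 by (rule C2_onI[where D="\<lambda>_. 0" and DD="\<lambda>_. 0"]) (auto simp: zero_blinfun.rep_eq intro!: derivative_eq_intros)

lemma C2_on_bounded_linear:
 assumes "bounded_linear f" shows "C2_on S f"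
 by (rule C2_onI[where D="\<lambda>_. Blinfun f" and DD="\<lambda>_. 0"])
  (auto simp: zero_blinfun.rep_eq bounded_linear_Blinfun_apply[OF assms] bounded_linear_imp_has_derivative[OF assms])

lemma C2_on_add:
 assumes "C2_on S f" "C2_on S g" shows "C2_on S (\<lambda>z. f z + g z)"
proof -
 obtain D D2 where f: "\<And>z. z \<in> S ==> (f has_derivative blinfun_apply (D z)) (at z)"
  "\<And>z. z \<in> S ==> (D has_derivative blinfun_apply (D2 z)) (at z)" "continuous_on S D2"
  using assms(1) unfolding C2_on_def by blast
 obtain E E2 where g: "\<And>z. z \<in> S ==> (g has_derivative blinfun_apply (E z)) (at z)"
  "\<And>z. z \<in> S ==> (E has_derivative blinfun_apply (E2 z)) (at z)" "continuous_on S E2"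
  using assms(2) unfolding C2_on_def by blast
 show ?thesis
  by (rule C2_onI[where D="\<lambda>z. D z + E z" and DD="\<lambda>z. D2 z + E2 z"])
   (auto simp: plus_blinfun.rep_eq[abs_def] intro!: has_derivative_add f g continuous_on_add)
qed

lemma C2_on_mult:
 assumes "C2_on S f" "C2_on S g" shows "C2_on S (\<lambda>z. f z * g z)"
proof -
 obtain D D2 where f: "\<And>z. z \<in> S ==> (f has_derivative blinfun_apply (D z)) (at z)"
  "\<And>z. z \<in> S ==> (D has_derivative blinfun_apply (D2 z)) (at z)" "continuous_on S D2"
  using assms(1) unfolding C2_on_def by blast
 obtain E E2 where g: "\<And>z. z \<in> S ==> (g has_derivative blinfun_apply (E z)) (at z)"
  "\<And>z. z \<in> S ==> (E has_derivative blinfun_apply (E2 z)) (at z)" "continuous_on S E2"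
  using assms(2) unfolding C2_on_def by blast
 have cont: "continuous_on S f" "continuous_on S g" "continuous_on S D" "continuous_on S E"
  by (rule has_derivative_continuous_on, rule has_derivative_at_withinI, erule f g)+
 show ?thesis
 proof (rule C2_onI[where D="\<lambda>z. f z *\<^sub>R E z + g z *\<^sub>R D z" and
   DD="\<lambda>z. (f z *\<^sub>R E2 z + (blinfun_scaleR_left (E z) o\<^sub>L D z)) + (g z *\<^sub>R D2 z + (blinfun_scaleR_left (D z) o\<^sub>L E z))"])
  fix z assume z: "z \<in> S"
  show "((\<lambda>z. f z * g z) has_derivative blinfun_apply (f z *\<^sub>R E z + g z *\<^sub>R D z)) (at z)"
   using f(1)[OF z] g(1)[OF z]
   by (auto simp: plus_blinfun.rep_eq scaleR_blinfun.rep_eq intro!: derivative_eq_intros)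
  show "((\<lambda>z. f z *\<^sub>R E z + g z *\<^sub>R D z) has_derivative
    blinfun_apply ((f z *\<^sub>R E2 z + (blinfun_scaleR_left (E z) o\<^sub>L D z)) + (g z *\<^sub>R D2 z + (blinfun_scaleR_left (D z) o\<^sub>L E z)))) (at z)"
   by (rule has_derivative_eq_rhs[OF has_derivative_add[OF has_derivative_scaleR[OF f(1)[OF z] g(2)[OF z]]
     has_derivative_scaleR[OF g(1)[OF z] f(2)[OF z]]]])
    (simp add: fun_eq_iff plus_blinfun.rep_eq scaleR_blinfun.rep_eq blinfun_compose.rep_eq)
 next
  show "continuous_on S (\<lambda>z. (f z *\<^sub>R E2 z + (blinfun_scaleR_left (E z) o\<^sub>L D z)) + (g z *\<^sub>R D2 z + (blinfun_scaleR_left (D z) o\<^sub>L E z)))"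
   using f(3) g(3) cont by (intro continuous_intros)
 qed
qed

lemma C2_on_sum:
 assumes "finite I" "\<And>i. i \<in> I ==> C2_on S (f i)" shows "C2_on S (\<lambda>z. \<Sum>i\<in>I. f i z)"
 using assms by (induction I rule: finite_induct) (auto simp: C2_on_const C2_on_add)

subsection \<open>Polynomial test functions\<close>

definition tpoly :: "real^'n => real => real => real^'n => real^'n^'n => real => real => (real^'n) \<times> real => real" where
 "tpoly x t a xi X c k z = a * (snd z - t) + xi \<bullet> (fst z - x) + ((X *v (fst z - x)) \<bullet> (fst z - x)) / 2
   + c * (snd z - t)\<^sup>2 + k * ((fst z - x) \<bullet> (fst z - x) + (snd z - t)\<^sup>2)\<^sup>2"

lemma tpoly_uminus: "tpoly x t (- a) (- xi) (- X) (- c) (- k) z = - tpoly x t a xi X c k z"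
proof -
 have "(- X) *v w = - (X *v w)" for w
  by (simp add: vec_eq_iff matrix_vector_mult_def sum_negf)
 then show ?thesis by (simp add: tpoly_def)
qed

lemma C2_on_tpoly: "C2_on (S :: ((real^'n) \<times> real) set) (tpoly x t a xi X c k)"
proof -
 have cm: "C2_on S (\<lambda>z. b * f z)" if "C2_on S f" for b and f :: "(real^'n) \<times> real => real"
  using C2_on_mult[OF C2_on_const that] .
 have s: "C2_on S (\<lambda>z :: (real^'n) \<times> real. snd z - t)"
  using C2_on_add[OF C2_on_bounded_linear[OF bounded_linear_snd] C2_on_const[of _ "-t"]] by simp
 have f: "C2_on S (\<lambda>z :: (real^'n) \<times> real. fst z $ i - x $ i)" for i
  using C2_on_add[OF C2_on_bounded_linear[OF bounded_linear_compose[OF bounded_linear_vec_nth bounded_linear_fst]] C2_on_const[of _ "-x$i"]] by simp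
 have eq: "tpoly x t a xi X c k = (\<lambda>z. a * (snd z - t) + (\<Sum>i\<in>UNIV. xi $ i * (fst z $ i - x $ i))
   + (1/2) * (\<Sum>i\<in>UNIV. \<Sum>j\<in>UNIV. X $ i $ j * ((fst z $ j - x $ j) * (fst z $ i - x $ i)))
   + c * ((snd z - t) * (snd z - t))
   + k * (((\<Sum>i\<in>UNIV. (fst z $ i - x $ i) * (fst z $ i - x $ i)) + (snd z - t) * (snd z - t)) *
    ((\<Sum>i\<in>UNIV. (fst z $ i - x $ i) * (fst z $ i - x $ i)) + (snd z - t) * (snd z - t))))"
  by (rule ext) (simp add: tpoly_def inner_vec_def matrix_vector_mult_def sum_distrib_left sum_distrib_right power2_eq_square mult.assoc sum_divide_distrib)
 show ?thesis unfolding eq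
  by (intro C2_on_add cm C2_on_mult C2_on_sum s f finite)
qed

lemma deriv_tpoly: "deriv (\<lambda>s. tpoly x t a xi X c k (x, s)) t = a"
 by (rule DERIV_imp_deriv) (auto simp: tpoly_def intro!: derivative_eq_intros)

lemma sym_matrix_inner: "transpose X = (X :: real^'n^'n) ==> (X *v v) \<bullet> w = (X *v w) \<bullet> v"
 by (metis dot_lmul_matrix inner_commute transpose_matrix_vector)

lemma matrix_vector_axis: "((X :: real^'n^'n) *v axis i 1) $ j = X $ j $ i"
 by (simp add: matrix_vector_mult_basis column_def)

lemma partial_tpoly:
 assumes X: "transpose X = (X :: real^'n^'n)"
 shows "partial_deriv j (\<lambda>y. tpoly x t a xi X c k (y, t)) y =
  xi $ j + (X *v (y - x)) $ j + 4 * k * ((y - x) \<bullet> (y - x)) * (y - x) $ j"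
proof -
 define u where "u = y - x"
 let ?e = "axis j 1 :: real^'n"
 have "tpoly x t a xi X c k (y + s *\<^sub>R ?e, t) =
   xi \<bullet> u + s * (xi $ j) + ((X *v u) \<bullet> u + 2 * s * (X *v u) $ j + s\<^sup>2 * ((X *v ?e) \<bullet> ?e)) / 2
   + k * (u \<bullet> u + 2 * s * u $ j + s\<^sup>2)\<^sup>2" for s
 proof -
  have d: "y + s *\<^sub>R ?e - x = u + s *\<^sub>R ?e" by (simp add: u_def)
  have e: "v \<bullet> ?e = v $ j" "?e \<bullet> v = v $ j" for v :: "real^'n" by (simp_all add: inner_axis inner_axis')
  have "(X *v (u + s *\<^sub>R ?e)) \<bullet> (u + s *\<^sub>R ?e) = (X *v u) \<bullet> u + 2 * s * (X *v u) $ j + s\<^sup>2 * ((X *v ?e) \<bullet> ?e)"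
   using sym_matrix_inner[OF X, of ?e u]
   by (simp only: matrix_vector_right_distrib matrix_vector_mult_scaleR inner_add_left inner_add_right inner_scaleR_left inner_scaleR_right e)
    (simp add: power2_eq_square algebra_simps)
  moreover have "(u + s *\<^sub>R ?e) \<bullet> (u + s *\<^sub>R ?e) = u \<bullet> u + 2 * s * u $ j + s\<^sup>2"
   by (simp only: inner_add_left inner_add_right inner_scaleR_left inner_scaleR_right e) (simp add: power2_eq_square algebra_simps)
  ultimately show ?thesis unfolding tpoly_def fst_conv snd_conv d
   by (simp add: inner_add_right e)
 qed
 then have "(\<lambda>s. tpoly x t a xi X c k (y + s *\<^sub>R ?e, t)) = (\<lambda>s. xi \<bullet> u + s * (xi $ j) + ((X *v u) \<bullet> u + 2 * s * (X *v u) $ j + s\<^sup>2 * ((X *v ?e) \<bullet> ?e)) / 2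
   + k * (u \<bullet> u + 2 * s * u $ j + s\<^sup>2)\<^sup>2)" by (rule ext)
 then show ?thesis unfolding partial_deriv_def u_def[symmetric]
  by (auto intro!: DERIV_imp_deriv derivative_eq_intros simp: algebra_simps)
qed

lemma gradient_tpoly:
 assumes "transpose X = (X :: real^'n^'n)"
 shows "gradient (\<lambda>y. tpoly x t a xi X c k (y, t)) x = xi"
 by (simp add: gradient_def partial_tpoly[OF assms] vec_eq_iff)

lemma hessian_tpoly:
 assumes X: "transpose X = (X :: real^'n^'n)"
 shows "hessian (\<lambda>y. tpoly x t a xi X c k (y, t)) x = X"
proof -
 have "partial_deriv i (partial_deriv j (\<lambda>y. tpoly x t a xi X c k (y, t))) x = X $ i $ j" for i j
 proof -
  have Xs: "X $ j $ i = X $ i $ j" using X by (simp add: transpose_def vec_eq_iff)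
  have "partial_deriv j (\<lambda>y. tpoly x t a xi X c k (y, t)) (x + s *\<^sub>R axis i 1) =
   xi $ j + s * X $ j $ i + 4 * k * s\<^sup>2 * (s * axis i 1 $ j)" for s
   unfolding partial_tpoly[OF X]
   by (simp add: matrix_vector_mult_scaleR matrix_vector_axis power2_eq_square)
  then have "(\<lambda>s. partial_deriv j (\<lambda>y. tpoly x t a xi X c k (y, t)) (x + s *\<^sub>R axis i 1)) =
   (\<lambda>s. xi $ j + s * X $ j $ i + 4 * k * s\<^sup>2 * (s * axis i 1 $ j))" by (rule ext)
  then have "deriv (\<lambda>s. partial_deriv j (\<lambda>y. tpoly x t a xi X c k (y, t)) (x + s *\<^sub>R axis i 1)) 0 = X $ i $ j"
   by (auto intro!: DERIV_imp_deriv derivative_eq_intros simp: Xs)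
  then show ?thesis unfolding partial_deriv_def[of i] .
 qed
 then show ?thesis by (simp add: hessian_def vec_eq_iff)
qed

subsection \<open>Envelopes\<close>

lemma lower_env_ge:
 fixes G :: "real^'n => real^'n^'n => real"
 assumes r0: "rz > 0" and X: "transpose X = X" and B: "\<And>eta. eta \<noteq> 0 ==> G eta X <= B"
  and m: "\<And>eta Y. eta \<noteq> 0 ==> transpose Y = Y ==> norm (eta - xi) < rz ==> norm (Y - X) < rz ==> m <= G eta Y"
 shows "m <= lower_env G xi X"
proof -
 define S where "S = (\<lambda>rho. {G eta Y |eta Y. eta \<noteq> 0 \<and> transpose Y = Y \<and> norm (eta - xi) < rho \<and> norm (Y - X) < rho})"
 define I where "I = (\<lambda>rho. Inf (S rho))"
 have ne: "\<exists>g\<in>S rho. g <= B" if "rho > 0" for rho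
 proof -
  have "\<exists>eta. eta \<noteq> 0 \<and> norm (eta - xi) < rho"
  proof (cases "xi = 0")
   case True
   obtain i :: 'n where True by simp
   show ?thesis using that True
    by (intro exI[of _ "(rho/2) *\<^sub>R axis undefined 1"]) auto
  next
   case False then show ?thesis using that by (intro exI[of _ xi]) auto
  qed
  then obtain eta where "eta \<noteq> 0" "norm (eta - xi) < rho" by blast
  then have "G eta X \<in> S rho" unfolding S_def using X that
   by (intro CollectI exI[of _ eta] exI[of _ X]) auto
  then show ?thesis using B[OF \<open>eta \<noteq> 0\<close>] by blast
 qed
 have lb: "m <= g" if "g \<in> S rho" "rho <= rz" for g rho
  using that m unfolding S_def by force
 have bb: "bdd_below (S rho)" if "rho <= rz" for rho using lb[OF _ that] by (rule bdd_belowI)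
 have I1: "m <= I rho" if "0 < rho" "rho <= rz" for rho
  unfolding I_def using ne[OF that(1)] lb[OF _ that(2)] by (intro cInf_greatest) auto
 have I2: "I rho <= B" if r: "0 < rho" "rho <= rz" for rho
 proof -
  obtain g where "g \<in> S rho" "g <= B" using ne[OF r(1)] by blast
  then show ?thesis unfolding I_def using cInf_lower[OF _ bb[OF r(2)], of g] by linarith
 qed
 have I3: "I rho' <= I rho" if "0 < rho" "rho <= rho'" "rho' <= rz" for rho rho'
 proof -
  have "S rho \<subseteq> S rho'" using that unfolding S_def by force
  then show ?thesis unfolding I_def using ne[OF that(1)] bb[OF that(3)] by (intro cInf_superset_mono) auto
 qed
 define l where "l = Sup (I ` {0<..rz})"
 have bdd: "bdd_above (I ` {0<..rz})" using I2 by (intro bdd_aboveI[of _ B]) auto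
 have "(I \<longlongrightarrow> l) (at_right 0)"
 proof (rule order_tendstoI)
  fix a assume "a < l"
  then obtain rho where r: "0 < rho" "rho <= rz" "a < I rho"
   unfolding l_def using less_cSup_iff[OF _ bdd] r0 by auto
  show "\<forall>\<^sub>F x in at_right 0. a < I x"
   unfolding eventually_at_right_field using r I3 by (intro exI[of _ rho]) (auto intro: less_le_trans)
 next
  fix a assume a: "l < a"
  show "\<forall>\<^sub>F x in at_right 0. I x < a"
   unfolding eventually_at_right_field
  proof (intro exI[of _ rz] conjI allI impI r0)
   fix y assume "0 < y" "y < rz"
   then have "I y <= l" unfolding l_def using bdd by (intro cSup_upper) auto
   then show "I y < a" using a by simp
  qed
 qed
 then have "Lim (at_right 0) I = l" by (intro tendsto_Lim) auto
 moreover have "m <= l"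
 proof -
  have "I rz <= l" unfolding l_def using bdd r0 by (intro cSup_upper) auto
  then show ?thesis using I1[of rz] r0 by linarith
 qed
 ultimately show ?thesis unfolding lower_env_def I_def S_def by simp
qed


subsection \<open>The operator\<close>

lemma norm_matrix_vector_le: "norm (Z *v v) <= norm (Z :: real^'n^'m) * norm v"
proof -
 have "norm (Z *v v) = L2_set (\<lambda>i. \<bar>(Z *v v) $ i\<bar>) UNIV" by (simp add: norm_vec_def)
 also have "\<dots> <= L2_set (\<lambda>i. norm (Z $ i) * norm v) UNIV"
 proof (rule L2_set_mono)
  fix i
  have "(Z *v v) $ i = (Z $ i) \<bullet> v" by (simp add: matrix_vector_mult_def inner_vec_def)
  then show "\<bar>(Z *v v) $ i\<bar> <= norm (Z $ i) * norm v" by (simp add: Cauchy_Schwarz_ineq2)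
 qed auto
 also have "\<dots> = norm Z * norm v" by (simp add: norm_vec_def L2_set_left_distrib)
 finally show ?thesis .
qed

lemma matrix_form_bound: "\<bar>(Z *v v) \<bullet> v\<bar> <= norm (Z :: real^'n^'n) * (norm v)\<^sup>2"
proof -
 have "\<bar>(Z *v v) \<bullet> v\<bar> <= norm (Z *v v) * norm v" by (rule Cauchy_Schwarz_ineq2)
 also have "\<dots> <= norm Z * norm v * norm v" by (intro mult_right_mono norm_matrix_vector_le) auto
 finally show ?thesis by (simp add: power2_eq_square mult.assoc)
qed

lemma game_F_eq_Fq: "game_F p eta X = Fq (real_of_ereal (1 / p)) eta (\<lambda>v. (X *v v) \<bullet> v)"
 by (simp add: game_F_def Fq_def trace_def matrix_vector_axis inner_axis)

lemma Fq_bound: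
 fixes q :: "real^'n => real"
 assumes "\<And>v. \<bar>q v\<bar> <= L * (norm v)\<^sup>2" "0 <= L"
 shows "\<bar>Fq alpha eta q\<bar> <= (\<bar>alpha\<bar> * CARD('n) + \<bar>1 - 2 * alpha\<bar>) * L"
proof -
 have "\<bar>\<Sum>i\<in>UNIV. q (axis i 1)\<bar> <= (\<Sum>i\<in>(UNIV :: 'n set). L)"
 proof (rule order_trans[OF sum_abs sum_mono])
  show "\<bar>q (axis i 1)\<bar> <= L" for i using assms(1)[of "axis i 1"] by simp
 qed
 then have 1: "\<bar>alpha * (\<Sum>i\<in>UNIV. q (axis i 1))\<bar> <= \<bar>alpha\<bar> * (CARD('n) * L)"
  unfolding abs_mult by (intro mult_left_mono) auto
 have "\<bar>q eta / (norm eta)\<^sup>2\<bar> <= L"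
 proof (cases "eta = 0")
  case False
  then have "0 < (norm eta)\<^sup>2" by simp
  then show ?thesis using assms(1)[of eta] by (simp add: abs_divide pos_divide_le_eq)
 qed (use assms(2) in simp)
 then have 2: "\<bar>(1 - 2 * alpha) * (q eta / (norm eta)\<^sup>2)\<bar> <= \<bar>1 - 2 * alpha\<bar> * L"
  unfolding abs_mult by (intro mult_left_mono) auto
 have "(\<bar>alpha\<bar> * CARD('n) + \<bar>1 - 2 * alpha\<bar>) * L = \<bar>alpha\<bar> * (CARD('n) * L) + \<bar>1 - 2 * alpha\<bar> * L"
  by (simp add: algebra_simps)
 then show ?thesis unfolding Fq_def using 1 2 by linarith
qed

lemma Fq_diff: "Fq alpha eta (\<lambda>v. q v - r v) = Fq alpha eta q - Fq alpha eta r"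
 by (simp add: Fq_def sum_subtractf algebra_simps diff_divide_distrib)

lemma Fq_add: "Fq alpha eta (\<lambda>v. q v + r v) = Fq alpha eta q + Fq alpha eta r"
 by (simp add: Fq_def sum.distrib algebra_simps add_divide_distrib)

lemma Fq_uminus: "Fq alpha eta (\<lambda>v. - q v) = - Fq alpha eta q"
 by (simp add: Fq_def sum_negf algebra_simps)

lemma Fq_cmult: "Fq alpha eta (\<lambda>v. c * q v) = c * Fq alpha eta q"
 by (simp add: Fq_def sum_distrib_left algebra_simps)

lemma isqf_bound: "isqf q ==> \<exists>L\<ge>0. \<forall>v. \<bar>q v\<bar> <= L * (norm v)\<^sup>2"
 unfolding isqf_def using matrix_form_bound by (metis norm_ge_zero)

lemma transpose_add: "transpose (A + B) = transpose A + transpose (B :: real^'n^'m)"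
 by (simp add: transpose_def vec_eq_iff)

lemma isqf_add: "isqf q ==> isqf r ==> isqf (\<lambda>v. q v + r v)"
 unfolding isqf_def
 by (elim exE conjE, rule_tac x="X + Xa" in exI) (simp add: transpose_add matrix_vector_mult_add_rdistrib inner_add_left)

lemma isqf_cmult: "isqf q ==> isqf (\<lambda>v. c * q v)"
 unfolding isqf_def
 by (elim exE conjE, rule_tac x="c *\<^sub>R X" in exI)
  (simp add: transpose_scalar scaleR_matrix_vector_assoc[symmetric])

lemma isqf_uminus: "isqf q ==> isqf (\<lambda>v. - q v)" using isqf_cmult[of q "-1"] by simp

lemma isqf_norm2: "isqf (\<lambda>v :: real^'n. (norm v)\<^sup>2)"
 unfolding isqf_def by (rule exI[of _ "mat 1"]) (simp add: power2_norm_eq_inner)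

lemma isqf_inner2: "isqf (\<lambda>v :: real^'n. (xi \<bullet> v)\<^sup>2)"
proof -
 let ?X = "(\<chi> i j. xi $ i * xi $ j) :: real^'n^'n"
 have "(?X *v v) \<bullet> v = (xi \<bullet> v)\<^sup>2" for v
 proof -
  have "?X *v v = (xi \<bullet> v) *\<^sub>R xi"
   by (simp add: vec_eq_iff matrix_vector_mult_def inner_vec_def sum_distrib_left sum_distrib_right mult_ac)
  then show ?thesis by (simp add: power2_eq_square)
 qed
 then show ?thesis unfolding isqf_def
  by (intro exI[of _ ?X]) (auto simp: transpose_def vec_eq_iff mult.commute)
qed


subsection \<open>Viscosity solutions satisfy the jet inequalities\<close>

text \<open>
 A jet that touches from below locally is replaced by a polynomial that touches globally: subtract a small
 multiple of the squared distance and a large multiple of its square, which dominates the bounded function far away.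
\<close>

lemma super_at_of_tests:
 fixes u :: "(real^'n) \<times> real => real"
 assumes x: "x \<in> Om" and t: "0 < t"
  and bnd: "\<And>z. z \<in> Om \<times> {0<..} ==> \<bar>u z\<bar> <= B"
  and tests: "\<And>a xi X c k. transpose X = X ==>
    (\<And>z. z \<in> Om \<times> {0<..} ==> u (x, t) <= u z - tpoly x t a xi X c k z) ==> lower_env (game_F p) xi X <= a"
 shows "super_at (real_of_ereal (1 / p)) u x t"
 unfolding super_at_def
proof (intro allI impI)
 fix phi a xi and q :: "real^'n => real" and m
 assume j: "pjet phi x t a xi q" and q: "isqf q"
  and touch: "\<exists>dlt>0. \<forall>v s. norm v < dlt --> \<bar>s\<bar> < dlt -->
    u (x, t) - phi (x, t) <= u (x + v, t + s) - phi (x + v, t + s)"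
  and Fm: "\<exists>rho>0. \<forall>eta. eta \<noteq> 0 --> norm (eta - xi) < rho --> m <= Fq (real_of_ereal (1 / p)) eta q"
 define alpha where "alpha = real_of_ereal (1 / p)"
 obtain X where X: "transpose X = X" and qX: "\<And>v. q v = (X *v v) \<bullet> v" using q unfolding isqf_def by blast
 obtain d0 where d0: "d0 > 0" and T: "\<And>v s. norm v < d0 ==> \<bar>s\<bar> < d0 ==>
    u (x, t) - phi (x, t) <= u (x + v, t + s) - phi (x + v, t + s)" using touch by blast
 obtain rho where rho: "rho > 0" and F: "\<And>eta. eta \<noteq> 0 ==> norm (eta - xi) < rho ==> m <= Fq alpha eta q"
  using Fm unfolding alpha_def by blast
 define Kc where "Kc = \<bar>alpha\<bar> * CARD('n) + \<bar>1 - 2 * alpha\<bar>"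
 have Kc: "Kc \<ge> 0" by (simp add: Kc_def)
 define nI where "nI = norm (mat 1 :: real^'n^'n)"
 have main: "m - Kc * (1 + 2 * nI) * e <= a" if e: "e > 0" for e
 proof -
  define X' where "X' = X - (2 * e) *\<^sub>R mat 1"
  have X': "transpose X' = X'"
   using X by (simp add: X'_def transpose_def vec_eq_iff mat_def)
  have fX': "(X' *v v) \<bullet> v = q v - 2 * e * (norm v)\<^sup>2" for v
   by (simp add: X'_def qX matrix_vector_mult_diff_rdistrib inner_diff_left scaleR_matrix_vector_assoc[symmetric] power2_norm_eq_inner)
  obtain C d1 where C: "0 < d1" "0 <= C" and P: "\<And>v s. norm v < d1 ==> \<bar>s\<bar> < d1 ==>
    \<bar>phi (x + v, t + s) - (phi (x, t) + a * s + xi \<bullet> v + q v / 2)\<bar> <= e * (norm v)\<^sup>2 + C * s\<^sup>2"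
   using pjetD[OF j e] by metis
  define d where "d = min d0 d1"
  have d: "d > 0" using d0 C by (simp add: d_def)
  define L where "L = norm X"
  define K where "K = 2 * \<bar>B\<bar> / d^4 + (\<bar>a\<bar> + norm xi) / d^3 + L / d\<^sup>2"
  have K: "K \<ge> 0" using d by (simp add: K_def L_def)
  have "lower_env (game_F p) xi X' <= a"
  proof (rule tests[OF X', where c="- C" and k="- K"])
   fix z :: "(real^'n) \<times> real" assume z: "z \<in> Om \<times> {0<..}"
   define v where "v = fst z - x"
   define s where "s = snd z - t"
   have zz: "z = (x + v, t + s)" by (simp add: v_def s_def prod_eq_iff)
   define R where "R = (norm v)\<^sup>2 + s\<^sup>2"
   have R: "R \<ge> 0" by (simp add: R_def)
   have tp: "tpoly x t a xi X' (- C) (- K) z = a * s + xi \<bullet> v + q v / 2 - e * (norm v)\<^sup>2 - C * s\<^sup>2 - K * R\<^sup>2"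
    unfolding tpoly_def v_def[symmetric] s_def[symmetric] fX' R_def by (simp add: power2_norm_eq_inner)
   show "u (x, t) <= u z - tpoly x t a xi X' (- C) (- K) z"
   proof (cases "norm v < d \<and> \<bar>s\<bar> < d")
    case True
    then have "norm v < d0" "\<bar>s\<bar> < d0" "norm v < d1" "\<bar>s\<bar> < d1" by (auto simp: d_def)
    from T[OF this(1,2)] P[OF this(3,4)]
    have "u (x, t) + (a * s + xi \<bullet> v + q v / 2 - e * (norm v)\<^sup>2 - C * s\<^sup>2) <= u z"
     unfolding zz by linarith
    moreover have "0 <= K * R\<^sup>2" using K by simp
    ultimately show ?thesis unfolding tp by linarith
   next
    case False
    define r where "r = sqrt R"
    have r2: "r\<^sup>2 = R" using R by (simp add: r_def)
    have vr: "norm v <= r" "\<bar>s\<bar> <= r" unfolding r_def R_def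
     by (auto intro!: real_le_rsqrt)
    then have rd: "r \<ge> d" using False by linarith
    then have r0: "r > 0" using d by linarith
    have "q v / 2 <= L * r\<^sup>2"
    proof -
     have "q v <= L * (norm v)\<^sup>2" using matrix_form_bound[of X v] unfolding qX L_def by linarith
     also have "\<dots> <= L * r\<^sup>2" using vr by (intro mult_left_mono power_mono) (auto simp: L_def)
     finally show ?thesis
      by (smt (verit, best) L_def field_sum_of_halves mult_nonneg_nonneg norm_ge_zero zero_le_power2)
    qed
    moreover have "a * s + xi \<bullet> v <= (\<bar>a\<bar> + norm xi) * r"
    proof -
     have "a * s <= \<bar>a\<bar> * \<bar>s\<bar>" by (metis abs_ge_self abs_mult)
     moreover have "\<bar>a\<bar> * \<bar>s\<bar> <= \<bar>a\<bar> * r" using vr by (intro mult_left_mono) auto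
     moreover have "xi \<bullet> v <= norm xi * norm v" by (rule norm_cauchy_schwarz)
     moreover have "norm xi * norm v <= norm xi * r" using vr by (intro mult_left_mono) auto
     ultimately show ?thesis by (simp add: distrib_right)
    qed
    moreover have "2 * \<bar>B\<bar> + (\<bar>a\<bar> + norm xi) * r + L * r\<^sup>2 <= K * R\<^sup>2"
    proof -
     have 1: "2 * \<bar>B\<bar> <= 2 * \<bar>B\<bar> / d^4 * r^4"
      using mult_left_mono[OF power_mono[OF rd, of 4], of "2 * \<bar>B\<bar> / d^4"] d by (simp add: field_simps)
     have 2: "(\<bar>a\<bar> + norm xi) * r <= (\<bar>a\<bar> + norm xi) / d^3 * r^4"
     proof -
      have "r * d^3 <= r * r^3" using power_mono[OF rd, of 3] d r0 by (intro mult_left_mono) auto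
      then have "r <= r^4 / d^3" using d by (simp add: pos_le_divide_eq power_Suc[symmetric] del: power_Suc)
      then have "(\<bar>a\<bar> + norm xi) * r <= (\<bar>a\<bar> + norm xi) * (r^4 / d^3)" by (intro mult_left_mono) auto
      then show ?thesis by simp
     qed
     have 3: "L * r\<^sup>2 <= L / d\<^sup>2 * r^4"
     proof -
      have "r\<^sup>2 * d\<^sup>2 <= r\<^sup>2 * r\<^sup>2" using power_mono[OF rd, of 2] d by (intro mult_left_mono) auto
      then have "r\<^sup>2 <= r^4 / d\<^sup>2" using d by (simp add: pos_le_divide_eq eval_nat_numeral)
      then have "L * r\<^sup>2 <= L * (r^4 / d\<^sup>2)" by (intro mult_left_mono) (auto simp: L_def)
      then show ?thesis by simp
     qed
     have "K * R\<^sup>2 = 2 * \<bar>B\<bar> / d^4 * r^4 + (\<bar>a\<bar> + norm xi) / d^3 * r^4 + L / d\<^sup>2 * r^4"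
      by (simp add: K_def r2[symmetric] distrib_right power_mult[symmetric] flip: power_mult)
     then show ?thesis using 1 2 3 by linarith
    qed
    moreover have "0 <= e * (norm v)\<^sup>2 + C * s\<^sup>2" using e C by simp
    moreover have "u (x, t) <= \<bar>B\<bar>" "- \<bar>B\<bar> <= u z" using bnd[OF z] bnd[of "(x, t)"] x t by auto
    ultimately show ?thesis unfolding tp by linarith
   qed
  qed
  moreover have "m - Kc * (1 + 2 * nI) * e <= lower_env (game_F p) xi X'"
  proof (rule lower_env_ge[where rz="min rho e" and B="Kc * norm X'"])
   show "0 < min rho e" using rho e by simp
   show "transpose X' = X'" by (rule X')
   show "game_F p eta X' <= Kc * norm X'" for eta
    using Fq_bound[of "\<lambda>v. (X' *v v) \<bullet> v" "norm X'" alpha eta] matrix_form_bound[of X']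
    unfolding game_F_eq_Fq Kc_def alpha_def by fastforce
   fix eta :: "real^'n" and Y :: "real^'n^'n"
   assume h: "eta \<noteq> 0" "norm (eta - xi) < min rho e" "norm (Y - X') < min rho e"
   have YX: "norm (Y - X) <= (1 + 2 * nI) * e"
   proof -
    have "Y - X = (Y - X') - (2 * e) *\<^sub>R mat 1" by (simp add: X'_def)
    then have "norm (Y - X) <= norm (Y - X') + norm ((2 * e) *\<^sub>R mat 1 :: real^'n^'n)" by (metis norm_triangle_ineq4)
    then show ?thesis using h(3) e by (simp add: nI_def algebra_simps)
   qed
   have "\<bar>Fq alpha eta (\<lambda>v. (Y *v v) \<bullet> v - q v)\<bar> <= Kc * norm (Y - X)"
    unfolding Kc_def
    by (rule Fq_bound) (use matrix_form_bound[of "Y - X"] in \<open>simp_all add: qX matrix_vector_mult_diff_rdistrib inner_diff_left\<close>)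
   also have "\<dots> <= Kc * ((1 + 2 * nI) * e)" using YX Kc by (intro mult_left_mono)
   finally have "Fq alpha eta q - Kc * ((1 + 2 * nI) * e) <= Fq alpha eta (\<lambda>v. (Y *v v) \<bullet> v)"
    unfolding Fq_diff by linarith
   then show "m - Kc * (1 + 2 * nI) * e <= game_F p eta Y"
    using F[OF h(1)] h(2) unfolding game_F_eq_Fq alpha_def by (simp add: mult.assoc)
  qed
  ultimately show ?thesis by linarith
 qed
 show "m <= a"
 proof (rule field_le_epsilon)
  fix e :: real assume e: "e > 0"
  define D where "D = Kc * (1 + 2 * nI) + 1"
  have D: "D > 0" using Kc by (simp add: D_def nI_def add_nonneg_pos)
  have "m - Kc * (1 + 2 * nI) * (e / D) <= a" using e D by (intro main) simp
  moreover have "Kc * (1 + 2 * nI) * (e / D) <= D * (e / D)" using e D by (intro mult_right_mono) (auto simp: D_def)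
  ultimately show "m <= a + e" using D by simp
 qed
qed

lemma viscosity_super_at:
 assumes sol: "game_viscosity_solution p Om w" and x: "x \<in> Om" and t: "0 < t"
  and bnd: "\<And>z. z \<in> Om \<times> {0<..} ==> \<bar>w z\<bar> <= B"
 shows "super_at (real_of_ereal (1 / p)) w x t" "super_at (real_of_ereal (1 / p)) (\<lambda>z. - w z) x t"
proof -
 have T0: "tpoly x t a xi X c k (x, t) = 0" for a xi X c k by (simp add: tpoly_def)
 have S: "\<forall>phi. C2_on (Om \<times> {0<..}) phi -->
    ((\<forall>z\<in>Om \<times> {0<..}. w z - phi z <= w (x, t) - phi (x, t)) -->
      deriv (\<lambda>s. phi (x, s)) t -
       upper_env (game_F p) (gradient (\<lambda>y. phi (y, t)) x) (hessian (\<lambda>y. phi (y, t)) x) <= 0) \<and>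
    ((\<forall>z\<in>Om \<times> {0<..}. w z - phi z \<ge> w (x, t) - phi (x, t)) -->
      deriv (\<lambda>s. phi (x, s)) t -
       lower_env (game_F p) (gradient (\<lambda>y. phi (y, t)) x) (hessian (\<lambda>y. phi (y, t)) x) \<ge> 0)"
  using sol x t unfolding game_viscosity_solution_def by blast
 show "super_at (real_of_ereal (1 / p)) w x t"
 proof (rule super_at_of_tests[OF x t bnd])
  fix a xi c k and X :: "real^'a^'a"
  assume X: "transpose X = X" and le: "\<And>z. z \<in> Om \<times> {0<..} ==> w (x, t) <= w z - tpoly x t a xi X c k z"
  have "deriv (\<lambda>s. tpoly x t a xi X c k (x, s)) t -
       lower_env (game_F p) (gradient (\<lambda>y. tpoly x t a xi X c k (y, t)) x) (hessian (\<lambda>y. tpoly x t a xi X c k (y, t)) x) \<ge> 0"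
   using S C2_on_tpoly[of "Om \<times> {0<..}" x t a xi X c k] le T0 by auto
  then show "lower_env (game_F p) xi X <= a"
   by (simp add: deriv_tpoly gradient_tpoly[OF X] hessian_tpoly[OF X])
 qed
 show "super_at (real_of_ereal (1 / p)) (\<lambda>z. - w z) x t"
 proof (rule super_at_of_tests[OF x t])
  show "\<And>z. z \<in> Om \<times> {0<..} ==> \<bar>- w z\<bar> <= B" using bnd by simp
  fix a xi c k and X :: "real^'a^'a"
  assume X: "transpose X = X" and le: "\<And>z. z \<in> Om \<times> {0<..} ==> - w (x, t) <= - w z - tpoly x t a xi X c k z"
  have X': "transpose (- X) = - X" using X by (simp add: transpose_def vec_eq_iff)
  have G: "- game_F p eta Y = game_F p eta (- Y)" for eta and Y :: "real^'a^'a"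
  proof -
   have "(- Y) *v v = - (Y *v v)" for v by (simp add: vec_eq_iff matrix_vector_mult_def sum_negf)
   then show ?thesis unfolding game_F_eq_Fq by (simp add: Fq_uminus)
  qed
  have G2: "game_F p (- eta) Y = game_F p eta Y" for eta and Y :: "real^'a^'a"
  proof -
   have "Y *v (- eta) = - (Y *v eta)" by (simp add: vec_eq_iff matrix_vector_mult_def sum_negf)
   then show ?thesis by (simp add: game_F_def)
  qed
  have "deriv (\<lambda>s. tpoly x t (- a) (- xi) (- X) (- c) (- k) (x, s)) t -
       upper_env (game_F p) (gradient (\<lambda>y. tpoly x t (- a) (- xi) (- X) (- c) (- k) (y, t)) x) (hessian (\<lambda>y. tpoly x t (- a) (- xi) (- X) (- c) (- k) (y, t)) x) <= 0"
   using S C2_on_tpoly[of "Om \<times> {0<..}" x t "- a" "- xi" "- X" "- c" "- k"] le T0 unfolding tpoly_uminus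
   by (auto simp: algebra_simps)
  then have le': "lower_env (\<lambda>eta Y. - game_F p eta Y) (- xi) (- X) <= a"
   by (simp add: deriv_tpoly gradient_tpoly[OF X'] hessian_tpoly[OF X'] upper_env_def)
  have "{- game_F p eta Y |eta Y. eta \<noteq> 0 \<and> transpose Y = Y \<and> norm (eta - - xi) < rho \<and> norm (Y - - X) < rho} =
    {game_F p eta Y |eta Y. eta \<noteq> 0 \<and> transpose Y = Y \<and> norm (eta - xi) < rho \<and> norm (Y - X) < rho}" (is "?L = ?R") for rho
  proof
   have tr: "transpose (- Y) = - Y" if "transpose Y = Y" for Y :: "real^'a^'a" using that by (simp add: transpose_def vec_eq_iff)
   have nn: "norm (- b - c) = norm (b - - c)" "norm (- b - - c) = norm (b - c)" for b c :: "'z::real_normed_vector"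
    by (metis add.commute diff_minus_eq_add minus_diff_eq norm_minus_commute uminus_add_conv_diff, metis minus_diff_minus norm_minus_cancel)
   show "?L \<subseteq> ?R"
   proof
    fix g assume "g \<in> ?L"
    then obtain eta Y where h: "g = - game_F p eta Y" "eta \<noteq> 0" "transpose Y = Y" "norm (eta - - xi) < rho" "norm (Y - - X) < rho" by blast
    have "g = game_F p (- eta) (- Y)" by (simp add: h(1) G G2)
    moreover have "norm (- eta - xi) < rho" "norm (- Y - X) < rho" using h unfolding nn by auto
    ultimately show "g \<in> ?R" using h(2) tr[OF h(3)]
     by (intro CollectI exI[of _ "- eta"] exI[of _ "- Y"]) auto
   qed
   show "?R \<subseteq> ?L"
   proof
    fix g assume "g \<in> ?R"
    then obtain eta Y where h: "g = game_F p eta Y" "eta \<noteq> 0" "transpose Y = Y" "norm (eta - xi) < rho" "norm (Y - X) < rho" by blast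
    have "g = - game_F p (- eta) (- Y)" by (simp add: h(1) G G2)
    moreover have "norm (- eta - - xi) < rho" "norm (- Y - - X) < rho" using h unfolding nn by auto
    ultimately show "g \<in> ?L" using h(2) tr[OF h(3)]
     by (intro CollectI exI[of _ "- eta"] exI[of _ "- Y"]) auto
   qed
  qed
  then have "lower_env (\<lambda>eta Y. - game_F p eta Y) (- xi) (- X) = lower_env (game_F p) xi X"
   unfolding lower_env_def by presburger
  then show "lower_env (game_F p) xi X <= a" using le' by simp
 qed
qed

section \<open>Comparison for linear equations with constant coefficients\<close>

lemma pjet_min:
 fixes x :: "'a::real_inner"
 assumes j: "pjet phi x t a xi q" and d: "dlt > 0"
  and m: "\<And>v s. norm v < dlt ==> - dlt < s ==> s <= 0 ==> phi (x, t) <= phi (x + v, t + s)"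
 shows "a <= 0" "(\<And>c. q (c *\<^sub>R v) = c\<^sup>2 * q v) ==> 0 <= q v"
proof -
 obtain B where "\<And>v. \<bar>q v\<bar> <= B * (norm v)\<^sup>2" using j unfolding pjet_def by blast
 from this[of 0] have q0: "q 0 = 0" by simp
 show "a <= 0"
 proof (rule ccontr)
  assume a: "\<not> a <= 0"
  obtain C d1 where C: "0 < d1" "0 <= C" and P: "\<And>v s. norm v < d1 ==> \<bar>s\<bar> < d1 ==>
    \<bar>phi (x + v, t + s) - (phi (x, t) + a * s + xi \<bullet> v + q v / 2)\<bar> <= 1 * (norm v)\<^sup>2 + C * s\<^sup>2"
   using pjetD[OF j, of 1] by (metis zero_less_one)
  define m0 where "m0 = a / (2 * (C + 1))"
  have m0: "m0 > 0" using a C by (simp add: m0_def)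
  define s where "s = min (min (dlt/2) (d1/2)) m0"
  have s: "s > 0" "s < dlt" "s < d1" "s <= a / (2 * (C + 1))"
   using d C m0 unfolding m0_def[symmetric] s_def by auto
  have "phi (x, t) <= phi (x + 0, t + - s)" using m[of 0 "- s"] s d by simp
  moreover have "phi (x + 0, t + - s) <= phi (x, t) - a * s + C * s\<^sup>2"
   using P[of 0 "- s"] s C q0 by simp
  ultimately have "a * s <= C * s\<^sup>2" by linarith
  then have "a <= C * s" using s by (simp add: power2_eq_square)
  also have "\<dots> <= (C + 1) * s" using s by simp
  also have "\<dots> <= a / 2" using s(4) C by (simp add: field_simps)
  finally show False using a by linarith
 qed
 assume hom: "\<And>c. q (c *\<^sub>R v) = c\<^sup>2 * q v"
 show "0 <= q v"
 proof (rule field_le_epsilon)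
  fix e :: real assume e: "e > 0"
  define eps where "eps = e / (2 * ((norm v)\<^sup>2 + 1))"
  have n1: "(norm v)\<^sup>2 + 1 > 0" by (simp add: add_nonneg_pos)
  have eps: "eps > 0" using e n1 by (simp add: eps_def)
  obtain C d1 where C: "0 < d1" "0 <= C" and P: "\<And>v s. norm v < d1 ==> \<bar>s\<bar> < d1 ==>
    \<bar>phi (x + v, t + s) - (phi (x, t) + a * s + xi \<bullet> v + q v / 2)\<bar> <= eps * (norm v)\<^sup>2 + C * s\<^sup>2"
   using pjetD[OF j eps] by metis
  define c where "c = min dlt d1 / (2 * (norm v + 1))"
  have nv: "norm v + 1 > 0" by (simp add: add_nonneg_pos)
  have c: "c > 0" using d C nv by (simp add: c_def)
  have "norm v < 2 * (norm v + 1)" using norm_ge_zero[of v] by argo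
  then have "c * norm v < c * (2 * (norm v + 1))" by (rule mult_strict_left_mono[OF _ c])
  also have "\<dots> = min dlt d1" using nv by (simp add: c_def)
  finally have cv: "norm (c *\<^sub>R v) < dlt" "norm (c *\<^sub>R v) < d1" using c by auto
  have 1: "phi (x, t) <= phi (x + c *\<^sub>R v, t + 0)" "phi (x, t) <= phi (x + (- c) *\<^sub>R v, t + 0)"
   using m[of "c *\<^sub>R v" 0] m[of "(- c) *\<^sub>R v" 0] cv d by simp_all
  have 2: "phi (x + c *\<^sub>R v, t + 0) <= phi (x, t) + c * (xi \<bullet> v) + c\<^sup>2 * q v / 2 + eps * (c\<^sup>2 * (norm v)\<^sup>2)"
   using P[of "c *\<^sub>R v" 0] cv C hom[of c] by (simp add: power_mult_distrib)
  have 3: "phi (x + (- c) *\<^sub>R v, t + 0) <= phi (x, t) - c * (xi \<bullet> v) + c\<^sup>2 * q v / 2 + eps * (c\<^sup>2 * (norm v)\<^sup>2)"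
   using P[of "(- c) *\<^sub>R v" 0] cv C hom[of "- c"] by (simp add: power_mult_distrib)
  have "0 <= c\<^sup>2 * q v + 2 * eps * (c\<^sup>2 * (norm v)\<^sup>2)" using 1 2 3 by linarith
  also have "\<dots> = c\<^sup>2 * (q v + 2 * eps * (norm v)\<^sup>2)" by (simp add: algebra_simps)
  finally have "0 <= q v + 2 * eps * (norm v)\<^sup>2" using c by (simp add: zero_le_mult_iff)
  also have "2 * eps * (norm v)\<^sup>2 <= e" using n1 e by (simp add: eps_def field_simps)
  finally show "0 <= q v + e" by simp
 qed
qed

lemma isqf_hom: "isqf q ==> q (c *\<^sub>R v) = c\<^sup>2 * q v"
 unfolding isqf_def by (auto simp: matrix_vector_mult_scaleR power2_eq_square)

text \<open>
 Bounded classical solutions of the constant coefficient equation whose diffusion matrix is the sum of the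
 squares of the vectors \<open>sg k\<close>.
\<close>

definition heatlike :: "('k::finite => real^'n) => ((real^'n) \<times> real => real) => bool" where
 "heatlike sg H \<longleftrightarrow> continuous_on UNIV H \<and> (\<exists>C. \<forall>x t. 0 <= t --> \<bar>H (x, t)\<bar> <= C) \<and>
   (\<forall>x t. \<exists>a xi q. pjet H x t a xi q \<and> isqf q \<and> a = (\<Sum>k\<in>UNIV. q (sg k)))"

inductive_set trigp :: "(real^'n => real) set" where
 cos: "(\<lambda>x. c * cos (k \<bullet> x + b)) \<in> trigp"
| add: "f \<in> trigp ==> g \<in> trigp ==> (\<lambda>x. f x + g x) \<in> trigp"

lemma trigp_const: "(\<lambda>x. c) \<in> trigp"
 using trigp.cos[of c 0 0] by simp

lemma trigp_mult_cos: "f \<in> trigp ==> (\<lambda>x. f x * (c * cos (k \<bullet> x + b))) \<in> trigp"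
proof (induction f rule: trigp.induct)
 case (cos c' k' b')
 have "(\<lambda>x. c' * cos (k' \<bullet> x + b') * (c * cos (k \<bullet> x + b))) =
  (\<lambda>x. (c' * c / 2) * cos ((k' - k) \<bullet> x + (b' - b)) + (c' * c / 2) * cos ((k' + k) \<bullet> x + (b' + b)))"
 proof
  fix x
  have "cos (k' \<bullet> x + b') * cos (k \<bullet> x + b) = (cos ((k' \<bullet> x + b') - (k \<bullet> x + b)) + cos ((k' \<bullet> x + b') + (k \<bullet> x + b))) / 2"
   by (rule cos_times_cos)
  moreover have "(k' \<bullet> x + b') - (k \<bullet> x + b) = (k' - k) \<bullet> x + (b' - b)" "(k' \<bullet> x + b') + (k \<bullet> x + b) = (k' + k) \<bullet> x + (b' + b)"
   by (simp_all add: inner_diff_left inner_add_left)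
  ultimately show "c' * cos (k' \<bullet> x + b') * (c * cos (k \<bullet> x + b)) =
    (c' * c / 2) * cos ((k' - k) \<bullet> x + (b' - b)) + (c' * c / 2) * cos ((k' + k) \<bullet> x + (b' + b))"
   by (simp add: algebra_simps add_divide_distrib)
 qed
 then show ?case by (simp only:) (intro trigp.add trigp.cos)
next
 case (add f g)
 then show ?case by (simp add: distrib_right trigp.add)
qed

lemma trigp_mult: "g \<in> trigp ==> f \<in> trigp ==> (\<lambda>x. f x * g x) \<in> trigp"
proof (induction g rule: trigp.induct)
 case (cos c k b) then show ?case by (rule trigp_mult_cos)
next
 case (add g h) then show ?case by (simp add: distrib_left trigp.add)
qed

lemma trigp_continuous: "f \<in> trigp ==> continuous_on S f"
 by (induction f rule: trigp.induct) (auto intro!: continuous_intros)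

lemma peano2_exp: "peano2 exp y (exp y) (exp y)"
 by (rule peano2I[of 1 _ exp exp]) (auto intro!: derivative_eq_intros)

lemma peano2_cos: "peano2 cos y (- sin y) (- cos y)"
 by (rule peano2I[of 1 _ cos "\<lambda>y. - sin y"]) (auto intro!: derivative_eq_intros)

text \<open>
 A trigonometric monomial is an eigenfunction of the constant coefficient operator, so its solution is an exponential in time.
\<close>

lemma trig_extension:
 fixes sg :: "'k::finite => real^'n"
 assumes "f \<in> trigp"
 shows "\<exists>H. heatlike sg H \<and> (\<forall>x. H (x, 0) = f x)"
 using assms
proof (induction f rule: trigp.induct)
 case (cos c k b)
 define lam where "lam = (\<Sum>i\<in>UNIV. (k \<bullet> sg i)\<^sup>2)"
 have lam0: "lam \<ge> 0" by (simp add: lam_def sum_nonneg)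
 define H where "H = (\<lambda>z :: (real^'n) \<times> real. (c * cos (k \<bullet> fst z + b)) * exp (- lam * snd z))"
 have "heatlike sg H" unfolding heatlike_def
 proof (intro conjI allI)
  show "continuous_on UNIV H" unfolding H_def by (intro continuous_intros)
  have "\<bar>H (x, t)\<bar> <= \<bar>c\<bar>" if "0 <= t" for x t
  proof -
   have "\<bar>H (x, t)\<bar> = \<bar>c\<bar> * (\<bar>cos (k \<bullet> x + b)\<bar> * exp (- (lam * t)))" by (simp add: H_def abs_mult)
   also have "\<dots> <= \<bar>c\<bar> * (1 * 1)" using lam0 that by (intro mult_left_mono mult_mono) auto
   finally show ?thesis by simp
  qed
  then show "\<exists>C. \<forall>x t. 0 <= t --> \<bar>H (x, t)\<bar> <= C" by blast
  fix x t
  note j1 = pjet_cmult[OF pjet_comp[OF pjet_add[OF pjet_linear[of k] pjet_const[of b]] peano2_cos], of c x t]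
  note j2 = pjet_comp[OF pjet_cmult[OF pjet_snd, of "- lam"] peano2_exp, of x t]
  note j = pjet_mult[OF j1 j2]
  let ?e = "exp (- lam * t)" and ?c = "c * cos (k \<bullet> x + b)"
  have "pjet H x t (- lam * (?c * ?e)) (- (c * sin (k \<bullet> x + b) * ?e) *\<^sub>R k) (\<lambda>v. - (?c * ?e) * (k \<bullet> v)\<^sup>2)"
   by (rule pjet_cong[OF j]) (auto simp: H_def algebra_simps)
  moreover have "isqf (\<lambda>v. - (?c * ?e) * (k \<bullet> v)\<^sup>2)" by (rule isqf_cmult[OF isqf_inner2])
  moreover have "- lam * (?c * ?e) = (\<Sum>i\<in>UNIV. - (?c * ?e) * (k \<bullet> sg i)\<^sup>2)"
   unfolding lam_def sum_distrib_left[symmetric] by (simp add: algebra_simps)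
  ultimately show "\<exists>a xi q. pjet H x t a xi q \<and> isqf q \<and> a = (\<Sum>k\<in>UNIV. q (sg k))" by blast
 qed
 moreover have "H (x, 0) = c * cos (k \<bullet> x + b)" for x by (simp add: H_def)
 ultimately show ?case by blast
next
 case (add f g)
 obtain H where H: "heatlike sg H" "\<And>x. H (x, 0) = f x" using add.IH by blast
 obtain G where G: "heatlike sg G" "\<And>x. G (x, 0) = g x" using add.IH by blast
 have "heatlike sg (\<lambda>z. H z + G z)" unfolding heatlike_def
 proof (intro conjI allI)
  show "continuous_on UNIV (\<lambda>z. H z + G z)" using H G by (auto simp: heatlike_def intro!: continuous_on_add)
  obtain C D where C: "\<And>x t. 0 <= t ==> \<bar>H (x, t)\<bar> <= C" and D: "\<And>x t. 0 <= t ==> \<bar>G (x, t)\<bar> <= D"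
   using H(1) G(1) unfolding heatlike_def by metis
  have "\<bar>H (x, t) + G (x, t)\<bar> <= C + D" if "0 <= t" for x t
   using C[OF that, of x] D[OF that, of x] by linarith
  then show "\<exists>C. \<forall>x t. 0 <= t --> \<bar>H (x, t) + G (x, t)\<bar> <= C" by blast
  fix x t
  obtain a xi q where h: "pjet H x t a xi q" "isqf q" "a = (\<Sum>k\<in>UNIV. q (sg k))" using H(1) unfolding heatlike_def by blast
  obtain b eta r where g: "pjet G x t b eta r" "isqf r" "b = (\<Sum>k\<in>UNIV. r (sg k))" using G(1) unfolding heatlike_def by blast
  have "a + b = (\<Sum>k\<in>UNIV. q (sg k) + r (sg k))" using h g by (simp add: sum.distrib)
  then show "\<exists>a xi q. pjet (\<lambda>z. H z + G z) x t a xi q \<and> isqf q \<and> a = (\<Sum>k\<in>UNIV. q (sg k))"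
   using pjet_add[OF h(1) g(1)] isqf_add[OF h(2) g(2)] by blast
 qed
 then show ?case using H G by (intro exI[of _ "\<lambda>z. H z + G z"]) auto
qed

lemma heatlike_uminus:
 assumes "heatlike sg H" shows "heatlike sg (\<lambda>z. - H z)"
 unfolding heatlike_def
proof (intro conjI allI)
 show "continuous_on UNIV (\<lambda>z. - H z)" using assms by (auto simp: heatlike_def intro!: continuous_on_minus)
 show "\<exists>C. \<forall>x t. 0 <= t --> \<bar>- H (x, t)\<bar> <= C" using assms by (simp add: heatlike_def)
 fix x t
 obtain a xi q where h: "pjet H x t a xi q" "isqf q" "a = (\<Sum>k\<in>UNIV. q (sg k))" using assms unfolding heatlike_def by blast
 show "\<exists>a xi q. pjet (\<lambda>z. - H z) x t a xi q \<and> isqf q \<and> a = (\<Sum>k\<in>UNIV. q (sg k))"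
  using pjet_minus[OF h(1)] isqf_uminus[OF h(2)] h(3) by (intro exI conjI) (auto simp: sum_negf)
qed

text \<open>A minimum over a compact cylinder that is not on its parabolic boundary.\<close>
lemma cylinder_min:
 fixes W :: "'a::{real_inner,heine_borel} \<times> real => real"
 assumes c: "continuous_on (S \<times> {t0..t1}) W" and S: "compact S" and le: "t0 <= t1"
  and z: "x1 \<in> S" "t0 <= s1" "s1 <= t1" "W (x1, s1) < m"
  and b: "\<And>x t. x \<in> S ==> t0 <= t ==> t <= t1 ==> W (x, t) < m ==> x \<in> interior S \<and> t0 < t"
 obtains x t where "x \<in> interior S" "t0 < t" "t <= t1" "W (x, t) < m"
  "\<And>y s. y \<in> S ==> t0 <= s ==> s <= t1 ==> W (x, t) <= W (y, s)"
  "\<exists>dlt>0. \<forall>v s. norm v < dlt --> - dlt < s --> s <= 0 --> W (x, t) <= W (x + v, t + s)"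
  "t < t1 ==> \<exists>dlt>0. \<forall>v s. norm v < dlt --> \<bar>s\<bar> < dlt --> W (x, t) <= W (x + v, t + s)"
proof -
 have "compact (S \<times> {t0..t1})" using S by (intro compact_Times) auto
 moreover have "S \<times> {t0..t1} \<noteq> {}" using z le by auto
 ultimately obtain p where p: "p \<in> S \<times> {t0..t1}" "\<And>z. z \<in> S \<times> {t0..t1} ==> W p <= W z"
  using continuous_attains_inf[OF _ _ c] by blast
 obtain x t where xt: "p = (x, t)" by (cases p)
 have mm: "W (x, t) <= W (y, s)" if "y \<in> S" "t0 <= s" "s <= t1" for y s using p(2)[of "(y, s)"] that xt by auto
 have neg: "W (x, t) < m" using mm[of x1 s1] z by linarith
 have xS: "x \<in> S" "t0 <= t" "t <= t1" using p(1) xt by auto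
 have int: "x \<in> interior S" "t0 < t" using b[OF xS neg] by auto
 obtain e where e: "e > 0" "ball x e \<subseteq> S" using int(1) by (meson interior_subset mem_interior order_trans)
 define d where "d = min e (t - t0)"
 have d: "d > 0" using e int by (simp add: d_def)
 have inS: "x + v \<in> S" if "norm v < d" for v using e(2) that by (auto simp: d_def dist_norm subset_iff)
 have 1: "\<exists>dlt>0. \<forall>v s. norm v < dlt --> - dlt < s --> s <= 0 --> W (x, t) <= W (x + v, t + s)"
  using d xS inS by (intro exI[of _ d]) (auto intro!: mm simp: d_def)
 have 2: "\<exists>dlt>0. \<forall>v s. norm v < dlt --> \<bar>s\<bar> < dlt --> W (x, t) <= W (x + v, t + s)" if "t < t1"
  using d xS inS that by (intro exI[of _ "min d (t1 - t)"]) (auto intro!: mm simp: d_def)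
 show ?thesis using that[OF int(1,2) xS(3) neg mm 1 2] .
qed

lemma heatlike_max:
 fixes H :: "(real^'n) \<times> real => real"
 assumes H: "heatlike sg H" and B: "\<And>x. H (x, 0) <= B" and t: "0 <= t1"
 shows "H (x1, t1) <= B"
proof (rule field_le_epsilon)
 fix e :: real assume e: "e > 0"
 obtain C where C: "\<And>x t. 0 <= t ==> \<bar>H (x, t)\<bar> <= C" using H unfolding heatlike_def by blast
 define T where "T = (\<Sum>k\<in>UNIV. (norm (sg k))\<^sup>2)"
 have T: "T \<ge> 0" by (simp add: T_def sum_nonneg)
 define eps where "eps = e / (1 + (norm x1)\<^sup>2 + (2 * T + 1) * t1)"
 have den: "1 + (norm x1)\<^sup>2 + (2 * T + 1) * t1 > 0" using T t by (simp add: add_nonneg_pos add_pos_nonneg)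
 have eps: "eps > 0" using e den by (simp add: eps_def)
 define pen where "pen = (\<lambda>z :: (real^'n) \<times> real. eps * (1 + (norm (fst z - 0))\<^sup>2 + (2 * T + 1) * snd z))"
 define W where "W = (\<lambda>z. B - H z + pen z)"
 show "H (x1, t1) <= B + e"
 proof (rule ccontr)
  assume "\<not> ?thesis"
  moreover have "pen (x1, t1) = e" using den by (simp add: pen_def eps_def)
  ultimately have neg: "W (x1, t1) < 0" by (simp add: W_def)
  define R where "R = norm x1 + sqrt ((C + \<bar>B\<bar>) / eps) + 1"
  have C0: "C \<ge> 0" using C[of 0 0] by simp
  have R: "eps * R\<^sup>2 \<ge> C + \<bar>B\<bar>"
  proof -
   have "sqrt ((C + \<bar>B\<bar>) / eps) <= R" by (simp add: R_def)
   then have "(sqrt ((C + \<bar>B\<bar>) / eps))\<^sup>2 <= R\<^sup>2" using C0 eps by (intro power_mono) auto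
   then have "(C + \<bar>B\<bar>) / eps <= R\<^sup>2" using C0 eps by simp
   then show ?thesis using eps by (simp add: field_simps)
  qed
  have cont: "continuous_on (cball 0 R \<times> {0..t1}) W"
   using H unfolding W_def pen_def heatlike_def
   by (auto intro!: continuous_intros intro: continuous_on_subset)
  have sq: "sqrt ((C + \<bar>B\<bar>) / eps) \<ge> 0" using C0 eps by simp
  obtain x t where xt: "0 < t" "t <= t1"
   "\<exists>dlt>0. \<forall>v s. norm v < dlt --> - dlt < s --> s <= 0 --> W (x, t) <= W (x + v, t + s)"
  proof (rule cylinder_min[OF cont compact_cball t, of x1 t1 0])
   show "x1 \<in> cball 0 R" using sq by (simp add: R_def)
   fix x t assume h: "x \<in> cball 0 R" "0 <= t" "t <= t1" "W (x, t) < 0"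
   have "t \<noteq> 0"
   proof
    assume "t = 0"
    moreover have "0 <= eps * (1 + (norm x)\<^sup>2)" using eps by (simp add: add_nonneg_nonneg)
    ultimately show False using h(4) B[of x] by (simp add: W_def pen_def)
   qed
   moreover have "norm x \<noteq> R"
   proof
    assume n: "norm x = R"
    have "eps * R\<^sup>2 <= pen (x, t)" using eps T h(2) by (simp add: pen_def n)
    moreover have "H (x, t) <= C" using C[OF h(2), of x] by linarith
    ultimately show False using h(4) R by (simp add: W_def)
   qed
   ultimately show "x \<in> interior (cball 0 R) \<and> 0 < t" using h by (auto simp: interior_cball)
  qed (use t neg in auto)
  obtain a xi q where h: "pjet H x t a xi q" "isqf q" "a = (\<Sum>k\<in>UNIV. q (sg k))" using H unfolding heatlike_def by blast
  have jp: "pjet pen x t (eps * (2 * T + 1)) (eps *\<^sub>R 2 *\<^sub>R x) (\<lambda>v. eps * (2 * (norm v)\<^sup>2))"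
   by (rule pjet_cong[OF pjet_cmult[OF pjet_add[OF pjet_add[OF pjet_const[of 1] pjet_norm2[of 0]] pjet_cmult[OF pjet_snd, of "2 * T + 1"]], of eps]])
    (auto simp: pen_def)
  have jW: "pjet W x t (- a + eps * (2 * T + 1)) (- xi + eps *\<^sub>R 2 *\<^sub>R x) (\<lambda>v. - q v + eps * (2 * (norm v)\<^sup>2))"
   by (rule pjet_cong[OF pjet_add[OF pjet_add[OF pjet_const[of B] pjet_minus[OF h(1)]] jp]]) (auto simp: W_def)
  obtain d where d: "d > 0" "\<And>v s. norm v < d ==> - d < s ==> s <= 0 ==> W (x, t) <= W (x + v, t + s)" using xt(3) by blast
  have 1: "- a + eps * (2 * T + 1) <= 0" using pjet_min(1)[OF jW d] .
  have 2: "0 <= - q (sg k) + eps * (2 * (norm (sg k))\<^sup>2)" for k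
   by (rule pjet_min(2)[OF jW d]) (auto simp: isqf_hom[OF h(2)] power_mult_distrib algebra_simps)
  have "0 <= (\<Sum>k\<in>UNIV. - q (sg k) + eps * (2 * (norm (sg k))\<^sup>2))" by (rule sum_nonneg) (use 2 in auto)
  also have "\<dots> = - a + eps * (2 * T)" by (simp add: h(3) T_def sum.distrib sum_negf sum_subtractf sum_distrib_left)
  finally show False using 1 eps by (simp add: algebra_simps)
 qed
qed

text \<open>
 The trigonometric polynomial must be bounded in the whole space by nearly the same constant as the function
 on the ball; this holds because it approximates a function of the sines of the coordinates.
\<close>

lemma trig_approx:
 fixes g :: "real^'n => real"
 assumes c: "continuous_on (cball 0 r) g" and r: "r <= 1" and e: "e > 0"
  and B: "\<And>x. x \<in> cball 0 r ==> \<bar>g x\<bar> <= B" "B \<ge> 0"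
 obtains f where "f \<in> trigp" "\<And>x. x \<in> cball 0 r ==> \<bar>f x - g x\<bar> < e" "\<And>x. \<bar>f x\<bar> <= B + e"
proof -
 define fold :: "real^'n => real^'n" where "fold = (\<lambda>x. \<chi> i. arcsin (sin (x $ i)))"
 define S :: "(real^'n) set" where "S = cbox (\<chi> i. - (pi/2)) (\<chi> i. pi/2)"
 have S: "x \<in> S \<longleftrightarrow> (\<forall>i. - (pi/2) <= x $ i \<and> x $ i <= pi/2)" for x by (simp add: S_def mem_box_cart)
 have foldS: "fold x \<in> S" for x
  unfolding S fold_def using arcsin_bounded[of "sin (x $ i)" for i] by auto
 have fold_id: "fold x = x" if "x \<in> S" for x
  using that unfolding S fold_def by (simp add: vec_eq_iff arcsin_sin)
 have sub: "cball 0 r \<subseteq> S"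
 proof
  fix x :: "real^'n" assume "x \<in> cball 0 r"
  then have x1: "\<bar>x $ i\<bar> <= 1" for i using component_le_norm_cart[of x i] r by simp
  have "- (pi/2) <= x $ i \<and> x $ i <= pi/2" for i using x1[of i] pi_ge_two by linarith
  then show "x \<in> S" unfolding S by blast
 qed
 obtain G where G: "continuous_on UNIV G" "\<And>x. x \<in> cball 0 r ==> G x = g x" "\<And>x. \<bar>G x\<bar> <= B"
  using Tietze[OF c, of UNIV B] B by auto
 define P where "P = (\<lambda>f :: real^'n => real. f \<in> trigp \<and> (\<forall>x. f (fold x) = f x))"
 have "\<exists>f. P f \<and> (\<forall>x\<in>S. \<bar>G x - f x\<bar> < e)"
 proof (rule Stone_Weierstrass_HOL[of S P G e])
  show "compact S" by (simp add: S_def)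
  show "P (\<lambda>x. c)" for c by (simp add: P_def trigp_const)
  show "continuous_on S f" if "P f" for f using that trigp_continuous by (auto simp: P_def)
  show "P (\<lambda>x. f x + g x)" "P (\<lambda>x. f x * g x)" if "P f \<and> P g" for f g
   using that by (auto simp: P_def trigp.add trigp_mult)
  show "\<exists>f. P f \<and> f x \<noteq> f y" if xy: "x \<in> S \<and> y \<in> S \<and> x \<noteq> y" for x y
  proof -
   obtain i where i: "x $ i \<noteq> y $ i" using xy by (auto simp: vec_eq_iff)
   have c2: "cos (a + (- pi/2)) = sin a" for a :: real using cos_diff[of a "pi/2"] by simp
   have eq: "(\<lambda>x :: real^'n. sin (x $ i)) = (\<lambda>x. 1 * cos (axis i 1 \<bullet> x + (- pi/2)))"
    by (rule ext) (simp only: c2 inner_axis' mult_1 real_inner_1_left)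
   have "(\<lambda>x :: real^'n. sin (x $ i)) \<in> trigp" unfolding eq by (rule trigp.cos)
   then have "P (\<lambda>x. sin (x $ i))" unfolding P_def by (simp add: fold_def)
   moreover have "sin (x $ i) \<noteq> sin (y $ i)"
    using i xy unfolding S by (metis arcsin_sin)
   ultimately show ?thesis by blast
  qed
  show "continuous_on S G" using G(1) continuous_on_subset by blast
 qed (rule e)
 then obtain f where f: "f \<in> trigp" "\<And>x. f (fold x) = f x" "\<And>x. x \<in> S ==> \<bar>G x - f x\<bar> < e" unfolding P_def by blast
 show ?thesis
 proof (rule that[OF f(1)])
  show "\<bar>f x - g x\<bar> < e" if "x \<in> cball 0 r" for x using f(3)[of x] G(2)[OF that] sub that by auto
  fix x
  have "\<bar>f x\<bar> = \<bar>f (fold x)\<bar>" by (simp add: f(2))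
  also have "\<dots> <= B + e" using f(3)[OF foldS[of x]] G(3)[of "fold x"] by linarith
  finally show "\<bar>f x\<bar> <= B + e" .
 qed
qed

text \<open>
 A quartic penalty that is itself a supersolution; its value at the origin is quadratic in time, which makes cut-off errors negligible for short times.
\<close>

definition qpen :: "real => real => ('a::real_inner) \<times> real => real" where
 "qpen c h z = ((norm (fst z - 0))\<^sup>2)\<^sup>2 + c * ((snd z + h) * (norm (fst z - 0))\<^sup>2) + c\<^sup>2 * (snd z + h)\<^sup>2"

lemma peano2_square: "peano2 (\<lambda>y. y\<^sup>2) y (2 * y) 2"
 unfolding peano2_def by (auto simp: algebra_simps power2_eq_square intro!: exI[of _ 1])

lemma pjet_qpen:
 fixes x :: "'a::real_inner"
 shows "pjet (qpen c h) x t (c * (norm x)\<^sup>2 + 2 * c\<^sup>2 * (t + h)) ((4 * (norm x)\<^sup>2 + 2 * c * (t + h)) *\<^sub>R x)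
   (\<lambda>v. 4 * (norm x)\<^sup>2 * (norm v)\<^sup>2 + 8 * (x \<bullet> v)\<^sup>2 + 2 * c * (t + h) * (norm v)\<^sup>2)"
proof -
 note n = pjet_norm2[of 0 x t]
 note s = pjet_add[OF pjet_snd[of x t] pjet_const[of h]]
 note j = pjet_add[OF pjet_add[OF pjet_comp[OF n peano2_square] pjet_cmult[OF pjet_mult[OF s n], of c]] pjet_cmult[OF pjet_comp[OF s peano2_square], of "c\<^sup>2"]]
 show ?thesis
  by (rule pjet_cong[OF j]) (auto simp: qpen_def algebra_simps power2_eq_square scaleR_add_left[symmetric] simp flip: scaleR_add_left)
qed

lemma qpen_super:
 fixes sg :: "'k::finite => 'a::real_inner"
 assumes c: "c = 12 * (\<Sum>k\<in>UNIV. (norm (sg k))\<^sup>2)" and t: "0 <= t + h"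
 shows "(\<Sum>k\<in>UNIV. 4 * (norm x)\<^sup>2 * (norm (sg k))\<^sup>2 + 8 * (x \<bullet> sg k)\<^sup>2 + 2 * c * (t + h) * (norm (sg k))\<^sup>2)
   <= c * (norm x)\<^sup>2 + 2 * c\<^sup>2 * (t + h)"
proof -
 define T where "T = (\<Sum>k\<in>UNIV. (norm (sg k))\<^sup>2)"
 have T: "T \<ge> 0" by (simp add: T_def sum_nonneg)
 have c0: "c \<ge> 0" using c T by (simp add: T_def)
 have "(\<Sum>k\<in>UNIV. 4 * (norm x)\<^sup>2 * (norm (sg k))\<^sup>2 + 8 * (x \<bullet> sg k)\<^sup>2 + 2 * c * (t + h) * (norm (sg k))\<^sup>2)
  <= (\<Sum>k\<in>UNIV. (12 * (norm x)\<^sup>2 + 2 * c * (t + h)) * (norm (sg k))\<^sup>2)"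
 proof (rule sum_mono)
  fix k
  have "(x \<bullet> sg k)\<^sup>2 <= (norm x)\<^sup>2 * (norm (sg k))\<^sup>2"
   using Cauchy_Schwarz_ineq[of x "sg k"] by (simp add: power2_norm_eq_inner)
  then show "4 * (norm x)\<^sup>2 * (norm (sg k))\<^sup>2 + 8 * (x \<bullet> sg k)\<^sup>2 + 2 * c * (t + h) * (norm (sg k))\<^sup>2
    <= (12 * (norm x)\<^sup>2 + 2 * c * (t + h)) * (norm (sg k))\<^sup>2" by (simp add: algebra_simps)
 qed
 also have "\<dots> = (12 * (norm x)\<^sup>2 + 2 * c * (t + h)) * T" by (simp add: T_def sum_distrib_left)
 also have "\<dots> = c * (norm x)\<^sup>2 + 2 * c * (t + h) * T" by (simp add: c T_def algebra_simps)
 also have "2 * c * (t + h) * T <= 2 * c * (t + h) * c"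
  using c0 t T by (intro mult_left_mono) (auto simp: c T_def)
 finally show ?thesis by (simp add: power2_eq_square algebra_simps)
qed

lemma continuous_on_qpen [continuous_intros]: "continuous_on S (qpen c h)"
 unfolding qpen_def by (intro continuous_intros)

lemma pjet_inverse_time:
 assumes "t < T"
 shows "pjet (\<lambda>z. iot / (T - snd z)) x t (iot / (T - t)\<^sup>2) 0 (\<lambda>v. 0)"
proof -
 have "peano2 (\<lambda>s. iot * inverse (T - s)) t (iot * (inverse (T - t))\<^sup>2) (2 * iot * (inverse (T - t))^3)"
  by (rule peano2I[of "T - t" t _ "\<lambda>s. iot * (inverse (T - s))\<^sup>2"])
   (use assms in \<open>auto intro!: derivative_eq_intros simp: power2_eq_square power3_eq_cube\<close>)
 then have "peano2 (\<lambda>s. iot * inverse (T - s)) (snd (x, t)) (iot * (inverse (T - t))\<^sup>2) (2 * iot * (inverse (T - t))^3)" by simp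
 from pjet_comp[OF pjet_snd this] show ?thesis
  by (simp add: divide_inverse power_inverse)
qed

text \<open>
 The solution started from \<open>f\<close> on the ball stays below \<open>f\<close> at the centre up to an error quadratic in the length of the
 time interval, although no boundary data are controlled.
\<close>

lemma linear_comparison:
 fixes f :: "(real^'n) \<times> real => real" and sg :: "'k::finite => real^'n"
 assumes r: "r > 0" and h: "h > 0" and k: "kappa > 0"
  and cf: "continuous_on (cball 0 r \<times> {-h..h}) f"
  and Bf: "\<And>x t. norm x <= r ==> \<bar>t\<bar> <= h ==> \<bar>f (x, t)\<bar> <= B"
  and lin: "\<And>x t phi a xi q. norm x < r ==> \<bar>t\<bar> < h ==> pjet phi x t a xi q ==> isqf q ==>
    (\<exists>dlt>0. \<forall>v s. norm v < dlt --> \<bar>s\<bar> < dlt --> f (x, t) - phi (x, t) <= f (x + v, t + s) - phi (x + v, t + s)) ==>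
    (\<Sum>k\<in>UNIV. q (sg k)) <= a + kappa"
  and H: "continuous_on UNIV H" "\<And>x t. \<exists>a xi q. pjet H x t a xi q \<and> isqf q \<and> a = (\<Sum>k\<in>UNIV. q (sg k))"
  and H0: "\<And>x. norm x <= r ==> H (x, -h) <= f (x, -h)"
  and BH: "\<And>x t. -h <= t ==> \<bar>H (x, t)\<bar> <= B'"
  and c: "c = 12 * (\<Sum>k\<in>UNIV. (norm (sg k))\<^sup>2)"
 shows "H (0, 0) - (B + B') / r^4 * c\<^sup>2 * h\<^sup>2 - 2 * kappa * h <= f (0, 0)"
proof (rule field_le_epsilon)
 fix e :: real assume e: "e > 0"
 define K where "K = (B + B') / r^4"
 have B0: "B \<ge> 0" "B' \<ge> 0" using Bf[of 0 0] BH[of 0 0] r h by auto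
 have K0: "K \<ge> 0" using B0 r by (simp add: K_def)
 define iot where "iot = e * h"
 have i: "iot > 0" using e h by (simp add: iot_def)
 define phi where "phi = (\<lambda>z. H z + (- K) * qpen c h z + (- (2 * kappa)) * (snd z + h) + - (iot / (h - snd z)))"
 define t2 where "t2 = max 0 (h - iot / (B + B' + 1))"
 have t2: "0 <= t2" "t2 < h" using h i B0 by (auto simp: t2_def)
 have t2i: "B + B' <= iot / (h - t2)"
 proof -
  have "h - t2 <= iot / (B + B' + 1)" by (simp add: t2_def)
  then have "(h - t2) * (B + B' + 1) <= iot" using B0 by (simp add: pos_le_divide_eq)
  then have "B + B' + 1 <= iot / (h - t2)" using t2 by (simp add: pos_le_divide_eq mult.commute)
  then show ?thesis by simp
 qed
 have qp: "qpen c h (x, t) \<ge> 0" if "-h <= t" for x :: "real^'n" and t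
 proof -
  have "c \<ge> 0" by (simp add: c sum_nonneg)
  then show ?thesis using that by (simp add: qpen_def)
 qed
 define W where "W = (\<lambda>z. f z - phi z)"
 have "W (0, 0) \<ge> 0"
 proof (rule ccontr)
  assume "\<not> ?thesis"
  then have neg: "W (0, 0) < 0" by simp
  have cont: "continuous_on (cball 0 r \<times> {-h..t2}) W"
   unfolding W_def phi_def using t2
   by (intro continuous_intros continuous_on_subset[OF cf] continuous_on_subset[OF H(1)]) auto
  have facts: "f (x, t) - H (x, t) \<ge> - (B + B')" if "norm x <= r" "-h <= t" "t <= t2" for x t
   using Bf[of x t] BH[of t x] that t2 by (smt (verit))
  have Wge: "W (x, t) \<ge> f (x, t) - H (x, t) + K * qpen c h (x, t) + iot / (h - t)" if "-h <= t" for x t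
   using that k by (simp add: W_def phi_def)
  have ip: "iot / (h - t) > 0" if "t <= t2" for t using that t2 i by simp
  obtain x t where xt: "x \<in> interior (cball 0 r)" "-h < t" "t <= t2" "W (x, t) < 0"
   "t < t2 ==> \<exists>dlt>0. \<forall>v s. norm v < dlt --> \<bar>s\<bar> < dlt --> W (x, t) <= W (x + v, t + s)"
  proof (rule cylinder_min[OF cont compact_cball, of 0 0 0])
   fix x t assume a: "x \<in> cball 0 r" "-h <= t" "t <= t2" "W (x, t) < 0"
   have kq: "K * qpen c h (x, t) \<ge> 0" using K0 qp[OF a(2)] by simp
   have "t \<noteq> -h"
   proof
    assume "t = -h"
    then show False using Wge[of t x] H0[of x] a kq ip[of t] by auto
   qed
   moreover have "norm x \<noteq> r"
   proof
    assume n: "norm x = r"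
    have "r^4 <= qpen c h (x, t)"
    proof -
     have "c \<ge> 0" by (simp add: c sum_nonneg)
     then have "0 <= c * ((t + h) * r\<^sup>2) + c\<^sup>2 * (t + h)\<^sup>2" using a by simp
     then show ?thesis by (simp add: qpen_def n power_mult[symmetric])
    qed
    then have "K * r^4 <= K * qpen c h (x, t)" using K0 by (intro mult_left_mono)
    moreover have "K * r^4 = B + B'" using r by (simp add: K_def)
    ultimately show False using Wge[OF a(2), of x] facts[of x t] a n ip[of t] by auto
   qed
   ultimately show "x \<in> interior (cball 0 r) \<and> -h < t" using a by (auto simp: interior_cball)
  qed (use t2 r h neg in auto)
  have tlt: "t < t2"
  proof (rule ccontr)
   assume "\<not> t < t2"
   then have "t = t2" using xt by simp
   then have "W (x, t) \<ge> 0"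
    using Wge[of t x] facts[of x t] t2i qp[of t x] K0 xt t2 h interior_subset[of "cball 0 r"]
    by (smt (verit, ccfv_SIG) mem_cball_0 mult_nonneg_nonneg subset_iff)
   then show False using xt by simp
  qed
  have xr: "norm x < r" using xt(1) by (simp add: interior_cball)
  have th: "\<bar>t\<bar> < h" using xt tlt t2 by auto
  obtain a xi q where jh: "pjet H x t a xi q" "isqf q" "a = (\<Sum>k\<in>UNIV. q (sg k))" using H(2) by blast
  define pa where "pa = c * (norm x)\<^sup>2 + 2 * c\<^sup>2 * (t + h)"
  define pq where "pq = (\<lambda>v. 4 * (norm x)\<^sup>2 * (norm v)\<^sup>2 + 8 * (x \<bullet> v)\<^sup>2 + 2 * c * (t + h) * (norm v)\<^sup>2)"
  have "th < h ==> True" for th by simp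
  have jt: "pjet (\<lambda>z. (- (2 * kappa)) * (snd z + h)) x t (- (2 * kappa)) 0 (\<lambda>v. 0)"
   by (rule pjet_cong[OF pjet_cmult[OF pjet_add[OF pjet_snd pjet_const[of h]], of "- (2 * kappa)"]]) auto
  have ji: "pjet (\<lambda>z. - (iot / (h - snd z))) x t (- (iot / (h - t)\<^sup>2)) (- 0) (\<lambda>v. - 0)"
   by (rule pjet_minus[OF pjet_inverse_time]) (use th in auto)
  note jq = pjet_cmult[OF pjet_qpen[of c h x t], of "- K", folded pa_def pq_def]
  note j = pjet_add[OF pjet_add[OF pjet_add[OF jh(1) jq] jt] ji]
  have jphi: "pjet phi x t (a + - K * pa + - (2 * kappa) + - (iot / (h - t)\<^sup>2)) (xi + (- K) *\<^sub>R ((4 * (norm x)\<^sup>2 + 2 * c * (t + h)) *\<^sub>R x)) (\<lambda>v. q v + (- K) * pq v)"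
   by (rule pjet_cong[OF j]) (auto simp: phi_def pq_def)
  have iq: "isqf (\<lambda>v. q v + (- K) * pq v)"
   unfolding pq_def by (intro isqf_add isqf_cmult isqf_norm2 isqf_inner2 jh)
  have "(\<Sum>k\<in>UNIV. q (sg k) + (- K) * pq (sg k)) <= (a + - K * pa + - (2 * kappa) + - (iot / (h - t)\<^sup>2)) + kappa"
   using lin[OF xr th jphi iq] xt(5)[OF tlt] by (auto simp: W_def)
  moreover have "(\<Sum>k\<in>UNIV. q (sg k) + (- K) * pq (sg k)) = a - K * (\<Sum>k\<in>UNIV. pq (sg k))"
   by (simp add: sum.distrib jh(3) sum_distrib_left sum_negf sum_subtractf)
  moreover have "K * (\<Sum>k\<in>UNIV. pq (sg k)) <= K * pa"
   unfolding pq_def pa_def using K0 th by (intro mult_left_mono qpen_super[OF c]) auto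
  moreover have "0 <= iot / (h - t)\<^sup>2" using i by simp
  ultimately show False using k by linarith
 qed
 then have "H (0, 0) - K * (c\<^sup>2 * h\<^sup>2) - 2 * kappa * h - e <= f (0, 0)"
  using h by (simp add: W_def phi_def qpen_def iot_def)
 then show "H (0, 0) - (B + B') / r^4 * c\<^sup>2 * h\<^sup>2 - 2 * kappa * h <= f (0, 0) + e" by (simp add: K_def)
qed

section \<open>Sums of supersolutions of linear equations\<close>

lemma pjet_shift:
 assumes "pjet f (x + x0) (t + t0) a xi q"
 shows "pjet (\<lambda>z. f (fst z + x0, snd z + t0)) x t a xi q"
 using assms unfolding pjet_def by (simp add: add_ac)

lemma pjet_fst:
 assumes "pjet f x t a xi q"
 shows "pjet (\<lambda>z. f (fst (fst z), snd z)) (x, y :: 'b::real_inner) t a (xi, 0) (\<lambda>v. q (fst v))"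
 unfolding pjet_def
proof (intro conjI allI impI)
 have nf: "norm (fst v) <= norm v" for v :: "'a \<times> 'b" by (metis norm_fst_le prod.collapse)
 obtain B where B: "\<And>v. \<bar>q v\<bar> <= B * (norm v)\<^sup>2" using assms unfolding pjet_def by blast
 have "\<bar>q (fst v)\<bar> <= \<bar>B\<bar> * (norm v)\<^sup>2" for v :: "'a \<times> 'b"
 proof -
  have "B * (norm (fst v))\<^sup>2 <= \<bar>B\<bar> * (norm v)\<^sup>2" using nf[of v] by (intro mult_mono power_mono) auto
  then show ?thesis using B[of "fst v"] by linarith
 qed
 then show "\<exists>B. \<forall>v :: 'a \<times> 'b. \<bar>q (fst v)\<bar> <= B * (norm v)\<^sup>2" by blast
 fix e :: real assume e: "e > 0"
 obtain C d where C: "0 < d" "0 <= C" and P: "\<And>v s. norm v < d ==> \<bar>s\<bar> < d ==>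
    \<bar>f (x + v, t + s) - (f (x, t) + a * s + xi \<bullet> v + q v / 2)\<bar> <= e * (norm v)\<^sup>2 + C * s\<^sup>2"
  using pjetD[OF assms e] by metis
 show "\<exists>C. \<exists>dlt>0. \<forall>v s. norm v < dlt --> \<bar>s\<bar> < dlt -->
   \<bar>f (fst (fst ((x, y) + v, t + s)), snd ((x, y) + v, t + s)) - (f (fst (fst ((x, y), t)), snd ((x, y), t)) + a * s + (xi, 0) \<bullet> v + q (fst v) / 2)\<bar> <= e * (norm v)\<^sup>2 + C * s\<^sup>2"
 proof (rule exI[of _ C], rule exI[of _ d], intro conjI allI impI C)
  fix v :: "'a \<times> 'b" and s :: real assume h: "norm v < d" "\<bar>s\<bar> < d"
  have "\<bar>f (x + fst v, t + s) - (f (x, t) + a * s + xi \<bullet> fst v + q (fst v) / 2)\<bar> <= e * (norm (fst v))\<^sup>2 + C * s\<^sup>2"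
   using P[of "fst v" s] nf[of v] h by linarith
  also have "\<dots> <= e * (norm v)\<^sup>2 + C * s\<^sup>2" using nf[of v] e by (intro add_right_mono mult_left_mono power_mono) auto
  finally show "\<bar>f (fst (fst ((x, y) + v, t + s)), snd ((x, y) + v, t + s)) - (f (fst (fst ((x, y), t)), snd ((x, y), t)) + a * s + (xi, 0) \<bullet> v + q (fst v) / 2)\<bar> <= e * (norm v)\<^sup>2 + C * s\<^sup>2"
   by (simp add: inner_prod_def)
 qed
qed

lemma pjet_snd':
 assumes "pjet f y t a xi q"
 shows "pjet (\<lambda>z. f (snd (fst z), snd z)) (x :: 'b::real_inner, y) t a (0, xi) (\<lambda>v. q (snd v))"
proof -
 have nf: "norm (prod.swap v) = norm v" for v :: "'b \<times> 'a"
  by (simp add: norm_prod_def prod.swap_def add.commute)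
 have ns: "prod.swap (a + b) = prod.swap a + prod.swap b" for a b :: "'b \<times> 'a" by (simp add: prod_eq_iff)
 have "pjet (\<lambda>z. f (fst (fst z), snd z)) (y, x) t a (xi, 0) (\<lambda>v. q (fst v))" by (rule pjet_fst[OF assms])
 then show ?thesis
  unfolding pjet_def
 proof (elim conjE, intro conjI allI impI)
  assume "\<exists>B. \<forall>v :: 'a \<times> 'b. \<bar>q (fst v)\<bar> <= B * (norm v)\<^sup>2"
  then obtain B where B: "\<And>v :: 'a \<times> 'b. \<bar>q (fst v)\<bar> <= B * (norm v)\<^sup>2" by blast
  then show "\<exists>B. \<forall>v :: 'b \<times> 'a. \<bar>q (snd v)\<bar> <= B * (norm v)\<^sup>2"
   using nf by (metis fst_swap)
  fix e :: real assume e: "e > 0"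
  assume A: "\<forall>eps>0. \<exists>C. \<exists>dlt>0. \<forall>v s. norm v < dlt --> \<bar>s\<bar> < dlt -->
   \<bar>f (fst (fst ((y, x) + v, t + s)), snd ((y, x) + v, t + s)) - (f (fst (fst ((y, x), t)), snd ((y, x), t)) + a * s + (xi, 0) \<bullet> v + q (fst v) / 2)\<bar> <= eps * (norm v)\<^sup>2 + C * s\<^sup>2"
  obtain C d where d: "d > 0" and P: "\<And>v s. norm v < d ==> \<bar>s\<bar> < d ==>
   \<bar>f (fst (fst ((y, x) + v, t + s)), snd ((y, x) + v, t + s)) - (f (fst (fst ((y, x), t)), snd ((y, x), t)) + a * s + (xi, 0) \<bullet> v + q (fst v) / 2)\<bar> <= e * (norm v)\<^sup>2 + C * s\<^sup>2"
   using A e by blast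
  show "\<exists>C. \<exists>dlt>0. \<forall>v s. norm v < dlt --> \<bar>s\<bar> < dlt -->
   \<bar>f (snd (fst ((x, y) + v, t + s)), snd ((x, y) + v, t + s)) - (f (snd (fst ((x, y), t)), snd ((x, y), t)) + a * s + (0, xi) \<bullet> v + q (snd v) / 2)\<bar> <= e * (norm v)\<^sup>2 + C * s\<^sup>2"
  proof (rule exI[of _ C], rule exI[of _ d], intro conjI allI impI d)
   fix v :: "'b \<times> 'a" and s :: real assume h: "norm v < d" "\<bar>s\<bar> < d"
   show "\<bar>f (snd (fst ((x, y) + v, t + s)), snd ((x, y) + v, t + s)) - (f (snd (fst ((x, y), t)), snd ((x, y), t)) + a * s + (0, xi) \<bullet> v + q (snd v) / 2)\<bar> <= e * (norm v)\<^sup>2 + C * s\<^sup>2"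
    using P[of "prod.swap v" s] h nf[of v] by (simp add: inner_prod_def)
  qed
 qed
qed

definition dform :: "(real^'n => real) => real => real => (real^'n) \<times> (real^'n) => real" where
 "dform Z mu nu z = Z (fst z - snd z) + mu * (norm (fst z))\<^sup>2 + nu * (norm (snd z))\<^sup>2"

lemma isqf_expand:
 assumes "isqf Z"
 obtains X :: "real^'n^'n" where "\<And>u v. Z (u + v) = Z u + 2 * ((X *v u) \<bullet> v) + Z v" "\<And>u. norm (X *v u) <= norm X * norm u"
proof -
 obtain X where X: "transpose X = X" "\<And>v. Z v = (X *v v) \<bullet> v" using assms unfolding isqf_def by blast
 show ?thesis
 proof (rule that[of X])
  show "Z (u + v) = Z u + 2 * ((X *v u) \<bullet> v) + Z v" for u v
   using sym_matrix_inner[OF X(1), of v u] by (simp add: X(2) matrix_vector_right_distrib inner_add_left inner_add_right)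
 qed (rule norm_matrix_vector_le)
qed

lemma dform_expand:
 assumes "isqf Z"
 obtains b K where "\<And>z v. dform Z mu nu (z + v) = dform Z mu nu z + 2 * (b z \<bullet> v) + dform Z mu nu v"
  "\<And>z. norm (b z) <= K * norm z" "K \<ge> 0"
proof -
 obtain X where X: "\<And>u v. Z (u + v) = Z u + 2 * ((X *v u) \<bullet> v) + Z v" "\<And>u. norm (X *v u) <= norm X * norm u"
  using isqf_expand[OF assms] by blast
 define b where "b = (\<lambda>z. (X *v (fst z - snd z) + mu *\<^sub>R fst z, - (X *v (fst z - snd z)) + nu *\<^sub>R snd z))"
 show ?thesis
 proof (rule that[of b "4 * norm X + \<bar>mu\<bar> + \<bar>nu\<bar>"])
  show "dform Z mu nu (z + v) = dform Z mu nu z + 2 * (b z \<bullet> v) + dform Z mu nu v" for z v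
  proof -
   have "fst (z + v) - snd (z + v) = (fst z - snd z) + (fst v - snd v)" by simp
   then have "Z (fst (z + v) - snd (z + v)) = Z (fst z - snd z) + 2 * ((X *v (fst z - snd z)) \<bullet> (fst v - snd v)) + Z (fst v - snd v)"
    using X(1) by metis
   then show ?thesis
    by (simp add: dform_def b_def inner_prod_def power2_norm_eq_inner inner_add_left inner_add_right inner_diff_right inner_commute algebra_simps)
  qed
  show "norm (b z) <= (4 * norm X + \<bar>mu\<bar> + \<bar>nu\<bar>) * norm z" for z
  proof -
   have f: "norm (fst z) <= norm z" "norm (snd z) <= norm z" by (metis norm_fst_le prod.collapse, metis norm_snd_le prod.collapse)
   have d: "norm (fst z - snd z) <= 2 * norm z" using norm_triangle_ineq4[of "fst z" "snd z"] f by linarith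
   have "norm (X *v (fst z - snd z)) <= norm X * (2 * norm z)"
    using order_trans[OF X(2) mult_left_mono[OF d, of "norm X"]] by simp
   moreover have "norm (b z) <= norm (X *v (fst z - snd z) + mu *\<^sub>R fst z) + norm (- (X *v (fst z - snd z)) + nu *\<^sub>R snd z)"
    unfolding b_def by (rule norm_Pair_le)
   moreover have "norm (X *v (fst z - snd z) + mu *\<^sub>R fst z) <= norm (X *v (fst z - snd z)) + \<bar>mu\<bar> * norm z"
    using norm_triangle_ineq[of "X *v (fst z - snd z)" "mu *\<^sub>R fst z"] mult_left_mono[OF f(1), of "\<bar>mu\<bar>"] by simp
   moreover have "norm (- (X *v (fst z - snd z)) + nu *\<^sub>R snd z) <= norm (X *v (fst z - snd z)) + \<bar>nu\<bar> * norm z"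
    using norm_triangle_ineq[of "- (X *v (fst z - snd z))" "nu *\<^sub>R snd z"] mult_left_mono[OF f(2), of "\<bar>nu\<bar>"] by simp
   ultimately show ?thesis by (simp add: algebra_simps)
  qed
 qed simp
qed

lemma dform_bound:
 assumes "isqf Z" shows "\<exists>L\<ge>0. \<forall>v. \<bar>dform Z mu nu v\<bar> <= L * (norm v)\<^sup>2"
proof -
 obtain L where L: "L \<ge> 0" "\<And>v. \<bar>Z v\<bar> <= L * (norm v)\<^sup>2" using isqf_bound[OF assms] by blast
 have "\<bar>dform Z mu nu z\<bar> <= (4 * L + \<bar>mu\<bar> + \<bar>nu\<bar>) * (norm z)\<^sup>2" for z
 proof -
  have f: "norm (fst z) <= norm z" "norm (snd z) <= norm z" by (metis norm_fst_le prod.collapse, metis norm_snd_le prod.collapse)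
  have d: "norm (fst z - snd z) <= 2 * norm z" using norm_triangle_ineq4[of "fst z" "snd z"] f by linarith
  have "\<bar>Z (fst z - snd z)\<bar> <= L * (2 * norm z)\<^sup>2"
   using order_trans[OF L(2) mult_left_mono[OF power_mono[OF d norm_ge_zero] L(1)]] .
  moreover have "\<bar>mu * (norm (fst z))\<^sup>2\<bar> <= \<bar>mu\<bar> * (norm z)\<^sup>2" "\<bar>nu * (norm (snd z))\<^sup>2\<bar> <= \<bar>nu\<bar> * (norm z)\<^sup>2"
   using f by (auto simp: abs_mult intro!: mult_left_mono power_mono)
  ultimately show ?thesis unfolding dform_def by (simp add: algebra_simps power2_eq_square)
 qed
 moreover have "0 <= 4 * L + \<bar>mu\<bar> + \<bar>nu\<bar>" using L by simp
 ultimately show ?thesis by blast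
qed

lemma dform_hom: "isqf Z ==> dform Z mu nu (c *\<^sub>R z) = c\<^sup>2 * dform Z mu nu z"
 using isqf_hom[of Z c "fst z - snd z"]
 by (simp add: dform_def power_mult_distrib scaleR_diff_right[symmetric] distrib_left mult.left_commute del: scaleR_diff_right)

lemma continuous_on_isqf:
 assumes "isqf q" "continuous_on S f" shows "continuous_on S (\<lambda>x. q (f x :: real^'n))"
proof -
 obtain X where X: "\<And>v. q v = (X *v v) \<bullet> v" using assms unfolding isqf_def by blast
 have "continuous_on S (\<lambda>x. (X *v f x) \<bullet> f x)"
  by (intro continuous_intros matrix_vector_mult_linear_continuous_on[THEN continuous_on_compose2[OF _ assms(2)]] assms(2)) auto
 then show ?thesis by (simp add: X)
qed

lemma continuous_on_dform:
 assumes "isqf Z" "continuous_on S f" "continuous_on S g"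
 shows "continuous_on S (\<lambda>x. dform Z mu nu (f x, g x))"
 unfolding dform_def fst_conv snd_conv
 by (intro continuous_on_add continuous_on_isqf[OF assms(1)] continuous_on_mult_left continuous_on_power continuous_on_norm continuous_on_diff assms)

definition dpoly :: "(real^'n) => (real^'n) => real => (real^'n => real) => real => real => real => ((real^'n) \<times> (real^'n)) \<times> real => real" where
 "dpoly p1 p2 A Z mu nu C z = (p1, p2) \<bullet> fst z + A * snd z - dform Z mu nu (fst z) / 2 - C * (snd z)\<^sup>2"

lemma pjet_dpoly:
 assumes Z: "isqf Z"
 shows "\<exists>xi. pjet (dpoly p1 p2 A Z mu nu C) z t (A - 2 * C * t) xi (\<lambda>v. - dform Z mu nu v)"
proof -
 obtain b K where b: "\<And>z v. dform Z mu nu (z + v) = dform Z mu nu z + 2 * (b z \<bullet> v) + dform Z mu nu v"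
  using dform_expand[OF Z] by metis
 obtain L where L: "\<And>v. \<bar>dform Z mu nu v\<bar> <= L * (norm v)\<^sup>2" using dform_bound[OF Z] by blast
 have 1: "pjet (\<lambda>z. (p1, p2) \<bullet> fst z - dform Z mu nu (fst z) / 2) z t 0 ((p1, p2) - b z) (\<lambda>v. - dform Z mu nu v)"
  by (rule pjetI_exact[where B=L]) (simp_all only: fst_conv b abs_minus_cancel L, simp_all add: inner_add_right inner_diff_left add_divide_distrib)
 note 2 = pjet_add[OF pjet_add[OF 1 pjet_cmult[OF pjet_snd, of A]] pjet_cmult[OF pjet_comp[OF pjet_snd peano2_square], of "- C"]]
 show ?thesis
  by (rule exI, rule pjet_cong[OF 2]) (auto simp: dpoly_def)
qed

text \<open>
 The heat flows of the two functions are compared separately; together they form a solution of a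
 degenerate equation in doubled variables, diffusing along the pairs \<open>(sg k, sg' k)\<close>, which preserves the quadratic lower
 bound up to the trace term.  Division by the time step and passage to the limit give the inequality.
\<close>

lemma linear_sum:
 fixes f g :: "(real^'n) \<times> real => real" and sg sg' :: "'k::finite => real^'n"
 assumes r: "0 < r" "r <= 1" and h0: "0 < h0" "h0 <= 1" and k: "kappa > 0" and Z: "isqf Z"
  and cf: "continuous_on (cball 0 r \<times> {-h0..h0}) f" and cg: "continuous_on (cball 0 r \<times> {-h0..h0}) g"
  and Bf: "\<And>x t. norm x <= r ==> \<bar>t\<bar> <= h0 ==> \<bar>f (x, t)\<bar> <= B" and Bg: "\<And>x t. norm x <= r ==> \<bar>t\<bar> <= h0 ==> \<bar>g (x, t)\<bar> <= B"
  and linf: "\<And>x t phi a xi q. norm x < r ==> \<bar>t\<bar> < h0 ==> pjet phi x t a xi q ==> isqf q ==>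
    (\<exists>dlt>0. \<forall>v s. norm v < dlt --> \<bar>s\<bar> < dlt --> f (x, t) - phi (x, t) <= f (x + v, t + s) - phi (x + v, t + s)) ==>
    (\<Sum>k\<in>UNIV. q (sg k)) <= a + kappa"
  and ling: "\<And>x t phi a xi q. norm x < r ==> \<bar>t\<bar> < h0 ==> pjet phi x t a xi q ==> isqf q ==>
    (\<exists>dlt>0. \<forall>v s. norm v < dlt --> \<bar>s\<bar> < dlt --> g (x, t) - phi (x, t) <= g (x + v, t + s) - phi (x + v, t + s)) ==>
    (\<Sum>k\<in>UNIV. q (sg' k)) <= a + kappa"
  and z0: "f (0, 0) + g (0, 0) = 0"
  and ineq: "\<And>x y t. norm x <= r ==> norm y <= r ==> -h0 <= t ==> t <= 0 ==>
    dpoly p1 p2 A Z mu nu C ((x, y), t) <= f (x, t) + g (y, t)"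
  and C: "C \<ge> 0"
 shows "- (\<Sum>k\<in>UNIV. dform Z mu nu (sg k, sg' k)) - 8 * kappa <= A"
proof (rule ccontr)
 assume neg: "\<not> ?thesis"
 define c1 where "c1 = 12 * (\<Sum>k\<in>UNIV. (norm (sg k))\<^sup>2)"
 define c2 where "c2 = 12 * (\<Sum>k\<in>UNIV. (norm (sg' k))\<^sup>2)"
 have c12: "c1 \<ge> 0" "c2 \<ge> 0" by (auto simp: c1_def c2_def sum_nonneg)
 have B0: "B \<ge> 0" using Bf[of 0 0] r h0 by auto
 define P where "P = dpoly p1 p2 A Z mu nu C"
 have cP: "continuous_on S P" for S
 proof -
  have "continuous_on S (\<lambda>z. dform Z mu nu (fst (fst z), snd (fst z)))"
   by (intro continuous_on_dform[OF Z] continuous_intros)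
  then have "continuous_on S (\<lambda>z. dform Z mu nu (fst z))" by simp
  then show ?thesis unfolding P_def dpoly_def by (intro continuous_intros) auto
 qed
 have "compact ((cball (0::real^'n) r \<times> cball (0::real^'n) r) \<times> {-1..0::real})" by (intro compact_Times) auto
 then have bd: "bounded (P ` ((cball 0 r \<times> cball 0 r) \<times> {-1..0}))" using compact_continuous_image[OF cP] compact_imp_bounded by blast
 obtain PM where PM: "\<And>x y t. norm x <= r ==> norm y <= r ==> -1 <= t ==> t <= 0 ==> \<bar>P ((x, y), t)\<bar> <= PM" "PM \<ge> 0"
 proof -
  obtain b where b: "\<And>z. z \<in> (cball (0::real^'n) r \<times> cball (0::real^'n) r) \<times> {-1..0} ==> norm (P z) <= b"
   using bd unfolding bounded_iff by blast
  show ?thesis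
  proof (rule that[of "\<bar>b\<bar>"])
   show "\<bar>P ((x, y), t)\<bar> <= \<bar>b\<bar>" if "norm x <= r" "norm y <= r" "-1 <= t" "t <= 0" for x y t
    using b[of "((x, y), t)"] that by auto
  qed simp
 qed
 define K1 where "K1 = (B + (B + 1)) / r^4"
 define K2 where "K2 = (2 * (B + 1) + PM + 6 * kappa) / r^4"
 have K: "K1 \<ge> 0" "K2 \<ge> 0" using B0 PM k r by (auto simp: K1_def K2_def)
 define D where "D = (K1 + K2) * (c1\<^sup>2 + c2\<^sup>2) + 2 * C + 1"
 have D: "D \<ge> 1" using K C by (simp add: D_def)
 define h where "h = min (h0 / 2) (kappa / D)"
 have h: "0 < h" "h < h0" "h <= 1" "h * D <= kappa" using h0 k D by (auto simp: h_def min_mult_distrib_right)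
 have hD1: "h * ((K1 + K2) * (c1\<^sup>2 + c2\<^sup>2)) <= kappa"
 proof -
  have "h * ((K1 + K2) * (c1\<^sup>2 + c2\<^sup>2)) <= h * D" using h C by (intro mult_left_mono) (auto simp: D_def)
  then show ?thesis using h by linarith
 qed
 have hD2: "2 * C * h <= kappa"
 proof -
  have "h * (2 * C) <= h * D" using h K C by (intro mult_left_mono) (auto simp: D_def)
  then have "h * (2 * C) <= kappa" using h by linarith
  then show ?thesis by (simp only: mult_ac)
 qed
 define eps where "eps = min (kappa * h / 4) 1"
 have eps: "0 < eps" "eps <= 1" "eps <= kappa * h / 4" using h k by (auto simp: eps_def)
 have ext: "\<exists>H. continuous_on UNIV H \<and> (\<forall>x t. \<exists>a xi q. pjet H x t a xi q \<and> isqf q \<and> a = (\<Sum>k\<in>UNIV. q (tau k))) \<and>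
   (\<forall>x. norm x <= r --> H (x, -h) <= u (x, -h) \<and> u (x, -h) - eps <= H (x, -h)) \<and> (\<forall>x t. -h <= t --> \<bar>H (x, t)\<bar> <= B + 1)"
  if cu: "continuous_on (cball 0 r \<times> {-h0..h0}) u" and Bu: "\<And>x t. norm x <= r ==> \<bar>t\<bar> <= h0 ==> \<bar>u (x, t)\<bar> <= B" for u and tau :: "'k => real^'n"
 proof -
  have c1: "continuous_on (cball 0 r) (\<lambda>x. u (x, -h) - eps / 2)"
   using h by (intro continuous_intros continuous_on_compose2[OF cu]) auto
  have b1: "\<bar>u (x, -h) - eps / 2\<bar> <= B + eps / 2" if "x \<in> cball 0 r" for x
   using Bu[of x "-h"] that h eps by auto
  have e1: "0 < eps / 2" "B + eps / 2 \<ge> 0" using eps B0 by auto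
  obtain F where F: "F \<in> trigp" "\<And>x. x \<in> cball 0 r ==> \<bar>F x - (u (x, -h) - eps / 2)\<bar> < eps / 2" "\<And>x. \<bar>F x\<bar> <= (B + eps / 2) + eps / 2"
   using trig_approx[OF c1 r(2) e1(1) b1 e1(2)] by blast
  obtain G where G: "heatlike tau G" "\<And>x. G (x, 0) = F x" using trig_extension[OF F(1)] by blast
  define H where "H = (\<lambda>z :: (real^'n) \<times> real. G (fst z + 0, snd z + h))"
  have Fb: "F x <= B + 1" "- F x <= B + 1" for x using F(3)[of x] eps by auto
  show ?thesis
  proof (intro exI[of _ H] conjI allI impI)
   have cG: "continuous_on UNIV G" using G(1) unfolding heatlike_def by blast
   show "continuous_on UNIV H" unfolding H_def
    by (rule continuous_on_compose2[OF cG, of UNIV "\<lambda>z. (fst z + 0, snd z + h)"]) (auto intro!: continuous_intros)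
   fix x t
   show "\<exists>a xi q. pjet H x t a xi q \<and> isqf q \<and> a = (\<Sum>k\<in>UNIV. q (tau k))"
    using G(1) pjet_shift[of G x 0 t h] unfolding heatlike_def H_def by blast
   show "\<bar>H (x, t)\<bar> <= B + 1" if "-h <= t"
   proof -
    have "G (x, t + h) <= B + 1" by (rule heatlike_max[OF G(1)]) (use that Fb G(2) in auto)
    moreover have "- G (x, t + h) <= B + 1" by (rule heatlike_max[OF heatlike_uminus[OF G(1)]]) (use that Fb G(2) in auto)
    ultimately show ?thesis by (simp add: H_def)
   qed
  next
   fix x :: "real^'n" assume "norm x <= r"
   then have "x \<in> cball 0 r" by simp
   from F(2)[OF this] have "F x <= u (x, -h)" "u (x, -h) - eps <= F x" by argo+
   then show "H (x, -h) <= u (x, -h)" "u (x, -h) - eps <= H (x, -h)" unfolding H_def by (simp_all add: G(2))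
  qed
 qed
 obtain H1 where H1: "continuous_on UNIV H1" "\<And>x t. \<exists>a xi q. pjet H1 x t a xi q \<and> isqf q \<and> a = (\<Sum>k\<in>UNIV. q (sg k))"
  "\<And>x. norm x <= r ==> H1 (x, -h) <= f (x, -h)" "\<And>x. norm x <= r ==> f (x, -h) - eps <= H1 (x, -h)" "\<And>x t. -h <= t ==> \<bar>H1 (x, t)\<bar> <= B + 1"
  using ext[OF cf Bf, of sg] by blast
 obtain H2 where H2: "continuous_on UNIV H2" "\<And>x t. \<exists>a xi q. pjet H2 x t a xi q \<and> isqf q \<and> a = (\<Sum>k\<in>UNIV. q (sg' k))"
  "\<And>x. norm x <= r ==> H2 (x, -h) <= g (x, -h)" "\<And>x. norm x <= r ==> g (x, -h) - eps <= H2 (x, -h)" "\<And>x t. -h <= t ==> \<bar>H2 (x, t)\<bar> <= B + 1"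
  using ext[OF cg Bg, of sg'] by blast
 have sub: "cball 0 r \<times> {-h..h} \<subseteq> cball 0 r \<times> {-h0..h0}" for r :: real using h by auto
 have L1: "H1 (0, 0) - (B + (B + 1)) / r^4 * c1\<^sup>2 * h\<^sup>2 - 2 * kappa * h <= f (0, 0)"
 proof (rule linear_comparison[OF r(1) h(1) k continuous_on_subset[OF cf sub] _ _ H1(1,2,3,5) c1_def])
  show "\<bar>f (x, t)\<bar> <= B" if "norm x <= r" "\<bar>t\<bar> <= h" for x t using Bf[of x t] that h by auto
  fix x :: "real^'n" and t phi a xi and q :: "real^'n => real"
  assume a: "norm x < r" "\<bar>t\<bar> < h" "pjet phi x t a xi q" "isqf q"
    "\<exists>dlt>0. \<forall>v s. norm v < dlt --> \<bar>s\<bar> < dlt --> f (x, t) - phi (x, t) <= f (x + v, t + s) - phi (x + v, t + s)"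
  have "\<bar>t\<bar> < h0" using a(2) h by linarith
  from linf[OF a(1) this a(3,4,5)] show "(\<Sum>k\<in>UNIV. q (sg k)) <= a + kappa" .
 qed
 have L2: "H2 (0, 0) - (B + (B + 1)) / r^4 * c2\<^sup>2 * h\<^sup>2 - 2 * kappa * h <= g (0, 0)"
 proof (rule linear_comparison[OF r(1) h(1) k continuous_on_subset[OF cg sub] _ _ H2(1,2,3,5) c2_def])
  show "\<bar>g (x, t)\<bar> <= B" if "norm x <= r" "\<bar>t\<bar> <= h" for x t using Bg[of x t] that h by auto
  fix x :: "real^'n" and t phi a xi and q :: "real^'n => real"
  assume a: "norm x < r" "\<bar>t\<bar> < h" "pjet phi x t a xi q" "isqf q"
    "\<exists>dlt>0. \<forall>v s. norm v < dlt --> \<bar>s\<bar> < dlt --> g (x, t) - phi (x, t) <= g (x + v, t + s) - phi (x + v, t + s)"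
  have "\<bar>t\<bar> < h0" using a(2) h by linarith
  from ling[OF a(1) this a(3,4,5)] show "(\<Sum>k\<in>UNIV. q (sg' k)) <= a + kappa" .
 qed
 define S where "S = cball (0 :: real^'n) r \<times> cball (0 :: real^'n) r"
 define pen where "pen = (\<lambda>z :: ((real^'n) \<times> (real^'n)) \<times> real. K2 * (qpen c1 h (fst (fst z), snd z) + qpen c2 h (snd (fst z), snd z)) + (2 * eps - 6 * kappa * h) - 6 * kappa * snd z)"
 define W where "W = (\<lambda>z :: ((real^'n) \<times> (real^'n)) \<times> real. H1 (fst (fst z), snd z) + H2 (snd (fst z), snd z) - P z + pen z)"
 have W0: "W ((0, 0), 0) \<ge> 0"
 proof (rule ccontr)
  assume "\<not> ?thesis"
  then have Wneg: "W ((0, 0), 0) < 0" by simp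
  have cW: "continuous_on (S \<times> {-h..0}) W"
   unfolding W_def pen_def
   by (intro continuous_intros cP continuous_on_compose2[OF H1(1)] continuous_on_compose2[OF H2(1)]
     continuous_on_compose2[OF continuous_on_qpen[of UNIV]]) auto
  have qp: "qpen c h (x, t) \<ge> 0" if "c \<ge> 0" "-h <= t" for x :: "real^'n" and c t using that by (simp add: qpen_def)
  have qr: "qpen c h (x, t) \<ge> r^4" if "c \<ge> 0" "-h <= t" "norm x = r" for x :: "real^'n" and c t
   using that by (simp add: qpen_def power_mult[symmetric])
  obtain z t where zt: "z \<in> interior S" "-h < t" "t <= 0"
   "\<exists>dlt>0. \<forall>v s. norm v < dlt --> - dlt < s --> s <= 0 --> W (z, t) <= W (z + v, t + s)"
  proof (rule cylinder_min[OF cW, of "(0, 0)" 0 0])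
   show "compact S" unfolding S_def by (intro compact_Times) auto
   fix z t assume a: "z \<in> S" "-h <= t" "t <= 0" "W (z, t) < 0"
   obtain x y where z: "z = (x, y)" by (cases z)
   have xy: "norm x <= r" "norm y <= r" using a(1) by (auto simp: S_def z)
   have q12: "qpen c1 h (x, t) \<ge> 0" "qpen c2 h (y, t) \<ge> 0" using qp c12 a by auto
   have "t \<noteq> -h"
   proof
    assume t: "t = -h"
    have "P ((x, y), -h) <= f (x, -h) + g (y, -h)" unfolding P_def using ineq xy h by auto
    then have "H1 (x, -h) + H2 (y, -h) - P ((x, y), -h) \<ge> - 2 * eps" using H1(4) H2(4) xy by (smt (verit, ccfv_SIG))
    moreover have "pen (z, t) \<ge> 2 * eps" using q12 K by (simp add: pen_def z t)
    ultimately show False using a(4) by (simp add: W_def z t)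
   qed
   moreover have "norm x \<noteq> r \<and> norm y \<noteq> r"
   proof (rule ccontr)
    assume "\<not> ?thesis"
    then have "norm x = r \<or> norm y = r" by blast
    then have "r^4 <= qpen c1 h (x, t) + qpen c2 h (y, t)"
     using qr[OF c12(1) a(2), of x] qr[OF c12(2) a(2), of y] q12 by auto
    then have "K2 * r^4 <= K2 * (qpen c1 h (x, t) + qpen c2 h (y, t))" using K by (intro mult_left_mono)
    moreover have "K2 * r^4 = 2 * (B + 1) + PM + 6 * kappa" using r by (simp add: K2_def)
    moreover have "6 * kappa * h <= 6 * kappa" using k h by simp
    moreover have "0 <= - (6 * kappa * t)" using k a by (simp add: mult_nonneg_nonpos)
    ultimately have "pen (z, t) \<ge> 2 * (B + 1) + PM" using eps by (simp add: pen_def z)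
    moreover have "- (B + 1) <= H1 (x, t)" "- (B + 1) <= H2 (y, t)" "P ((x, y), t) <= PM"
     using abs_le_D2[OF H1(5)[OF a(2), of x]] abs_le_D2[OF H2(5)[OF a(2), of y]] abs_le_D1[OF PM(1)[OF xy _ a(3)]] a(2) h(3) by auto
    moreover have "H1 (x, t) + H2 (y, t) - P ((x, y), t) + pen (z, t) < 0" using a(4) by (simp add: W_def z)
    ultimately show False by argo
   qed
   ultimately show "z \<in> interior S \<and> -h < t" using xy a by (auto simp: S_def z interior_Times interior_cball)
  qed (use r h Wneg in \<open>auto simp: S_def\<close>)
  obtain x y where z: "z = (x, y)" by (cases z)
  obtain a1 xi1 q1 where j1: "pjet H1 x t a1 xi1 q1" "isqf q1" "a1 = (\<Sum>k\<in>UNIV. q1 (sg k))" using H1(2) by blast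
  obtain a2 xi2 q2 where j2: "pjet H2 y t a2 xi2 q2" "isqf q2" "a2 = (\<Sum>k\<in>UNIV. q2 (sg' k))" using H2(2) by blast
  obtain xi3 where j3: "pjet P z t (A - 2 * C * t) xi3 (\<lambda>v. - dform Z mu nu v)" unfolding P_def using pjet_dpoly[OF Z] by blast
  define pa where "pa = (\<lambda>c (x :: real^'n). c * (norm x)\<^sup>2 + 2 * c\<^sup>2 * (t + h))"
  define pq where "pq = (\<lambda>c (x :: real^'n) v. 4 * (norm x)\<^sup>2 * (norm v)\<^sup>2 + 8 * (x \<bullet> v)\<^sup>2 + 2 * c * (t + h) * (norm v)\<^sup>2)"
  have jq: "\<exists>xi. pjet (qpen c h) x t (pa c x) xi (pq c x)" for c and x :: "real^'n"
   using pjet_qpen[of c h x t] unfolding pa_def pq_def by blast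
  obtain xi4 where j4: "pjet (qpen c1 h) x t (pa c1 x) xi4 (pq c1 x)" using jq by blast
  obtain xi5 where j5: "pjet (qpen c2 h) y t (pa c2 y) xi5 (pq c2 y)" using jq by blast
  note jp = pjet_add[OF pjet_add[OF pjet_cmult[OF pjet_add[OF pjet_fst[OF j4, of y] pjet_snd'[OF j5, of x]], of K2] pjet_const[of "2 * eps - 6 * kappa * h"]]
    pjet_cmult[OF pjet_snd, of "- (6 * kappa)"]]
  note jj = pjet_add[OF pjet_add[OF pjet_add[OF pjet_fst[OF j1(1), of y] pjet_snd'[OF j2(1), of x]] pjet_minus[OF j3[unfolded z]]] jp]
  define aW where "aW = a1 + a2 - (A - 2 * C * t) + (K2 * (pa c1 x + pa c2 y) - 6 * kappa)"
  define qW where "qW = (\<lambda>v. q1 (fst v) + q2 (snd v) + dform Z mu nu v + K2 * (pq c1 x (fst v) + pq c2 y (snd v)))"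
  have "\<exists>xi. pjet W (x, y) t aW xi qW"
   by (rule exI, rule pjet_cong[OF jj]) (auto simp: W_def pen_def aW_def qW_def)
  then obtain xiW where jW: "pjet W (x, y) t aW xiW qW" by blast
  obtain d where d: "d > 0" "\<And>v s. norm v < d ==> - d < s ==> s <= 0 ==> W ((x, y), t) <= W ((x, y) + v, t + s)"
   using zt(4) z by blast
  have 1: "aW <= 0" using pjet_min(1)[OF jW d] .
  have hom: "qW (c *\<^sub>R v) = c\<^sup>2 * qW v" for c v
   unfolding qW_def dform_hom[OF Z] pq_def
   by (simp add: isqf_hom[OF j1(2)] isqf_hom[OF j2(2)] power_mult_distrib algebra_simps)
  have 2: "0 <= qW (sg k, sg' k)" for k by (rule pjet_min(2)[OF jW d hom])
  have "0 <= (\<Sum>k\<in>UNIV. qW (sg k, sg' k))" by (rule sum_nonneg) (use 2 in auto)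
  also have "\<dots> = a1 + a2 + (\<Sum>k\<in>UNIV. dform Z mu nu (sg k, sg' k)) + K2 * ((\<Sum>k\<in>UNIV. pq c1 x (sg k)) + (\<Sum>k\<in>UNIV. pq c2 y (sg' k)))"
   by (simp only: qW_def sum.distrib j1(3) j2(3) sum_distrib_left[symmetric] fst_conv snd_conv distrib_left)
  also have "\<dots> <= a1 + a2 + (\<Sum>k\<in>UNIV. dform Z mu nu (sg k, sg' k)) + K2 * (pa c1 x + pa c2 y)"
   unfolding pq_def pa_def using K zt h by (intro add_left_mono mult_left_mono add_mono qpen_super c1_def c2_def) auto
  finally have "(\<Sum>k\<in>UNIV. dform Z mu nu (sg k, sg' k)) + A - 2 * C * t + 6 * kappa \<ge> 0" using 1 unfolding aW_def by linarith
  moreover have "- (2 * C * t) <= kappa"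
  proof -
   have "2 * C * (- t) <= 2 * C * h" using zt C by (intro mult_left_mono) auto
   then show ?thesis using hD2 by simp
  qed
  ultimately show False using neg k by linarith
 qed
 have "P ((0, 0), 0) = 0" using dform_hom[OF Z, of mu nu 0 "(0, 0)"] by (simp add: P_def dpoly_def zero_prod_def)
 then have "W ((0, 0), 0) = H1 (0, 0) + H2 (0, 0) + K2 * (c1\<^sup>2 * h\<^sup>2 + c2\<^sup>2 * h\<^sup>2) + (2 * eps - 6 * kappa * h)"
  by (simp add: W_def pen_def qpen_def)
 then have "0 <= K1 * c1\<^sup>2 * h\<^sup>2 + K1 * c2\<^sup>2 * h\<^sup>2 + 4 * kappa * h + K2 * (c1\<^sup>2 * h\<^sup>2 + c2\<^sup>2 * h\<^sup>2) + 2 * eps - 6 * kappa * h"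
  using W0 L1 L2 z0 unfolding K1_def by linarith
 also have "\<dots> = h * (h * ((K1 + K2) * (c1\<^sup>2 + c2\<^sup>2))) + 2 * eps - 2 * kappa * h"
  by (simp add: algebra_simps power2_eq_square)
 also have "\<dots> <= h * kappa + 2 * (kappa * h / 4) - 2 * kappa * h"
  using hD1 h eps by (intro add_mono diff_right_mono mult_left_mono) auto
 also have "\<dots> < 0" using h k by simp
 finally show False by simp
qed

section \<open>The theorem on sums\<close>

text \<open>
 A square root of the coefficient matrix of the operator at gradient \<open>p\<close>, written as a family of vectors.  Pairing two such
 families index by index is a coupling of the two diffusions.
\<close>

definition coupl :: "real => ('k::finite => real^'n => real^'n) => bool" where
 "coupl alpha s \<longleftrightarrow> (\<forall>p v. p \<noteq> 0 --> (\<Sum>k\<in>UNIV. (s k p \<bullet> v)\<^sup>2) = alpha * (norm v)\<^sup>2 + (1 - 2 * alpha) * ((p \<bullet> v)\<^sup>2 / (norm p)\<^sup>2)) \<and>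
   (\<forall>k. continuous_on (- {0}) (s k))"

lemma coupl_Fq:
 fixes s :: "'k::finite => real^'n => real^'n"
 assumes c: "coupl alpha s" and p: "p \<noteq> 0" and q: "isqf q"
 shows "(\<Sum>k\<in>UNIV. q (s k p)) = Fq alpha p q"
proof -
 obtain X where X: "\<And>v. q v = (X *v v) \<bullet> v" using q unfolding isqf_def by blast
 have sq: "(\<Sum>k\<in>UNIV. (s k p \<bullet> v)\<^sup>2) = alpha * (norm v)\<^sup>2 + (1 - 2 * alpha) * ((p \<bullet> v)\<^sup>2 / (norm p)\<^sup>2)" for v
  using c p unfolding coupl_def by blast
 have M: "(\<Sum>k\<in>UNIV. (s k p \<bullet> v) * (s k p \<bullet> w)) = alpha * (v \<bullet> w) + (1 - 2 * alpha) * ((p \<bullet> v) * (p \<bullet> w) / (norm p)\<^sup>2)" for v w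
 proof -
  have "(\<Sum>k\<in>UNIV. (s k p \<bullet> (v + w))\<^sup>2) = (\<Sum>k\<in>UNIV. (s k p \<bullet> v)\<^sup>2) + (\<Sum>k\<in>UNIV. (s k p \<bullet> w)\<^sup>2) + 2 * (\<Sum>k\<in>UNIV. (s k p \<bullet> v) * (s k p \<bullet> w))"
   by (simp add: inner_add_right power2_sum sum.distrib sum_distrib_left mult.assoc)
  then have "2 * (\<Sum>k\<in>UNIV. (s k p \<bullet> v) * (s k p \<bullet> w)) =
   alpha * ((norm (v + w))\<^sup>2 - (norm v)\<^sup>2 - (norm w)\<^sup>2) + (1 - 2 * alpha) * (((p \<bullet> (v + w))\<^sup>2 - (p \<bullet> v)\<^sup>2 - (p \<bullet> w)\<^sup>2) / (norm p)\<^sup>2)"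
   unfolding sq diff_divide_distrib right_diff_distrib by linarith
  also have "\<dots> = 2 * (alpha * (v \<bullet> w) + (1 - 2 * alpha) * ((p \<bullet> v) * (p \<bullet> w) / (norm p)\<^sup>2))"
   
  proof -
   have "(norm (v + w))\<^sup>2 - (norm v)\<^sup>2 - (norm w)\<^sup>2 = 2 * (v \<bullet> w)"
    by (simp add: power2_norm_eq_inner inner_add_left inner_add_right inner_commute)
   moreover have "(p \<bullet> (v + w))\<^sup>2 - (p \<bullet> v)\<^sup>2 - (p \<bullet> w)\<^sup>2 = 2 * ((p \<bullet> v) * (p \<bullet> w))"
    by (simp add: inner_add_right power2_sum)
   ultimately show ?thesis by (simp only: times_divide_eq_right[symmetric] distrib_left mult.left_commute[of 2])
  qed
  finally show ?thesis by simp
 qed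
 have qe: "q u = (\<Sum>i\<in>UNIV. \<Sum>j\<in>UNIV. X $ i $ j * (u $ j * u $ i))" for u
  by (simp add: X inner_vec_def matrix_vector_mult_def sum_distrib_right mult.assoc)
 have "(\<Sum>k\<in>UNIV. q (s k p)) = (\<Sum>i\<in>UNIV. \<Sum>j\<in>UNIV. \<Sum>k\<in>UNIV. X $ i $ j * (s k p $ j * s k p $ i))"
  unfolding qe by (subst sum.swap, rule sum.cong[OF refl], subst sum.swap, rule refl)
 also have "\<dots> = (\<Sum>i\<in>UNIV. \<Sum>j\<in>UNIV. X $ i $ j * (\<Sum>k\<in>UNIV. (s k p \<bullet> axis j 1) * (s k p \<bullet> axis i 1)))"
  by (simp add: sum_distrib_left inner_axis)
 also have "\<dots> = (\<Sum>i\<in>UNIV. \<Sum>j\<in>UNIV. alpha * (if i = j then X $ i $ j else 0)) +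
   (\<Sum>i\<in>UNIV. \<Sum>j\<in>UNIV. ((1 - 2 * alpha) / (norm p)\<^sup>2) * (X $ i $ j * (p $ j * p $ i)))"
  unfolding M sum.distrib[symmetric]
 proof (intro sum.cong refl)
  fix i j :: 'n
  have ax: "(axis j 1 :: real^'n) \<bullet> axis i 1 = (if i = j then 1 else 0)" by (auto simp: inner_axis_axis)
  have px: "p \<bullet> axis j 1 = p $ j" "p \<bullet> axis i 1 = p $ i" by (simp_all add: inner_axis)
  show "X $ i $ j * (alpha * (axis j 1 \<bullet> (axis i 1 :: real^'n)) + (1 - 2 * alpha) * ((p \<bullet> axis j 1) * (p \<bullet> axis i 1) / (norm p)\<^sup>2)) =
    alpha * (if i = j then X $ i $ j else 0) + (1 - 2 * alpha) / (norm p)\<^sup>2 * (X $ i $ j * (p $ j * p $ i))"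
   unfolding ax px by (simp add: distrib_left)
 qed
 also have "(\<Sum>i\<in>UNIV. \<Sum>j\<in>UNIV. alpha * (if i = j then X $ i $ j else 0)) = alpha * (\<Sum>i\<in>UNIV. X $ i $ i)"
  unfolding sum_distrib_left[symmetric] by simp
 also have "(\<Sum>i\<in>UNIV. \<Sum>j\<in>UNIV. ((1 - 2 * alpha) / (norm p)\<^sup>2) * (X $ i $ j * (p $ j * p $ i))) = (1 - 2 * alpha) * (q p / (norm p)\<^sup>2)"
  unfolding sum_distrib_left[symmetric] qe[symmetric] by simp
 also have "(\<Sum>i\<in>UNIV. X $ i $ i) = (\<Sum>i\<in>UNIV. q (axis i 1))" by (simp add: X matrix_vector_axis inner_axis)
 finally show ?thesis by (simp add: Fq_def)
qed

lemma psd_trace: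
 assumes Y: "isqf (Y :: real^'n => real)" and pos: "\<And>v. 0 <= Y v" and u: "norm u = 1"
 shows "Y u <= (\<Sum>i\<in>UNIV. Y (axis i 1))"
proof -
 obtain X where X: "\<And>u v. Y (u + v) = Y u + 2 * ((X *v u) \<bullet> v) + Y v" "\<And>u. norm (X *v u) <= norm X * norm u"
  using isqf_expand[OF Y] by blast
 have cvx: "convex_on UNIV Y"
 proof (rule convex_onI)
  fix t :: real and x y :: "real^'n" assume t: "0 < t" "t < 1"
  have h: "Y (c *\<^sub>R v) = c\<^sup>2 * Y v" for c v by (rule isqf_hom[OF Y])
  have 1: "Y ((1 - t) *\<^sub>R x + t *\<^sub>R y) = (1 - t)\<^sup>2 * Y x + 2 * (1 - t) * t * ((X *v x) \<bullet> y) + t\<^sup>2 * Y y"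
   unfolding X(1) h by (simp add: matrix_vector_mult_scaleR)
  have 2: "Y (x + (- 1) *\<^sub>R y) = Y x - 2 * ((X *v x) \<bullet> y) + Y y" unfolding X(1) h by simp
  have "0 <= t * (1 - t) * Y (x + (- 1) *\<^sub>R y)" using pos t by simp
  then show "Y ((1 - t) *\<^sub>R x + t *\<^sub>R y) <= (1 - t) * Y x + t * Y y"
   unfolding 1 2 by (simp add: power2_eq_square algebra_simps)
 qed simp
 define I where "I = {i. u $ i \<noteq> 0}"
 have n1: "(\<Sum>i\<in>UNIV. (u $ i)\<^sup>2) = 1"
  using u by (simp add: norm_vec_def L2_set_def)
 have sI: "(\<Sum>i\<in>I. (u $ i)\<^sup>2) = 1"
  unfolding n1[symmetric] by (rule sum.mono_neutral_left) (auto simp: I_def)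
 have Ine: "I \<noteq> {}" using sI by auto
 have uu: "(\<Sum>i\<in>I. (u $ i)\<^sup>2 *\<^sub>R ((1 / u $ i) *\<^sub>R axis i 1)) = u"
 proof -
  have "(\<Sum>i\<in>I. (u $ i)\<^sup>2 *\<^sub>R ((1 / u $ i) *\<^sub>R axis i 1)) = (\<Sum>i\<in>I. u $ i *\<^sub>R axis i (1::real))"
   by (rule sum.cong) (auto simp: I_def power2_eq_square)
  also have "\<dots> = (\<Sum>i\<in>UNIV. u $ i *\<^sub>R axis i (1::real))" by (rule sum.mono_neutral_left) (auto simp: I_def)
  also have "\<dots> = u" by (simp add: vec_eq_iff axis_def if_distrib cong: if_cong)
  finally show ?thesis .
 qed
 have "Y u = Y (\<Sum>i\<in>I. (u $ i)\<^sup>2 *\<^sub>R ((1 / u $ i) *\<^sub>R axis i 1))" by (simp only: uu)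
 also have "\<dots> <= (\<Sum>i\<in>I. (u $ i)\<^sup>2 * Y ((1 / u $ i) *\<^sub>R axis i 1))"
  by (rule convex_on_sum[OF _ Ine cvx sI]) (auto simp: I_def)
 also have "\<dots> = (\<Sum>i\<in>I. Y (axis i 1))" by (rule sum.cong) (auto simp: I_def isqf_hom[OF Y] power_divide)
 also have "\<dots> <= (\<Sum>i\<in>UNIV. Y (axis i 1))" by (rule sum_mono2) (auto simp: pos)
 finally show ?thesis .
qed

lemma isqf_sgn:
 assumes "isqf q" "xi \<noteq> 0" shows "q xi / (norm xi)\<^sup>2 = q (sgn xi)"
 using isqf_hom[OF assms(1), of "inverse (norm xi)" xi] assms(2) by (simp add: sgn_div_norm divide_inverse power_inverse)

lemma sgn_diff_le:
 fixes xi pv :: "'a::real_normed_vector"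
 assumes "xi \<noteq> 0" "pv \<noteq> 0" shows "norm (sgn xi - sgn pv) <= 2 * norm (xi - pv) / norm pv"
proof -
 have eq: "sgn xi - sgn pv = inverse (norm pv) *\<^sub>R (xi - pv) + (inverse (norm xi) - inverse (norm pv)) *\<^sub>R xi"
  by (simp add: sgn_div_norm algebra_simps)
 have "norm ((inverse (norm xi) - inverse (norm pv)) *\<^sub>R xi) = \<bar>norm pv - norm xi\<bar> / norm pv"
 proof -
  have "(inverse (norm xi) - inverse (norm pv)) * norm xi = (norm pv - norm xi) / norm pv"
   using assms by (simp add: field_simps)
  then show ?thesis by (metis abs_divide abs_mult abs_norm_cancel norm_scaleR)
 qed
 also have "\<dots> <= norm (xi - pv) / norm pv"
  using norm_triangle_ineq3[of pv xi] by (intro divide_right_mono) (auto simp: norm_minus_commute)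
 finally have 2: "norm ((inverse (norm xi) - inverse (norm pv)) *\<^sub>R xi) <= norm (xi - pv) / norm pv" .
 have "norm (inverse (norm pv) *\<^sub>R (xi - pv)) = norm (xi - pv) / norm pv" by (simp add: divide_inverse mult.commute)
 then show ?thesis unfolding eq using 2 norm_triangle_ineq[of "inverse (norm pv) *\<^sub>R (xi - pv)" "(inverse (norm xi) - inverse (norm pv)) *\<^sub>R xi"]
  by simp
qed

text \<open>
 Freezing the gradient changes the operator by a factor close to one on nonnegative forms, because
 for \<open>0 < alpha < 1\<close> the operator is uniformly elliptic.
\<close>

lemma freeze_psd:
 fixes Y :: "real^'n => real"
 assumes al: "0 < alpha" "alpha < 1" and Y: "isqf Y" and pos: "\<And>v. 0 <= Y v" and nz: "xi \<noteq> 0" "pv \<noteq> 0"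
 shows "Fq alpha xi Y <= (1 + 4 * (real CARD('n))\<^sup>2 / (min alpha (1 - alpha)) * norm (xi - pv) / norm pv) * Fq alpha pv Y"
proof -
 obtain X where Xt: "transpose X = X" and X: "\<And>v. Y v = (X *v v) \<bullet> v" using Y unfolding isqf_def by blast
 define T where "T = (\<Sum>i\<in>UNIV. Y (axis i 1))"
 define c0 where "c0 = min alpha (1 - alpha)"
 define N where "N = real CARD('n)"
 have c0: "c0 > 0" using al by (simp add: c0_def)
 have N1: "N \<ge> 1" by (simp add: N_def Suc_le_eq)
 have T0: "T \<ge> 0" by (simp add: T_def sum_nonneg pos)
 have diag: "X $ i $ i = Y (axis i 1)" for i by (simp add: X matrix_vector_axis inner_axis)
 have dle: "X $ i $ i <= T" "0 <= X $ i $ i" for i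
  unfolding diag T_def by (auto intro!: member_le_sum pos)
 have entry: "\<bar>X $ i $ j\<bar> <= T" for i j
 proof -
  have sym: "X $ j $ i = X $ i $ j" using Xt by (simp add: transpose_def vec_eq_iff)
  have e: "Y (axis i 1 + c *\<^sub>R axis j 1) = X $ i $ i + 2 * c * X $ i $ j + c\<^sup>2 * X $ j $ j" for c
   by (simp add: X matrix_vector_right_distrib matrix_vector_mult_scaleR inner_add_left inner_add_right
     matrix_vector_axis inner_axis sym power2_eq_square algebra_simps)
  show ?thesis using pos[of "axis i 1 + 1 *\<^sub>R axis j 1"] pos[of "axis i 1 + (-1) *\<^sub>R axis j 1"] dle[of i] dle[of j]
   unfolding e by simp
 qed
 have nX: "norm X <= N\<^sup>2 * T"
 proof -
  have "norm X <= (\<Sum>i\<in>UNIV. norm (X $ i))" unfolding norm_vec_def[of X] by (rule L2_set_le_sum) auto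
  also have "\<dots> <= (\<Sum>i\<in>(UNIV :: 'n set). \<Sum>j\<in>(UNIV :: 'n set). T)"
   by (intro sum_mono order_trans[OF norm_le_l1_cart] entry)
  also have "\<dots> = N\<^sup>2 * T" by (simp add: N_def power2_eq_square)
  finally show ?thesis .
 qed
 have un: "norm (sgn xi) = 1" "norm (sgn pv) = 1" using nz by (auto simp: norm_sgn)
 have "\<bar>Y (sgn xi) - Y (sgn pv)\<bar> <= norm X * norm (sgn xi - sgn pv) * 2"
 proof -
  have "Y (sgn xi) - Y (sgn pv) = (X *v (sgn xi - sgn pv)) \<bullet> (sgn xi + sgn pv)"
   using sym_matrix_inner[OF Xt, of "sgn xi" "sgn pv"]
   by (simp add: X matrix_vector_mult_diff_distrib inner_add_right inner_diff_left)
  also have "\<bar>\<dots>\<bar> <= norm (X *v (sgn xi - sgn pv)) * norm (sgn xi + sgn pv)" by (rule Cauchy_Schwarz_ineq2)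
  also have "\<dots> <= (norm X * norm (sgn xi - sgn pv)) * 2"
   using norm_triangle_ineq[of "sgn xi" "sgn pv"] un by (intro mult_mono norm_matrix_vector_le) auto
  finally show ?thesis .
 qed
 also have "\<dots> <= (N\<^sup>2 * T) * (2 * norm (xi - pv) / norm pv) * 2"
  using sgn_diff_le[OF nz] nX T0 by (intro mult_right_mono mult_mono) auto
 finally have Yd: "\<bar>Y (sgn xi) - Y (sgn pv)\<bar> <= 4 * N\<^sup>2 * (norm (xi - pv) / norm pv) * T" by (simp add: algebra_simps)
 have FqY: "Fq alpha eta Y = alpha * T + (1 - 2 * alpha) * Y (sgn eta)" if "eta \<noteq> 0" for eta
  unfolding Fq_def T_def using isqf_sgn[OF Y that] by simp
 have low: "c0 * T <= Fq alpha pv Y"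
 proof (cases "alpha <= 1/2")
  case True
  then have "0 <= (1 - 2 * alpha) * Y (sgn pv)" using pos by simp
  moreover have "c0 * T <= alpha * T" using T0 by (intro mult_right_mono) (auto simp: c0_def)
  ultimately show ?thesis unfolding FqY[OF nz(2)] by linarith
 next
  case False
  have "Y (sgn pv) <= T" unfolding T_def by (rule psd_trace[OF Y pos un(2)])
  then have "(1 - 2 * alpha) * T <= (1 - 2 * alpha) * Y (sgn pv)" using False by (intro mult_left_mono_neg) auto
  moreover have "c0 * T <= (1 - alpha) * T" using T0 by (intro mult_right_mono) (auto simp: c0_def)
  ultimately show ?thesis unfolding FqY[OF nz(2)] by (simp add: algebra_simps)
 qed
 have "Fq alpha xi Y - Fq alpha pv Y = (1 - 2 * alpha) * (Y (sgn xi) - Y (sgn pv))"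
  unfolding FqY[OF nz(1)] FqY[OF nz(2)] by (simp add: algebra_simps)
 also have "\<dots> <= 1 * \<bar>Y (sgn xi) - Y (sgn pv)\<bar>"
 proof -
  have "\<bar>(1 - 2 * alpha) * (Y (sgn xi) - Y (sgn pv))\<bar> <= 1 * \<bar>Y (sgn xi) - Y (sgn pv)\<bar>"
   unfolding abs_mult using al by (intro mult_right_mono) auto
  then show ?thesis by linarith
 qed
 also have "\<dots> <= 4 * N\<^sup>2 * (norm (xi - pv) / norm pv) * T" using Yd by simp
 also have "\<dots> <= 4 * N\<^sup>2 * (norm (xi - pv) / norm pv) * (Fq alpha pv Y / c0)"
  using low c0 by (intro mult_left_mono) (auto simp: pos_le_divide_eq mult.commute)
 finally show ?thesis by (simp add: algebra_simps N_def c0_def)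
qed

lemma Fq_norm2:
 fixes eta :: "real^'n"
 shows "eta \<noteq> 0 ==> Fq alpha eta (\<lambda>v. (norm v)\<^sup>2) = alpha * CARD('n) + (1 - 2 * alpha)"
 by (simp add: Fq_def)

lemma continuous_on_Fq:
 assumes "isqf q" shows "continuous_on (- {0}) (\<lambda>eta :: real^'n. Fq alpha eta q)"
 unfolding Fq_def by (intro continuous_intros continuous_on_isqf[OF assms]) auto

lemma super_at_Fq:
 assumes "super_at alpha u x t" "pjet phi x t a xi q" "isqf q" "xi \<noteq> 0"
  "\<exists>dlt>0. \<forall>v s. norm v < dlt --> \<bar>s\<bar> < dlt --> u (x, t) - phi (x, t) <= u (x + v, t + s) - phi (x + v, t + s)"
 shows "Fq alpha xi q <= a"
proof (rule field_le_epsilon)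
 fix e :: real assume e: "e > 0"
 have "isCont (\<lambda>eta. Fq alpha eta q) xi"
  using continuous_on_Fq[OF assms(3), of alpha] assms(4) continuous_on_eq_continuous_at[OF open_Compl[OF closed_singleton[of "0 :: real^'n"]]] by auto
 then obtain rho where "rho > 0" "\<And>eta. norm (eta - xi) < rho ==> \<bar>Fq alpha eta q - Fq alpha xi q\<bar> < e"
  using e unfolding continuous_at_eps_delta dist_norm by (metis real_norm_def)
 then have "\<exists>rho>0. \<forall>eta. eta \<noteq> 0 --> norm (eta - xi) < rho --> Fq alpha xi q - e <= Fq alpha eta q"
  by (intro exI[of _ rho]) fastforce
 then have "Fq alpha xi q - e <= a" using assms(1,2,3,5) unfolding super_at_def by blast
 then show "Fq alpha xi q <= a + e" by simp
qed

lemma super_at_shift: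
 fixes xh :: "real^'n"
 assumes "super_at alpha v (xh + x) (th + t)"
 shows "super_at alpha (\<lambda>z. v ((xh, th) + z) - c) x t"
 unfolding super_at_def
proof (intro allI impI)
 fix phi a xi q m
 assume j: "pjet phi x t a xi q" and q: "isqf q"
  and T: "\<exists>dlt>0. \<forall>w s. norm w < dlt --> \<bar>s\<bar> < dlt --> v ((xh, th) + (x, t)) - c - phi (x, t) <= v ((xh, th) + (x + w, t + s)) - c - phi (x + w, t + s)"
  and F: "\<exists>rho>0. \<forall>eta. eta \<noteq> 0 --> norm (eta - xi) < rho --> m <= Fq alpha eta q"
 define pf where "pf = (\<lambda>z :: (real^'n) \<times> real. phi (fst z + (- xh), snd z + (- th)))"
 have "pjet pf (xh + x) (th + t) a xi q" unfolding pf_def by (rule pjet_shift) (simp add: j)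
 moreover have "\<exists>dlt>0. \<forall>w s. norm w < dlt --> \<bar>s\<bar> < dlt --> v (xh + x, th + t) - pf (xh + x, th + t) <= v (xh + x + w, th + t + s) - pf (xh + x + w, th + t + s)"
  using T by (simp add: pf_def add.assoc)
 ultimately show "m <= a" using assms q F unfolding super_at_def by blast
qed

lemma inf_conv:
 fixes f :: "'z::euclidean_space => real"
 assumes "compact Bx" "Bx \<noteq> {}" "continuous_on Bx f" and d: "0 < dlt"
 obtains fd opt where "\<And>z. opt z \<in> Bx" "\<And>z. fd z = f (opt z) + (norm (z - opt z))\<^sup>2 / (2 * dlt)"
  "\<And>z zeta. zeta \<in> Bx ==> fd z <= f zeta + (norm (z - zeta))\<^sup>2 / (2 * dlt)"
proof -
 have "\<exists>zeta\<in>Bx. \<forall>zeta'\<in>Bx. f zeta + (norm (z - zeta))\<^sup>2 / (2 * dlt) <= f zeta' + (norm (z - zeta'))\<^sup>2 / (2 * dlt)" for z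
  by (rule continuous_attains_inf[OF assms(1,2)]) (use d in \<open>intro continuous_intros assms; simp\<close>)
 then obtain opt where o: "\<And>z. opt z \<in> Bx" "\<And>z zeta'. zeta' \<in> Bx ==> f (opt z) + (norm (z - opt z))\<^sup>2 / (2 * dlt) <= f zeta' + (norm (z - zeta'))\<^sup>2 / (2 * dlt)"
  by metis
 show ?thesis by (rule that[of opt "\<lambda>z. f (opt z) + (norm (z - opt z))\<^sup>2 / (2 * dlt)"]) (auto intro: o)
qed

lemma inner_sgn_right: "(w :: 'a::real_inner) \<bullet> sgn w = norm w"

proof (cases "w = 0")
 case False
 then show ?thesis unfolding sgn_div_norm inner_scaleR_right dot_square_norm by (simp add: power2_eq_square)
qed simp

lemma norm2_diff_shift:
 fixes z :: "'a::real_inner"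
 shows "(norm (z' - zeta))\<^sup>2 = (norm (z - zeta))\<^sup>2 + 2 * ((z' - z) \<bullet> (z - zeta)) + (norm (z' - z))\<^sup>2"
proof -
 have "(norm (a + b))\<^sup>2 = (norm a)\<^sup>2 + 2 * (b \<bullet> a) + (norm b)\<^sup>2" for a b :: 'a
  unfolding power2_norm_eq_inner by (simp add: inner_add_left inner_add_right inner_commute)
 from this[of "z - zeta" "z' - z"] show ?thesis by simp
qed

lemma small_nonneg:
 fixes b C :: real
 assumes "d > 0" and "\<And>h. 0 < h ==> h < d ==> 0 <= b * h + C * h\<^sup>2"
 shows "0 <= b"
proof (rule ccontr)
 assume b: "\<not> 0 <= b"
 define m where "m = - b / (2 * (\<bar>C\<bar> + 1))"
 have m: "m > 0" using b by (simp add: m_def divide_neg_pos)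
 define h where "h = min (d / 2) m"
 have h: "0 < h" "h < d" "h <= m" using assms(1) m by (auto simp: h_def)
 have "0 <= h * (b + C * h)" using assms(2)[OF h(1,2)] by (simp add: power2_eq_square algebra_simps)
 then have "0 <= b + C * h" using h by (simp add: zero_le_mult_iff)
 also have "C * h <= (\<bar>C\<bar> + 1) * m" using h by (intro mult_mono) auto
 also have "(\<bar>C\<bar> + 1) * m = - b / 2"
 proof -
  have "c \<noteq> 0 ==> c * (- b / (2 * c)) = - b / 2" for c :: real by simp
  then show ?thesis unfolding m_def by (metis abs_ge_zero add_nonneg_pos less_irrefl zero_less_one)
 qed
 finally show False using b by linarith
qed

lemma pjet_min2:
 fixes x :: "'a::real_inner"
 assumes j: "pjet phi x t a xi q" and d: "dlt > 0"
  and m: "\<And>v s. norm v < dlt ==> \<bar>s\<bar> < dlt ==> phi (x, t) <= phi (x + v, t + s)"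
 shows "a = 0" "xi = 0"
proof -
 obtain B where B: "\<And>v. \<bar>q v\<bar> <= B * (norm v)\<^sup>2" using j unfolding pjet_def by blast
 have q0: "q 0 = 0" using B[of 0] by simp
 obtain C d1 where C: "0 < d1" "0 <= C" and P: "\<And>v s. norm v < d1 ==> \<bar>s\<bar> < d1 ==>
    \<bar>phi (x + v, t + s) - (phi (x, t) + a * s + xi \<bullet> v + q v / 2)\<bar> <= 1 * (norm v)\<^sup>2 + C * s\<^sup>2"
  using pjetD[OF j, of 1] by (metis zero_less_one)
 define e where "e = min dlt d1"
 have e: "e > 0" using d C by (simp add: e_def)
 have "0 <= a"
 proof (rule small_nonneg[OF e, of _ C])
  fix h assume "0 < h" "h < e"
  then show "0 <= a * h + C * h\<^sup>2" using m[of 0 h] P[of 0 h] C d q0 by (simp add: e_def)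
 qed
 moreover have "0 <= - a"
 proof (rule small_nonneg[OF e, of _ C])
  fix h assume "0 < h" "h < e"
  then show "0 <= - a * h + C * h\<^sup>2" using m[of 0 "- h"] P[of 0 "- h"] C d q0 by (simp add: e_def)
 qed
 ultimately show "a = 0" by simp
 have n1: "norm xi + 1 > 0" by (simp add: add_nonneg_pos)
 have "0 <= - (norm xi)\<^sup>2"
 proof (rule small_nonneg[of "e / (norm xi + 1)" _ "(B / 2 + 1) * (norm xi)\<^sup>2"])
  show "0 < e / (norm xi + 1)" using e n1 by simp
  fix h assume h: "0 < h" "h < e / (norm xi + 1)"
  have "h * (norm xi + 1) < e" using h(2) n1 by (simp add: pos_less_divide_eq)
  then have he: "norm ((- h) *\<^sub>R xi) < e" using h(1) by (simp add: algebra_simps)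
  have "phi (x, t) <= phi (x + (- h) *\<^sub>R xi, t + 0)" using m[of "(- h) *\<^sub>R xi" 0] he d by (simp add: e_def)
  moreover have "phi (x + (- h) *\<^sub>R xi, t + 0) <= phi (x, t) - h * (norm xi)\<^sup>2 + q ((- h) *\<^sub>R xi) / 2 + h\<^sup>2 * (norm xi)\<^sup>2"
   using P[of "(- h) *\<^sub>R xi" 0] he C by (simp add: e_def power_mult_distrib power2_norm_eq_inner)
  moreover have "q ((- h) *\<^sub>R xi) <= B * (h\<^sup>2 * (norm xi)\<^sup>2)" using B[of "(- h) *\<^sub>R xi"] by (simp add: power_mult_distrib)
  ultimately show "0 <= - (norm xi)\<^sup>2 * h + (B / 2 + 1) * (norm xi)\<^sup>2 * h\<^sup>2" by (simp add: algebra_simps)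
 qed
 then show "xi = 0" by simp
qed

lemma pjet_upper:
 fixes x :: "'a::real_inner"
 assumes j: "pjet phi x t a xi q" and e: "e > 0"
  and up: "\<And>v s. norm v < e ==> \<bar>s\<bar> < e ==> phi (x + v, t + s) <= phi (x, t) + (v, s) \<bullet> g + K * ((norm v)\<^sup>2 + s\<^sup>2)"
 shows "xi = fst g" "a = snd g" "(\<And>c. q (c *\<^sub>R v) = c\<^sup>2 * q v) ==> q v <= 2 * K * (norm v)\<^sup>2"
proof -
 define kk where "kk = (\<lambda>z. fst g \<bullet> fst z + snd g * snd z + K * ((norm (fst z - x))\<^sup>2) + K * (snd z + (- t))\<^sup>2 + - phi z)"
 note s = pjet_add[OF pjet_snd[of x t] pjet_const[of "- t"]]
 note jj = pjet_add[OF pjet_add[OF pjet_add[OF pjet_add[OF pjet_linear[of "fst g" x t] pjet_cmult[OF pjet_snd, of "snd g"]] pjet_cmult[OF pjet_norm2[of x], of K]]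
   pjet_cmult[OF pjet_comp[OF s peano2_square], of K]] pjet_minus[OF j]]
 have jc: "pjet kk x t (snd g - a) (fst g - xi) (\<lambda>v. 2 * K * (norm v)\<^sup>2 - q v)"
  by (rule pjet_cong[OF jj]) (auto simp: kk_def)
 have m: "kk (x, t) <= kk (x + v, t + s)" if "norm v < e" "\<bar>s\<bar> < e" for v s
  using up[OF that] by (cases g) (simp add: kk_def inner_add_right inner_commute algebra_simps)
 have "snd g - a = 0" "fst g - xi = 0" using pjet_min2[OF jc e m] by auto
 then show "xi = fst g" "a = snd g" by auto
 assume hom: "\<And>c. q (c *\<^sub>R v) = c\<^sup>2 * q v"
 have "0 <= 2 * K * (norm v)\<^sup>2 - q v"

 proof (rule pjet_min(2)[OF jc e])
  show "kk (x, t) <= kk (x + v, t + s)" if "norm v < e" "- e < s" "s <= 0" for v s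
   by (rule m) (use that e in auto)
 qed (auto simp: hom power_mult_distrib algebra_simps)
 then show "q v <= 2 * K * (norm v)\<^sup>2" by simp
qed

text \<open>
 At the point \<open>z1\<close> the inf-convolution has a one-sided expansion from below and is semiconcave, hence its gradient is
 close to \<open>pv\<close> nearby; all test gradients are therefore close to \<open>pv\<close> and the coefficients may be frozen there.
\<close>

lemma frozen_super:
 fixes f :: "(real^'n) \<times> real => real" and s :: "'k::finite => real^'n => real^'n"
 assumes al: "0 < alpha" "alpha < 1" and cs: "coupl alpha s" and R: "0 < R" and d0: "dlt > 0"
  and sup: "\<And>x t. norm x < R ==> \<bar>t\<bar> < R ==> super_at alpha f x t"
  and opt: "\<And>z. fd z = f (opt z) + (norm (z - opt z))\<^sup>2 / (2 * dlt)"
  and fd: "\<And>z zeta. zeta \<in> cball 0 R \<times> {-R..R} ==> fd z <= f zeta + (norm (z - zeta))\<^sup>2 / (2 * dlt)"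
  and optB: "\<And>z. opt z \<in> cball 0 R \<times> {-R..R}"
  and o1: "norm (fst (opt z1)) < R" "\<bar>snd (opt z1)\<bar> < R"
  and p: "pv \<noteq> 0" and L: "0 <= L" and rr: "0 < rr"
  and below: "\<And>z. norm (z - z1) <= rr ==> fd z1 + (pv, ap) \<bullet> (z - z1) - L * (norm (z - z1))\<^sup>2 <= fd z"
  and k: "kappa > 0"
 shows "\<exists>r>0. \<forall>x t phi a xi q. norm x < r --> \<bar>t\<bar> < r --> pjet phi x t a xi q --> isqf q -->
    (\<exists>dlt>0. \<forall>v s. norm v < dlt --> \<bar>s\<bar> < dlt --> fd (z1 + (x, t)) - phi (x, t) <= fd (z1 + (x + v, t + s)) - phi (x + v, t + s)) -->
    (\<Sum>k\<in>UNIV. q (s k pv)) <= a + kappa"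
proof -
 define G where "G = (\<lambda>z. inverse dlt *\<^sub>R (z - opt z))"
 define Pi where "Pi = (pv, ap)"
 have up: "fd z' <= fd z + (z' - z) \<bullet> G z + (norm (z' - z))\<^sup>2 / (2 * dlt)" for z z'
 proof -
  have "fd z' <= f (opt z) + (norm (z' - opt z))\<^sup>2 / (2 * dlt)" by (rule fd[OF optB])
  also have "\<dots> = fd z + (z' - z) \<bullet> G z + (norm (z' - z))\<^sup>2 / (2 * dlt)"
   unfolding norm2_diff_shift[of z' "opt z" z] opt[of z] G_def using d0 by (simp add: add_divide_distrib inverse_eq_divide)
  finally show ?thesis .
 qed
 have up': "fd z' <= fd z + (z' - z) \<bullet> G z + (norm (z' - z))\<^sup>2 * inverse dlt / 2" for z z'
  using up[of z' z] by (simp add: inverse_eq_divide mult.commute)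
 define Cc where "Cc = norm Pi + 4 * L + norm (G z1) + inverse dlt"
 have Cc: "Cc > 0" using d0 L by (simp add: Cc_def add_nonneg_pos)
 have Gd: "norm (Pi - G z) <= Cc * d" if d: "0 < d" "d <= rr / 2" "d <= 1" and z: "norm (z - z1) <= d\<^sup>2" for z d
 proof (cases "Pi = G z")
  case True then show ?thesis using Cc d by simp
 next
  case False
  define u where "u = sgn (Pi - G z)"
  have u: "norm u = 1" using False by (simp add: u_def norm_sgn)
  have Pu: "(Pi - G z) \<bullet> u = norm (Pi - G z)"
   unfolding u_def by (rule inner_sgn_right)
  define h where "h = z - z1"
  have dd: "d\<^sup>2 <= d" using d by (simp add: power2_eq_square mult_left_le_one_le)
  have hd: "norm h <= d\<^sup>2" "norm h <= d" using z dd by (auto simp: h_def)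
  have n: "norm (h + d *\<^sub>R u) <= 2 * d" using norm_triangle_ineq[of h "d *\<^sub>R u"] hd u d by simp
  have e1: "z + d *\<^sub>R u - z1 = h + d *\<^sub>R u" by (simp add: h_def)
  have "fd z1 + Pi \<bullet> (h + d *\<^sub>R u) - L * (norm (h + d *\<^sub>R u))\<^sup>2 <= fd (z + d *\<^sub>R u)"
   using below[of "z + d *\<^sub>R u"] n d unfolding e1 Pi_def by linarith
  moreover have "fd (z + d *\<^sub>R u) <= fd z + d * (u \<bullet> G z) + d\<^sup>2 * inverse dlt / 2"
   using up'[of "z + d *\<^sub>R u" z] u d by simp
  moreover have "fd z <= fd z1 + h \<bullet> G z1 + (norm h)\<^sup>2 * inverse dlt / 2"
   using up'[of z z1] by (simp add: h_def)
  moreover have "L * (norm (h + d *\<^sub>R u))\<^sup>2 <= L * (2 * d)\<^sup>2" using n L by (intro mult_left_mono power_mono) auto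
  moreover have "h \<bullet> G z1 <= d\<^sup>2 * norm (G z1)"
   using norm_cauchy_schwarz[of h "G z1"] mult_right_mono[OF hd(1), of "norm (G z1)"] by simp
  moreover have "- (Pi \<bullet> h) <= d\<^sup>2 * norm Pi"
   using Cauchy_Schwarz_ineq2[of Pi h] mult_left_mono[OF hd(1), of "norm Pi"] by (simp add: mult.commute)
  moreover have "(norm h)\<^sup>2 * inverse dlt / 2 <= d\<^sup>2 * inverse dlt / 2"
   using hd d0 by (intro divide_right_mono mult_right_mono power_mono) auto
  ultimately have "d * (Pi \<bullet> u) - d * (u \<bullet> G z) <= d\<^sup>2 * norm Pi + L * (2 * d)\<^sup>2 + d\<^sup>2 * norm (G z1) + d\<^sup>2 * inverse dlt"
   by (simp add: inner_add_right)
  then have "d * ((Pi - G z) \<bullet> u) <= d * (Cc * d)"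
   by (simp add: Cc_def inner_diff_left inner_commute[of u] power2_eq_square algebra_simps)
  then show ?thesis using d Pu by simp
 qed
 define c where "c = 4 * (real CARD('n))\<^sup>2 / (min alpha (1 - alpha)) / norm pv"
 define T where "T = alpha * CARD('n) + (1 - 2 * alpha)"
 have c0: "c > 0" using al p by (simp add: c_def)
 have T0: "T \<ge> 0"
 proof -
  have "alpha * 1 <= alpha * CARD('n)" using al by (intro mult_left_mono) (auto simp: Suc_le_eq)
  then show ?thesis using al unfolding T_def by linarith
 qed
 define A where "A = norm Pi + Cc + T / dlt + 1"
 have A: "A > 0" using Cc T0 d0 by (simp add: A_def add_nonneg_pos add_pos_nonneg)
 define gap where "gap = min (R - norm (fst (opt z1))) (R - \<bar>snd (opt z1)\<bar>)"
 have gap: "gap > 0" using o1 by (simp add: gap_def)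
 define d where "d = min (min (rr / 2) 1) (min (min (norm pv / (2 * Cc)) (kappa / (c * Cc * A))) (gap / (2 * (1 + 2 * dlt * Cc))))"
 have den: "c * Cc * A > 0" "1 + 2 * dlt * Cc > 0" using c0 Cc A d0 by (auto simp: add_pos_pos)
 have d: "d > 0" using rr p Cc k den gap by (simp add: d_def)
 have dle: "d <= rr / 2" "d <= 1" "Cc * d <= norm pv / 2" "c * Cc * A * d <= kappa" "(1 + 2 * dlt * Cc) * d <= gap / 2"
 proof -
  show "d <= rr / 2" "d <= 1" unfolding d_def by (rule min.coboundedI1, simp)+
  have "d <= norm pv / (2 * Cc)" by (simp add: d_def)
  then show "Cc * d <= norm pv / 2" using Cc by (simp add: field_simps)
  have "d <= kappa / (c * Cc * A)" by (simp add: d_def)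
  then show "c * Cc * A * d <= kappa" using den(1) by (simp add: pos_le_divide_eq mult.commute)
  have "d <= gap / (2 * (1 + 2 * dlt * Cc))" by (simp add: d_def)
  then show "(1 + 2 * dlt * Cc) * d <= gap / 2" using den(2) by (simp add: pos_le_divide_eq field_simps)
 qed
 show ?thesis
 proof (rule exI[of _ "d\<^sup>2 / 2"], intro conjI allI impI)
  show "0 < d\<^sup>2 / 2" using d by simp
  fix x :: "real^'n" and t phi a xi and q :: "real^'n => real"
  assume xt: "norm x < d\<^sup>2 / 2" "\<bar>t\<bar> < d\<^sup>2 / 2" and j: "pjet phi x t a xi q" and q: "isqf q"
   and touch: "\<exists>dlt>0. \<forall>v s. norm v < dlt --> \<bar>s\<bar> < dlt --> fd (z1 + (x, t)) - phi (x, t) <= fd (z1 + (x + v, t + s)) - phi (x + v, t + s)"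
  define z where "z = z1 + (x, t)"
  define zeta where "zeta = opt z"
  obtain e where e: "e > 0" and tch: "\<And>v s. norm v < e ==> \<bar>s\<bar> < e ==> fd z - phi (x, t) <= fd (z + (v, s)) - phi (x + v, t + s)"
   using touch unfolding z_def by (auto simp: add.assoc)
  have nz: "norm (z - z1) <= d\<^sup>2" using norm_Pair_le[of x t] xt by (simp add: z_def)
  have GP: "norm (Pi - G z) <= Cc * d" by (rule Gd[OF d dle(1,2) nz])
  have GP1: "norm (Pi - G z1) <= Cc * d" by (rule Gd[OF d dle(1,2)]) simp
  have optd: "norm (zeta - opt z1) <= gap / 2"
  proof -
   have "zeta - opt z1 = (z - z1) + dlt *\<^sub>R ((Pi - G z) - (Pi - G z1))"
    using d0 by (simp add: zeta_def G_def algebra_simps)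
   then have "norm (zeta - opt z1) <= norm (z - z1) + dlt * norm ((Pi - G z) - (Pi - G z1))"
    using norm_triangle_ineq[of "z - z1" "dlt *\<^sub>R ((Pi - G z) - (Pi - G z1))"] d0 by simp
   also have "norm ((Pi - G z) - (Pi - G z1)) <= 2 * (Cc * d)" using norm_triangle_ineq4[of "Pi - G z" "Pi - G z1"] GP GP1 by linarith
   also have "norm (z - z1) <= d" using nz dle(2) d by (smt (verit) mult_left_le_one_le power2_eq_square)
   finally have "norm (zeta - opt z1) <= d + dlt * (2 * (Cc * d))" using d0 by (simp add: mult_left_mono)
   also have "\<dots> = (1 + 2 * dlt * Cc) * d" by (simp add: algebra_simps)
   finally show ?thesis using dle(5) by linarith
  qed
  have zin: "norm (fst zeta) <= R - gap / 2" "\<bar>snd zeta\<bar> <= R - gap / 2"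
  proof -
   have "norm (fst zeta - fst (opt z1)) <= gap / 2" "\<bar>snd zeta - snd (opt z1)\<bar> <= gap / 2"
    using optd norm_fst_le[of "fst (zeta - opt z1)" "snd (zeta - opt z1)"] norm_snd_le[of "snd (zeta - opt z1)" "fst (zeta - opt z1)"]
    by (simp_all only: prod.collapse fst_diff[symmetric] snd_diff[symmetric] real_norm_def[symmetric])
   then show "norm (fst zeta) <= R - gap / 2" "\<bar>snd zeta\<bar> <= R - gap / 2"
    using norm_triangle_sub[of "fst zeta" "fst (opt z1)"] norm_triangle_sub[of "snd zeta" "snd (opt z1)"]
     min.cobounded1[of "R - norm (fst (opt z1))" "R - \<bar>snd (opt z1)\<bar>"] min.cobounded2[of "R - norm (fst (opt z1))" "R - \<bar>snd (opt z1)\<bar>"]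
    unfolding gap_def[symmetric] real_norm_def by linarith+
  qed
  have zin': "norm (fst zeta) < R" "\<bar>snd zeta\<bar> < R" using zin gap by auto
  define pf where "pf = (\<lambda>w :: (real^'n) \<times> real. phi (fst w + (x - fst zeta), snd w + (t - snd zeta)))"
  have jpsi: "pjet pf (fst zeta) (snd zeta) a xi q" unfolding pf_def by (rule pjet_shift) (simp add: j)
  have ptouch: "f (fst zeta, snd zeta) - pf (fst zeta, snd zeta) <= f (fst zeta + v, snd zeta + s) - pf (fst zeta + v, snd zeta + s)"
   if vs: "norm v < min e (gap / 2)" "\<bar>s\<bar> < min e (gap / 2)" for v s
  proof -
   have inB: "zeta + (v, s) \<in> cball 0 R \<times> {-R..R}"
    using zin vs norm_triangle_ineq[of "fst zeta" v] by (cases zeta) (auto simp: abs_le_iff)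
   have "fd (z + (v, s)) <= f (zeta + (v, s)) + (norm (z + (v, s) - (zeta + (v, s))))\<^sup>2 / (2 * dlt)" by (rule fd[OF inB])
   then have "fd (z + (v, s)) <= f (zeta + (v, s)) + (norm (z - zeta))\<^sup>2 / (2 * dlt)" by simp
   moreover have "fd z = f zeta + (norm (z - zeta))\<^sup>2 / (2 * dlt)" unfolding zeta_def by (rule opt)
   moreover have "fd z - phi (x, t) <= fd (z + (v, s)) - phi (x + v, t + s)" using tch vs by simp
   ultimately have "f zeta - phi (x, t) <= f (zeta + (v, s)) - phi (x + v, t + s)" by linarith
   then show ?thesis unfolding pf_def by (cases zeta) (simp add: algebra_simps)
  qed
  define K where "K = inverse dlt / 2"
  have upphi: "phi (x + v, t + s) <= phi (x, t) + (v, s) \<bullet> G z + K * ((norm v)\<^sup>2 + s\<^sup>2)" if "norm v < e" "\<bar>s\<bar> < e" for v s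
  proof -
   have "fd (z + (v, s)) <= fd z + (v, s) \<bullet> G z + (norm (v, s))\<^sup>2 * inverse dlt / 2" using up'[of "z + (v, s)" z] by simp
   moreover have "(norm (v, s))\<^sup>2 = (norm v)\<^sup>2 + s\<^sup>2" by (simp add: norm_Pair)
   ultimately show ?thesis using tch[OF that] unfolding K_def by (simp add: algebra_simps add_divide_distrib)
  qed
  note pu = pjet_upper[OF j e upphi]
  have xiG: "xi = fst (G z)" and aG: "a = snd (G z)" using pu by auto
  have qle: "q v <= (norm v)\<^sup>2 / dlt" for v
   using pu(3)[of v] isqf_hom[OF q] by (simp add: K_def inverse_eq_divide)
  have xip: "norm (xi - pv) <= Cc * d"
  proof -
   have "norm (fst (Pi - G z)) <= norm (Pi - G z)" by (metis norm_fst_le prod.collapse)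
   then show ?thesis using GP by (simp add: xiG Pi_def norm_minus_commute)
  qed
  have xi0: "xi \<noteq> 0" 
  proof
   assume "xi = 0"
   then have "norm pv <= Cc * d" using xip by simp
   then have "norm pv <= norm pv / 2" using dle(3) by (rule order_trans)
   moreover have "norm pv > 0" using p by simp
   ultimately show False by linarith
  qed
  have aA: "\<bar>a\<bar> <= norm Pi + Cc"
  proof -
   have "\<bar>a\<bar> <= norm (G z)" unfolding aG by (metis norm_snd_le prod.collapse real_norm_def)
   also have "\<dots> <= norm Pi + norm (Pi - G z)" using norm_triangle_ineq4[of Pi "Pi - G z"] by simp
   also have "\<dots> <= norm Pi + Cc * 1" using GP dle(2) Cc mult_left_mono[of d 1 Cc] by linarith
   finally show ?thesis by simp
  qed
  have Fle: "Fq alpha xi q <= a"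
  proof (rule super_at_Fq[OF sup[OF zin'] jpsi q xi0])
   show "\<exists>dlt>0. \<forall>v s. norm v < dlt --> \<bar>s\<bar> < dlt --> f (fst zeta, snd zeta) - pf (fst zeta, snd zeta) <= f (fst zeta + v, snd zeta + s) - pf (fst zeta + v, snd zeta + s)"
    using ptouch e gap by (intro exI[of _ "min e (gap / 2)"]) auto
  qed
  define Y where "Y = (\<lambda>v. inverse dlt * (norm v)\<^sup>2 - q v)"
  have Y: "isqf Y" unfolding Y_def using isqf_add[OF isqf_cmult[OF isqf_norm2, of "inverse dlt"] isqf_uminus[OF q]] by simp
  have Y0: "0 <= Y v" for v using qle[of v] by (simp add: Y_def inverse_eq_divide)
  have FY: "Fq alpha eta q = T / dlt - Fq alpha eta Y" if "eta \<noteq> 0" for eta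
   unfolding Y_def Fq_diff Fq_cmult Fq_norm2[OF that] T_def[symmetric] by (simp add: inverse_eq_divide)
  define y where "y = Fq alpha pv Y"
  define e' where "e' = c * norm (xi - pv)"
  have y0: "y \<ge> 0" unfolding y_def coupl_Fq[OF cs p Y, symmetric] by (intro sum_nonneg Y0)
  have fr: "Fq alpha xi Y <= (1 + e') * y"
   using freeze_psd[OF al Y Y0 xi0 p] by (simp add: e'_def y_def c_def)
  have e'0: "e' \<ge> 0" using c0 by (simp add: e'_def)
  have e'A: "e' * A <= kappa"
  proof -
   have "e' <= c * (Cc * d)" unfolding e'_def using xip c0 by (intro mult_left_mono) auto
   then have "e' * A <= c * (Cc * d) * A" using A by (intro mult_right_mono) auto
   also have "\<dots> = c * Cc * A * d" by simp
   finally show ?thesis using dle(4) by linarith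
  qed
  have "T / dlt - y <= a + kappa"
  proof (cases "y <= A")
   case True
   have "e' * y <= kappa" using mult_left_mono[OF True e'0] e'A by linarith
   then show ?thesis using fr Fle FY[OF xi0] by (simp add: algebra_simps)
  next
   case False
   then have "T / dlt - y <= - \<bar>a\<bar>" using aA unfolding A_def by linarith
   then show ?thesis using k by linarith
  qed
  then show "(\<Sum>k\<in>UNIV. q (s k pv)) <= a + kappa"
   unfolding coupl_Fq[OF cs p q] FY[OF p] y_def .
 qed
qed

lemma inf_conv_continuous:
 fixes f :: "'z::euclidean_space => real"
 assumes B: "compact Bx" and d0: "dlt > 0" and o: "\<And>z. opt z \<in> Bx" "\<And>z. fd z = f (opt z) + (norm (z - opt z))\<^sup>2 / (2 * dlt)"
  "\<And>z zeta. zeta \<in> Bx ==> fd z <= f zeta + (norm (z - zeta))\<^sup>2 / (2 * dlt)"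
 shows "continuous_on (cball 0 rho) fd"
proof -
 obtain D where D: "\<And>zeta. zeta \<in> Bx ==> norm zeta <= D" using compact_imp_bounded[OF B] unfolding bounded_iff by blast
 define M where "M = (2 * (rho + D) + 2 * rho) / (2 * dlt)"
 have le: "fd z' - fd z <= M * norm (z' - z)" if "norm z <= rho" "norm z' <= rho" for z z'
 proof -
  have "fd z' <= f (opt z) + (norm (z' - opt z))\<^sup>2 / (2 * dlt)" by (rule o(3)[OF o(1)])
  then have "fd z' - fd z <= (2 * ((z' - z) \<bullet> (z - opt z)) + (norm (z' - z))\<^sup>2) / (2 * dlt)"
   unfolding o(2)[of z] norm2_diff_shift[of z' "opt z" z] by (simp add: add_divide_distrib)
  also have "\<dots> <= (2 * (norm (z' - z) * (rho + D)) + norm (z' - z) * (2 * rho)) / (2 * dlt)"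
  proof (intro divide_right_mono add_mono)
   have "norm (z - opt z) <= rho + D" using norm_triangle_ineq4[of z "opt z"] that D[OF o(1)[of z]] by linarith
   then show "2 * ((z' - z) \<bullet> (z - opt z)) <= 2 * (norm (z' - z) * (rho + D))"
    using norm_cauchy_schwarz[of "z' - z" "z - opt z"] mult_left_mono[of "norm (z - opt z)" "rho + D" "norm (z' - z)"] by simp
   have "norm (z' - z) <= 2 * rho" using norm_triangle_ineq4[of z' z] that by linarith
   then show "(norm (z' - z))\<^sup>2 <= norm (z' - z) * (2 * rho)" by (simp add: power2_eq_square mult_left_mono)
  qed (use d0 in simp)
  finally show ?thesis by (simp add: M_def algebra_simps)
 qed
 have "(max M 0)-lipschitz_on (cball 0 rho) fd"
 proof (rule lipschitz_onI)
  fix x y :: 'z assume "x \<in> cball 0 rho" "y \<in> cball 0 rho"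
  then have "fd x - fd y <= M * norm (x - y)" "fd y - fd x <= M * norm (y - x)" using le by auto
  moreover have "M * norm (x - y) <= max M 0 * norm (x - y)" by (intro mult_right_mono) auto
  ultimately show "dist (fd x) (fd y) <= max M 0 * dist x y" by (simp add: dist_norm norm_minus_commute abs_le_iff)
 qed simp
 then show ?thesis by (rule lipschitz_on_continuous_on)
qed

lemma inf_conv_close:
 fixes f :: "'z::euclidean_space => real"
 assumes B: "compact Bx" and cf: "continuous_on Bx f" and e: "e > 0"
 shows "\<exists>dd>0. \<forall>dlt z zeta. 0 < dlt --> dlt < dd --> z \<in> Bx --> zeta \<in> Bx --> f zeta + (norm (z - zeta))\<^sup>2 / (2 * dlt) <= f z -->
   norm (z - zeta) < e \<and> f z - e < f zeta"
proof -
 obtain d where d: "d > 0" "\<And>x y. x \<in> Bx ==> y \<in> Bx ==> dist y x < d ==> dist (f y) (f x) < e"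
  using compact_uniformly_continuous[OF cf B] e unfolding uniformly_continuous_on_def by metis
 have "bounded (f ` Bx)" by (intro compact_imp_bounded compact_continuous_image cf B)
 then obtain M where M: "\<And>z. z \<in> Bx ==> \<bar>f z\<bar> <= M" unfolding bounded_iff by auto
 define k where "k = min d e"
 have k: "k > 0" using d e by (simp add: k_def)
 show ?thesis
 proof (intro exI[of _ "k\<^sup>2 / (4 * (\<bar>M\<bar> + 1))"] conjI allI impI)
  show "0 < k\<^sup>2 / (4 * (\<bar>M\<bar> + 1))" using k by simp
  fix dlt z zeta assume dl: "0 < dlt" "dlt < k\<^sup>2 / (4 * (\<bar>M\<bar> + 1))" and z: "z \<in> Bx" "zeta \<in> Bx"
   and le: "f zeta + (norm (z - zeta))\<^sup>2 / (2 * dlt) <= f z"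
  have *: "a + b <= c ==> c <= M ==> - a <= M ==> b <= M + M" for a b c :: real
   by linarith
  have MM: "M + M <= 2 * (\<bar>M\<bar> + 1)" by simp
  from *[OF le abs_le_D1[OF M[OF z(1)]] abs_le_D2[OF M[OF z(2)]]] MM have "(norm (z - zeta))\<^sup>2 / (2 * dlt) <= 2 * (\<bar>M\<bar> + 1)" by (rule order_trans)
  then have "(norm (z - zeta))\<^sup>2 <= dlt * (4 * (\<bar>M\<bar> + 1))" using dl(1) by (simp add: pos_divide_le_eq algebra_simps)
  also have "\<dots> < k\<^sup>2" using dl(2) by (simp add: pos_less_divide_eq)
  finally have nk: "norm (z - zeta) < k" using k by (simp add: power_less_imp_less_base)
  then show "norm (z - zeta) < e" by (simp add: k_def)
  have "dist (f zeta) (f z) < e" by (rule d(2)[OF z]) (use nk in \<open>simp add: k_def dist_norm norm_minus_commute\<close>)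
  then show "f z - e < f zeta" by (simp add: dist_real_def abs_less_iff)
 qed
qed

text \<open>
 A minimum point of the regularized sum is used instead of the original contact point; it lies
 close to it by the strictness, and the gradients move by less than \<open>eta\<close>.
\<close>

lemma sums_core:
 fixes f g :: "(real^'n) \<times> real => real" and s s' :: "'k::finite => real^'n => real^'n"
 assumes al: "0 < alpha" "alpha < 1" and cs: "coupl alpha s" and cs': "coupl alpha s'" and R: "0 < R"
  and cf: "continuous_on (cball 0 R \<times> {-R..R}) f" and cg: "continuous_on (cball 0 R \<times> {-R..R}) g"
  and supf: "\<And>x t. norm x < R ==> \<bar>t\<bar> < R ==> super_at alpha f x t"
  and supg: "\<And>x t. norm x < R ==> \<bar>t\<bar> < R ==> super_at alpha g x t"
  and Z: "isqf Z" and C: "0 <= C" and th: "0 < tht" and p: "p1 \<noteq> 0" "p2 \<noteq> 0" and f0: "f 0 + g 0 = 0"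
  and ineq: "\<And>z w. z \<in> cball 0 R \<times> {-R..R} ==> w \<in> cball 0 R \<times> {-R..R} ==>
    (p1, a1) \<bullet> z + (p2, a2) \<bullet> w - dform Z mu nu (fst z, fst w) / 2 - C * ((snd z)\<^sup>2 + (snd w)\<^sup>2)
     + tht * ((norm z)\<^sup>2 + (norm w)\<^sup>2) <= f z + g w"
  and eta: "0 < eta"
 shows "\<exists>pv1 pv2 b1 b2. norm (pv1 - p1) < eta \<and> norm (pv2 - p2) < eta \<and> \<bar>b1 - a1\<bar> < eta \<and> \<bar>b2 - a2\<bar> < eta \<and> pv1 \<noteq> 0 \<and> pv2 \<noteq> 0 \<and>
   - (\<Sum>k\<in>UNIV. dform Z mu nu (s k pv1, s' k pv2)) <= b1 + b2"
proof -
 define Bx where "Bx = cball (0 :: real^'n) R \<times> {-R..R}"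
 define P where "P = (\<lambda>z w. (p1, a1) \<bullet> z + (p2, a2) \<bullet> w - dform Z mu nu (fst z, fst w) / 2 - C * ((snd z)\<^sup>2 + (snd w)\<^sup>2))"
 obtain b K where bK: "\<And>z v. dform Z mu nu (z + v) = dform Z mu nu z + 2 * (b z \<bullet> v) + dform Z mu nu v"
  "\<And>z. norm (b z) <= K * norm z" "K \<ge> 0"
  using dform_expand[OF Z, of mu nu] by blast
 obtain Ld where Ld: "0 <= Ld" "\<And>v. \<bar>dform Z mu nu v\<bar> <= Ld * (norm v)\<^sup>2" using dform_bound[OF Z, of mu nu] by blast
 define rho where "rho = min eta (min (norm p1) (norm p2))"
 have rho: "rho > 0" using eta p by (simp add: rho_def)
 define Kc where "Kc = K + 2 * C + 1"
 have Kc: "Kc > 0" using bK(3) C by (simp add: Kc_def)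
 define rad where "rad = min (R / 2) (rho / (2 * Kc))"
 have rad: "rad > 0" "rad <= R / 2" using R rho Kc by (auto simp: rad_def)
 have radK: "Kc * rad < rho"
 proof -
  have "rad <= rho / (2 * Kc)" by (simp add: rad_def)
  then have "Kc * rad <= rho / 2" using Kc by (simp add: pos_le_divide_eq field_simps)
  then show ?thesis using rho by linarith
 qed
 define e where "e = min (R / 4) (tht * rad\<^sup>2 / 16)"
 have e: "e > 0" using R th rad by (simp add: e_def)
 have BxC: "compact Bx" "Bx \<noteq> {}" unfolding Bx_def using R by (auto intro: compact_Times)
 have cB: "z \<in> Bx" if "norm z <= R" for z :: "(real^'n) \<times> real"
  using that norm_fst_le[of "fst z" "snd z"] norm_snd_le[of "snd z" "fst z"] unfolding Bx_def by (cases z) (auto simp: abs_le_iff)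
 have cf': "continuous_on Bx f" "continuous_on Bx g" using cf cg by (auto simp: Bx_def)
 obtain ddf where ddf: "ddf > 0" "\<And>dlt z zeta. 0 < dlt ==> dlt < ddf ==> z \<in> Bx ==> zeta \<in> Bx ==> f zeta + (norm (z - zeta))\<^sup>2 / (2 * dlt) <= f z ==>
   norm (z - zeta) < e \<and> f z - e < f zeta" using inf_conv_close[OF BxC(1) cf'(1) e] by blast
 obtain ddg where ddg: "ddg > 0" "\<And>dlt z zeta. 0 < dlt ==> dlt < ddg ==> z \<in> Bx ==> zeta \<in> Bx ==> g zeta + (norm (z - zeta))\<^sup>2 / (2 * dlt) <= g z ==>
   norm (z - zeta) < e \<and> g z - e < g zeta" using inf_conv_close[OF BxC(1) cf'(2) e] by blast
 define dlt where "dlt = min ddf ddg / 2"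
 have dl: "dlt > 0" "dlt < ddf" "dlt < ddg" using ddf(1) ddg(1) by (auto simp: dlt_def min_def)
 obtain fd opt where fd: "\<And>z. opt z \<in> Bx" "\<And>z. fd z = f (opt z) + (norm (z - opt z))\<^sup>2 / (2 * dlt)"
  "\<And>z zeta. zeta \<in> Bx ==> fd z <= f zeta + (norm (z - zeta))\<^sup>2 / (2 * dlt)"
  by (rule inf_conv[OF BxC cf'(1) dl(1)]) (rule that, assumption+)
 obtain gd opt' where gd: "\<And>z. opt' z \<in> Bx" "\<And>z. gd z = g (opt' z) + (norm (z - opt' z))\<^sup>2 / (2 * dlt)"
  "\<And>z zeta. zeta \<in> Bx ==> gd z <= g zeta + (norm (z - zeta))\<^sup>2 / (2 * dlt)"
  by (rule inf_conv[OF BxC cf'(2) dl(1)]) (rule that, assumption+)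
 have fdl: "fd z <= f z" "gd z <= g z" if "z \<in> Bx" for z using fd(3)[OF that, of z] gd(3)[OF that, of z] by auto
 have fdg: "norm (z - opt z) < e \<and> f z - e < fd z" if "z \<in> Bx" for z
 proof -
  have "f (opt z) + (norm (z - opt z))\<^sup>2 / (2 * dlt) <= f z" using fdl(1)[OF that] unfolding fd(2) .
  from ddf(2)[OF dl(1,2) that fd(1) this] show ?thesis unfolding fd(2) using dl(1) by (smt (verit) divide_nonneg_pos zero_le_power2)
 qed
 have gdg: "norm (z - opt' z) < e \<and> g z - e < gd z" if "z \<in> Bx" for z
 proof -
  have "g (opt' z) + (norm (z - opt' z))\<^sup>2 / (2 * dlt) <= g z" using fdl(2)[OF that] unfolding gd(2) .
  from ddg(2)[OF dl(1,3) that gd(1) this] show ?thesis unfolding gd(2) using dl(1) by (smt (verit) divide_nonneg_pos zero_le_power2)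
 qed
 have cfd: "continuous_on (cball 0 sg) fd" "continuous_on (cball 0 sg) gd" for sg
  using inf_conv_continuous[OF BxC(1) dl(1) fd] inf_conv_continuous[OF BxC(1) dl(1) gd] by auto
 define H where "H = (\<lambda>zw. fd (fst zw) + gd (snd zw) - P (fst zw) (snd zw))"
 have cH: "continuous_on (cball 0 rad \<times> cball 0 rad) H"
  unfolding H_def P_def
  by (intro continuous_intros continuous_on_dform[OF Z] continuous_on_compose2[OF cfd(1)[of rad]] continuous_on_compose2[OF cfd(2)[of rad]]) auto
 have "\<exists>x\<in>cball 0 rad \<times> cball 0 rad. \<forall>y\<in>cball 0 rad \<times> cball 0 rad. H x <= H y"
  by (rule continuous_attains_inf[OF _ _ cH]) (use rad in \<open>auto intro!: compact_Times\<close>)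
 then obtain z1 w1 where zw: "norm z1 <= rad" "norm w1 <= rad"
  and Hmin: "\<And>z w. norm z <= rad ==> norm w <= rad ==> H (z1, w1) <= H (z, w)"
  by (auto simp: mem_Times_iff)
 have zB: "z1 \<in> Bx" "w1 \<in> Bx" using zw rad by (auto intro!: cB)
 have "H (0, 0) <= 0"
 proof -
  have "0 \<in> Bx" by (rule cB) (use R in simp)
  then have "fd 0 + gd 0 <= 0" using fdl[of 0] f0 by simp
  moreover have "dform Z mu nu 0 = 0" using Ld(2)[of 0] by simp
  ultimately show ?thesis by (simp add: H_def P_def zero_prod_def)
 qed
 then have "H (z1, w1) <= 0" using Hmin[of 0 0] rad by simp
 moreover have "H (z1, w1) \<ge> tht * ((norm z1)\<^sup>2 + (norm w1)\<^sup>2) - 2 * e"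
  using ineq[OF zB[unfolded Bx_def]] fdg[OF zB(1)] gdg[OF zB(2)] unfolding H_def P_def by simp
 ultimately have "tht * ((norm z1)\<^sup>2 + (norm w1)\<^sup>2) <= 2 * e" by linarith
 also have "\<dots> <= tht * (rad / 2)\<^sup>2" 
 proof -
  have "e <= tht * rad\<^sup>2 / 16" by (simp add: e_def)
  moreover have "0 <= tht * rad\<^sup>2" using th by simp
  ultimately show ?thesis unfolding power_divide by simp
 qed
 finally have sz: "(norm z1)\<^sup>2 + (norm w1)\<^sup>2 <= (rad / 2)\<^sup>2" using th by simp
 then have zw2: "norm z1 <= rad / 2" "norm w1 <= rad / 2"

 proof -
  have "(norm z1)\<^sup>2 <= (rad / 2)\<^sup>2" "(norm w1)\<^sup>2 <= (rad / 2)\<^sup>2"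
   using sz zero_le_power2[of "norm z1"] zero_le_power2[of "norm w1"] by linarith+
  then show "norm z1 <= rad / 2" "norm w1 <= rad / 2" using rad by (auto intro: power2_le_imp_le)
 qed
 define bb where "bb = b (fst z1, fst w1)"
 define pv1 where "pv1 = p1 - fst bb"
 define pv2 where "pv2 = p2 - snd bb"
 define b1 where "b1 = a1 - 2 * C * snd z1"
 define b2 where "b2 = a2 - 2 * C * snd w1"
 have nb: "norm bb <= K * rad"
 proof -
  have "norm (fst z1, fst w1) <= norm (fst z1) + norm (fst w1)" by (rule norm_Pair_le)
  also have "\<dots> <= rad" using zw2 norm_fst_le[of "fst z1" "snd z1"] norm_fst_le[of "fst w1" "snd w1"] by simp
  finally show ?thesis unfolding bb_def using bK(2)[of "(fst z1, fst w1)"] bK(3) by (meson mult_left_mono order_trans)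
 qed
 have Kle: "K * rad <= Kc * rad" "2 * C * rad <= Kc * rad" using rad bK(3) C by (auto simp: Kc_def intro!: mult_right_mono)
 have npi: "norm (pv1 - p1) < rho" "norm (pv2 - p2) < rho"
  using nb radK Kle norm_fst_le[of "fst bb" "snd bb"] norm_snd_le[of "snd bb" "fst bb"] by (auto simp: pv1_def pv2_def)
 have pi0: "pv1 \<noteq> 0" "pv2 \<noteq> 0" using npi by (auto simp: rho_def)
 have nb12: "\<bar>b1 - a1\<bar> < rho" "\<bar>b2 - a2\<bar> < rho"
 proof -
  have *: "\<bar>2 * C * u\<bar> < rho" if "\<bar>u\<bar> <= rad / 2" for u
  proof -
   have "\<bar>2 * C * u\<bar> <= 2 * C * rad" unfolding abs_mult using that C rad by (simp add: mult_left_mono)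
   then show ?thesis using Kle radK by linarith
  qed
  have "\<bar>snd z1\<bar> <= rad / 2" "\<bar>snd w1\<bar> <= rad / 2" using zw2 norm_snd_le[of "snd z1" "fst z1"] norm_snd_le[of "snd w1" "fst w1"] by auto
  then show "\<bar>b1 - a1\<bar> < rho" "\<bar>b2 - a2\<bar> < rho" unfolding b1_def b2_def using * by auto
 qed
 have Pexp: "P (z1 + h) (w1 + k) - P z1 w1 = (pv1, b1) \<bullet> h + (pv2, b2) \<bullet> k - dform Z mu nu (fst h, fst k) / 2 - C * ((snd h)\<^sup>2 + (snd k)\<^sup>2)" for h k
 proof -
  have e1: "dform Z mu nu (fst (z1 + h), fst (w1 + k)) = dform Z mu nu (fst z1, fst w1) + 2 * (bb \<bullet> (fst h, fst k)) + dform Z mu nu (fst h, fst k)"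
   using bK(1)[of "(fst z1, fst w1)" "(fst h, fst k)"] by (simp add: bb_def)
  have e2: "bb \<bullet> (fst h, fst k) = fst bb \<bullet> fst h + snd bb \<bullet> snd (0 :: real^'n, fst k)" by (cases bb) simp
  show ?thesis unfolding P_def e1 e2
   by (cases h; cases k; cases z1; cases w1) (simp add: pv1_def pv2_def b1_def b2_def inner_add_right inner_diff_left power2_sum algebra_simps)
 qed
 have main: "fd z1 + gd w1 + (pv1, b1) \<bullet> h + (pv2, b2) \<bullet> k - dform Z mu nu (fst h, fst k) / 2 - C * ((snd h)\<^sup>2 + (snd k)\<^sup>2) <= fd (z1 + h) + gd (w1 + k)"
  if "norm h <= rad / 2" "norm k <= rad / 2" for h k
 proof -
  have "norm (z1 + h) <= rad" "norm (w1 + k) <= rad" using that zw2 norm_triangle_ineq[of z1 h] norm_triangle_ineq[of w1 k] by auto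
  from Hmin[OF this] show ?thesis using Pexp[of h k] unfolding H_def by simp
 qed
 define L where "L = Ld / 2 + C"
 have L0: "L \<ge> 0" using Ld C by (simp add: L_def)
 have dL: "dform Z mu nu v / 2 + C * u\<^sup>2 <= L * (norm z)\<^sup>2" if "norm v <= norm z" "\<bar>u\<bar> <= norm z" for v and u :: real and z :: "(real^'n) \<times> real"
 proof -
  have "dform Z mu nu v <= Ld * (norm v)\<^sup>2" using Ld(2)[of v] by linarith
  also have "\<dots> <= Ld * (norm z)\<^sup>2" using that Ld by (intro mult_left_mono power_mono) auto
  finally have "dform Z mu nu v <= Ld * (norm z)\<^sup>2" .
  moreover have "C * u\<^sup>2 <= C * (norm z)\<^sup>2" using that C power_mono[OF that(2), of 2] by (intro mult_left_mono) auto
  ultimately show ?thesis by (simp add: L_def algebra_simps)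
 qed
 have np: "norm (fst h, 0 :: real^'n) <= norm h" "norm (0 :: real^'n, fst h) <= norm h" "\<bar>snd h\<bar> <= norm h" for h :: "(real^'n) \<times> real"
  using norm_fst_le[of "fst h" "snd h"] norm_snd_le[of "snd h" "fst h"] by (auto simp: norm_Pair)
 have belowf: "fd z1 + (pv1, b1) \<bullet> (z - z1) - L * (norm (z - z1))\<^sup>2 <= fd z" if "norm (z - z1) <= rad / 2" for z
  using main[of "z - z1" 0] that rad dL[of "(fst (z - z1), 0)" "z - z1" "snd (z - z1)", OF np(1,3)] by simp
 have belowg: "gd w1 + (pv2, b2) \<bullet> (z - w1) - L * (norm (z - w1))\<^sup>2 <= gd z" if "norm (z - w1) <= rad / 2" for z
  using main[of 0 "z - w1"] that rad dL[of "(0, fst (z - w1))" "z - w1" "snd (z - w1)", OF np(2,3)] by simp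
 have oin: "norm (fst (opt z1)) < R" "\<bar>snd (opt z1)\<bar> < R" "norm (fst (opt' w1)) < R" "\<bar>snd (opt' w1)\<bar> < R"
 proof -
  have eR: "e <= R / 4" by (simp add: e_def)
  have "norm (opt z1) < R" using fdg[OF zB(1)] eR zw rad norm_triangle_sub[of "opt z1" z1] R by (simp add: norm_minus_commute)
  then show "norm (fst (opt z1)) < R" "\<bar>snd (opt z1)\<bar> < R" using norm_fst_le[of "fst (opt z1)" "snd (opt z1)"] np(3)[of "opt z1"] by auto
  have "norm (opt' w1) < R" using gdg[OF zB(2)] eR zw rad norm_triangle_sub[of "opt' w1" w1] R by (simp add: norm_minus_commute)
  then show "norm (fst (opt' w1)) < R" "\<bar>snd (opt' w1)\<bar> < R" using norm_fst_le[of "fst (opt' w1)" "snd (opt' w1)"] np(3)[of "opt' w1"] by auto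
 qed
 have rr2: "0 < rad / 2" using rad by simp
 have "- (\<Sum>k\<in>UNIV. dform Z mu nu (s k pv1, s' k pv2)) <= b1 + b2"
 proof (rule field_le_epsilon)
  fix ee :: real assume ee: "ee > 0"
  define kappa where "kappa = ee / 8"
  have k: "kappa > 0" using ee by (simp add: kappa_def)
  have "\<exists>ra>0. \<forall>x t phi a xi q. norm x < ra --> \<bar>t\<bar> < ra --> pjet phi x t a xi q --> isqf q -->
    (\<exists>dlt>0. \<forall>v s. norm v < dlt --> \<bar>s\<bar> < dlt --> fd (z1 + (x, t)) - phi (x, t) <= fd (z1 + (x + v, t + s)) - phi (x + v, t + s)) -->
    (\<Sum>k\<in>UNIV. q (s k pv1)) <= a + kappa"
   by (rule frozen_super[OF al cs R dl(1) _ fd(2) _ _ oin(1,2) pi0(1) L0 rr2 _ k])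
    (erule (1) supf | rule fd(1)[unfolded Bx_def] | erule fd(3)[unfolded Bx_def] | erule belowf)+
  then obtain ra where ra: "ra > 0" "\<forall>x t phi a xi q. norm x < ra --> \<bar>t\<bar> < ra --> pjet phi x t a xi q --> isqf q -->
    (\<exists>dlt>0. \<forall>v s. norm v < dlt --> \<bar>s\<bar> < dlt --> fd (z1 + (x, t)) - phi (x, t) <= fd (z1 + (x + v, t + s)) - phi (x + v, t + s)) -->
    (\<Sum>k\<in>UNIV. q (s k pv1)) <= a + kappa"
   by (elim exE conjE) (rule that)
  have "\<exists>rb>0. \<forall>x t phi a xi q. norm x < rb --> \<bar>t\<bar> < rb --> pjet phi x t a xi q --> isqf q -->
    (\<exists>dlt>0. \<forall>v s. norm v < dlt --> \<bar>s\<bar> < dlt --> gd (w1 + (x, t)) - phi (x, t) <= gd (w1 + (x + v, t + s)) - phi (x + v, t + s)) -->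
    (\<Sum>k\<in>UNIV. q (s' k pv2)) <= a + kappa"
   by (rule frozen_super[OF al cs' R dl(1) _ gd(2) _ _ oin(3,4) pi0(2) L0 rr2 _ k])
    (erule (1) supg | rule gd(1)[unfolded Bx_def] | erule gd(3)[unfolded Bx_def] | erule belowg)+
  then obtain rb where rb: "rb > 0" "\<forall>x t phi a xi q. norm x < rb --> \<bar>t\<bar> < rb --> pjet phi x t a xi q --> isqf q -->
    (\<exists>dlt>0. \<forall>v s. norm v < dlt --> \<bar>s\<bar> < dlt --> gd (w1 + (x, t)) - phi (x, t) <= gd (w1 + (x + v, t + s)) - phi (x + v, t + s)) -->
    (\<Sum>k\<in>UNIV. q (s' k pv2)) <= a + kappa"
   by (elim exE conjE) (rule that)
  define r where "r = min (min 1 (rad / 4)) (min ra rb)"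
  have r: "0 < r" "r <= 1" "r <= rad / 4" "r <= ra" "r <= rb" using ra(1) rb(1) rad by (auto simp: r_def min_def)
  define F where "F = (\<lambda>z. fd (z1 + z) - fd z1)"
  define G where "G = (\<lambda>z. gd (w1 + z) - gd w1)"
  have nin: "norm z <= rad / 2" if "z \<in> cball 0 r \<times> {-r..r}" for z :: "(real^'n) \<times> real"
   using that r norm_Pair_le[of "fst z" "snd z"] by (cases z) (auto simp: abs_le_iff)
  have sub: "norm (z1 + z) <= rad" "norm (w1 + z) <= rad" if "z \<in> cball 0 r \<times> {-r..r}" for z
   using nin[OF that] zw2 norm_triangle_ineq[of z1 z] norm_triangle_ineq[of w1 z] by linarith+
  have ct: "continuous_on (cball 0 r \<times> {-r..r}) (\<lambda>z. z1 + z)" "continuous_on (cball 0 r \<times> {-r..r}) (\<lambda>z. w1 + z)"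
   by (intro continuous_intros)+
  have "continuous_on (cball 0 r \<times> {-r..r}) (\<lambda>z. fd (z1 + z))"
   by (rule continuous_on_compose2[OF cfd(1)[of rad] ct(1)]) (use sub(1) in \<open>simp only: image_subset_iff mem_cball_0; blast\<close>)
  moreover have "continuous_on (cball 0 r \<times> {-r..r}) (\<lambda>z. gd (w1 + z))"
   by (rule continuous_on_compose2[OF cfd(2)[of rad] ct(2)]) (use sub(2) in \<open>simp only: image_subset_iff mem_cball_0; blast\<close>)
  ultimately have cFG: "continuous_on (cball 0 r \<times> {-r..r}) F" "continuous_on (cball 0 r \<times> {-r..r}) G"
   unfolding F_def G_def by (auto intro: continuous_on_diff)
  have cpt: "compact (cball (0 :: real^'n) r \<times> {-r..r})" by (intro compact_Times) auto
  have "bounded (F ` (cball 0 r \<times> {-r..r}))" "bounded (G ` (cball 0 r \<times> {-r..r}))"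
   by (intro compact_imp_bounded compact_continuous_image cFG cpt)+
  then have "\<exists>B1. \<forall>z\<in>cball 0 r \<times> {-r..r}. \<bar>F z\<bar> <= B1" "\<exists>B2. \<forall>z\<in>cball 0 r \<times> {-r..r}. \<bar>G z\<bar> <= B2"
   unfolding bounded_iff by (simp_all only: ball_simps real_norm_def)
  then obtain B1 B2 where "\<forall>z\<in>cball 0 r \<times> {-r..r}. \<bar>F z\<bar> <= B1" "\<forall>z\<in>cball 0 r \<times> {-r..r}. \<bar>G z\<bar> <= B2" by blast
  note B = this[rule_format]
  have "- (\<Sum>k\<in>UNIV. dform Z mu nu (s k pv1, s' k pv2)) - 8 * kappa <= b1 + b2"
  proof (rule linear_sum[where f = F and g = G and r = r and ?h0.0 = r and B = "max B1 B2" and C = "2 * C" and ?p1.0 = pv1 and ?p2.0 = pv2, OF r(1,2) r(1,2) k Z cFG])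
   show "\<bar>F (x, t)\<bar> <= max B1 B2" if "norm x <= r" "\<bar>t\<bar> <= r" for x t using B(1)[of "(x, t)"] that by (auto simp: abs_le_iff)
   show "\<bar>G (x, t)\<bar> <= max B1 B2" if "norm x <= r" "\<bar>t\<bar> <= r" for x t using B(2)[of "(x, t)"] that by (auto simp: abs_le_iff)
   show "(\<Sum>k\<in>UNIV. q (s k pv1)) <= a + kappa" if "norm x < r" "\<bar>t\<bar> < r" "pjet phi x t a xi q" "isqf q"
    and tc: "\<exists>dlt>0. \<forall>v s. norm v < dlt --> \<bar>s\<bar> < dlt --> F (x, t) - phi (x, t) <= F (x + v, t + s) - phi (x + v, t + s)" for x t phi a xi q
    by (rule ra(2)[rule_format, OF _ _ that(3,4)]) (use that(1,2) r tc in \<open>auto simp: F_def\<close>)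
   show "(\<Sum>k\<in>UNIV. q (s' k pv2)) <= a + kappa" if "norm x < r" "\<bar>t\<bar> < r" "pjet phi x t a xi q" "isqf q"
    and tc: "\<exists>dlt>0. \<forall>v s. norm v < dlt --> \<bar>s\<bar> < dlt --> G (x, t) - phi (x, t) <= G (x + v, t + s) - phi (x + v, t + s)" for x t phi a xi q
    by (rule rb(2)[rule_format, OF _ _ that(3,4)]) (use that(1,2) r tc in \<open>auto simp: G_def\<close>)
   show "F (0, 0) + G (0, 0) = 0" by (simp add: F_def G_def flip: zero_prod_def)
   show "dpoly pv1 pv2 (b1 + b2) Z mu nu (2 * C) ((x, y), t) <= F (x, t) + G (y, t)"
    if "norm x <= r" "norm y <= r" "- r <= t" "t <= 0" for x y t
    using main[of "(x, t)" "(y, t)", OF nin nin] that r by (simp add: dpoly_def F_def G_def algebra_simps)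
   show "0 <= 2 * C" using C by simp
  qed
  then show "- (\<Sum>k\<in>UNIV. dform Z mu nu (s k pv1, s' k pv2)) <= b1 + b2 + ee" by (simp add: kappa_def)
 qed
 moreover have "rho <= eta" by (simp add: rho_def)
 ultimately show ?thesis using npi nb12 pi0
  
  by (rule_tac exI[of _ pv1], rule_tac exI[of _ pv2], rule_tac exI[of _ b1], rule_tac exI[of _ b2]) simp
qed

lemma LIMSEQ_near:
 fixes x :: "nat => 'a::real_normed_vector"
 assumes "\<And>n. norm (x n - l) < inverse (real (Suc n))" shows "x \<longlonglongrightarrow> l"
 by (rule LIM_zero_cancel, rule Lim_null_comparison[OF _ LIMSEQ_inverse_real_of_nat]) (use less_imp_le[OF assms] in simp)

text \<open>
 For every pair of couplings the trace of the doubled form bounds the sum of the time derivatives.  Only nonzero gradients are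
 admitted, where the operator is continuous.
\<close>

lemma theorem_on_sums:
 fixes v1 v2 :: "(real^'n) \<times> real => real" and s s' :: "'k::finite => real^'n => real^'n"
 assumes al: "0 < alpha" "alpha < 1" and cs: "coupl alpha s" and cs': "coupl alpha s'" and R: "0 < R"
  and c1: "continuous_on (cball xh R \<times> {th-R..th+R}) v1" and c2: "continuous_on (cball yh R \<times> {sh-R..sh+R}) v2"
  and sup1: "\<And>x t. norm x < R ==> \<bar>t\<bar> < R ==> super_at alpha v1 (xh + x) (th + t)"
  and sup2: "\<And>x t. norm x < R ==> \<bar>t\<bar> < R ==> super_at alpha v2 (yh + x) (sh + t)"
  and Z: "isqf Z" and C: "0 <= C" and p: "p1 \<noteq> 0" "p2 \<noteq> 0"
  and ineq: "\<And>x y t tau. norm x <= R ==> norm y <= R ==> \<bar>t\<bar> <= R ==> \<bar>tau\<bar> <= R ==>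
    v1 (xh, th) + v2 (yh, sh) + p1 \<bullet> x + p2 \<bullet> y + a1 * t + a2 * tau - dform Z mu nu (x, y) / 2 - C * (t\<^sup>2 + tau\<^sup>2)
     <= v1 (xh + x, th + t) + v2 (yh + y, sh + tau)"
 shows "- (\<Sum>k\<in>UNIV. dform Z mu nu (s k p1, s' k p2)) <= a1 + a2"
proof -
 define f where "f = (\<lambda>z. v1 ((xh, th) + z) - v1 (xh, th))"
 define g where "g = (\<lambda>z. v2 ((yh, sh) + z) - v2 (yh, sh))"
 have cf: "continuous_on (cball 0 R \<times> {-R..R}) f" unfolding f_def
  by (intro continuous_intros continuous_on_compose2[OF c1]) (auto simp: dist_norm)
 have cg: "continuous_on (cball 0 R \<times> {-R..R}) g" unfolding g_def
  by (intro continuous_intros continuous_on_compose2[OF c2]) (auto simp: dist_norm)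
 define S where "S = (\<Sum>k\<in>UNIV. (norm (s k p1))\<^sup>2 + (norm (s' k p2))\<^sup>2)"
 have S0: "S \<ge> 0" by (simp add: S_def sum_nonneg)
 have key: "- (\<Sum>k\<in>UNIV. dform Z (mu + 2 * tht) (nu + 2 * tht) (s k p1, s' k p2)) <= a1 + a2" if th: "tht > 0" for tht
 proof -
  define D where "D = dform Z (mu + 2 * tht) (nu + 2 * tht)"
  have ex: "\<exists>pv1 pv2 b1 b2. norm (pv1 - p1) < eta \<and> norm (pv2 - p2) < eta \<and> \<bar>b1 - a1\<bar> < eta \<and> \<bar>b2 - a2\<bar> < eta \<and> pv1 \<noteq> 0 \<and> pv2 \<noteq> 0 \<and>
   - (\<Sum>k\<in>UNIV. D (s k pv1, s' k pv2)) <= b1 + b2" if "eta > 0" for eta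
   unfolding D_def
  proof (rule sums_core[OF al cs cs' R cf cg _ _ Z _ th p, where C = "C + tht"])
   show "super_at alpha f x t" if "norm x < R" "\<bar>t\<bar> < R" for x t unfolding f_def by (rule super_at_shift[OF sup1[OF that]])
   show "super_at alpha g x t" if "norm x < R" "\<bar>t\<bar> < R" for x t unfolding g_def by (rule super_at_shift[OF sup2[OF that]])
   show "f 0 + g 0 = 0" by (simp add: f_def g_def)
   show "0 <= C + tht" using C th by simp
   show "(p1, a1) \<bullet> z + (p2, a2) \<bullet> w - dform Z (mu + 2 * tht) (nu + 2 * tht) (fst z, fst w) / 2 - (C + tht) * ((snd z)\<^sup>2 + (snd w)\<^sup>2)
     + tht * ((norm z)\<^sup>2 + (norm w)\<^sup>2) <= f z + g w"
    if zw: "z \<in> cball 0 R \<times> {-R..R}" "w \<in> cball 0 R \<times> {-R..R}" for z w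
   proof -
    obtain x t y tau where xy: "z = (x, t)" "w = (y, tau)" by (cases z; cases w)
    have "v1 (xh, th) + v2 (yh, sh) + p1 \<bullet> x + p2 \<bullet> y + a1 * t + a2 * tau - dform Z mu nu (x, y) / 2 - C * (t\<^sup>2 + tau\<^sup>2)
     <= v1 (xh + x, th + t) + v2 (yh + y, sh + tau)" by (rule ineq) (use zw xy in \<open>auto simp: abs_le_iff\<close>)
    moreover have "(norm (x, t))\<^sup>2 = (norm x)\<^sup>2 + t\<^sup>2" "(norm (y, tau))\<^sup>2 = (norm y)\<^sup>2 + tau\<^sup>2" by (simp_all add: norm_Pair)
    moreover have "dform Z (mu + 2 * tht) (nu + 2 * tht) (x, y) = dform Z mu nu (x, y) + 2 * (tht * (norm x)\<^sup>2 + tht * (norm y)\<^sup>2)"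
     by (simp add: dform_def algebra_simps)
    ultimately show ?thesis unfolding xy f_def g_def by (simp add: algebra_simps add_divide_distrib)
   qed
  qed (use that in auto)
  have "\<forall>n. \<exists>pv1 pv2 b1 b2. norm (pv1 - p1) < inverse (real (Suc n)) \<and> norm (pv2 - p2) < inverse (real (Suc n)) \<and> \<bar>b1 - a1\<bar> < inverse (real (Suc n)) \<and> \<bar>b2 - a2\<bar> < inverse (real (Suc n)) \<and> pv1 \<noteq> 0 \<and> pv2 \<noteq> 0 \<and>
   - (\<Sum>k\<in>UNIV. D (s k pv1, s' k pv2)) <= b1 + b2" by (intro allI ex) simp
  then obtain P1 P2 A1 A2 where lim: "\<And>n. norm (P1 n - p1) < inverse (real (Suc n))" "\<And>n. norm (P2 n - p2) < inverse (real (Suc n))"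
   "\<And>n. norm (A1 n - a1) < inverse (real (Suc n))" "\<And>n. norm (A2 n - a2) < inverse (real (Suc n))" and nz: "\<And>n. P1 n \<noteq> 0" "\<And>n. P2 n \<noteq> 0"
   and le: "\<And>n. - (\<Sum>k\<in>UNIV. D (s k (P1 n), s' k (P2 n))) <= A1 n + A2 n"
   unfolding choice_iff real_norm_def by blast
  have l1: "(\<lambda>n. s k (P1 n)) \<longlonglongrightarrow> s k p1" for k
   by (rule continuous_on_tendsto_compose[of "- {0}" "s k", OF _ LIMSEQ_near[OF lim(1)]]) (use cs p nz in \<open>auto simp: coupl_def\<close>)
  have l2: "(\<lambda>n. s' k (P2 n)) \<longlonglongrightarrow> s' k p2" for k
   by (rule continuous_on_tendsto_compose[of "- {0}" "s' k", OF _ LIMSEQ_near[OF lim(2)]]) (use cs' p nz in \<open>auto simp: coupl_def\<close>)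
  have cD: "continuous_on UNIV (\<lambda>z. D (fst z, snd z))" unfolding D_def by (intro continuous_on_dform[OF Z] continuous_intros)
  have l3: "(\<lambda>n. D (s k (P1 n), s' k (P2 n))) \<longlonglongrightarrow> D (s k p1, s' k p2)" for k
   using continuous_on_tendsto_compose[OF cD tendsto_Pair[OF l1[of k] l2[of k]]] by simp
  show ?thesis unfolding D_def[symmetric]
   by (rule LIMSEQ_le[OF tendsto_minus[OF tendsto_sum[OF l3]] tendsto_add[OF LIMSEQ_near[OF lim(3)] LIMSEQ_near[OF lim(4)]]]) (use le in auto)
 qed
 show ?thesis
 proof (rule field_le_epsilon)
  fix e :: real assume e: "e > 0"
  define tht where "tht = e / (2 * (S + 1))"
  have th: "tht > 0" using e S0 by (simp add: tht_def)
  have "2 * tht * S <= e" using e S0 by (simp add: tht_def field_simps)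
  moreover have "(\<Sum>k\<in>UNIV. dform Z (mu + 2 * tht) (nu + 2 * tht) (s k p1, s' k p2)) = (\<Sum>k\<in>UNIV. dform Z mu nu (s k p1, s' k p2)) + 2 * tht * S"
   unfolding S_def sum_distrib_left sum.distrib[symmetric] by (rule sum.cong) (auto simp: dform_def algebra_simps)
  ultimately show "- (\<Sum>k\<in>UNIV. dform Z mu nu (s k p1, s' k p2)) <= a1 + a2 + e" using key[OF th] by linarith
 qed
qed

section \<open>Couplings and doubling of the time variable\<close>

text \<open>
 The projection onto the gradient or onto its complement, whichever carries the larger weight; then the
 remaining weight \<open>min alpha (1 - alpha)\<close> multiplies the identity and can be reflected freely.
\<close>

definition qop :: "real => real^'n => real^'n => real^'n" where
 "qop alpha p v = (if alpha <= 1/2 then (sgn p \<bullet> v) *\<^sub>R sgn p else v - (sgn p \<bullet> v) *\<^sub>R sgn p)"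

text \<open>
 The isotropic part is composed with the reflection in the hyperplane orthogonal to \<open>e\<close>; \<open>e = 0\<close> gives the synchronous
 coupling, and \<open>e\<close> the direction of \<open>x - y\<close> gives the reflection coupling.
\<close>

definition cpl :: "real => real^'n => 'n \<times> bool => real^'n => real^'n" where
 "cpl alpha e k p = (if snd k then sqrt (min alpha (1 - alpha)) *\<^sub>R (axis (fst k) 1 - (2 * (e \<bullet> axis (fst k) 1)) *\<^sub>R e)
   else sqrt \<bar>1 - 2 * alpha\<bar> *\<^sub>R qop alpha p (axis (fst k) 1))"

lemma sum_prod_bool: "(\<Sum>k\<in>(UNIV :: ('n::finite \<times> bool) set). f k) = (\<Sum>i\<in>UNIV. f (i, True)) + (\<Sum>i\<in>UNIV. f (i, False) :: real)"
proof -
 have "(\<Sum>k\<in>(UNIV :: ('n::finite \<times> bool) set). f k) = (\<Sum>i\<in>UNIV. \<Sum>b\<in>UNIV. f (i, b))"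
  by (simp add: sum.cartesian_product flip: UNIV_Times_UNIV)
 then show ?thesis by (simp add: UNIV_bool sum.distrib add.commute)
qed

lemma sum_axis_sq: "(\<Sum>i\<in>UNIV. (axis i 1 \<bullet> (v :: real^'n))\<^sup>2) = (norm v)\<^sup>2"
 by (simp add: inner_axis' norm_vec_def L2_set_def sum_nonneg)

lemma qop_sym: "qop alpha p v \<bullet> w = v \<bullet> qop alpha p w"
 by (simp add: qop_def inner_diff_left inner_diff_right inner_commute)

lemma coupl_cpl:
 fixes e :: "real^'n"
 assumes al: "0 < alpha" "alpha < 1" and e: "e = 0 \<or> norm e = 1"
 shows "coupl alpha (cpl alpha e)"
 unfolding coupl_def
proof (intro conjI allI impI)
 fix p v :: "real^'n" assume p: "p \<noteq> 0"
 have ee: "e \<bullet> e = 0 \<and> e = 0 \<or> e \<bullet> e = 1" using e by (auto simp: dot_square_norm)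
 have 1: "(cpl alpha e (i, True) p \<bullet> v)\<^sup>2 = min alpha (1 - alpha) * (axis i 1 \<bullet> (v - (2 * (e \<bullet> v)) *\<^sub>R e))\<^sup>2" for i
 proof -
  have "cpl alpha e (i, True) p \<bullet> v = sqrt (min alpha (1 - alpha)) * (axis i 1 \<bullet> (v - (2 * (e \<bullet> v)) *\<^sub>R e))"
   by (simp add: cpl_def inner_diff_left inner_diff_right inner_commute)
  then show ?thesis using al by (simp add: power_mult_distrib)
 qed
 have 2: "(cpl alpha e (i, False) p \<bullet> v)\<^sup>2 = \<bar>1 - 2 * alpha\<bar> * (axis i 1 \<bullet> qop alpha p v)\<^sup>2" for i
  by (simp add: cpl_def qop_sym power_mult_distrib)
 have n1: "(norm (v - (2 * (e \<bullet> v)) *\<^sub>R e))\<^sup>2 = (norm v)\<^sup>2"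
  unfolding power2_norm_eq_inner using ee by (auto simp: inner_diff_left inner_diff_right inner_commute algebra_simps)
 have ss: "sgn p \<bullet> sgn p = 1" using p by (simp add: dot_square_norm norm_sgn)
 have sp: "(sgn p \<bullet> v)\<^sup>2 = (p \<bullet> v)\<^sup>2 / (norm p)\<^sup>2" by (simp add: sgn_div_norm power_mult_distrib divide_inverse power_inverse mult.commute)
 have n2: "(norm (qop alpha p v))\<^sup>2 = (if alpha <= 1/2 then (sgn p \<bullet> v)\<^sup>2 else (norm v)\<^sup>2 - (sgn p \<bullet> v)\<^sup>2)"
  unfolding power2_norm_eq_inner using ss by (auto simp: qop_def inner_diff_left inner_diff_right inner_commute power2_eq_square algebra_simps)
 have "(\<Sum>k\<in>UNIV. (cpl alpha e k p \<bullet> v)\<^sup>2) = min alpha (1 - alpha) * (norm v)\<^sup>2 + \<bar>1 - 2 * alpha\<bar> * (norm (qop alpha p v))\<^sup>2"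
  unfolding sum_prod_bool 1 2 sum_distrib_left[symmetric] sum_axis_sq n1 ..
 also have "\<dots> = alpha * (norm v)\<^sup>2 + (1 - 2 * alpha) * ((p \<bullet> v)\<^sup>2 / (norm p)\<^sup>2)"
  unfolding n2 sp[symmetric] by (simp add: algebra_simps)
 finally show "(\<Sum>k\<in>UNIV. (cpl alpha e k p \<bullet> v)\<^sup>2) = alpha * (norm v)\<^sup>2 + (1 - 2 * alpha) * ((p \<bullet> v)\<^sup>2 / (norm p)\<^sup>2)" .
next
 fix k :: "'n \<times> bool"
 have "continuous_on (- {0 :: real^'n}) sgn" unfolding sgn_div_norm by (intro continuous_intros) auto
 then show "continuous_on (- {0}) (cpl alpha e k)"
  unfolding cpl_def qop_def by (cases "snd k"; cases "alpha <= 1/2") (auto intro!: continuous_intros)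
qed

lemma coupl_trace:
 fixes s :: "'k::finite => real^'n => real^'n"
 assumes "coupl alpha s" "p \<noteq> 0"
 shows "(\<Sum>k\<in>UNIV. (norm (s k p))\<^sup>2) = alpha * CARD('n) + (1 - 2 * alpha)"
 using coupl_Fq[OF assms isqf_norm2] Fq_norm2[OF assms(2), of alpha] by simp

lemma qop_diff:
 fixes p p' :: "real^'n"
 assumes "p \<noteq> 0" "p' \<noteq> 0" "norm v = 1"
 shows "norm (qop alpha p v - qop alpha p' v) <= 4 * norm (p + p') / norm p'"
proof -
 define m where "m = sgn (- p)"
 define n where "n = sgn p'"
 have mn: "norm m = 1" "norm n = 1" using assms by (auto simp: m_def n_def norm_sgn)
 have d: "norm (m - n) <= 2 * norm (p + p') / norm p'"
  using sgn_diff_le[of "- p" p'] assms norm_minus_cancel[of "p + p'"] by (simp add: m_def n_def)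
 have sp: "sgn p = - m" by (simp add: m_def sgn_minus)
 have "norm ((m \<bullet> v) *\<^sub>R m - (n \<bullet> v) *\<^sub>R n) = norm (((m - n) \<bullet> v) *\<^sub>R m + (n \<bullet> v) *\<^sub>R (m - n))"
  by (simp add: inner_diff_left algebra_simps)
 also have "\<dots> <= \<bar>(m - n) \<bullet> v\<bar> * norm m + \<bar>n \<bullet> v\<bar> * norm (m - n)" by (rule order_trans[OF norm_triangle_ineq]) simp
 also have "\<dots> <= norm (m - n) * 1 + 1 * norm (m - n)"
  using Cauchy_Schwarz_ineq2[of "m - n" v] Cauchy_Schwarz_ineq2[of n v] mn assms(3) by (intro add_mono mult_mono) auto
 finally have "norm ((m \<bullet> v) *\<^sub>R m - (n \<bullet> v) *\<^sub>R n) <= 4 * norm (p + p') / norm p'" using d by simp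
 moreover have "norm (qop alpha p v - qop alpha p' v) = norm ((m \<bullet> v) *\<^sub>R m - (n \<bullet> v) *\<^sub>R n)"
  by (simp add: qop_def sp n_def[symmetric] norm_minus_commute)
 ultimately show ?thesis by simp
qed

text \<open>
 Reflection yields the second derivative in the direction \<open>e\<close> with weight \<open>4 min alpha (1 - alpha)\<close>.  The anisotropic
 part only sees the deviation of \<open>p1\<close> from \<open>- p2\<close>.
\<close>

lemma cpl_gain:
 fixes Z :: "real^'n => real"
 assumes al: "0 < alpha" "alpha < 1" and Z: "isqf Z" "\<And>u. Z u <= K * (norm u)\<^sup>2" "K \<ge> 0" and p: "p1 \<noteq> 0" "p2 \<noteq> 0" and e: "e = 0 \<or> norm e = 1"
 shows "(\<Sum>k\<in>UNIV. Z (cpl alpha 0 k p1 - cpl alpha e k p2)) <= 4 * min alpha (1 - alpha) * Z e + CARD('n) * (K * (4 * norm (p1 + p2) / norm p2)\<^sup>2)"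
proof -
 have 1: "Z (cpl alpha 0 (i, True) p1 - cpl alpha e (i, True) p2) = (4 * min alpha (1 - alpha) * Z e) * (axis i 1 \<bullet> e)\<^sup>2" for i
 proof -
  have "cpl alpha 0 (i, True) p1 - cpl alpha e (i, True) p2 = (sqrt (min alpha (1 - alpha)) * (2 * (e \<bullet> axis i 1))) *\<^sub>R e"
   by (simp add: cpl_def scaleR_diff_right)
  then show ?thesis using al by (simp add: isqf_hom[OF Z(1)] power_mult_distrib inner_commute)
 qed
 have ne: "(norm e)\<^sup>2 = 1 \<or> Z e = 0" using e isqf_hom[OF Z(1), of 0 0] by auto
 have 2: "Z (cpl alpha 0 (i, False) p1 - cpl alpha e (i, False) p2) <= K * (4 * norm (p1 + p2) / norm p2)\<^sup>2" for i
 proof -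
  define u where "u = qop alpha p1 (axis i 1) - qop alpha p2 (axis i 1)"
  have "cpl alpha 0 (i, False) p1 - cpl alpha e (i, False) p2 = sqrt \<bar>1 - 2 * alpha\<bar> *\<^sub>R u"
   by (simp add: cpl_def u_def scaleR_diff_right)
  moreover have "norm (sqrt \<bar>1 - 2 * alpha\<bar> *\<^sub>R u) <= 1 * norm u"
   unfolding norm_scaleR using al by (intro mult_right_mono) auto
  moreover have "norm u <= 4 * norm (p1 + p2) / norm p2" unfolding u_def by (rule qop_diff[OF p]) simp
  ultimately have "norm (cpl alpha 0 (i, False) p1 - cpl alpha e (i, False) p2) <= 4 * norm (p1 + p2) / norm p2" by simp
  then have "(norm (cpl alpha 0 (i, False) p1 - cpl alpha e (i, False) p2))\<^sup>2 <= (4 * norm (p1 + p2) / norm p2)\<^sup>2" by (intro power_mono) auto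
  from mult_left_mono[OF this Z(3)] show ?thesis by (rule order_trans[OF Z(2)])
 qed
 have "(\<Sum>i\<in>UNIV. Z (cpl alpha 0 (i, False) p1 - cpl alpha e (i, False) p2)) <= (\<Sum>i\<in>(UNIV::'n set). K * (4 * norm (p1 + p2) / norm p2)\<^sup>2)"
  by (intro sum_mono 2)
 moreover have "(\<Sum>i\<in>UNIV. Z (cpl alpha 0 (i, True) p1 - cpl alpha e (i, True) p2)) = 4 * min alpha (1 - alpha) * Z e"
  unfolding 1 sum_distrib_left[symmetric] sum_axis_sq using ne by auto
 ultimately show ?thesis unfolding sum_prod_bool by simp
qed

lemma peano2_upper:
 assumes "peano2 g t g1 g2"
 shows "\<exists>dlt>0. \<forall>h. \<bar>h\<bar> < dlt --> g (t + h) <= g t + g1 * h + (\<bar>g2\<bar> / 2 + 1) * h\<^sup>2"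
proof -
 obtain d where d: "d > 0" "\<And>h. \<bar>h\<bar> < d ==> \<bar>g (t + h) - (g t + g1 * h + g2 * h\<^sup>2 / 2)\<bar> <= 1 * h\<^sup>2"
  using assms unfolding peano2_def by (meson zero_less_one)
 show ?thesis
 proof (intro exI[of _ d] conjI allI impI d(1))
  fix h assume h: "\<bar>h\<bar> < d"
  have "g2 * h\<^sup>2 <= \<bar>g2\<bar> * h\<^sup>2" by (intro mult_right_mono) auto
  then have "g2 * h\<^sup>2 / 2 <= \<bar>g2\<bar> / 2 * h\<^sup>2" by simp
  then show "g (t + h) <= g t + g1 * h + (\<bar>g2\<bar> / 2 + 1) * h\<^sup>2" using d(2)[OF h] unfolding distrib_right by linarith
 qed
qed

text \<open>
 The Hessian of a function of the squared distance: \<open>k1\<close> and \<open>k2\<close> are its first two derivatives in that variable and \<open>z\<close> is the difference of the points.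
\<close>

definition rform :: "real => real => real^'n => real^'n => real" where
 "rform k1 k2 z u = 2 * k1 * (norm u)\<^sup>2 + 4 * k2 * (z \<bullet> u)\<^sup>2"

lemma isqf_rform: "isqf (rform k1 k2 z)"
 unfolding rform_def by (intro isqf_add isqf_cmult isqf_norm2 isqf_inner2)

lemma radial_upper:
 fixes z :: "real^'n"
 assumes "peano2 pf ((norm z)\<^sup>2) k1 k2" "e > 0"
 shows "\<exists>dlt>0. \<forall>v. norm v < dlt --> pf ((norm (z + v))\<^sup>2) <= pf ((norm z)\<^sup>2) + (2 * k1) * (z \<bullet> v) + rform k1 k2 z v / 2 + e * (norm v)\<^sup>2"
proof -
 have j: "pjet (\<lambda>w. pf ((norm (fst w - 0))\<^sup>2)) z 0 0 ((2 * k1) *\<^sub>R z) (rform k1 k2 z)"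
  by (rule pjet_cong[OF pjet_comp[OF pjet_norm2[of 0 z 0]]]) (use assms in \<open>auto simp: rform_def power_mult_distrib\<close>)
 from pjetD[OF j assms(2)] obtain C d where "d > 0" and P: "\<And>v s. norm v < d ==> \<bar>s\<bar> < d ==>
    \<bar>pf ((norm (fst (z + v, 0 + s) - 0))\<^sup>2) - (pf ((norm (fst (z, 0 :: real) - 0))\<^sup>2) + 0 * s + ((2 * k1) *\<^sub>R z) \<bullet> v + rform k1 k2 z v / 2)\<bar> <= e * (norm v)\<^sup>2 + C * s\<^sup>2"
  by metis
 show ?thesis
 proof (intro exI[of _ d] conjI allI impI \<open>d > 0\<close>)
  fix v :: "real^'n" assume "norm v < d"
  then show "pf ((norm (z + v))\<^sup>2) <= pf ((norm z)\<^sup>2) + (2 * k1) * (z \<bullet> v) + rform k1 k2 z v / 2 + e * (norm v)\<^sup>2"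
   using P[of v 0] \<open>d > 0\<close> unfolding abs_le_iff by simp
 qed
qed

lemma pair_sums:
 fixes v1 v2 :: "(real^'n) \<times> real => real" and s s' :: "'k::finite => real^'n => real^'n"
 assumes al: "0 < alpha" "alpha < 1" and cs: "coupl alpha s" and cs': "coupl alpha s'" and R: "0 < R" and ep: "0 < eps"
  and c1: "continuous_on (cball x R \<times> {t-R..t+R}) v1" and c2: "continuous_on (cball y R \<times> {tau-R..tau+R}) v2"
  and sup1: "\<And>xi h. norm xi < R ==> \<bar>h\<bar> < R ==> super_at alpha v1 (x + xi) (t + h)"
  and sup2: "\<And>xi h. norm xi < R ==> \<bar>h\<bar> < R ==> super_at alpha v2 (y + xi) (tau + h)"
  and ps: "peano2 pf ((norm (x - y))\<^sup>2) k1 k2" and pg: "peano2 g t g1 g2"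
  and lm: "\<And>xi xi' h h'. norm xi <= R ==> norm xi' <= R ==> \<bar>h\<bar> <= R ==> \<bar>h'\<bar> <= R ==>
    v1 (x, t) + v2 (y, tau) + (norm (x - x0))\<^sup>2 + pf ((norm (x - y))\<^sup>2) + g t + (t - tau + eta)\<^sup>2 / (2 * eps)
    <= v1 (x + xi, t + h) + v2 (y + xi', tau + h') + (norm (x + xi - x0))\<^sup>2 + pf ((norm (x + xi - (y + xi')))\<^sup>2) + g (t + h) + (t + h - (tau + h') + eta)\<^sup>2 / (2 * eps)"
  and p1: "p1 = - (2 *\<^sub>R (x - x0) + (2 * k1) *\<^sub>R (x - y))" and p2: "p2 = (2 * k1) *\<^sub>R (x - y)" and nz: "p1 \<noteq> 0" "p2 \<noteq> 0"
 shows "g1 <= (\<Sum>k\<in>UNIV. rform k1 k2 (x - y) (s k p1 - s' k p2)) + 2 * (alpha * CARD('n) + (1 - 2 * alpha))"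
proof (rule field_le_epsilon)
 fix e0 :: real assume e0: "e0 > 0"
 define D where "D = (\<Sum>k\<in>UNIV. (norm (s k p1 - s' k p2))\<^sup>2)"
 have D0: "D \<ge> 0" by (simp add: D_def sum_nonneg)
 define e where "e = e0 / (2 * (D + 1))"
 have e: "e > 0" using e0 D0 by (simp add: e_def)
 have eD: "2 * e * D <= e0" using e0 D0 by (simp add: e_def field_simps)
 obtain d1 where d1: "d1 > 0" "\<And>v. norm v < d1 ==> pf ((norm (x - y + v))\<^sup>2) <= pf ((norm (x - y))\<^sup>2) + (2 * k1) * ((x - y) \<bullet> v) + rform k1 k2 (x - y) v / 2 + e * (norm v)\<^sup>2"
  using radial_upper[OF ps e] by blast
 obtain d2 where d2: "d2 > 0" "\<And>h. \<bar>h\<bar> < d2 ==> g (t + h) <= g t + g1 * h + (\<bar>g2\<bar> / 2 + 1) * h\<^sup>2"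
  using peano2_upper[OF pg] by blast
 define r where "r = min R (min (d1 / 3) (d2 / 2))"
 have r: "0 < r" "r <= R" "3 * r <= d1" "2 * r <= d2" using R d1(1) d2(1) by (auto simp: r_def min_def)
 define Z where "Z = (\<lambda>u. rform k1 k2 (x - y) u + 2 * e * (norm u)\<^sup>2)"
 have Z: "isqf Z" unfolding Z_def by (intro isqf_add isqf_cmult isqf_norm2 isqf_rform)
 define C where "C = \<bar>g2\<bar> / 2 + 1 + inverse eps"
 have C: "0 <= C" using ep by (simp add: C_def)
 define b where "b = (t - tau + eta) * inverse eps"
 have "- (\<Sum>k\<in>UNIV. dform Z 2 0 (s k p1, s' k p2)) <= (- g1 - b) + b"
 proof (rule theorem_on_sums[OF al cs cs' r(1) _ _ _ _ Z C nz])
  show "continuous_on (cball x r \<times> {t - r..t + r}) v1" by (rule continuous_on_subset[OF c1]) (use r in auto)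
  show "continuous_on (cball y r \<times> {tau - r..tau + r}) v2" by (rule continuous_on_subset[OF c2]) (use r in auto)
  show "super_at alpha v1 (x + xi) (t + h)" if "norm xi < r" "\<bar>h\<bar> < r" for xi h by (rule sup1) (use that r in auto)
  show "super_at alpha v2 (y + xi) (tau + h)" if "norm xi < r" "\<bar>h\<bar> < r" for xi h by (rule sup2) (use that r in auto)
  show "v1 (x, t) + v2 (y, tau) + p1 \<bullet> xi + p2 \<bullet> xi' + (- g1 - b) * h + b * h' - dform Z 2 0 (xi, xi') / 2 - C * (h\<^sup>2 + h'\<^sup>2)
   <= v1 (x + xi, t + h) + v2 (y + xi', tau + h')" if hh: "norm xi <= r" "norm xi' <= r" "\<bar>h\<bar> <= r" "\<bar>h'\<bar> <= r" for xi xi' h h'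
  proof -
   have a: "(norm (x + xi - x0))\<^sup>2 = (norm (x - x0))\<^sup>2 + 2 * ((x - x0) \<bullet> xi) + (norm xi)\<^sup>2"
    using norm2_diff_shift[of "x + xi" x0 x] by (simp add: inner_commute)
   have "norm (xi - xi') < d1" using norm_triangle_ineq4[of xi xi'] hh r by linarith
   from d1(2)[OF this] have bb: "pf ((norm (x + xi - (y + xi')))\<^sup>2) <= pf ((norm (x - y))\<^sup>2) + (2 * k1) * ((x - y) \<bullet> (xi - xi')) + Z (xi - xi') / 2"
    by (simp add: Z_def add_divide_distrib algebra_simps)
   have c: "g (t + h) <= g t + g1 * h + (\<bar>g2\<bar> / 2 + 1) * h\<^sup>2" by (rule d2(2)) (use hh r in linarith)
   have d: "(t + h - (tau + h') + eta)\<^sup>2 / (2 * eps) <= (t - tau + eta)\<^sup>2 / (2 * eps) + b * h - b * h' + inverse eps * h\<^sup>2 + inverse eps * h'\<^sup>2"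
   proof -
    have "(t + h - (tau + h') + eta)\<^sup>2 = (t - tau + eta)\<^sup>2 + 2 * (t - tau + eta) * (h - h') + (h - h')\<^sup>2" by (simp add: power2_eq_square algebra_simps)
    moreover have "(h - h')\<^sup>2 <= 2 * (h\<^sup>2 + h'\<^sup>2)" using zero_le_power2[of "h + h'"] by (simp add: power2_eq_square algebra_simps)
    ultimately have "(t + h - (tau + h') + eta)\<^sup>2 / (2 * eps) <= ((t - tau + eta)\<^sup>2 + 2 * (t - tau + eta) * (h - h') + 2 * (h\<^sup>2 + h'\<^sup>2)) / (2 * eps)"
     using ep by (intro divide_right_mono) auto
    also have "\<dots> = (t - tau + eta)\<^sup>2 / (2 * eps) + b * h - b * h' + inverse eps * h\<^sup>2 + inverse eps * h'\<^sup>2"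
     using ep by (simp add: b_def field_simps)
    finally show ?thesis .
   qed
   have l: "v1 (x, t) + v2 (y, tau) + (norm (x - x0))\<^sup>2 + pf ((norm (x - y))\<^sup>2) + g t + (t - tau + eta)\<^sup>2 / (2 * eps)
    <= v1 (x + xi, t + h) + v2 (y + xi', tau + h') + (norm (x + xi - x0))\<^sup>2 + pf ((norm (x + xi - (y + xi')))\<^sup>2) + g (t + h) + (t + h - (tau + h') + eta)\<^sup>2 / (2 * eps)"
    by (rule lm) (use hh r in auto)
   have f: "dform Z 2 0 (xi, xi') / 2 = Z (xi - xi') / 2 + (norm xi)\<^sup>2" by (simp add: dform_def add_divide_distrib)
   have p: "p1 \<bullet> xi + p2 \<bullet> xi' = - 2 * ((x - x0) \<bullet> xi) - (2 * k1) * ((x - y) \<bullet> (xi - xi'))"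
    by (simp add: p1 p2 inner_add_left inner_diff_right algebra_simps)
   have cc: "C * (h\<^sup>2 + h'\<^sup>2) = (\<bar>g2\<bar> / 2 + 1) * h\<^sup>2 + (\<bar>g2\<bar> / 2 + 1) * h'\<^sup>2 + inverse eps * h\<^sup>2 + inverse eps * h'\<^sup>2" by (simp add: C_def algebra_simps)
   have pos: "0 <= (\<bar>g2\<bar> / 2 + 1) * h'\<^sup>2" by simp
   have m: "(- g1 - b) * h = - (g1 * h) - b * h" by (simp add: algebra_simps)
   show ?thesis using a bb c d l f p cc pos m by linarith
  qed
 qed
 moreover have "(\<Sum>k\<in>UNIV. dform Z 2 0 (s k p1, s' k p2)) = (\<Sum>k\<in>UNIV. rform k1 k2 (x - y) (s k p1 - s' k p2)) + 2 * e * D + 2 * (\<Sum>k\<in>UNIV. (norm (s k p1))\<^sup>2)"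
  unfolding D_def sum_distrib_left sum.distrib[symmetric] by (rule sum.cong) (auto simp: dform_def Z_def)
 ultimately show "g1 <= (\<Sum>k\<in>UNIV. rform k1 k2 (x - y) (s k p1 - s' k p2)) + 2 * (alpha * CARD('n) + (1 - 2 * alpha)) + e0"
  using coupl_trace[OF cs nz(1)] eD by simp
qed

text \<open>
 When the gradients may vanish the theorem on sums is not available; testing each function separately costs the size of the Hessian.
\<close>

lemma pair_direct:
 fixes v1 v2 :: "(real^'n) \<times> real => real"
 assumes al: "0 <= alpha" "alpha < 1" and R: "0 < R" and ep: "0 < eps"
  and sup1: "super_at alpha v1 x t" and sup2: "super_at alpha v2 y tau"
  and ps: "peano2 pf ((norm (x - y))\<^sup>2) k1 k2" and pg: "peano2 g t g1 g2"
  and lm: "\<And>xi xi' h h'. norm xi <= R ==> norm xi' <= R ==> \<bar>h\<bar> <= R ==> \<bar>h'\<bar> <= R ==>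
    v1 (x, t) + v2 (y, tau) + (norm (x - x0))\<^sup>2 + pf ((norm (x - y))\<^sup>2) + g t + (t - tau + eta)\<^sup>2 / (2 * eps)
    <= v1 (x + xi, t + h) + v2 (y + xi', tau + h') + (norm (x + xi - x0))\<^sup>2 + pf ((norm (x + xi - (y + xi')))\<^sup>2) + g (t + h) + (t + h - (tau + h') + eta)\<^sup>2 / (2 * eps)"
  and M: "\<And>u. \<bar>rform k1 k2 (x - y) u\<bar> <= M * (norm u)\<^sup>2" "0 <= M"
 shows "g1 <= (real CARD('n) + 1) * (2 * M + 2)"
proof -
 define Z where "Z = rform k1 k2 (x - y)"
 have Zi: "isqf Z" by (simp add: Z_def isqf_rform)
 have cst: "\<bar>alpha\<bar> * real CARD('n) + \<bar>1 - 2 * alpha\<bar> <= real CARD('n) + 1"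
 proof -
  have "\<bar>alpha\<bar> * real CARD('n) <= 1 * real CARD('n)" using al by (intro mult_right_mono) auto
  then show ?thesis using al by linarith
 qed
 have Fb: "- ((real CARD('n) + 1) * L) <= Fq alpha eta' q" if "\<And>v. \<bar>q v\<bar> <= L * (norm v)\<^sup>2" "0 <= L" for q and L and eta' :: "real^'n"
  using Fq_bound[OF that, of alpha eta'] mult_right_mono[OF cst that(2)] by linarith
 have sq: "peano2 (\<lambda>h. h\<^sup>2 / (2 * eps)) a (a * inverse eps) (inverse eps)" for a
 proof (rule peano2I[of 1 _ _ "\<lambda>a. a * inverse eps"])
  show "((\<lambda>h. h\<^sup>2 / (2 * eps)) has_real_derivative z * inverse eps) (at z)" for z
   using ep by (auto intro!: derivative_eq_intros simp: field_simps)
  show "((\<lambda>a. a * inverse eps) has_real_derivative inverse eps) (at a)" by (auto intro!: derivative_eq_intros)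
 qed simp
 have js: "pjet (\<lambda>z. snd z + c) x' t' 1 0 (\<lambda>v. 0)" for c t' and x' :: "real^'n"
  by (rule pjet_cong[OF pjet_add[OF pjet_snd pjet_const]]) auto
 define phi1 where "phi1 = (\<lambda>z :: (real^'n) \<times> real. - ((norm (fst z - x0))\<^sup>2 + pf ((norm (fst z - y))\<^sup>2) + g (snd z) + (snd z + (eta - tau))\<^sup>2 / (2 * eps)))"
 have j1: "pjet phi1 x t (- (g1 + (t - tau + eta) * inverse eps)) (- (2 *\<^sub>R (x - x0) + (2 * k1) *\<^sub>R (x - y))) (\<lambda>v. - (2 * (norm v)\<^sup>2 + Z v))"
  unfolding phi1_def
 proof (rule pjet_cong[OF pjet_minus[OF pjet_add[OF pjet_add[OF pjet_add[OF pjet_norm2[of x0 x t] pjet_comp[OF pjet_norm2[of y x t]]]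
   pjet_comp[OF pjet_snd[of x t]]] pjet_comp[OF js[of "eta - tau" x t]]]]])
  show "peano2 pf ((norm (fst (x, t) - y))\<^sup>2) k1 k2" using ps by simp
  show "peano2 g (snd (x, t)) g1 g2" using pg by simp
  show "peano2 (\<lambda>h. h\<^sup>2 / (2 * eps)) (snd (x, t) + (eta - tau)) ((t + (eta - tau)) * inverse eps) (inverse eps)" using sq[of "t + (eta - tau)"] by simp
 qed (auto simp: Z_def rform_def power_mult_distrib mult.commute[of k1 2] add_diff_eq)
 define m where "m = (real CARD('n) + 1) * (2 + M)"
 define m' where "m' = (real CARD('n) + 1) * M"
 have i1: "isqf (\<lambda>v. - (2 * (norm v)\<^sup>2 + Z v))" by (intro isqf_uminus isqf_add isqf_cmult isqf_norm2 Zi)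
 have "- m <= - (g1 + (t - tau + eta) * inverse eps)"
 proof (rule sup1[unfolded super_at_def, rule_format, OF j1 i1])
  show "\<exists>dlt>0. \<forall>v s. norm v < dlt --> \<bar>s\<bar> < dlt --> v1 (x, t) - phi1 (x, t) <= v1 (x + v, t + s) - phi1 (x + v, t + s)"
  proof (intro exI[of _ R] conjI allI impI R)
   fix v :: "real^'n" and s assume "norm v < R" "\<bar>s\<bar> < R"
   then show "v1 (x, t) - phi1 (x, t) <= v1 (x + v, t + s) - phi1 (x + v, t + s)"
    using lm[of v 0 s 0] R by (simp add: phi1_def algebra_simps)
  qed
  show "\<exists>rho>0. \<forall>eta'. eta' \<noteq> 0 --> norm (eta' - - (2 *\<^sub>R (x - x0) + (2 * k1) *\<^sub>R (x - y))) < rho --> - m <= Fq alpha eta' (\<lambda>v. - (2 * (norm v)\<^sup>2 + Z v))"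
  proof (intro exI[of _ 1] conjI allI impI)
   fix eta' :: "real^'n"
   show "- m <= Fq alpha eta' (\<lambda>v. - (2 * (norm v)\<^sup>2 + Z v))" unfolding m_def
   proof (rule Fb)
    show "\<bar>- (2 * (norm v)\<^sup>2 + Z v)\<bar> <= (2 + M) * (norm v)\<^sup>2" for v
     using M(1)[of v] abs_triangle_ineq[of "2 * (norm v)\<^sup>2" "Z v"] unfolding abs_minus_cancel Z_def distrib_right[of 2 M] by simp
   qed (use M in simp)
  qed simp
 qed
 define phi2 where "phi2 = (\<lambda>z :: (real^'n) \<times> real. - (pf ((norm (fst z - x))\<^sup>2) + (snd z + (- eta - t))\<^sup>2 / (2 * eps)))"
 have j2: "pjet phi2 y tau (- ((tau - eta - t) * inverse eps)) (- ((2 * k1) *\<^sub>R (y - x))) (\<lambda>v. - (Z v))"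
  unfolding phi2_def
 proof (rule pjet_cong[OF pjet_minus[OF pjet_add[OF pjet_comp[OF pjet_norm2[of x y tau]] pjet_comp[OF js[of "- eta - t" y tau]]]]])
  show "peano2 pf ((norm (fst (y, tau) - x))\<^sup>2) k1 k2" using ps by (simp add: norm_minus_commute)
  show "peano2 (\<lambda>h. h\<^sup>2 / (2 * eps)) (snd (y, tau) + (- eta - t)) ((tau + (- eta - t)) * inverse eps) (inverse eps)" using sq[of "tau + (- eta - t)"] by simp
  show "\<And>v. - (k1 * (2 * (norm v)\<^sup>2) + k2 * (2 *\<^sub>R (y - x) \<bullet> v)\<^sup>2 + ((tau + (- eta - t)) * inverse eps * 0 + inverse eps * (0 \<bullet> v)\<^sup>2)) = - Z v"

  proof -
   fix v
   have "(y - x) \<bullet> v = - ((x - y) \<bullet> v)" by (simp add: inner_diff_left)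
   then have "(2 *\<^sub>R (y - x) \<bullet> v)\<^sup>2 = 4 * ((x - y) \<bullet> v)\<^sup>2" by (simp add: power_mult_distrib)
   then show "- (k1 * (2 * (norm v)\<^sup>2) + k2 * (2 *\<^sub>R (y - x) \<bullet> v)\<^sup>2 + ((tau + (- eta - t)) * inverse eps * 0 + inverse eps * (0 \<bullet> v)\<^sup>2)) = - Z v"
    by (simp add: Z_def rform_def)
  qed
 qed (auto simp: algebra_simps)
 have i2: "isqf (\<lambda>v. - (Z v))" by (intro isqf_uminus Zi)
 have "- m' <= - ((tau - eta - t) * inverse eps)"
 proof (rule sup2[unfolded super_at_def, rule_format, OF j2 i2])
  show "\<exists>dlt>0. \<forall>v s. norm v < dlt --> \<bar>s\<bar> < dlt --> v2 (y, tau) - phi2 (y, tau) <= v2 (y + v, tau + s) - phi2 (y + v, tau + s)"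
  proof (intro exI[of _ R] conjI allI impI R)
   fix v :: "real^'n" and s assume vs: "norm v < R" "\<bar>s\<bar> < R"
   have e1: "norm (y + v - x) = norm (x - (y + v))" "norm (y - x) = norm (x - y)" by (simp_all add: norm_minus_commute)
   have e2: "(tau + s + (- eta - t))\<^sup>2 = (t - (tau + s) + eta)\<^sup>2" "(tau + (- eta - t))\<^sup>2 = (t - tau + eta)\<^sup>2" by (simp_all add: power2_eq_square algebra_simps)
   show "v2 (y, tau) - phi2 (y, tau) <= v2 (y + v, tau + s) - phi2 (y + v, tau + s)"
    using lm[of 0 v 0 s] R vs by (simp add: phi2_def e1 e2)
  qed
  show "\<exists>rho>0. \<forall>eta'. eta' \<noteq> 0 --> norm (eta' - - ((2 * k1) *\<^sub>R (y - x))) < rho --> - m' <= Fq alpha eta' (\<lambda>v. - (Z v))"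
  proof (intro exI[of _ 1] conjI allI impI)
   fix eta' :: "real^'n"
   show "- m' <= Fq alpha eta' (\<lambda>v. - (Z v))" unfolding m'_def by (rule Fb) (use M in \<open>auto simp: Z_def\<close>)
  qed simp
 qed
 moreover have "(tau - eta - t) * inverse eps = - ((t - tau + eta) * inverse eps)" by (simp add: algebra_simps)
 moreover have "m + m' = (real CARD('n) + 1) * (2 * M + 2)" by (simp add: m_def m'_def algebra_simps)
 ultimately show ?thesis using \<open>- m <= - (g1 + (t - tau + eta) * inverse eps)\<close> by linarith
qed

text \<open>
 The two time variables are tied by a quadratic penalty.  The minimum avoids the set \<open>N\<close> of points where the
 bound is already known, since it approaches the diagonal in time as the penalty grows.
\<close>

lemma time_doubling:
 fixes v1 v2 :: "'a::euclidean_space \<times> real => real" and Psi :: "'a \<times> 'a => real"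
 assumes S: "compact S1" "compact S2" and t: "t0 <= t1"
  and c1: "continuous_on (S1 \<times> {t0..t1}) v1" and c2: "continuous_on (S2 \<times> {t0..t1}) v2"
  and cP: "continuous_on (S1 \<times> S2) Psi" and cg: "continuous_on {t0..t1} g"
  and bad: "\<And>x y t. x \<in> S1 ==> y \<in> S2 ==> t \<in> {t0..t1} ==> N x y t ==> m <= v1 (x, t) + v2 (y, t) + Psi (x, y) + g t"
  and z: "x1 \<in> S1" "y1 \<in> S2" "s1 \<in> {t0..t1}" "v1 (x1, s1) + v2 (y1, s1) + Psi (x1, y1) + g s1 < m"
 obtains x y t s eps where "0 < eps" "x \<in> S1" "y \<in> S2" "t \<in> {t0..t1}" "s \<in> {t0..t1}" "\<not> N x y t" "\<not> N x y s"
  "\<And>x' y' t' s'. x' \<in> S1 ==> y' \<in> S2 ==> t' \<in> {t0..t1} ==> s' \<in> {t0..t1} ==>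
    v1 (x, t) + v2 (y, s) + Psi (x, y) + g t + (t - s)\<^sup>2 / (2 * eps) <= v1 (x', t') + v2 (y', s') + Psi (x', y') + g t' + (t' - s')\<^sup>2 / (2 * eps)"
proof -
 define ms where "ms = v1 (x1, s1) + v2 (y1, s1) + Psi (x1, y1) + g s1"
 define W where "W = (\<lambda>w. v1 (fst (fst w), fst (snd w)) + v2 (snd (fst w), snd (snd w)) + Psi (fst w) + g (fst (snd w)))"
 define B where "B = (S1 \<times> S2) \<times> ({t0..t1} \<times> {t0..t1})"
 have Bc: "compact B" unfolding B_def by (intro compact_Times S) auto
 have Bne: "B \<noteq> {}" using z by (auto simp: B_def)
 have cW: "continuous_on B W" unfolding W_def B_def
  by (intro continuous_intros continuous_on_compose2[OF c1] continuous_on_compose2[OF c2] continuous_on_compose2[OF cP] continuous_on_compose2[OF cg]) auto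
 define d where "d = m - ms"
 have d: "d > 0" using z(4) by (simp add: d_def ms_def)
 obtain dlt where dl: "dlt > 0" "\<And>w w'. w \<in> B ==> w' \<in> B ==> dist w' w < dlt ==> dist (W w') (W w) < d"
  using compact_uniformly_continuous[OF cW Bc] d unfolding uniformly_continuous_on_def by metis
 have "bounded (W ` B)" by (intro compact_imp_bounded compact_continuous_image cW Bc)
 then obtain M where M: "\<And>w. w \<in> B ==> \<bar>W w\<bar> <= M" unfolding bounded_iff by auto
 define K where "K = \<bar>M\<bar> + \<bar>ms\<bar> + 1"
 have K: "K > 0" by (simp add: K_def)
 define eps where "eps = dlt\<^sup>2 / (2 * K) / 2"
 have ep: "eps > 0" using dl K by (simp add: eps_def)
 have cWp: "continuous_on B (\<lambda>w. W w + (fst (snd w) - snd (snd w))\<^sup>2 / (2 * eps))"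
  using ep by (intro continuous_intros cW) auto
 have "\<exists>w\<in>B. \<forall>w'\<in>B. W w + (fst (snd w) - snd (snd w))\<^sup>2 / (2 * eps) <= W w' + (fst (snd w') - snd (snd w'))\<^sup>2 / (2 * eps)"
  by (rule continuous_attains_inf[OF Bc Bne cWp])
 then obtain x y t s where xB: "((x, y), (t, s)) \<in> B"
  and mn: "\<And>w'. w' \<in> B ==> W ((x, y), (t, s)) + (t - s)\<^sup>2 / (2 * eps) <= W w' + (fst (snd w') - snd (snd w'))\<^sup>2 / (2 * eps)"
  by (metis (no_types, lifting) fst_conv prod.collapse snd_conv)
 have xin: "x \<in> S1" "y \<in> S2" "t \<in> {t0..t1}" "s \<in> {t0..t1}" using xB by (auto simp: B_def)
 have le: "W ((x, y), (t, s)) + (t - s)\<^sup>2 / (2 * eps) <= ms"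
  using mn[of "((x1, y1), (s1, s1))"] z by (simp add: B_def W_def ms_def)
 have le': "W ((x, y), (t, s)) <= ms" using le ep by (smt (verit) divide_nonneg_pos zero_le_power2)
 have "(t - s)\<^sup>2 / (2 * eps) <= ms - W ((x, y), (t, s))" using le by linarith
 also have "\<dots> <= K" using abs_le_D2[OF M[OF xB]] abs_ge_self[of M] abs_ge_self[of ms] unfolding K_def by linarith
 finally have "(t - s)\<^sup>2 <= K * (2 * eps)" using ep by (simp add: pos_divide_le_eq)
 also have "\<dots> = dlt\<^sup>2 / 2" using K by (simp add: eps_def)
 also have "\<dots> < dlt\<^sup>2" using dl by simp
 finally have ts: "\<bar>t - s\<bar> < dlt" using dl by (metis abs_of_pos abs_square_less_1 power2_abs power_less_imp_less_base abs_ge_zero less_imp_le)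
 have near: "\<bar>W ((x, y), (u, u)) - W ((x, y), (t, s))\<bar> < d" if "u = t \<or> u = s" for u
 proof -
  have "dist ((x, y), (u, u)) ((x, y), (t, s)) < dlt" using that ts by (auto simp: dist_Pair_Pair dist_real_def)
  from dl(2)[OF xB _ this] show ?thesis using that xin by (auto simp: B_def dist_real_def)
 qed
 have nb: "\<not> N x y u" if u: "u = t \<or> u = s" for u
 proof
  assume "N x y u"
  then have "m <= W ((x, y), (u, u))" using bad[OF xin(1,2), of u] u xin by (auto simp: W_def)
  then show False using near[OF u] le' unfolding d_def by linarith
 qed
 show thesis
 proof (rule that[OF ep xin nb nb])
  show "v1 (x, t) + v2 (y, s) + Psi (x, y) + g t + (t - s)\<^sup>2 / (2 * eps) <= v1 (x', t') + v2 (y', s') + Psi (x', y') + g t' + (t' - s')\<^sup>2 / (2 * eps)"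
   if "x' \<in> S1" "y' \<in> S2" "t' \<in> {t0..t1}" "s' \<in> {t0..t1}" for x' y' t' s'
   using mn[of "((x', y'), (t', s'))"] that by (simp add: W_def B_def)
 qed auto
qed

section \<open>Propagation of a bound on the diagonal\<close>

text \<open>
 A failure at the final time persists slightly earlier after adding a term that blows up at the final time.
\<close>

lemma left_penalty:
 fixes f :: "real => real"
 assumes c: "continuous_on {t0..T} f" and T: "t0 < T" and f: "f T < m"
 obtains iot t' t1 where "0 < iot" "t0 < t'" "t' < t1" "t1 < T" "f t' + iot / (T - t') < m" "1 <= iot / (T - t1)"
proof -
 obtain d where d: "d > 0" "\<And>s. s \<in> {t0..T} ==> dist s T < d ==> dist (f s) (f T) < m - f T"
  using c T f unfolding continuous_on_iff by (metis atLeastAtMost_iff diff_gt_0_iff_gt less_eq_real_def)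
 obtain b where b: "0 < b" "b <= d" "b <= T - t0" using d(1) T that[of "min d (T - t0)"] by (metis diff_gt_0_iff_gt min.cobounded1 min.cobounded2 min_less_iff_conj)
 define t' where "t' = T - b / 2"
 have t': "t0 < t'" "t' < T" "dist t' T < d" using b by (auto simp: t'_def dist_real_def)
 have "dist (f t') (f T) < m - f T" by (rule d(2)) (use t' in auto)
 then have ft: "f t' < m" by (simp add: dist_real_def abs_less_iff)
 define iot where "iot = (m - f t') * (T - t') / 2"
 have io: "iot > 0" using ft t' by (simp add: iot_def)
 obtain b where bb: "0 < b" "b <= iot" "b <= (T - t') / 2"
  using io t' that[of "min iot ((T - t') / 2)"] by (metis diff_gt_0_iff_gt half_gt_zero min.cobounded1 min.cobounded2 min_less_iff_conj)
 define t1 where "t1 = T - b"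
 have t1: "t' < t1" "t1 < T" "T - t1 <= iot" using bb t' by (auto simp: t1_def)
 show thesis
 proof (rule that[OF io t'(1) t1(1,2)])
  have "u \<noteq> 0 ==> a * u / 2 / u = a / 2" for a u :: real by simp
  then have io2: "iot / (T - t') = (m - f t') / 2" using t' unfolding iot_def by (metis diff_gt_0_iff_gt less_irrefl)
  show "f t' + iot / (T - t') < m" unfolding io2 using ft by (simp add: field_simps)
  show "1 <= iot / (T - t1)" using t1 by simp
 qed
qed

lemma peano2_penalty:
 fixes e1 l :: real
 assumes "t < T"
 shows "peano2 (\<lambda>t. E + l * (t - t0) + iot / (T - t)) t (l + iot / (T - t)\<^sup>2) (2 * iot / (T - t)^3)"
proof (rule peano2I[of "T - t" _ _ "\<lambda>t. l + iot / (T - t)\<^sup>2"])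
 show "((\<lambda>t. E + l * (t - t0) + iot / (T - t)) has_real_derivative l + iot / (T - z)\<^sup>2) (at z)" if "\<bar>z - t\<bar> < T - t" for z

 proof -
  have z: "T - z \<noteq> 0" using that by auto
  have "((\<lambda>t. iot / (T - t)) has_real_derivative (0 * (T - z) - iot * (0 - 1)) / ((T - z) * (T - z))) (at z)"
   by (intro DERIV_divide DERIV_const DERIV_diff DERIV_ident z)
  then have "((\<lambda>t. iot / (T - t)) has_real_derivative iot / (T - z)\<^sup>2) (at z)" by (simp add: power2_eq_square)
  moreover have "((\<lambda>t. E + l * (t - t0)) has_real_derivative l) (at z)" by (auto intro!: derivative_eq_intros)
  ultimately show ?thesis by (rule DERIV_add[rotated])
 qed
 show "((\<lambda>t. l + iot / (T - t)\<^sup>2) has_real_derivative 2 * iot / (T - t) ^ 3) (at t)"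

 proof -
  have "T - t \<noteq> 0" using assms by simp
  then have "((\<lambda>t. iot / (T - t)\<^sup>2) has_real_derivative (0 * (T - t)\<^sup>2 - iot * (2 * (T - t) * (0 - 1))) / ((T - t)\<^sup>2 * (T - t)\<^sup>2)) (at t)"
   by (intro DERIV_divide DERIV_const) (auto intro!: derivative_eq_intros)
  moreover have "(0 * (T - t)\<^sup>2 - iot * (2 * (T - t) * (0 - 1))) / ((T - t)\<^sup>2 * (T - t)\<^sup>2) = 2 * iot / (T - t) ^ 3"
  proof -
   have "u \<noteq> 0 ==> (0 * u\<^sup>2 - iot * (2 * u * (0 - 1))) / (u\<^sup>2 * u\<^sup>2) = 2 * iot / u ^ 3" for u :: real
    by (simp add: power2_eq_square power3_eq_cube mult.assoc mult.commute)
   then show ?thesis using \<open>T - t \<noteq> 0\<close> by blast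
  qed
  ultimately have "((\<lambda>t. iot / (T - t)\<^sup>2) has_real_derivative 2 * iot / (T - t) ^ 3) (at t)" by simp
  from DERIV_add[OF DERIV_const[of l] this] show ?thesis by simp
 qed
qed (use assms in simp)

lemma pair_min:
 fixes v :: "(real^'n) \<times> real => real"
 assumes cv: "continuous_on (UNIV \<times> {0<..}) v" and bd: "\<And>x t. 0 < t ==> -1 <= v (x, t)"
  and t: "0 < t0" "t0 <= t1" and et: "0 <= eta"
  and cpsi: "continuous_on {0..} pf" and psi1: "\<And>Q. 1 <= Q ==> 1 <= pf Q" and psi0: "\<And>Q. 0 <= Q ==> 0 <= pf Q"
  and cg: "continuous_on {t0..t1} g" and g0: "\<And>t. t \<in> {t0..t1} ==> 0 <= g t"
  and bad: "\<And>x y t. t \<in> {t0..t1} ==> t = t0 \<or> t = t1 \<or> D x y ==>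
    -1 <= v (x, t) + v (y, t + eta) + (norm (x - x0))\<^sup>2 + pf ((norm (x - y))\<^sup>2) + g t"
  and z: "s1 \<in> {t0..t1}" "v (x1, s1) + v (y1, s1 + eta) + (norm (x1 - x0))\<^sup>2 + pf ((norm (x1 - y1))\<^sup>2) + g s1 < -1"
 obtains x y t s eps R where "0 < eps" "0 < R" "R <= t0 / 2" "t0 < t" "t < t1" "t0 < s" "s < t1" "\<not> D x y" "norm (x - x0) < 1"
  "pf ((norm (x - y))\<^sup>2) < 1"
  "\<And>xi xi' h h'. norm xi <= R ==> norm xi' <= R ==> \<bar>h\<bar> <= R ==> \<bar>h'\<bar> <= R ==>
    v (x, t) + v (y, s + eta) + (norm (x - x0))\<^sup>2 + pf ((norm (x - y))\<^sup>2) + g t + (t - (s + eta) + eta)\<^sup>2 / (2 * eps)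
    <= v (x + xi, t + h) + v (y + xi', s + eta + h') + (norm (x + xi - x0))\<^sup>2 + pf ((norm (x + xi - (y + xi')))\<^sup>2) + g (t + h) + (t + h - (s + eta + h') + eta)\<^sup>2 / (2 * eps)"
proof -
 define N where "N = (\<lambda>x y t. t = t0 \<or> t = t1 \<or> D x y \<or> 1 <= norm (x - x0) \<or> 1 <= pf ((norm (x - y))\<^sup>2))"
 define Psi where "Psi = (\<lambda>z :: (real^'n) \<times> (real^'n). (norm (fst z - x0))\<^sup>2 + pf ((norm (fst z - snd z))\<^sup>2))"
 define v2 where "v2 = (\<lambda>z :: (real^'n) \<times> real. v (fst z, snd z + eta))"
 have badN: "-1 <= v (x, t) + v2 (y, t) + Psi (x, y) + g t" if "t \<in> {t0..t1}" "N x y t" for x y t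
 proof (cases "t = t0 \<or> t = t1 \<or> D x y")
  case True then show ?thesis using bad[OF that(1), of x y] by (simp add: v2_def Psi_def)
 next
  case False
  then have "1 <= norm (x - x0) \<or> 1 <= pf ((norm (x - y))\<^sup>2)" using that(2) by (auto simp: N_def)
  moreover have "1 <= norm (x - x0) ==> 1 <= (norm (x - x0))\<^sup>2" by simp
  moreover have "0 <= pf ((norm (x - y))\<^sup>2)" "0 <= (norm (x - x0))\<^sup>2" by (simp_all add: psi0)
  ultimately have "1 <= Psi (x, y)" unfolding Psi_def fst_conv snd_conv by argo
  moreover have "-1 <= v (x, t)" "-1 <= v2 (y, t)" unfolding v2_def using bd that(1) t et by auto
  ultimately show ?thesis using g0[OF that(1)] by linarith
 qed
 have near: "norm (x - y) < 1" if "pf ((norm (x - y))\<^sup>2) < 1" for x y :: "real^'n"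
 proof (rule ccontr)
  assume "\<not> norm (x - y) < 1"
  then have "1 <= (norm (x - y))\<^sup>2" by simp
  from psi1[OF this] show False using that by linarith
 qed
 have "\<not> N x1 y1 s1" using badN[OF z(1), of x1 y1] z(2) by (auto simp: v2_def Psi_def)
 then have x1: "norm (x1 - x0) < 1" "pf ((norm (x1 - y1))\<^sup>2) < 1" by (auto simp: N_def)
 have tri: "norm (y - x0) < 2" if "norm (x - x0) < 1" "pf ((norm (x - y))\<^sup>2) < 1" for x y
  using norm_triangle_ineq4[of "x - x0" "x - y"] that(1) near[OF that(2)] by simp
 have c1: "continuous_on (cball x0 1 \<times> {t0..t1}) v" by (rule continuous_on_subset[OF cv]) (use t in auto)
 have c2: "continuous_on (cball x0 3 \<times> {t0..t1}) v2" unfolding v2_def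
  by (rule continuous_on_compose2[OF cv]) (use t et in \<open>auto intro!: continuous_intros\<close>)
 have cP: "continuous_on (cball x0 1 \<times> cball x0 3) Psi" unfolding Psi_def
  by (intro continuous_intros continuous_on_compose2[OF cpsi]) auto
 have z1: "v (x1, s1) + v2 (y1, s1) + Psi (x1, y1) + g s1 < -1" using z(2) by (simp add: v2_def Psi_def)
 have xin: "x1 \<in> cball x0 1" "y1 \<in> cball x0 3" using x1(1) tri[OF x1] by (auto simp: dist_norm norm_minus_commute)
 show thesis
 proof (rule time_doubling[OF compact_cball compact_cball t(2) c1 c2 cP cg badN xin z(1) z1], assumption, assumption)
  fix x y t s eps assume ep: "0 < eps" and xy: "x \<in> cball x0 1" "y \<in> cball x0 3" and ts: "t \<in> {t0..t1}" "s \<in> {t0..t1}"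
   and nN: "\<not> N x y t" "\<not> N x y s"
   and mn: "\<And>x' y' t' s'. x' \<in> cball x0 1 ==> y' \<in> cball x0 3 ==> t' \<in> {t0..t1} ==> s' \<in> {t0..t1} ==>
    v (x, t) + v2 (y, s) + Psi (x, y) + g t + (t - s)\<^sup>2 / (2 * eps) <= v (x', t') + v2 (y', s') + Psi (x', y') + g t' + (t' - s')\<^sup>2 / (2 * eps)"
  have x: "norm (x - x0) < 1" "pf ((norm (x - y))\<^sup>2) < 1" "\<not> D x y" "t0 < t" "t < t1" "t0 < s" "s < t1"
   using nN ts by (auto simp: N_def)
  define R where "R = min (min (1 - norm (x - x0)) (t0 / 2)) (min (min (t - t0) (t1 - t)) (min (s - t0) (t1 - s)))"
  have R: "0 < R" using x t by (simp add: R_def)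
  have Rl: "R <= 1 - norm (x - x0)" "R <= t0 / 2" "R <= t - t0" "R <= t1 - t" "R <= s - t0" "R <= t1 - s"
   unfolding R_def by linarith+
  show thesis
  proof (rule that[OF ep R Rl(2) x(4,5,6,7,3,1,2)])
   fix xi xi' :: "real^'n" and h h' assume s: "norm xi <= R" "norm xi' <= R" "\<bar>h\<bar> <= R" "\<bar>h'\<bar> <= R"
   have a: "x + xi \<in> cball x0 1" using norm_triangle_ineq[of "x - x0" xi] s Rl by (simp add: dist_norm norm_minus_commute add_diff_eq diff_add_eq)
   have R1: "R <= 1" using Rl(1) norm_ge_zero[of "x - x0"] by linarith
   have b: "y + xi' \<in> cball x0 3"
    using norm_triangle_ineq[of "y - x0" xi'] s R1 tri[OF x(1,2)] by (simp add: dist_norm norm_minus_commute add_diff_eq diff_add_eq)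
   have c: "t + h \<in> {t0..t1}" "s + h' \<in> {t0..t1}" using s Rl by auto
   have e: "t - (s + eta) + eta = t - s" "t + h - (s + h' + eta) + eta = t + h - (s + h')" "s + eta + h' = s + h' + eta" by simp_all
   show "v (x, t) + v (y, s + eta) + (norm (x - x0))\<^sup>2 + pf ((norm (x - y))\<^sup>2) + g t + (t - (s + eta) + eta)\<^sup>2 / (2 * eps)
    <= v (x + xi, t + h) + v (y + xi', s + eta + h') + (norm (x + xi - x0))\<^sup>2 + pf ((norm (x + xi - (y + xi')))\<^sup>2) + g (t + h) + (t + h - (s + eta + h') + eta)\<^sup>2 / (2 * eps)"
    using mn[OF a b c] unfolding e by (simp only: v2_def Psi_def fst_conv snd_conv add.assoc)
  qed
 qed
qed

lemma trace_le: "0 < alpha ==> alpha < 1 ==> alpha * real CARD('n::finite) + (1 - 2 * alpha) <= real CARD('n) + 1"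
proof -
 assume "0 < alpha" "alpha < 1"
 moreover from this have "alpha * real CARD('n) <= 1 * real CARD('n)" by (intro mult_right_mono) auto
 ultimately show ?thesis by linarith
qed

lemma sgn_inner_self: "norm (sgn z) = 1 ==> (z \<bullet> sgn z)\<^sup>2 = (norm (z :: 'a::real_inner))\<^sup>2"
 by (simp add: inner_sgn_right)

lemma peano2_root:
 fixes c :: real
 assumes Q: "0 < Q"
 shows "peano2 (\<lambda>Q. c * Q powr (1/4)) Q (c * Q powr (1/4) / (4 * Q)) (- 3 * (c * Q powr (1/4)) / (16 * Q\<^sup>2))"
proof (rule peano2I[of Q _ _ "\<lambda>Q. c * Q powr (1/4) / (4 * Q)"])
 have a: "((\<lambda>Q. c * Q powr (1/4)) has_real_derivative c * z powr (1/4) / (4 * z)) (at z)" if "z > 0" for z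

 proof -
  have "((\<lambda>Q. c * Q powr (1/4)) has_real_derivative c * (1/4 * z powr (1/4 - 1))) (at z)"
   by (rule DERIV_cmult) (rule has_real_derivative_powr[OF that])
  moreover have "z powr (1/4 - 1) = z powr (1/4) / z" using that by (simp only: powr_diff powr_one less_imp_le)
  ultimately show ?thesis by (simp add: mult.commute)
 qed
 then show "((\<lambda>Q. c * Q powr (1/4)) has_real_derivative c * z powr (1/4) / (4 * z)) (at z)" if "\<bar>z - Q\<bar> < Q" for z
  using that by simp
 have "((\<lambda>Q. c * Q powr (1/4) / (4 * Q)) has_real_derivative (c * Q powr (1/4) / (4 * Q) * (4 * Q) - c * Q powr (1/4) * 4) / ((4 * Q) * (4 * Q))) (at Q)"
  by (rule DERIV_divide[OF a[OF Q]]) (use Q in \<open>auto intro!: derivative_eq_intros\<close>)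
 moreover have "(c * Q powr (1/4) / (4 * Q) * (4 * Q) - c * Q powr (1/4) * 4) / ((4 * Q) * (4 * Q)) = - 3 * (c * Q powr (1/4)) / (16 * Q\<^sup>2)"
  using Q by (simp add: power2_eq_square field_simps)
 ultimately show "((\<lambda>Q. c * Q powr (1/4) / (4 * Q)) has_real_derivative - 3 * (c * Q powr (1/4)) / (16 * Q\<^sup>2)) (at Q)" by simp
qed (use Q in simp)

lemma powr_quarter: "0 <= x ==> (x powr (1/4)) ^ 4 = (x :: real)"
 by (cases "x = 0") (simp_all add: powr_realpow[symmetric] powr_powr)

lemma powr_neg_quarter: "0 < x ==> (x powr (-1/4)) ^ 4 = inverse (x :: real)"
proof -
 assume x: "0 < x"
 have e: "(-1/4 :: real) = - (1/4)" by simp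
 show ?thesis unfolding e powr_minus power_inverse powr_quarter[OF less_imp_le[OF x]] ..
qed

text \<open>
 The concave profile \<open>A (|x - y|\<^sup>2 / tau)\<close> to the power \<open>1/4\<close> has a strongly negative second derivative; the reflection coupling
 uses it to beat the time derivative \<open>4 / tau\<close> of the window and the errors from the localization \<open>|x - x0|\<^sup>2\<close>.
\<close>

lemma ishii_lions:
 fixes v :: "(real^'n) \<times> real => real"
 assumes al: "0 < alpha" "alpha < 1" and cv: "continuous_on (UNIV \<times> {0<..}) v" and bd: "\<And>x t. 0 < t ==> -1 <= v (x, t)"
  and sup: "\<And>x t. 0 < t ==> super_at alpha v x t" and et: "0 <= eta" and E: "0 <= E"
  and A: "2 <= A" "300 * real CARD('n) + 64 <= min alpha (1 - alpha) * A^4" and tau: "0 < tau" "tau <= 1"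
  and diag: "\<And>x t. tau / 2 <= t ==> t <= tau ==> -1 <= v (x, t) + v (x, t + eta) + (norm (x - x0))\<^sup>2 + E"
 shows "-1 <= v (x, tau) + v (y, tau + eta) + (norm (x - x0))\<^sup>2 + E + A * tau powr (-1/4) * ((norm (x - y))\<^sup>2) powr (1/4)"
proof (rule ccontr)
 define c where "c = A * tau powr (-1/4)"
 have cpos: "c > 0" using A tau by (simp add: c_def)
 have c4: "c ^ 4 = A ^ 4 / tau"
 proof -
  have "(tau powr (-1/4)) ^ 4 = inverse tau" by (rule powr_neg_quarter[OF tau(1)])
  then show ?thesis unfolding c_def power_mult_distrib divide_inverse by (simp only:)
 qed
 define pf where "pf = (\<lambda>Q. c * Q powr (1/4) :: real)"
 define f where "f = (\<lambda>t. v (x, t) + v (y, t + eta) + (norm (x - x0))\<^sup>2 + pf ((norm (x - y))\<^sup>2) + (E + (- 4 / tau) * (t - tau)))"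
 assume "\<not> ?thesis"
 then have ft: "f tau < -1" by (simp add: f_def pf_def c_def)
 have cf: "continuous_on {tau/2..tau} f" unfolding f_def
  by (intro continuous_intros continuous_on_compose2[OF cv]) (use tau et in auto)
 obtain iot t' t1 where io: "0 < iot" "tau/2 < t'" "t' < t1" "t1 < tau" "f t' + iot / (tau - t') < -1" "1 <= iot / (tau - t1)"
  using left_penalty[OF cf _ ft] tau by auto
 define g where "g = (\<lambda>t. E + (- 4 / tau) * (t - tau) + iot / (tau - t))"
 have g0: "0 <= (- 4 / tau) * (t - tau)" if "t <= t1" for t
  by (rule mult_nonpos_nonpos) (use that io tau in auto)
 have gi: "0 <= iot / (tau - t)" if "t <= t1" for t using that io by simp
 have th: "0 < tau / 2" "tau / 2 <= t1" using tau io by auto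
 have P1: "1 <= pf Q" if "1 <= Q" for Q
 proof -
  have "1 <= c ^ 4" unfolding c4 using tau A power_mono[of 1 A 4] by (simp add: pos_le_divide_eq order_trans[of tau 1])
  then have "1 <= c" using cpos by (metis less_imp_le linorder_not_less power_less_one_iff zero_less_numeral)
  moreover have "1 <= Q powr (1/4)" using that by (simp add: ge_one_powr_ge_zero)
  ultimately show ?thesis unfolding pf_def using mult_mono[of 1 c 1 "Q powr (1/4)"] by simp
 qed
 show False
 proof (rule pair_min[OF cv bd th et, where pf = pf and g = g and D = "\<lambda>x y. x = y" and ?s1.0 = t' and ?x1.0 = x and ?y1.0 = y and ?x0.0 = x0])
  show "continuous_on {0..} pf" unfolding pf_def by (intro continuous_on_mult continuous_on_powr' continuous_on_const continuous_on_id) auto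
  have ca: "continuous_on {tau/2..t1} (\<lambda>t. iot / (tau - t))" by (intro continuous_intros) (use io in auto)
  have cb: "continuous_on {tau/2..t1} (\<lambda>t. E + c * (t - tau))" for c by (intro continuous_intros)
  show "continuous_on {tau/2..t1} g" unfolding g_def by (rule continuous_on_add[OF cb ca])
  show "0 <= g t" if "t \<in> {tau/2..t1}" for t using g0[of t] gi[of t] that E unfolding g_def by simp
  show "1 <= pf Q" if "1 <= Q" for Q by (rule P1[OF that])
  show "0 <= pf Q" if "0 <= Q" for Q unfolding pf_def using cpos by simp
  show "t' \<in> {tau/2..t1}" using io by simp
  show "v (x, t') + v (y, t' + eta) + (norm (x - x0))\<^sup>2 + pf ((norm (x - y))\<^sup>2) + g t' < -1"
   using io(5) by (simp add: f_def g_def)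
  show "-1 <= v (x, t) + v (y, t + eta) + (norm (x - x0))\<^sup>2 + pf ((norm (x - y))\<^sup>2) + g t"
   if t: "t \<in> {tau/2..t1}" and c: "t = tau/2 \<or> t = t1 \<or> x = y" for x y t
  proof -
   have b: "-1 <= v (x, t)" "-1 <= v (y, t + eta)" "0 <= (norm (x - x0))\<^sup>2" "0 <= pf ((norm (x - y))\<^sup>2)"
    using bd t tau et cpos by (auto simp: pf_def)
   have gg: "0 <= (- 4 / tau) * (t - tau)" "0 <= iot / (tau - t)" using g0 gi t by auto
   from c show ?thesis
   proof (elim disjE)
    assume t2: "t = tau/2"
    have "(- 4 / tau) * (t - tau) = 2" using tau unfolding t2 by (simp add: field_simps)
    then show ?thesis using b gg E unfolding g_def by linarith
   next
    assume "t = t1"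
    then have "1 <= iot / (tau - t)" using io(6) by simp
    then show ?thesis using b gg(1) E unfolding g_def by linarith
   next
    assume xy: "x = y"
    have "-1 <= v (x, t) + v (x, t + eta) + (norm (x - x0))\<^sup>2 + E" by (rule diag) (use t io in auto)
    then show ?thesis using b gg unfolding g_def xy by linarith
   qed
  qed
 next
  fix x y t s eps R
  assume ep: "0 < eps" and R: "0 < R" "R <= tau / 2 / 2" and ts: "tau / 2 < t" "t < t1" "tau / 2 < s" "s < t1" and xy: "x \<noteq> y"
   and x: "norm (x - x0) < 1" "pf ((norm (x - y))\<^sup>2) < 1"
   and lm: "\<And>xi xi' h h'. norm xi <= R ==> norm xi' <= R ==> \<bar>h\<bar> <= R ==> \<bar>h'\<bar> <= R ==>
    v (x, t) + v (y, s + eta) + (norm (x - x0))\<^sup>2 + pf ((norm (x - y))\<^sup>2) + g t + (t - (s + eta) + eta)\<^sup>2 / (2 * eps)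
    <= v (x + xi, t + h) + v (y + xi', s + eta + h') + (norm (x + xi - x0))\<^sup>2 + pf ((norm (x + xi - (y + xi')))\<^sup>2) + g (t + h) + (t + h - (s + eta + h') + eta)\<^sup>2 / (2 * eps)"
  define z where "z = x - y"
  define Q where "Q = (norm z)\<^sup>2"
  define P where "P = pf Q"
  define k1 where "k1 = P / (4 * Q)"
  define k2 where "k2 = - 3 * P / (16 * Q\<^sup>2)"
  define N where "N = real CARD('n)"
  define c0 where "c0 = min alpha (1 - alpha)"
  have c00: "0 < c0" using al by (simp add: c0_def)
  have z0: "z \<noteq> 0" using xy by (simp add: z_def)
  have Q: "0 < Q" using z0 by (simp add: Q_def)
  have P: "0 < P" "P < 1" using Q cpos x(2) by (auto simp: P_def pf_def Q_def z_def)
  have P4: "P ^ 4 * tau = A ^ 4 * Q"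
   unfolding P_def pf_def power_mult_distrib c4 using powr_quarter[of Q] Q tau by simp
  have A16: "16 <= A ^ 4" using power_mono[OF A(1), of 4] by simp
  define p1 where "p1 = - (2 *\<^sub>R (x - x0) + (2 * k1) *\<^sub>R (x - y))"
  define p2 where "p2 = (2 * k1) *\<^sub>R (x - y)"
  have k1pos: "0 < k1" using P Q by (simp add: k1_def)
  have np2: "(norm p2)\<^sup>2 = P\<^sup>2 / (4 * Q)"
  proof -
   have "(norm p2)\<^sup>2 = (2 * k1)\<^sup>2 * Q" unfolding p2_def z_def[symmetric] Q_def by (simp add: power_mult_distrib)
   also have "\<dots> = P\<^sup>2 / (4 * Q)" unfolding k1_def using Q by (simp add: power2_eq_square)
   finally show ?thesis .
  qed
  have PQ: "A ^ 4 / tau <= P / Q"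
  proof -
   have "P ^ 4 <= P" using P by (simp add: power_le_one numeral_eq_Suc mult_left_le_one_le mult_le_one)
   then have "A ^ 4 * Q <= P * tau" unfolding P4[symmetric] using tau by simp
   then show ?thesis using Q tau by (simp add: field_simps)
  qed
  have np2': "2 < norm p2"
  proof -
   have "P\<^sup>2 / (4 * Q) = (P / Q) * P / 4" using Q by (simp add: power2_eq_square)
   have "P ^ 4 * 1 <= P\<^sup>2 * 1" using P by (intro mult_right_mono power_decreasing) auto
   then have "P ^ 4 * tau <= P\<^sup>2 * 1" using tau P by (intro mult_mono) auto
   then have "A ^ 4 * Q <= P\<^sup>2" unfolding P4 by simp
   moreover have A64: "300 * N + 64 <= A ^ 4"
   proof -
    have "c0 * A ^ 4 <= 1 * A ^ 4" using al A by (intro mult_right_mono) (auto simp: c0_def)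
    then show ?thesis using A(2) by (simp add: N_def c0_def)
   qed
   moreover have "64 * Q <= A ^ 4 * Q"
   proof (rule mult_right_mono)
    have "0 <= N" by (simp add: N_def)
    then show "64 <= A ^ 4" using A64 by linarith
   qed (use Q in simp)
   ultimately have "64 * Q <= P\<^sup>2" by linarith
   then have "16 <= (norm p2)\<^sup>2" unfolding np2 using Q by (simp add: pos_le_divide_eq)
   then have "4 <= norm p2" using power2_le_imp_le[of 4 "norm p2"] by simp
   then show ?thesis by simp
  qed
  have p2nz: "p2 \<noteq> 0" using np2' by auto
  have sm: "p1 + p2 = - (2 *\<^sub>R (x - x0))" by (simp add: p1_def p2_def)
  have nsm: "norm (p1 + p2) <= 2" unfolding sm using x(1) by simp
  have p1nz: "p1 \<noteq> 0" using np2' nsm by auto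
  have pk: "peano2 pf ((norm (x - y))\<^sup>2) k1 k2"
   using peano2_root[OF Q, of c] by (simp add: pf_def k1_def k2_def P_def Q_def z_def)
  have pg: "peano2 g t (- 4 / tau + iot / (tau - t)\<^sup>2) (2 * iot / (tau - t)^3)"
   unfolding g_def by (rule peano2_penalty) (use ts io in simp)
  define e where "e = sgn z"
  have e1: "norm e = 1" using z0 by (simp add: e_def norm_sgn)
  have Kb: "rform k1 k2 (x - y) u <= (2 * k1) * (norm u)\<^sup>2" for u
   using P Q by (simp add: rform_def k2_def mult_nonpos_nonneg)
  have Ze: "rform k1 k2 (x - y) e = - (P / (4 * Q))"
  proof -
   have "(z \<bullet> e)\<^sup>2 = Q" unfolding e_def Q_def by (rule sgn_inner_self) (use e1 e_def in simp)
   then show ?thesis unfolding rform_def z_def[symmetric] e1 using Q by (simp add: k1_def k2_def power2_eq_square field_simps)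
  qed
  have "- 4 / tau + iot / (tau - t)\<^sup>2 <= (\<Sum>k\<in>UNIV. rform k1 k2 (x - y) (cpl alpha 0 k p1 - cpl alpha e k p2)) + 2 * (alpha * CARD('n) + (1 - 2 * alpha))"
  proof (rule pair_sums[OF al coupl_cpl[OF al] coupl_cpl[OF al] R(1) ep _ _ _ _ pk pg lm p1_def p2_def p1nz p2nz])
   show "continuous_on (cball x R \<times> {t - R..t + R}) v" by (rule continuous_on_subset[OF cv]) (use R ts tau in auto)
   show "continuous_on (cball y R \<times> {s + eta - R..s + eta + R}) v" by (rule continuous_on_subset[OF cv]) (use R ts tau et in auto)
   show "super_at alpha v (x + xi) (t + h)" if "norm xi < R" "\<bar>h\<bar> < R" for xi h by (rule sup) (use that R ts tau in auto)
   show "super_at alpha v (y + xi) (s + eta + h)" if "norm xi < R" "\<bar>h\<bar> < R" for xi h by (rule sup) (use that R ts tau et in auto)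
  qed (use e1 in auto)
  also have "\<dots> <= 4 * c0 * rform k1 k2 (x - y) e + N * (2 * k1 * (4 * norm (p1 + p2) / norm p2)\<^sup>2) + 2 * (N + 1)"
   using cpl_gain[OF al isqf_rform Kb _ p1nz p2nz, of e] k1pos e1 trace_le[OF al, where 'n = 'n] by (simp add: N_def c0_def)
  also have "4 * c0 * rform k1 k2 (x - y) e = - c0 * (P / Q)" unfolding Ze by simp
  also have "2 * k1 * (4 * norm (p1 + p2) / norm p2)\<^sup>2 <= 2 * k1 * (64 * (4 * Q / P\<^sup>2))"
  proof -
   have "(4 * norm (p1 + p2) / norm p2)\<^sup>2 <= (8 / norm p2)\<^sup>2"
    using nsm by (intro power_mono divide_right_mono) auto
   also have "\<dots> = 64 / (norm p2)\<^sup>2" by (simp add: power_divide)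
   also have "\<dots> = 64 * (4 * Q / P\<^sup>2)" unfolding np2 using P Q by simp
   finally have zz: "(4 * norm (p1 + p2) / norm p2)\<^sup>2 <= 64 * (4 * Q / P\<^sup>2)" .
   show ?thesis by (rule mult_left_mono[OF zz]) (use k1pos in simp)
  qed
  also have "2 * k1 * (64 * (4 * Q / P\<^sup>2)) = 128 / P" using P Q by (simp add: k1_def power2_eq_square)
  finally have fin: "- 4 / tau + iot / (tau - t)\<^sup>2 <= - c0 * (P / Q) + N * (128 / P) + 2 * (N + 1)"
   by (smt (verit) N_def mult_left_mono of_nat_0_le_iff)
  have A4: "300 * N + 64 <= c0 * A ^ 4" using A(2) by (simp add: N_def c0_def)
  have N0: "0 <= N" by (simp add: N_def)
  have iP: "1 / P <= (P / Q) / A ^ 4"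
  proof -
   have "A ^ 4 * Q <= P ^ 2"
   proof -
    have "P ^ 4 * 1 <= P\<^sup>2 * 1" using P by (intro mult_right_mono power_decreasing) auto
    then have "P ^ 4 * tau <= P\<^sup>2 * 1" using tau P by (intro mult_mono) auto
    then show ?thesis unfolding P4 by simp
   qed
   then have "P / P\<^sup>2 <= P / (A ^ 4 * Q)" 
   proof (intro divide_left_mono)
    have "0 < A ^ 4" using A16 by linarith
    then show "0 < P\<^sup>2 * (A ^ 4 * Q)" using P Q by simp
   qed (use P in auto)
   moreover have "P / P\<^sup>2 = 1 / P" by (simp add: power2_eq_square)
   moreover have "P / (A ^ 4 * Q) = (P / Q) / A ^ 4" by (simp add: mult.commute)
   ultimately show ?thesis by simp
  qed
  have "N * (128 / P) <= (c0 / 2) * (P / Q)"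
  proof -
   have "N * (128 / P) = (128 * N) * (1 / P)" by simp
   also have "\<dots> <= (c0 / 2 * A ^ 4) * ((P / Q) / A ^ 4)" 
   proof (rule mult_mono[OF _ iP])
    show "128 * N <= c0 / 2 * A ^ 4" using A4 N0 by simp
    show "0 <= c0 / 2 * A ^ 4" using c00 A16 by simp
   qed (use P in simp)
   also have "\<dots> = (c0 / 2) * (P / Q)"
   proof -
    have "A ^ 4 \<noteq> 0" using A16 by linarith
    then have "a * A ^ 4 * (b / A ^ 4) = a * b" for a b :: real by simp
    then show ?thesis .
   qed
   finally show ?thesis .
  qed
  then have "- 4 / tau + iot / (tau - t)\<^sup>2 <= - (c0 / 2) * (P / Q) + 2 * (N + 1)" using fin by (simp add: algebra_simps)
  also have "\<dots> <= - (c0 / 2) * (A ^ 4 / tau) + 2 * (N + 1)"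
  proof -
   have "(c0 / 2) * (A ^ 4 / tau) <= (c0 / 2) * (P / Q)" by (rule mult_left_mono[OF PQ]) (use c00 in simp)
   then show ?thesis by (simp only: mult_minus_left)
  qed
  finally have F: "- 4 / tau + iot / (tau - t)\<^sup>2 <= - (c0 / 2) * (A ^ 4 / tau) + 2 * (N + 1)" .
  have "0 <= iot / (tau - t)\<^sup>2" using io(1) by simp
  then have F2: "- 4 / tau <= - (c0 / 2) * (A ^ 4 / tau) + 2 * (N + 1)" using F by linarith
  have "- 4 / tau * tau <= (- (c0 / 2) * (A ^ 4 / tau) + 2 * (N + 1)) * tau" by (rule mult_right_mono[OF F2]) (use tau in simp)
  moreover have "- 4 / tau * tau = - 4" using tau by simp
  moreover have "(- (c0 / 2) * (A ^ 4 / tau) + 2 * (N + 1)) * tau = - (c0 / 2) * A ^ 4 + 2 * (N + 1) * tau"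
  proof -
   have "(- c * (a / tau) + b) * tau = - c * a + b * tau" for a b c :: real
    using tau by (simp add: left_diff_distrib)
   then show ?thesis .
  qed
  ultimately have "- 4 <= - (c0 / 2) * A ^ 4 + 2 * (N + 1) * tau" by simp
  moreover have "2 * (N + 1) * tau <= 2 * (N + 1) * 1" using tau N0 by (intro mult_left_mono) auto
  moreover have "- (c0 / 2) * A ^ 4 = - (c0 * A ^ 4) / 2" by simp
  ultimately have "- 4 <= - (c0 * A ^ 4) / 2 + 2 * (N + 1)" by linarith
  then show False using A4 N0 by (simp add: field_simps)
 qed
qed

lemma eighth_power_bound:
 fixes A y :: real
 assumes "1 <= A" "0 <= y" shows "A * y <= y ^ 8 / 16 + 16 * A\<^sup>2"
proof (cases "y <= 16 * A")
 case True
 have "A * y <= A * (16 * A)" using True assms by (intro mult_left_mono) auto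
 moreover have "A * (16 * A) = 16 * A\<^sup>2" by (simp add: power2_eq_square)
 moreover have "0 <= y ^ 8 / 16" using assms(2) by simp
 ultimately show ?thesis by linarith
next
 case False
 have y1: "1 <= y" using False assms by simp
 have "y * y <= y ^ 8" using power_increasing[OF _ y1, of 2 8] by (simp add: power2_eq_square)
 moreover have "16 * A * y <= y * y" using False assms by (intro mult_right_mono) auto
 moreover have "0 <= 16 * A\<^sup>2" by simp
 ultimately show ?thesis by linarith
qed

text \<open>
 With \<open>tau = sg^10\<close> the kernel \<open>sg^(-27) |x - y|^4 / 16\<close> dominates the Hoelder profile up to \<open>16 A\<^sup>2 sg\<close>, and the synchronous coupling keeps
 the error produced during a time \<open>tau\<close> of order \<open>sg^(-9) tau = sg\<close>.  The exponents balance the two errors.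
\<close>

lemma sync_step:
 fixes v :: "(real^'n) \<times> real => real"
 assumes al: "0 < alpha" "alpha < 1" and cv: "continuous_on (UNIV \<times> {0<..}) v" and bd: "\<And>x t. 0 < t ==> -1 <= v (x, t)"
  and sup: "\<And>x t. 0 < t ==> super_at alpha v x t" and et: "0 <= eta" and E: "0 <= E"
  and A: "2 <= A" and sg: "0 < sg" "sg <= 1/2" and tau: "tau = sg ^ 10"
  and start: "\<And>x y. -1 <= v (x, tau) + v (y, tau + eta) + (norm (x - x0))\<^sup>2 + E + A * tau powr (-1/4) * ((norm (x - y))\<^sup>2) powr (1/4)"
 shows "-1 <= v (x, 2 * tau) + v (x, 2 * tau + eta) + (norm (x - x0))\<^sup>2 + E + 16 * A\<^sup>2 * sg + 40 * (real CARD('n) + 1) * sg"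
proof (rule ccontr)
 define Lam where "Lam = 1 / sg ^ 9"
 define N where "N = real CARD('n)"
 define L1 where "L1 = 40 * (N + 1) * Lam"
 define E1 where "E1 = E + 16 * A\<^sup>2 * sg"
 have N0: "0 <= N" by (simp add: N_def)
 have taup: "0 < tau" using sg tau by simp
 have L: "1 <= Lam" unfolding Lam_def using sg by (simp add: power_le_one)
 have L1t: "L1 * tau = 40 * (N + 1) * sg" unfolding L1_def Lam_def tau using sg by (simp add: numeral_eq_Suc)
 have L10: "0 <= L1" using L N0 by (simp add: L1_def)
 have E10: "0 <= E1" using E sg by (simp add: E1_def)
 define pf where "pf = (\<lambda>Q :: real. Lam ^ 3 * Q\<^sup>2 / 16)"
 define f where "f = (\<lambda>t. v (x, t) + v (x, t + eta) + (norm (x - x0))\<^sup>2 + (E1 + L1 * (t - tau)))"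
 assume "\<not> ?thesis"
 then have ft: "f (2 * tau) < -1" using L1t by (simp add: f_def E1_def N_def)
 have cf: "continuous_on {tau..2 * tau} f" unfolding f_def
  by (intro continuous_intros continuous_on_compose2[OF cv]) (use taup et in auto)
 obtain iot t' t1 where io: "0 < iot" "tau < t'" "t' < t1" "t1 < 2 * tau" "f t' + iot / (2 * tau - t') < -1" "1 <= iot / (2 * tau - t1)"
  using left_penalty[OF cf _ ft] taup by auto
 define g where "g = (\<lambda>t. E1 + L1 * (t - tau) + iot / (2 * tau - t))"
 have gg: "0 <= L1 * (t - tau)" "0 <= iot / (2 * tau - t)" if "t \<in> {tau..t1}" for t using that io L10 by auto
 have L3: "16 <= Lam ^ 3"
 proof -
  have "sg ^ 9 <= (1/2) ^ 9" using sg by (intro power_mono) auto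
  then have "512 <= Lam" unfolding Lam_def using sg by (simp add: pos_le_divide_eq power_divide)
  moreover have "Lam <= Lam ^ 3" using L by (simp add: self_le_power)
  ultimately show ?thesis by linarith
 qed
 have st: "-1 <= v (x, tau) + v (y, tau + eta) + (norm (x - x0))\<^sup>2 + pf ((norm (x - y))\<^sup>2) + E1" for x y
 proof -
  define Q where "Q = (norm (x - y))\<^sup>2"
  define w where "w = tau powr (-1/4) * Q powr (1/4)"
  define u where "u = w / sg"
  have Q0: "0 <= Q" by (simp add: Q_def)
  have w4: "w ^ 4 = Q / tau"
  proof -
   have "(tau powr (-1/4)) ^ 4 = inverse tau" by (rule powr_neg_quarter[OF taup])
   then show ?thesis unfolding w_def power_mult_distrib powr_quarter[OF Q0] by (simp only: divide_inverse[of Q] mult.commute)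
  qed
  have w8: "w ^ 8 = Q\<^sup>2 / tau\<^sup>2" using arg_cong[OF w4, of "\<lambda>a. a\<^sup>2"] by (simp add: power_divide flip: power_mult)
  have u0: "0 <= u" using sg by (simp add: u_def w_def)
  have "u ^ 8 * sg = Q\<^sup>2 * Lam ^ 3"
   unfolding u_def power_divide w8 tau Lam_def using sg by (simp add: field_simps flip: power_mult power_add power_Suc)
  then have "sg * (u ^ 8 / 16 + 16 * A\<^sup>2) = pf Q + 16 * A\<^sup>2 * sg" by (simp add: pf_def algebra_simps)
  moreover have "sg * (A * u) <= sg * (u ^ 8 / 16 + 16 * A\<^sup>2)" using eighth_power_bound[OF _ u0, of A] A sg by (intro mult_left_mono) auto
  moreover have "sg * (A * u) = A * w" using sg by (simp add: u_def)
  ultimately have "A * w <= pf Q + 16 * A\<^sup>2 * sg" by simp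
  then show ?thesis using start[of x y] unfolding Q_def[symmetric] E1_def w_def by (simp add: mult.assoc)
 qed
 have t1: "tau <= t1" using io by simp
 show False
 proof (rule pair_min[OF cv bd taup t1 et, where pf = pf and g = g and D = "\<lambda>x y. False" and ?s1.0 = t' and ?x1.0 = x and ?y1.0 = x and ?x0.0 = x0])
  show "continuous_on {0..} pf" unfolding pf_def by (intro continuous_intros) auto
  show "continuous_on {tau..t1} g" unfolding g_def using io by (intro continuous_intros) auto
  show "0 <= g t" if "t \<in> {tau..t1}" for t using gg[OF that] E10 unfolding g_def by simp
  show "0 <= pf Q" if "0 <= Q" for Q using L by (simp add: pf_def)
  show "1 <= pf Q" if "1 <= Q" for Q
  proof -
   have "1 <= Q\<^sup>2" using that by simp
   then have "16 * 1 <= Lam ^ 3 * Q\<^sup>2" using L3 L by (intro mult_mono) auto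
   then show ?thesis by (simp add: pf_def)
  qed
  show "t' \<in> {tau..t1}" using io by simp
  show "v (x, t') + v (x, t' + eta) + (norm (x - x0))\<^sup>2 + pf ((norm (x - x))\<^sup>2) + g t' < -1"
   using io(5) by (simp add: f_def g_def pf_def)
  show "-1 <= v (x, t) + v (y, t + eta) + (norm (x - x0))\<^sup>2 + pf ((norm (x - y))\<^sup>2) + g t"
   if t: "t \<in> {tau..t1}" and c: "t = tau \<or> t = t1 \<or> False" for x y t
  proof -
   have b: "-1 <= v (x, t)" "-1 <= v (y, t + eta)" "0 <= (norm (x - x0))\<^sup>2" "0 <= pf ((norm (x - y))\<^sup>2)"
    using bd t taup et L by (auto simp: pf_def)
   show ?thesis
   proof (cases "t = t1")
    case True
    have "1 <= iot / (2 * tau - t)" using io(6) True by simp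
    then show ?thesis using b gg(1)[OF t] E10 unfolding g_def by linarith
   next
    case False
    then have "t = tau" using c by simp
    then show ?thesis using st[of x y] gg[OF t] unfolding g_def by simp
   qed
  qed
 next
  fix x y t s eps R
  assume ep: "0 < eps" and R: "0 < R" "R <= tau / 2" and ts: "tau < t" "t < t1" "tau < s" "s < t1"
   and x: "norm (x - x0) < 1"
   and lm: "\<And>xi xi' h h'. norm xi <= R ==> norm xi' <= R ==> \<bar>h\<bar> <= R ==> \<bar>h'\<bar> <= R ==>
    v (x, t) + v (y, s + eta) + (norm (x - x0))\<^sup>2 + pf ((norm (x - y))\<^sup>2) + g t + (t - (s + eta) + eta)\<^sup>2 / (2 * eps)
    <= v (x + xi, t + h) + v (y + xi', s + eta + h') + (norm (x + xi - x0))\<^sup>2 + pf ((norm (x + xi - (y + xi')))\<^sup>2) + g (t + h) + (t + h - (s + eta + h') + eta)\<^sup>2 / (2 * eps)"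
  define z where "z = x - y"
  define Q where "Q = (norm z)\<^sup>2"
  define k1 where "k1 = Lam ^ 3 * Q / 8"
  define k2 where "k2 = Lam ^ 3 / 8"
  define M where "M = 3 / 4 * (Lam ^ 3 * Q)"
  define q where "q = Lam * norm z"
  have q0: "0 <= q" using L by (simp add: q_def)
  have Lp: "0 < Lam" using L by simp
  have Q0: "0 <= Q" by (simp add: Q_def)
  have M0: "0 <= M" using Lp Q0 by (simp add: M_def)
  have rb: "0 <= rform k1 k2 (x - y) u" "rform k1 k2 (x - y) u <= M * (norm u)\<^sup>2" for u
  proof -
   show "0 <= rform k1 k2 (x - y) u" using Lp Q0 by (simp add: rform_def k1_def k2_def)
   have "\<bar>z \<bullet> u\<bar>\<^sup>2 <= (norm z * norm u)\<^sup>2" by (intro power_mono Cauchy_Schwarz_ineq2) auto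
   then have "(z \<bullet> u)\<^sup>2 <= Q * (norm u)\<^sup>2" by (simp add: Q_def power_mult_distrib)
   then have "Lam ^ 3 / 2 * (z \<bullet> u)\<^sup>2 <= Lam ^ 3 / 2 * (Q * (norm u)\<^sup>2)" using Lp by (intro mult_left_mono) auto
   then show "rform k1 k2 (x - y) u <= M * (norm u)\<^sup>2" unfolding rform_def z_def[symmetric] by (simp add: k1_def k2_def M_def algebra_simps)
  qed
  define p1 where "p1 = - (2 *\<^sub>R (x - x0) + (2 * k1) *\<^sub>R (x - y))"
  define p2 where "p2 = (2 * k1) *\<^sub>R (x - y)"
  have np2: "norm p2 = q ^ 3 / 4"
   unfolding p2_def z_def[symmetric] using Lp Q0 by (simp add: k1_def q_def Q_def power_mult_distrib power2_eq_square power3_eq_cube)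
  have pk: "peano2 pf ((norm (x - y))\<^sup>2) k1 k2"
  proof -
   have "peano2 pf Q (Lam ^ 3 * Q / 8) k2"
   proof (rule peano2I[of 1 _ _ "\<lambda>Q. Lam ^ 3 * Q / 8"])
    show "(pf has_real_derivative Lam ^ 3 * Q / 8) (at Q)" for Q unfolding pf_def by (auto intro!: derivative_eq_intros)
    show "((\<lambda>Q. Lam ^ 3 * Q / 8) has_real_derivative k2) (at Q)" by (auto intro!: derivative_eq_intros simp: k2_def)
   qed simp
   then show ?thesis by (simp add: k1_def Q_def z_def)
  qed
  have pg: "peano2 g t (L1 + iot / (2 * tau - t)\<^sup>2) (2 * iot / (2 * tau - t)^3)"
   unfolding g_def by (rule peano2_penalty) (use ts io in simp)
  have iopos: "0 <= iot / (2 * tau - t)\<^sup>2" using io by simp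
  show False
  proof (cases "q ^ 3 <= 16")
   case True
   have "q <= 3"
   proof (rule ccontr)
    assume "\<not> q <= 3"
    then have "3 ^ 3 < q ^ 3" by (intro power_strict_mono) auto
    then show False using True by simp
   qed
   then have "q\<^sup>2 <= 3\<^sup>2" using q0 by (intro power_mono) auto
   then have "Lam * q\<^sup>2 <= Lam * 9" using Lp by simp
   moreover have "Lam * q\<^sup>2 = Lam ^ 3 * Q" by (simp add: q_def Q_def power_mult_distrib power2_eq_square power3_eq_cube)
   ultimately have "M <= 27 / 4 * Lam" unfolding M_def by linarith
   then have "2 * M + 2 <= 16 * Lam" using L by linarith
   then have "(N + 1) * (2 * M + 2) <= (N + 1) * (16 * Lam)" using N0 by (intro mult_left_mono) auto
   moreover have "L1 + iot / (2 * tau - t)\<^sup>2 <= (N + 1) * (2 * M + 2)" unfolding N_def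
   proof (rule pair_direct[OF _ al(2) R(1) ep _ _ pk pg lm _ M0])
    show "super_at alpha v x t" "super_at alpha v y (s + eta)" using sup ts taup et by auto
    show "\<bar>rform k1 k2 (x - y) u\<bar> <= M * (norm u)\<^sup>2" for u using rb[of u] by simp
   qed (use al in auto)
   moreover have "0 < (N + 1) * Lam" using N0 Lp by simp
   ultimately show False using iopos unfolding L1_def by (simp add: mult.assoc)
  next
   case False
   have q2: "2 <= q"
   proof (rule ccontr)
    assume "\<not> 2 <= q"
    then have "q ^ 3 <= 2 ^ 3" using q0 by (intro power_mono) auto
    then show False using False by simp
   qed
   have np4: "4 < norm p2" unfolding np2 using False by simp
   have p2nz: "p2 \<noteq> 0" using np4 by auto
   have sm: "p1 + p2 = - (2 *\<^sub>R (x - x0))" by (simp add: p1_def p2_def)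
   have nsm: "norm (p1 + p2) <= 2" unfolding sm using x(1) by simp
   have p1nz: "p1 \<noteq> 0" using np4 nsm by auto
   have "L1 + iot / (2 * tau - t)\<^sup>2 <= (\<Sum>k\<in>UNIV. rform k1 k2 (x - y) (cpl alpha 0 k p1 - cpl alpha 0 k p2)) + 2 * (alpha * CARD('n) + (1 - 2 * alpha))"
   proof (rule pair_sums[OF al coupl_cpl[OF al] coupl_cpl[OF al] R(1) ep _ _ _ _ pk pg lm p1_def p2_def p1nz p2nz])
    show "continuous_on (cball x R \<times> {t - R..t + R}) v" by (rule continuous_on_subset[OF cv]) (use R ts taup in auto)
    show "continuous_on (cball y R \<times> {s + eta - R..s + eta + R}) v" by (rule continuous_on_subset[OF cv]) (use R ts taup et in auto)
    show "super_at alpha v (x + xi) (t + h)" if "norm xi < R" "\<bar>h\<bar> < R" for xi h by (rule sup) (use that R ts taup in auto)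
    show "super_at alpha v (y + xi) (s + eta + h)" if "norm xi < R" "\<bar>h\<bar> < R" for xi h by (rule sup) (use that R ts taup et in auto)
   qed auto
   also have "\<dots> <= N * (M * (4 * norm (p1 + p2) / norm p2)\<^sup>2) + 2 * (N + 1)"
    using cpl_gain[OF al isqf_rform rb(2) M0 p1nz p2nz, of 0] trace_le[OF al, where 'n = 'n] by (simp add: N_def rform_def)
   also have "M * (4 * norm (p1 + p2) / norm p2)\<^sup>2 <= 24 * Lam"
   proof -
    have "(4 * norm (p1 + p2) / norm p2)\<^sup>2 <= (8 / norm p2)\<^sup>2"
     using nsm by (intro power_mono divide_right_mono) auto
    also have "\<dots> = 1024 / q ^ 6" unfolding np2 by (simp add: power_divide flip: power_mult)
    finally have "M * (4 * norm (p1 + p2) / norm p2)\<^sup>2 <= M * (1024 / q ^ 6)" using M0 by (rule mult_left_mono)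
    also have "M * (1024 / q ^ 6) = 768 * Lam / q ^ 4"
    proof -
     have "M = 3 / 4 * (Lam * q\<^sup>2)" by (simp add: M_def q_def Q_def power_mult_distrib power2_eq_square power3_eq_cube)
     then have "M * (1024 / q ^ 6) = 768 * Lam * (q\<^sup>2 / q ^ 6)" by simp
     also have "q\<^sup>2 / q ^ 6 = 1 / q ^ 4" using q2 by (simp add: field_simps flip: power_add)
     finally show ?thesis by simp
    qed
    also have "\<dots> <= 768 * Lam / 32"
    proof -
     have "16 * 2 <= q ^ 3 * q" using False q2 by (intro mult_mono) auto
     then have "32 <= q ^ 4" by (simp add: numeral_eq_Suc mult.commute)
     then show ?thesis using Lp by (intro divide_left_mono) auto
    qed
    finally show ?thesis by simp
   qed
   finally have "L1 + iot / (2 * tau - t)\<^sup>2 <= N * (24 * Lam) + 2 * (N + 1)" using N0 by (simp add: mult_left_mono)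
   moreover have "2 * (N + 1) * 1 <= 2 * (N + 1) * Lam" using L N0 by (intro mult_left_mono) auto
   moreover have "0 < Lam" "0 <= N * Lam" using Lp N0 by auto
   ultimately show False using iopos unfolding L1_def by (simp add: algebra_simps)
  qed
 qed
qed

text \<open>
 The errors of the doubling steps add up to a multiple of \<open>t\<close> to the power \<open>1/10\<close>, because \<open>2\<close> to the power \<open>1/10\<close> exceeds \<open>17/16\<close>.
 The time interval depends on the dimension and \<open>alpha\<close> only, which allows the result to be iterated.
\<close>

lemma contraction_fin:
 assumes al: "0 < alpha" "alpha < 1"
 shows "\<exists>Tz>0. \<forall>v :: (real^'n) \<times> real => real. continuous_on (UNIV \<times> {0<..}) v --> (\<forall>x t. 0 < t --> -1 <= v (x, t)) -->
   (\<forall>x t. 0 < t --> super_at alpha v x t) -->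
   (\<forall>x0 eta e. 0 < eta --> 0 < e --> (\<exists>tb>0. \<forall>t x. 0 < t --> t <= tb --> -1 <= v (x, t) + v (x, t + eta) + (norm (x - x0))\<^sup>2 + e)) -->
   (\<forall>x t. 0 < t --> t <= Tz --> -5/8 <= v (x, t))"
proof -
 define N where "N = real CARD('n)"
 define c0 where "c0 = min alpha (1 - alpha)"
 define A where "A = max 2 ((300 * N + 64) / c0)"
 have c0: "0 < c0" using al by (simp add: c0_def)
 have N0: "0 <= N" by (simp add: N_def)
 have A2: "2 <= A" by (simp add: A_def)
 have A4: "300 * N + 64 <= c0 * A ^ 4"
 proof -
  have "(300 * N + 64) / c0 <= A" by (simp add: A_def)
  also have "A <= A ^ 4" using A2 by (simp add: self_le_power)
  finally show ?thesis using c0 by (simp add: pos_divide_le_eq mult.commute)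
 qed
 define C where "C = 16 * (16 * A\<^sup>2 + 40 * (N + 1))"
 have C: "0 < C" using N0 by (simp add: C_def add_nonneg_pos)
 define s0 where "s0 = min (1/2) (1 / (8 * C))"
 have s0: "0 < s0" "s0 <= 1/2" "s0 <= 1 / (8 * C)" using C by (auto simp: s0_def)
 have s0C: "C * s0 <= 1/8" using s0(3) C by (simp add: pos_le_divide_eq mult_ac)
 define Tz where "Tz = s0 ^ 10"
 have Tz: "0 < Tz" using s0 by (simp add: Tz_def)
 have rt: "(x powr (1/10)) ^ 10 = x" if "0 < x" for x :: real using that by (simp add: powr_realpow[symmetric] powr_powr)
 have rts: "x powr (1/10) <= s0" if "0 < x" "x <= Tz" for x
 proof (rule ccontr)
  assume "\<not> x powr (1/10) <= s0"
  then have "s0 ^ 10 < (x powr (1/10)) ^ 10" using s0 by (intro power_strict_mono) auto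
  then show False using that by (simp add: rt Tz_def)
 qed
 have main: "-5/8 <= v (xz, t)"
  if cv: "continuous_on (UNIV \<times> {0<..}) v" and bd: "\<And>x t. 0 < t ==> -1 <= v (x, t)" and sup: "\<And>x t. 0 < t ==> super_at alpha v x t"
   and start: "\<And>x0 eta e. 0 < eta ==> 0 < e ==> \<exists>tb>0. \<forall>t x. 0 < t --> t <= tb --> -1 <= v (x, t) + v (x, t + eta) + (norm (x - x0))\<^sup>2 + e"
   and t: "0 < t" "t <= Tz" for v :: "(real^'n) \<times> real => real" and xz t
 proof -
  have pair: "-1 - 1/4 <= v (xz, t) + v (xz, t + eta)" if et: "0 < eta" for eta
  proof -
   obtain tb where tb: "tb > 0" "\<And>t x. 0 < t ==> t <= tb ==> -1 <= v (x, t) + v (x, t + eta) + (norm (x - xz))\<^sup>2 + 1/8"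
    using start[OF et, of "1/8" xz] by auto
   define Cl where "Cl = (\<lambda>t. \<forall>x. -1 <= v (x, t) + v (x, t + eta) + (norm (x - xz))\<^sup>2 + (1/8 + C * t powr (1/10)))"
   have step: "Cl (2 * tau)" if tau: "0 < tau" "2 * tau <= Tz" and cl: "\<And>t. 0 < t ==> t <= tau ==> Cl t" for tau
   proof -
    define sg where "sg = tau powr (1/10)"
    define E where "E = 1/8 + C * sg"
    have sg: "0 < sg" "sg <= 1/2" using tau rts[of tau] s0(2) by (auto simp: sg_def)
    have s10: "tau = sg ^ 10" using rt[OF tau(1)] by (simp add: sg_def)
    have E0: "0 <= E" using C sg by (simp add: E_def)
    have tau1: "tau <= 1" unfolding s10 using sg by (intro power_le_one) auto
    have diag: "-1 <= v (x, t) + v (x, t + eta) + (norm (x - xz))\<^sup>2 + E" if t: "tau / 2 <= t" "t <= tau" for x t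
    proof -
     have "0 < t" using t tau by linarith
     have "t powr (1/10) <= sg" unfolding sg_def using t \<open>0 < t\<close> by (intro powr_mono2) auto
     then have "C * t powr (1/10) <= C * sg" using C by simp
     then show ?thesis using cl[OF \<open>0 < t\<close> t(2)] unfolding Cl_def E_def by (smt (verit))
    qed
    have il: "-1 <= v (x, tau) + v (y, tau + eta) + (norm (x - xz))\<^sup>2 + E + A * tau powr (-1/4) * ((norm (x - y))\<^sup>2) powr (1/4)" for x y
     by (rule ishii_lions[OF al cv bd sup less_imp_le[OF et] E0 A2 _ tau(1) tau1 diag]) (use A4 in \<open>simp_all add: N_def c0_def\<close>)
    have sy: "-1 <= v (x, 2 * tau) + v (x, 2 * tau + eta) + (norm (x - xz))\<^sup>2 + E + 16 * A\<^sup>2 * sg + 40 * (real CARD('n) + 1) * sg" for x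
     by (rule sync_step[OF al cv bd sup less_imp_le[OF et] E0 A2 sg s10 il])
    have r2: "17/16 * sg <= (2 * tau) powr (1/10)"
    proof (rule ccontr)
     assume "\<not> ?thesis"
     then have "((2 * tau) powr (1/10)) ^ 10 < (17/16 * sg) ^ 10" by (intro power_strict_mono) auto
     moreover have "((2 * tau) powr (1/10)) ^ 10 = 2 * tau" by (rule rt) (use tau in simp)
     moreover have "(17/16 * sg) ^ 10 = (17/16) ^ 10 * tau" by (simp only: power_mult_distrib s10)
     moreover have "(17/16) ^ 10 * tau <= 2 * tau" by (rule mult_right_mono) (use tau in \<open>simp_all add: power_divide\<close>)
     ultimately show False by linarith
    qed
    have "C * (17/16 * sg) <= C * (2 * tau) powr (1/10)" using r2 C by (intro mult_left_mono) auto
    moreover have "C * (17/16 * sg) = C * sg + 16 * A\<^sup>2 * sg + 40 * (real CARD('n) + 1) * sg" by (simp add: C_def N_def algebra_simps)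
    ultimately have le: "E + 16 * A\<^sup>2 * sg + 40 * (real CARD('n) + 1) * sg <= 1/8 + C * (2 * tau) powr (1/10)" unfolding E_def by linarith
    show "Cl (2 * tau)" unfolding Cl_def
    proof
     fix x show "-1 <= v (x, 2 * tau) + v (x, 2 * tau + eta) + (norm (x - xz))\<^sup>2 + (1/8 + C * (2 * tau) powr (1/10))"
      using sy[of x] le by linarith
    qed
   qed
   have ind: "Cl t" if "0 < t" "t <= Tz" "t <= 2 ^ n * tb" for n t
    using that
   proof (induction n arbitrary: t)
    case 0
    show ?case unfolding Cl_def
    proof
     fix x
     have "0 <= C * t powr (1/10)" using C by simp
     then show "-1 <= v (x, t) + v (x, t + eta) + (norm (x - xz))\<^sup>2 + (1/8 + C * t powr (1/10))"
      using tb(2)[of t x] 0 by simp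
    qed
   next
    case (Suc n)
    have "Cl (2 * (t / 2))"
    proof (rule step)
     fix s assume "0 < s" "s <= t / 2"
     then show "Cl s" using Suc.prems by (intro Suc.IH) auto
    qed (use Suc.prems in auto)
    then show ?case by simp
   qed
   obtain n where "Tz / tb < 2 ^ n" using real_arch_pow[of 2 "Tz / tb"] by auto
   then have "Tz <= 2 ^ n * tb" using tb(1) by (simp add: pos_divide_less_eq)
   then have "Cl t" using ind[OF t, of n] t by simp
   then have "-1 <= v (xz, t) + v (xz, t + eta) + (norm (xz - xz))\<^sup>2 + (1/8 + C * t powr (1/10))" unfolding Cl_def by blast
   moreover have "C * t powr (1/10) <= C * s0" using rts[OF t] C by simp
   ultimately show ?thesis using s0C by simp
  qed
  show ?thesis
  proof (rule ccontr)
   assume n: "\<not> -5/8 <= v (xz, t)"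
   define d where "d = -5/4 - 2 * v (xz, t)"
   have d: "0 < d" using n by (simp add: d_def)
   have "continuous_on {t..t+1} (\<lambda>s. v (xz, s))"
    by (rule continuous_on_compose2[OF cv]) (use t in \<open>auto intro!: continuous_intros\<close>)
   then obtain dlt where dl: "dlt > 0" "\<And>s. s \<in> {t..t+1} ==> dist s t < dlt ==> dist (v (xz, s)) (v (xz, t)) < d"
    using d unfolding continuous_on_iff by (metis atLeastAtMost_iff le_add_same_cancel1 order_refl zero_le_one)
   define eta where "eta = min 1 (dlt / 2)"
   have et: "0 < eta" "eta <= 1" "eta < dlt" using dl(1) by (auto simp: eta_def min_def)
   have "dist (v (xz, t + eta)) (v (xz, t)) < d" by (rule dl(2)) (use et in \<open>auto simp: dist_real_def\<close>)
   then have "v (xz, t + eta) - v (xz, t) < d" by (simp add: dist_real_def abs_less_iff)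
   then show False using pair[OF et(1)] unfolding d_def by simp
  qed
 qed
 show ?thesis by (intro exI[of _ Tz] conjI Tz allI impI) (rule main; blast)
qed

section \<open>Radial comparison functions and the lower barrier\<close>

text \<open>
 Jets of functions of \<open>Q = |x - c|\<^sup>2\<close> and \<open>t\<close>: \<open>a\<close>, \<open>g\<close> and \<open>h\<close> are the derivatives in \<open>t\<close>, in \<open>Q\<close> and twice in \<open>Q\<close>.
\<close>

definition rjet :: "((real^'n) \<times> real => real) => real^'n => real^'n => real => real => real => real => bool" where
 "rjet phi c x t a g h \<longleftrightarrow> pjet phi x t a ((2 * g) *\<^sub>R (x - c)) (rform g h (x - c))"

lemma rjet_dist: "rjet (\<lambda>z. (norm (fst z - c))\<^sup>2) c x t 0 1 0"
 unfolding rjet_def by (rule pjet_cong[OF pjet_norm2[of c x t]]) (auto simp: rform_def)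

lemma rjet_const: "rjet (\<lambda>z. k) c x t 0 0 0"
 unfolding rjet_def by (rule pjet_cong[OF pjet_const[of k x t]]) (auto simp: rform_def)

lemma rjet_snd: "rjet (\<lambda>z. snd z) c x t 1 0 0"
 unfolding rjet_def by (rule pjet_cong[OF pjet_snd[of x t]]) (auto simp: rform_def)

lemma rjet_add:
 assumes "rjet f c x t a g h" "rjet f' c x t a' g' h'"
 shows "rjet (\<lambda>z. f z + f' z) c x t (a + a') (g + g') (h + h')"
 unfolding rjet_def by (rule pjet_cong[OF pjet_add[OF assms[unfolded rjet_def]]]) (auto simp: rform_def algebra_simps)

lemma rjet_cmult:
 assumes "rjet f c x t a g h" shows "rjet (\<lambda>z. k * f z) c x t (k * a) (k * g) (k * h)"
 unfolding rjet_def by (rule pjet_cong[OF pjet_cmult[OF assms[unfolded rjet_def], of k]]) (auto simp: rform_def algebra_simps)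

lemma rjet_mult:
 assumes "rjet f c x t a g h" "rjet f' c x t a' g' h'"
 shows "rjet (\<lambda>z. f z * f' z) c x t (f (x, t) * a' + f' (x, t) * a) (f (x, t) * g' + f' (x, t) * g) (f (x, t) * h' + f' (x, t) * h + 2 * g * g')"
proof -
 note m = pjet_mult[OF assms[unfolded rjet_def]]
 have e: "2 * (((2 * g) *\<^sub>R (x - c)) \<bullet> v) * (((2 * g') *\<^sub>R (x - c)) \<bullet> v) = 8 * g * g' * ((x - c) \<bullet> v)\<^sup>2" for v
  by (simp add: power2_eq_square)
 show ?thesis unfolding rjet_def
  by (rule pjet_cong[OF m]) (simp_all only: e rform_def scaleR_left_distrib[symmetric] scaleR_scaleR, simp_all add: algebra_simps)
qed

lemma rjet_comp:
 assumes "rjet f c x t a g h" "peano2 pf (f (x, t)) k1 k2"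
 shows "rjet (\<lambda>z. pf (f z)) c x t (k1 * a) (k1 * g) (k1 * h + k2 * g\<^sup>2)"
proof -
 note m = pjet_comp[OF assms(1)[unfolded rjet_def] assms(2)]
 have e: "(((2 * g) *\<^sub>R (x - c)) \<bullet> v)\<^sup>2 = 4 * g\<^sup>2 * ((x - c) \<bullet> v)\<^sup>2" for v by (simp add: power_mult_distrib)
 show ?thesis unfolding rjet_def
  by (rule pjet_cong[OF m]) (simp_all only: e rform_def, simp_all add: algebra_simps)
qed

lemma rjet_cong:
 assumes "rjet f c x t a g h" "a = a'" "g = g'" "h = h'" "\<And>z. f z = f' z" shows "rjet f' c x t a' g' h'"
 using assms ext[of f f'] by metis

lemma Fq_rform:
 fixes eta z :: "real^'n"
 assumes "eta \<noteq> 0"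
 shows "Fq alpha eta (rform g h z) = 2 * g * (alpha * real CARD('n) + (1 - 2 * alpha)) + 4 * h * (alpha * (norm z)\<^sup>2 + (1 - 2 * alpha) * ((z \<bullet> eta)\<^sup>2 / (norm eta)\<^sup>2))"
proof -
 have "Fq alpha eta (rform g h z) = 2 * g * Fq alpha eta (\<lambda>v. (norm v)\<^sup>2) + 4 * h * Fq alpha eta (\<lambda>v. (z \<bullet> v)\<^sup>2)"
  unfolding rform_def Fq_add Fq_cmult ..
 moreover have "(\<Sum>i\<in>UNIV. (z \<bullet> axis i 1)\<^sup>2) = (norm z)\<^sup>2" using sum_axis_sq[of z] by (simp add: inner_commute)
 ultimately show ?thesis using Fq_norm2[OF assms, of alpha] by (simp add: Fq_def)
qed

text \<open>
 Comparison with a radial subsolution.  At the centre the Hessian is a multiple of the identity, so the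
 vanishing gradient does no harm there; elsewhere the gradient must not vanish.
\<close>

lemma cmp_radial:
 fixes u phi :: "(real^'n) \<times> real => real"
 assumes S: "compact S" and U: "open U" "U \<subseteq> S" and T: "t0 < T"
  and cu: "continuous_on (S \<times> {t0..T}) u" and cp: "continuous_on (S \<times> {t0..T}) phi"
  and sup: "\<And>x t. x \<in> U ==> t0 < t ==> t < T ==> super_at alpha u x t"
  and bd: "\<And>x t. x \<in> S ==> t0 <= t ==> t <= T ==> x \<notin> U \<or> t = t0 ==> phi (x, t) <= u (x, t)"
  and sub: "\<And>x t. x \<in> U ==> t0 < t ==> t < T ==> u (x, t) < phi (x, t) ==>
    \<exists>a g h. rjet phi c x t a g h \<and> a <= 2 * g * (alpha * real CARD('n) + (1 - 2 * alpha)) + 4 * (1 - alpha) * h * (norm (x - c))\<^sup>2 \<and> (x = c \<or> g \<noteq> 0)"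
  and x: "x1 \<in> S" "t0 <= s1" "s1 < T"
 shows "phi (x1, s1) <= u (x1, s1)"
proof (rule ccontr)
 assume n: "\<not> phi (x1, s1) <= u (x1, s1)"
 have s10: "t0 < s1" using bd[of x1 s1] x n by force
 have cW: "continuous_on (S \<times> {t0..T}) (\<lambda>z. u z - phi z)" by (intro continuous_intros cu cp)
 have "bounded ((\<lambda>z. u z - phi z) ` (S \<times> {t0..T}))"
  by (intro compact_imp_bounded compact_continuous_image cW compact_Times S) auto
 then obtain B where B: "\<And>z. z \<in> S \<times> {t0..T} ==> \<bar>u z - phi z\<bar> <= B" unfolding bounded_iff by auto
 define d where "d = phi (x1, s1) - u (x1, s1)"
 have d: "0 < d" using n by (simp add: d_def)
 define iot where "iot = d * (T - s1) / 2"
 have io: "0 < iot" using d x by (simp add: iot_def)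
 define B' where "B' = \<bar>B\<bar> + 2 * d"
 have B': "0 < B'" "B <= B'" using d by (auto simp: B'_def)
 define t1 where "t1 = T - iot / B'"
 have t1: "t1 < T" "s1 < t1"
 proof -
  show "t1 < T" using io B' by (simp add: t1_def)
  have "d <= B'" using d by (simp add: B'_def)
  then have "d * (T - s1) <= B' * (T - s1)" using x by (intro mult_right_mono) auto
  moreover have "0 < B' * (T - s1)" using B' x by simp
  ultimately have "iot < B' * (T - s1)" unfolding iot_def by simp
  then have "iot / B' < T - s1" using B' by (simp add: pos_divide_less_eq mult.commute)
  then show "s1 < t1" by (simp add: t1_def)
 qed
 define W where "W = (\<lambda>z. u z - phi z + iot / (T - snd z))"
 have cWW: "continuous_on (S \<times> {t0..t1}) W" unfolding W_def
  by (intro continuous_intros continuous_on_subset[OF cu] continuous_on_subset[OF cp]) (use t1 in auto)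
 have W1: "W (x1, s1) < 0"
 proof -
  have "iot / (T - s1) = d / 2"
  proof -
   have "b \<noteq> 0 ==> d * b / 2 / b = d / 2" for b :: real by simp
   then show ?thesis unfolding iot_def using x by (metis diff_gt_0_iff_gt less_irrefl)
  qed
  then show ?thesis using d unfolding W_def d_def by simp
 qed
 have bb: "x \<in> U \<and> t0 < t \<and> t < t1" if "x \<in> S" "t0 <= t" "t <= t1" "W (x, t) < 0" for x t
 proof -
  have pen: "0 < iot / (T - t)" using io that t1 by simp
  have lt: "u (x, t) < phi (x, t)" using that(4) pen unfolding W_def by simp
  then have 1: "x \<in> U" "t \<noteq> t0" using bd[of x t] that t1 by force+
  have "t \<noteq> t1"
  proof
   assume "t = t1"
   then have "iot / (T - t) = B'" using io B' by (simp add: t1_def)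
   then show False using that(4) B[of "(x, t)"] that t1 B' unfolding W_def by force
  qed
  then show ?thesis using 1 that by simp
 qed
 have Ui: "U \<subseteq> interior S" using U by (simp add: interior_maximal)
 obtain x t where xt: "x \<in> interior S" "t0 < t" "t <= t1" "W (x, t) < 0"
  and nb: "t < t1 ==> \<exists>dlt>0. \<forall>v s. norm v < dlt --> \<bar>s\<bar> < dlt --> W (x, t) <= W (x + v, t + s)"
 proof (rule cylinder_min[OF cWW S _ x(1,2) _ W1])
  show "t0 <= t1" "s1 <= t1" using t1 s10 by auto
  show "x \<in> interior S \<and> t0 < t" if "x \<in> S" "t0 <= t" "t <= t1" "W (x, t) < 0" for x t using bb[OF that] Ui by auto
 qed (rule that)
 have xU: "x \<in> U" "t < t1" using bb[of x t] xt interior_subset by auto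
 have tT: "t < T" using xU t1 by simp
 have pen: "0 < iot / (T - t)" using io tT by simp
 have lt: "u (x, t) < phi (x, t)" using xt(4) pen unfolding W_def by simp
 obtain a g h where j: "rjet phi c x t a g h" and le: "a <= 2 * g * (alpha * real CARD('n) + (1 - 2 * alpha)) + 4 * (1 - alpha) * h * (norm (x - c))\<^sup>2"
  and nz: "x = c \<or> g \<noteq> 0" using sub[OF xU(1) xt(2) tT lt] by blast
 define ib where "ib = iot / (T - t)\<^sup>2"
 have ib: "0 < ib" using io tT by (simp add: ib_def)
 have jj: "pjet (\<lambda>z. phi z + - (iot / (T - snd z))) x t (a - ib) ((2 * g) *\<^sub>R (x - c)) (rform g h (x - c))"
  by (rule pjet_cong[OF pjet_add[OF j[unfolded rjet_def] pjet_minus[OF pjet_inverse_time[OF tT, of iot x]]]]) (auto simp: ib_def)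
 have touch: "\<exists>dlt>0. \<forall>v s. norm v < dlt --> \<bar>s\<bar> < dlt -->
   u (x, t) - (phi (x, t) + - (iot / (T - snd (x, t)))) <= u (x + v, t + s) - (phi (x + v, t + s) + - (iot / (T - snd (x + v, t + s))))"
  using nb[OF xU(2)] unfolding W_def by (simp add: algebra_simps)
 have su: "super_at alpha u x t" by (rule sup) (use xU xt tT in auto)
 have sm: "m <= a - ib" if "\<exists>rho>0. \<forall>eta. eta \<noteq> 0 --> norm (eta - (2 * g) *\<^sub>R (x - c)) < rho --> m <= Fq alpha eta (rform g h (x - c))" for m
  using su jj isqf_rform touch that unfolding super_at_def by blast
 show False
 proof (cases "x = c")
  case True
  have "a <= a - ib"
  proof (rule sm, intro exI[of _ 1] conjI allI impI)
   fix eta :: "real^'n" assume "eta \<noteq> 0"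
   from Fq_rform[OF this, of alpha g h "x - c"] show "a <= Fq alpha eta (rform g h (x - c))" using le True by simp
  qed simp
  then show False using ib by simp
 next
  case False
  define xi where "xi = (2 * g) *\<^sub>R (x - c)"
  have g0: "g \<noteq> 0" using nz False by simp
  have xi0: "xi \<noteq> 0" using g0 False by (simp add: xi_def)
  have r: "((x - c) \<bullet> xi)\<^sup>2 / (norm xi)\<^sup>2 = (norm (x - c))\<^sup>2"
  proof -
   have "(x - c) \<bullet> xi = (2 * g) * (norm (x - c))\<^sup>2" by (simp add: xi_def power2_norm_eq_inner)
   moreover have "(norm xi)\<^sup>2 = (2 * g)\<^sup>2 * (norm (x - c))\<^sup>2" by (simp add: xi_def power_mult_distrib)
   ultimately show ?thesis using g0 False by (simp add: power2_eq_square)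
  qed
  have "Fq alpha xi (rform g h (x - c)) <= a - ib"
   by (rule super_at_Fq[OF su jj[folded xi_def] isqf_rform xi0 touch])
  moreover have "a <= Fq alpha xi (rform g h (x - c))"
   unfolding Fq_rform[OF xi0] r using le by (simp add: algebra_simps)
  ultimately show False using ib by simp
 qed
qed

lemma rjet_time:
 assumes "peano2 pf t k1 k2" shows "rjet (\<lambda>z. pf (snd z)) c x t k1 0 0"
 by (rule rjet_cong[OF rjet_comp[OF rjet_snd]]) (use assms in auto)

lemma peano2_inverse_shift:
 assumes "b < t" shows "\<exists>k2. peano2 (\<lambda>t. k / (t - b)) t (- (k / (t - b)\<^sup>2)) k2"
proof (intro exI peano2I[of "t - b" _ _ "\<lambda>t. - (k / (t - b)\<^sup>2)"])
 show "((\<lambda>t. k / (t - b)) has_real_derivative - (k / (z - b)\<^sup>2)) (at z)" if "\<bar>z - t\<bar> < t - b" for z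
  using that by (auto intro!: derivative_eq_intros simp: power2_eq_square)
 have "((\<lambda>t. - (k / (t - b)\<^sup>2)) has_real_derivative - ((0 * (t - b)\<^sup>2 - k * (2 * (t - b))) / ((t - b)\<^sup>2 * (t - b)\<^sup>2))) (at t)"
  using assms by (intro DERIV_minus DERIV_divide DERIV_const) (auto intro!: derivative_eq_intros)
 then show "((\<lambda>t. - (k / (t - b)\<^sup>2)) has_real_derivative - ((0 * (t - b)\<^sup>2 - k * (2 * (t - b))) / ((t - b)\<^sup>2 * (t - b)\<^sup>2))) (at t)" .
qed (use assms in simp)

lemma peano2_inverse_c:
 assumes "0 < t" shows "\<exists>k2. peano2 (\<lambda>t. k / t) t (- (k / t\<^sup>2)) k2"
 using peano2_inverse_shift[OF assms, of k] by simp

lemma peano2_inverse_square: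
 assumes "0 < t" shows "\<exists>k2. peano2 (\<lambda>t. k / t\<^sup>2) t (- 2 * k / t ^ 3) k2"
proof (intro exI peano2I[of t _ _ "\<lambda>t. - 2 * k / t ^ 3"])
 show "((\<lambda>t. k / t\<^sup>2) has_real_derivative - 2 * k / z ^ 3) (at z)" if "\<bar>z - t\<bar> < t" for z
 proof -
  have z: "z \<noteq> 0" using that assms by auto
  have "((\<lambda>t. k / t\<^sup>2) has_real_derivative (0 * z\<^sup>2 - k * (2 * z)) / (z\<^sup>2 * z\<^sup>2)) (at z)"
   using z by (intro DERIV_divide DERIV_const) (auto intro!: derivative_eq_intros)
  moreover have "(0 * z\<^sup>2 - k * (2 * z)) / (z\<^sup>2 * z\<^sup>2) = - 2 * k / z ^ 3" using z by (simp add: field_simps power2_eq_square power3_eq_cube)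
  ultimately show ?thesis by simp
 qed
 show "((\<lambda>t. - 2 * k / t ^ 3) has_real_derivative (0 * t ^ 3 - (- 2 * k) * (3 * t\<^sup>2)) / (t ^ 3 * t ^ 3)) (at t)"
  using assms by (intro DERIV_divide DERIV_const) (auto intro!: derivative_eq_intros)
qed (use assms in simp)

lemma peano2_ln: "0 < t ==> peano2 ln t (1 / t) (- 1 / t\<^sup>2)"
 by (rule peano2I[of t _ _ "\<lambda>t. 1 / t"]) (auto intro!: derivative_eq_intros simp: power2_eq_square divide_simps)

text \<open>
 The kernel with exponent \<open>k = n / 2\<close>, written as an exponential so that real exponents cause no trouble.
\<close>

lemma rjet_gauss:
 assumes t: "0 < t" and kp: "0 < kappa"
 shows "rjet (\<lambda>z. exp (- k * ln (snd z) - (norm (fst z - c))\<^sup>2 / (4 * kappa * snd z))) c x t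
  (exp (- k * ln t - (norm (x - c))\<^sup>2 / (4 * kappa * t)) * (- k / t + (norm (x - c))\<^sup>2 / (4 * kappa * t\<^sup>2)))
  (- (exp (- k * ln t - (norm (x - c))\<^sup>2 / (4 * kappa * t)) / (4 * kappa * t)))
  (exp (- k * ln t - (norm (x - c))\<^sup>2 / (4 * kappa * t)) / (4 * kappa * t)\<^sup>2)"
proof -
 obtain k2 where i: "peano2 (\<lambda>t. (1 / (4 * kappa)) / t) t (- ((1 / (4 * kappa)) / t\<^sup>2)) k2" using peano2_inverse_c[OF t] by blast
 note j = rjet_add[OF rjet_cmult[OF rjet_time[OF peano2_ln[OF t]], of "- k"] rjet_cmult[OF rjet_mult[OF rjet_dist[of c x t] rjet_time[OF i]], of "-1"]]
 show ?thesis
  by (rule rjet_cong[OF rjet_comp[OF j peano2_exp]]) (use kp t in \<open>auto simp: power2_eq_square field_simps\<close>)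
qed

lemma power_exp_bound:
 fixes k u :: real assumes "0 < k" "0 < u" shows "k * ln u - u <= k * ln k"
proof -
 have "ln (u / k) <= u / k - 1" using assms by (intro ln_le_minus_one) simp
 then have "ln u - ln k <= u / k - 1" using assms by (simp add: ln_div)
 then have "k * (ln u - ln k) <= k * (u / k - 1)" using assms by (intro mult_left_mono) auto
 also have "k * (u / k - 1) = u - k" using assms by (simp add: right_diff_distrib)
 finally show ?thesis using assms by (simp add: right_diff_distrib)
qed

text \<open>
 The factor of the kernel is chosen so that its maximum over all times at distance \<open>dlt\<close> is at most the lower bound
 of the boundary data; the penalty makes it nonpositive initially and far away.
\<close>

lemma exterior_lower:
 fixes w :: "(real^'n) \<times> real => real"
 assumes al: "0 <= alpha" "alpha < 1" and O: "open Om" and T: "0 < T"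
  and cw: "continuous_on (closure Om \<times> {0<..}) w"
  and sup: "\<And>x t. x \<in> Om ==> 0 < t ==> super_at alpha w x t"
  and pos: "\<And>x t. x \<in> closure Om ==> 0 < t ==> t < T ==> 0 <= w (x, t)"
  and bl: "\<And>x t. x \<in> frontier Om ==> 0 < t ==> hl <= w (x, t)" and hl: "0 < hl"
  and z: "0 < dlt" "\<And>x. x \<in> closure Om ==> dlt <= norm (x - z)"
  and k: "2 * (1 - alpha) * k = alpha * real CARD('n) + (1 - 2 * alpha)"
  and x: "x \<in> closure Om" "0 < t" "t < T"
 shows "hl * exp (- k * ln (4 * (1 - alpha) * k / dlt\<^sup>2) - k * ln t - (norm (x - z))\<^sup>2 / (4 * (1 - alpha) * t)) <= w (x, t)"
proof (rule field_le_epsilon)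
 fix e0 :: real assume e0: "0 < e0"
 define kappa where "kappa = 1 - alpha"
 have kp: "0 < kappa" using al by (simp add: kappa_def)
 have N1: "1 <= real CARD('n)" by (simp add: Suc_le_eq)
 have k2: "2 * kappa * k = alpha * real CARD('n) + (1 - 2 * alpha)" using k by (simp add: kappa_def)
 have kpos: "0 < k"
 proof -
  have "alpha * 1 <= alpha * real CARD('n)" using N1 al by (intro mult_left_mono) auto
  then have "0 < 2 * kappa * k" unfolding k2 using al by linarith
  then show ?thesis using kp by (simp add: zero_less_mult_iff)
 qed
 define D where "D = dlt\<^sup>2 / (4 * kappa)"
 have D: "0 < D" using z kp by (simp add: D_def)
 define c where "c = hl * exp (- k * ln (k / D))"
 have c: "0 < c" using hl by (simp add: c_def)
 define f where "f = (\<lambda>y. exp (- k * ln (snd y) - (norm (fst y - z))\<^sup>2 / (4 * kappa * snd y)))"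
 have fle: "c * f (y, s) <= hl" if "y \<in> closure Om" "0 < s" for y s
 proof -
  have "dlt\<^sup>2 <= (norm (y - z))\<^sup>2" using z(2)[OF that(1)] z(1) by (intro power_mono) auto
  then have "D / s <= (norm (y - z))\<^sup>2 / (4 * kappa * s)" unfolding D_def using kp that(2) by (simp add: divide_right_mono)
  moreover have "k * ln (D / s) - D / s <= k * ln k" by (rule power_exp_bound[OF kpos]) (use D that in simp)
  moreover have "k * ln (D / s) = k * ln D - k * ln s" using D that(2) by (simp add: ln_div right_diff_distrib)
  moreover have "- k * ln (k / D) = k * ln D - k * ln k" using D kpos by (simp add: ln_div right_diff_distrib)
  moreover have "a <= b ==> c - a <= d ==> c = e - f ==> g = e - d ==> g + (- f - b) <= 0" for a b c d e f g :: real by linarith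
  ultimately have "- k * ln (k / D) + (- (k * ln s) - (norm (y - z))\<^sup>2 / (4 * kappa * s)) <= 0" by blast
  then have "- k * ln (k / D) + (- k * ln s - (norm (y - z))\<^sup>2 / (4 * kappa * s)) <= 0" by simp
  then have "exp (- k * ln (k / D)) * exp (- k * ln s - (norm (y - z))\<^sup>2 / (4 * kappa * s)) <= 1"
   unfolding exp_add[symmetric] by simp
  then show ?thesis unfolding c_def f_def fst_conv snd_conv using hl by (simp add: mult.assoc mult_le_cancel_left2)
 qed
 define B where "B = 4 * kappa * k"
 have B0: "0 < B" using kp kpos by (simp add: B_def)
 define eps where "eps = e0 / ((norm (x - z))\<^sup>2 + 1 + B * t)"
 have den: "0 < (norm (x - z))\<^sup>2 + 1 + B * t" using B0 x by (intro add_nonneg_pos add_pos_nonneg) (auto simp: add_nonneg_pos)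
 have ep: "0 < eps" using e0 den by (simp add: eps_def)
 define R where "R = norm (x - z) + sqrt (hl / eps) + 1"
 have R: "hl <= eps * R\<^sup>2" "norm (x - z) < R"
 proof -
  have "sqrt (hl / eps) <= R" by (simp add: R_def)
  then have "(sqrt (hl / eps))\<^sup>2 <= R\<^sup>2" using hl ep by (intro power_mono) auto
  then have "hl / eps <= R\<^sup>2" using hl ep by simp
  then show "hl <= eps * R\<^sup>2" using ep by (simp add: pos_divide_le_eq mult.commute)
  have "0 <= sqrt (hl / eps)" using hl ep by simp
  then show "norm (x - z) < R" unfolding R_def by linarith
 qed
 \<comment> \<open>start at a time at which the kernel is below the penalty\<close>
 have "\<exists>t0. 0 < t0 \<and> t0 < t \<and> (\<forall>y\<in>closure Om. c * f (y, t0) <= eps)"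
 proof -
  define C1 where "C1 = (k + 1) * ln (k + 1) - (k + 1) * ln D"
  obtain s where s: "0 < s" "s < t" "s <= eps / (c * exp C1)"
  proof (rule that)
   show "0 < min (t / 2) (eps / (c * exp C1))" using x(2) ep c by simp
   show "min (t / 2) (eps / (c * exp C1)) < t" using x(2) by (simp add: min_less_iff_disj)
   show "min (t / 2) (eps / (c * exp C1)) <= eps / (c * exp C1)" by simp
  qed
  have s1: "c * exp (- k * ln s - D / s) <= eps"
  proof -
   have "(k + 1) * ln (D / s) - D / s <= (k + 1) * ln (k + 1)" by (rule power_exp_bound) (use kpos D s in auto)
   moreover have "(k + 1) * ln (D / s) = (k + 1) * ln D - k * ln s - ln s" using D s by (simp add: ln_div algebra_simps)
   moreover have "a - b <= c ==> a = d - e - f ==> - e - b <= (c - d) + f" for a b c d e f :: real by linarith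
   ultimately have "- (k * ln s) - D / s <= C1 + ln s" unfolding C1_def by blast
   then have "exp (- k * ln s - D / s) <= exp C1 * s" using s(1) by (metis exp_add exp_le_cancel_iff exp_ln mult_minus_left)
   then have "c * exp (- k * ln s - D / s) <= c * (exp C1 * s)" using c by simp
   also have "\<dots> <= eps" using s(3) c by (simp add: pos_le_divide_eq mult_ac)
   finally show ?thesis .
  qed
  have "c * f (y, s) <= eps" if "y \<in> closure Om" for y
  proof -
   have "dlt\<^sup>2 <= (norm (y - z))\<^sup>2" using z(2)[OF that(1)] z(1) by (intro power_mono) auto
   then have "D / s <= (norm (y - z))\<^sup>2 / (4 * kappa * s)" unfolding D_def using kp s(1) by (simp add: divide_right_mono)
   then have "f (y, s) <= exp (- k * ln s - D / s)" by (simp add: f_def)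
   then have "c * f (y, s) <= c * exp (- k * ln s - D / s)" using c by simp
   then show ?thesis using s1 by linarith
  qed
  then show ?thesis using s(1,2) by auto
 qed
 then obtain t0 where t0: "0 < t0" "t0 < t" and st: "\<And>y. y \<in> closure Om ==> c * f (y, t0) <= eps" by blast
 define T1 where "T1 = (t + T) / 2"
 have T1: "t < T1" "T1 < T" using x by (auto simp: T1_def)
 define phi where "phi = (\<lambda>y. c * f y + (- eps) * ((norm (fst y - z))\<^sup>2 + 1 + B * snd y))"
 define S where "S = closure Om \<inter> cball z R"
 have "phi (x, t) <= w (x, t)"
 proof (rule cmp_radial[where S = S and U = "Om \<inter> ball z R" and ?t0.0 = t0 and T = T1 and c = z and alpha = alpha])
  show "compact S" unfolding S_def by (intro closed_Int_compact) auto
  show "open (Om \<inter> ball z R)" using O by auto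
  show "Om \<inter> ball z R \<subseteq> S" unfolding S_def using closure_subset by fastforce
  show "t0 < T1" using t0 T1 by simp
  show "continuous_on (S \<times> {t0..T1}) w" by (rule continuous_on_subset[OF cw]) (use t0 in \<open>auto simp: S_def\<close>)
  show "continuous_on (S \<times> {t0..T1}) phi" unfolding phi_def f_def by (intro continuous_intros) (use t0 kp in auto)
  show "super_at alpha w y s" if "y \<in> Om \<inter> ball z R" "t0 < s" "s < T1" for y s by (rule sup) (use that t0 in auto)
  show "x \<in> S" using x R by (auto simp: S_def dist_norm norm_minus_commute)
  show "t0 <= t" "t < T1" using t0 T1 by auto
  show "phi (y, s) <= w (y, s)" if yS: "y \<in> S" and s: "t0 <= s" "s <= T1" and b: "y \<notin> Om \<inter> ball z R \<or> s = t0" for y s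
  proof -
   have yc: "y \<in> closure Om" using yS by (simp add: S_def)
   have s0: "0 < s" "s < T" using s t0 T1 by auto
   have w0: "0 <= w (y, s)" by (rule pos[OF yc s0])
   have q: "0 <= eps * (norm (y - z))\<^sup>2" "0 <= eps * (B * s)" using ep B0 s0 by auto
   have ph: "phi (y, s) = c * f (y, s) - eps * (norm (y - z))\<^sup>2 - eps - eps * (B * s)" by (simp add: phi_def algebra_simps)
   consider "s = t0" | "y \<notin> Om" | "y \<in> Om" "y \<notin> ball z R" using b by blast
   then show ?thesis
   proof cases
    case 1 then show ?thesis using st[OF yc] w0 q unfolding ph by simp
   next
    case 2
    then have "y \<in> frontier Om" using yc O by (simp add: frontier_def interior_open)
    then have "hl <= w (y, s)" using bl s0 by blast
    then show ?thesis using fle[OF yc s0(1)] q ep unfolding ph by linarith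
   next
    case 3
    then have "R <= norm (y - z)" by (simp add: dist_norm norm_minus_commute)
    then have "R\<^sup>2 <= (norm (y - z))\<^sup>2" by (rule power_mono) (use R(2) norm_ge_zero[of "x - z"] in linarith)
    then have "eps * R\<^sup>2 <= eps * (norm (y - z))\<^sup>2" using ep by simp
    then show ?thesis using R(1) fle[OF yc s0(1)] q w0 ep unfolding ph by linarith
   qed
  qed
  show "\<exists>a g h. rjet phi z y s a g h \<and> a <= 2 * g * (alpha * real CARD('n) + (1 - 2 * alpha)) + 4 * (1 - alpha) * h * (norm (y - z))\<^sup>2 \<and> (y = z \<or> g \<noteq> 0)"
   if ts: "t0 < s" "s < T1" for y s
  proof -
   have s0: "0 < s" using ts t0 by simp
   define E where "E = exp (- k * ln s - (norm (y - z))\<^sup>2 / (4 * kappa * s))"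
   define Q where "Q = (norm (y - z))\<^sup>2"
   have E: "0 < E" by (simp add: E_def)
   have j: "rjet f z y s (E * (- k / s + Q / (4 * kappa * s\<^sup>2))) (- (E / (4 * kappa * s))) (E / (4 * kappa * s)\<^sup>2)"
    unfolding f_def E_def Q_def by (rule rjet_gauss[OF s0 kp])
   have jp: "rjet phi z y s (c * (E * (- k / s + Q / (4 * kappa * s\<^sup>2))) + - eps * B) (c * - (E / (4 * kappa * s)) + - eps) (c * (E / (4 * kappa * s)\<^sup>2))"
    unfolding phi_def
    by (rule rjet_cong[OF rjet_add[OF rjet_cmult[OF j, of c] rjet_cmult[OF rjet_add[OF rjet_add[OF rjet_dist rjet_const[of 1]] rjet_cmult[OF rjet_snd, of B]], of "- eps"]]]) auto
   have "2 * (c * - (E / (4 * kappa * s)) + - eps) * (2 * kappa * k) + 4 * kappa * (c * (E / (4 * kappa * s)\<^sup>2)) * Q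
    = c * (E * (- k / s + Q / (4 * kappa * s\<^sup>2))) + - eps * B"
    using kp s0 by (simp add: B_def field_simps power2_eq_square)
   then have "c * (E * (- k / s + Q / (4 * kappa * s\<^sup>2))) + - eps * B <= 2 * (c * - (E / (4 * kappa * s)) + - eps) * (2 * kappa * k) + 4 * kappa * (c * (E / (4 * kappa * s)\<^sup>2)) * Q"
    by (simp only:)
   moreover have "c * - (E / (4 * kappa * s)) + - eps \<noteq> 0"
   proof -
    have "0 < c * (E / (4 * kappa * s))" using c E kp s0 by simp
    moreover have "0 < a ==> - a + - eps \<noteq> 0" for a :: real using ep by simp
    ultimately show ?thesis unfolding mult_minus_right by blast
   qed
   ultimately show ?thesis using jp unfolding k2[symmetric] kappa_def[symmetric] Q_def[symmetric] by blast
  qed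
 qed
 moreover have "eps * ((norm (x - z))\<^sup>2 + 1 + B * t) = e0" using den by (simp add: eps_def)
 moreover have "c * f (x, t) = hl * exp (- k * ln (4 * (1 - alpha) * k / dlt\<^sup>2) - k * ln t - (norm (x - z))\<^sup>2 / (4 * (1 - alpha) * t))"
  unfolding c_def f_def D_def kappa_def by (simp add: mult.assoc exp_add[symmetric] algebra_simps)
 ultimately show "hl * exp (- k * ln (4 * (1 - alpha) * k / dlt\<^sup>2) - k * ln t - (norm (x - z))\<^sup>2 / (4 * (1 - alpha) * t)) <= w (x, t) + e0"
  unfolding phi_def by simp
qed

section \<open>Barriers in balls and at boundary points\<close>

text \<open>
 The inequality that makes \<open>e^s s^(-n/2)\<close>, \<open>s = sqrt ((n + 2)^2 + z^2)\<close>, a supersolution of the modified Bessel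
 equation in dimension \<open>n\<close>, written in the variable \<open>i = 1 / s\<close>.
\<close>

lemma bessel_super:
 fixes n i :: real
 assumes n: "0 <= n" and i: "0 < i" "(n + 2) * i <= 1"
 shows "2 * n * (i / 2 - n * i\<^sup>2 / 4) + 4 * (1 - (n + 2)\<^sup>2 * i\<^sup>2) * (1/4 - (1 + n) / 4 * i + (n / 4 + n\<^sup>2 / 16) * i\<^sup>2) <= 1"
proof -
 define sg where "sg = n + 2"
 have "(sg * i) * ((1 + n) * sg * i\<^sup>2) <= 1 * ((1 + n) * sg * i\<^sup>2)" using i n by (intro mult_right_mono) (auto simp: sg_def)
 then have a: "sg\<^sup>2 * (1 + n) * i ^ 3 <= (1 + n) * sg * i\<^sup>2" by (simp add: power2_eq_square power3_eq_cube algebra_simps)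
 have e: "2 * n * (i / 2 - n * i\<^sup>2 / 4) + 4 * (1 - sg\<^sup>2 * i\<^sup>2) * (1/4 - (1 + n) / 4 * i + (n / 4 + n\<^sup>2 / 16) * i\<^sup>2)
   = 1 - i + (n - n\<^sup>2 / 4 - sg\<^sup>2) * i\<^sup>2 + sg\<^sup>2 * (1 + n) * i ^ 3 - sg\<^sup>2 * (n + n\<^sup>2 / 4) * i ^ 4"
  by (simp add: field_simps power2_eq_square power3_eq_cube power4_eq_xxxx)
 have "0 <= sg\<^sup>2 * (n + n\<^sup>2 / 4) * i ^ 4" using n i by simp
 moreover have "(n - n\<^sup>2 / 4 - sg\<^sup>2) * i\<^sup>2 + (1 + n) * sg * i\<^sup>2 = - (2 + n\<^sup>2 / 4) * i\<^sup>2"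
  by (simp add: sg_def power2_eq_square algebra_simps)
 moreover have "0 <= (2 + n\<^sup>2 / 4) * i\<^sup>2" by simp
 ultimately show ?thesis unfolding sg_def[symmetric] e using a i(1) by linarith
qed

lemma peano2_log_bessel:
 fixes n A y :: real
 assumes A: "0 < A" "0 <= y"
 shows "peano2 (\<lambda>y. sqrt (A + y) - n / 4 * ln (A + y)) y (1 / sqrt (A + y) / 2 - n * (1 / sqrt (A + y))\<^sup>2 / 4)
   (n * (1 / sqrt (A + y)) ^ 4 / 4 - (1 / sqrt (A + y)) ^ 3 / 4)"
proof -
 have p: "0 < A + y" using A by simp
 have "peano2 (\<lambda>y. sqrt (A + y) - n / 4 * ln (A + y)) y (1 / (2 * sqrt (A + y)) - n / 4 / (A + y)) (n * (1 / sqrt (A + y)) ^ 4 / 4 - (1 / sqrt (A + y)) ^ 3 / 4)"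
 proof (rule peano2I[of A _ _ "\<lambda>y. 1 / (2 * sqrt (A + y)) - n / 4 / (A + y)"])
 show "((\<lambda>y. sqrt (A + y) - n / 4 * ln (A + y)) has_real_derivative 1 / (2 * sqrt (A + z)) - n / 4 / (A + z)) (at z)" if "\<bar>z - y\<bar> < A" for z

 proof -
  have p: "0 < A + z" using that A by (simp add: abs_less_iff)
  have i: "((\<lambda>y. A + y) has_real_derivative 1) (at z)" by (auto intro!: derivative_eq_intros)
  have "((\<lambda>y. sqrt (A + y)) has_real_derivative inverse (sqrt (A + z)) / 2 * 1) (at z)"
   by (rule DERIV_chain2[OF DERIV_real_sqrt[OF p] i])
  moreover have "((\<lambda>y. ln (A + y)) has_real_derivative 1 / (A + z) * 1) (at z)" by (rule DERIV_chain2[OF DERIV_ln_divide[OF p] i])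
  ultimately have "((\<lambda>y. sqrt (A + y) - n / 4 * ln (A + y)) has_real_derivative inverse (sqrt (A + z)) / 2 * 1 - n / 4 * (1 / (A + z) * 1)) (at z)"
   by (intro DERIV_diff DERIV_cmult)
  moreover have "inverse u / 2 * 1 - n / 4 * (1 / v * 1) = 1 / (2 * u) - n / 4 / v" for u v :: real
   by (simp add: inverse_eq_divide mult.commute)
  ultimately show ?thesis by (simp only:)
 qed
 define s where "s = sqrt (A + y)"
 have s: "0 < s" "A + y = s\<^sup>2" using p by (auto simp: s_def)
 have "((\<lambda>y. 1 / (2 * sqrt (A + y)) - n / 4 / (A + y)) has_real_derivative
   (0 * (2 * s) - 1 * (2 * (1 * (inverse s / 2)))) / ((2 * s) * (2 * s)) - (0 * (A + y) - n / 4 * 1) / ((A + y) * (A + y))) (at y)"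
  unfolding s_def using p by (intro DERIV_diff DERIV_divide DERIV_const) (auto intro!: derivative_eq_intros)
 moreover have "(0 * (2 * s) - 1 * (2 * (1 * (inverse s / 2)))) / ((2 * s) * (2 * s)) - (0 * (A + y) - n / 4 * 1) / ((A + y) * (A + y))
   = n * (1 / s) ^ 4 / 4 - (1 / s) ^ 3 / 4"
  unfolding s(2) using s(1) by (simp add: field_simps power2_eq_square power3_eq_cube power4_eq_xxxx)
 ultimately show "((\<lambda>y. 1 / (2 * sqrt (A + y)) - n / 4 / (A + y)) has_real_derivative n * (1 / sqrt (A + y)) ^ 4 / 4 - (1 / sqrt (A + y)) ^ 3 / 4) (at y)"
  by (simp add: s_def)
 qed (use A in simp)
 moreover have "(1 / sqrt (A + y))\<^sup>2 = 1 / (A + y)" using p by (simp add: power_divide)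
 ultimately have "1 / sqrt (A + y) / 2 - n * (1 / sqrt (A + y))\<^sup>2 / 4 = 1 / (2 * sqrt (A + y)) - n / 4 / (A + y)"
  by (simp add: mult.commute)
 then show ?thesis using \<open>peano2 _ y _ _\<close> by (simp only:)
qed

text \<open>
 The barrier is \<open>tau^(-n/2) exp (- (R\<^sup>2 + rho\<^sup>2) / 4tau) S(R rho / 2tau)\<close> with \<open>tau = kappa t\<close> and \<open>S\<close> a smooth substitute for the Bessel function that would
 give the average of the heat kernel over the sphere of radius \<open>R\<close>.  Where its gradient vanishes it is already below
 \<open>- M\<close>, so no test is needed there.
\<close>

lemma ball_lower:
 fixes u :: "(real^'n) \<times> real => real"
 assumes al: "0 <= alpha" "alpha < 1" and R: "0 < R" and T: "0 < T" and M: "0 <= M"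
  and cu: "continuous_on (cball x0 R \<times> {0..T}) u" and u0: "\<And>x. x \<in> cball x0 R ==> u (x, 0) = 0"
  and sup: "\<And>x t. x \<in> ball x0 R ==> 0 < t ==> t < T ==> super_at alpha u x t"
  and bd: "\<And>x t. x \<in> cball x0 R ==> 0 <= t ==> t <= T ==> - M <= u (x, t)"
  and k: "(1 - alpha) * n = alpha * real CARD('n) + (1 - 2 * alpha)" and t: "0 < t" "t < T"
 shows "- (M * exp (2 * n + 2 + n / 2 * (ln ((1 - alpha) * T * (n + 2) + R\<^sup>2 / 2) - ln ((1 - alpha) * t) - ln (n + 2)) - R\<^sup>2 / (4 * (1 - alpha) * t))) <= u (x0, t)"
proof (rule field_le_epsilon)
 fix eps :: real assume ep: "0 < eps"
 define kappa where "kappa = 1 - alpha"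
 have kp: "0 < kappa" using al by (simp add: kappa_def)
 have n0: "0 < n"
 proof -
  have "alpha * 1 <= alpha * real CARD('n)" using al by (intro mult_left_mono) (auto simp: Suc_le_eq)
  then have "0 < (1 - alpha) * n" unfolding k using al by linarith
  then show ?thesis using al by (simp add: zero_less_mult_iff)
 qed
 define sg where "sg = n + 2"
 define A where "A = sg\<^sup>2"
 have sg: "2 < sg" "0 < A" using n0 by (auto simp: sg_def A_def)
 define D where "D = kappa * T * sg + R\<^sup>2 / 2"
 have D: "0 < D" using kp T sg R by (simp add: D_def add_pos_pos)
 define yy where "yy = (\<lambda>z :: (real^'n) \<times> real. (norm (fst z - x0))\<^sup>2 * ((R\<^sup>2 / (4 * kappa\<^sup>2)) / (snd z)\<^sup>2))"
 define L where "L = (\<lambda>z :: (real^'n) \<times> real. (sqrt (A + yy z) - n / 4 * ln (A + yy z)) + ((- (n / 2)) * ln (snd z) + (- 1) * ((R\<^sup>2 + (norm (fst z - x0))\<^sup>2) * ((1 / (4 * kappa)) / snd z))))"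
 define m where "m = M * exp (n + n / 2 * (ln D - ln kappa))"
 have m0: "0 <= m" using M by (simp add: m_def)
 define phi where "phi = (\<lambda>z :: (real^'n) \<times> real. (- m) * exp (L z) + (- eps))"
 have yy0: "0 <= yy z" for z by (simp add: yy_def)
 define ss where "ss = (\<lambda>z. sqrt (A + yy z))"
 have ss: "sg <= ss z" "(ss z)\<^sup>2 = A + yy z" for z
 proof -
  have "sqrt A <= ss z" unfolding ss_def using yy0[of z] by simp
  then show "sg <= ss z" using sg by (simp add: A_def)
  show "(ss z)\<^sup>2 = A + yy z" unfolding ss_def using yy0[of z] sg by simp
 qed
 \<comment> \<open>where the square root is not much smaller than its value on the sphere, the barrier is below -M\<close>
 have low: "- M \<ge> (- m) * exp (L (x, s))" if x: "x \<in> cball x0 R" and s: "0 < s" "s <= T" and b: "R\<^sup>2 / (2 * kappa * s) - n <= ss (x, s)" for x s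
 proof -
  define Y where "Y = R\<^sup>2 / (2 * kappa * s)"
  define S where "S = ss (x, s)"
  have Y0: "0 <= Y" using kp s by (simp add: Y_def)
  have S0: "0 < S" using ss(1)[of "(x, s)"] sg by (simp add: S_def)
  have nR: "(norm (x - x0))\<^sup>2 <= R\<^sup>2" using x by (intro power_mono) (auto simp: dist_norm norm_minus_commute)
  have yY: "yy (x, s) <= Y\<^sup>2"
  proof -
   have "yy (x, s) <= R\<^sup>2 * ((R\<^sup>2 / (4 * kappa\<^sup>2)) / s\<^sup>2)" unfolding yy_def fst_conv snd_conv by (intro mult_right_mono nR) simp
   also have "\<dots> = Y\<^sup>2" unfolding Y_def by (simp add: power_divide power_mult_distrib power2_eq_square)
   finally show ?thesis .
  qed
  have SY: "S <= sg + Y"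
  proof (rule power2_le_imp_le)
   have "S\<^sup>2 <= sg\<^sup>2 + Y\<^sup>2" using ss(2)[of "(x, s)"] yY by (simp add: S_def A_def)
   also have "\<dots> <= (sg + Y)\<^sup>2" using sg Y0 by (simp add: power2_sum)
   finally show "S\<^sup>2 <= (sg + Y)\<^sup>2" .
  qed (use sg Y0 in simp)
  have "kappa * s * S <= kappa * s * (sg + Y)" using SY kp s by (intro mult_left_mono) auto
  also have "\<dots> = kappa * s * sg + R\<^sup>2 / 2" using kp s by (simp add: Y_def distrib_left)
  also have "\<dots> <= D" unfolding D_def using kp s sg by (simp add: mult_right_mono)
  finally have "ln (kappa * s * S) <= ln D" using kp s S0 D by (subst ln_le_cancel_iff) auto
  then have l1: "ln kappa + ln s + ln S <= ln D" using kp s S0 by (simp add: ln_mult)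
  have l2: "ln (A + yy (x, s)) = 2 * ln S" unfolding ss(2)[symmetric] S_def[symmetric] using S0 by (simp add: ln_realpow)
  have e1: "(R\<^sup>2 + (norm (x - x0))\<^sup>2) * ((1 / (4 * kappa)) / s) <= Y"
  proof -
   have "(R\<^sup>2 + (norm (x - x0))\<^sup>2) * ((1 / (4 * kappa)) / s) <= (R\<^sup>2 + R\<^sup>2) * ((1 / (4 * kappa)) / s)" using nR kp s by (intro mult_right_mono) auto
   also have "\<dots> = Y" unfolding Y_def using kp s by (simp add: field_simps)
   finally show ?thesis .
  qed
  have "L (x, s) = S - n / 2 * ln S + ((- (n / 2)) * ln s - (R\<^sup>2 + (norm (x - x0))\<^sup>2) * ((1 / (4 * kappa)) / s))"
   unfolding L_def fst_conv snd_conv l2 by (simp only: S_def ss_def mult_minus1 add_uminus_conv_diff)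
  moreover have "n / 2 * (ln kappa + ln s + ln S) <= n / 2 * ln D" using l1 n0 by (intro mult_left_mono) auto
  ultimately have "0 <= n + n / 2 * (ln D - ln kappa) + L (x, s)" using e1 b
   unfolding S_def[symmetric] Y_def[symmetric] distrib_left right_diff_distrib mult_minus_left by linarith
  then have "1 <= exp (n + n / 2 * (ln D - ln kappa)) * exp (L (x, s))" unfolding exp_add[symmetric] by simp
  then have "M * 1 <= M * (exp (n + n / 2 * (ln D - ln kappa)) * exp (L (x, s)))" using M by (intro mult_left_mono)
  then show ?thesis unfolding m_def by (simp add: mult.assoc)
 qed
 have "uniformly_continuous_on (cball x0 R \<times> {0..T}) u" by (intro compact_uniformly_continuous cu compact_Times) auto
 then obtain d where d: "0 < d" "\<And>z z'. z \<in> cball x0 R \<times> {0..T} ==> z' \<in> cball x0 R \<times> {0..T} ==> dist z' z < d ==> dist (u z') (u z) < eps"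
  using ep unfolding uniformly_continuous_on_def by metis
 obtain t0 where t0: "0 < t0" "t0 < t" "t0 < d" using that[of "min t d / 2"] t d(1) by (auto simp: min_def)
 have st: "- eps <= u (x, t0)" if "x \<in> cball x0 R" for x
 proof -
  have "dist (u (x, t0)) (u (x, 0)) < eps" by (rule d(2)) (use that t0 t in \<open>auto simp: dist_Pair_Pair\<close>)
  then show ?thesis using u0[OF that] by (simp add: dist_real_def abs_less_iff)
 qed
 have cy: "continuous_on (cball x0 R \<times> {t0..T}) yy" unfolding yy_def by (intro continuous_intros) (use t0 in auto)
 have "phi (x0, t) <= u (x0, t)"
 proof (rule cmp_radial[where S = "cball x0 R" and U = "ball x0 R" and ?t0.0 = t0 and T = T and c = x0 and alpha = alpha])
  show "continuous_on (cball x0 R \<times> {t0..T}) u" by (rule continuous_on_subset[OF cu]) (use t0 in auto)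
  have "A + yy z \<noteq> 0" for z using yy0[of z] sg by (metis add_pos_nonneg less_irrefl)
  then show "continuous_on (cball x0 R \<times> {t0..T}) phi" unfolding phi_def L_def
   by (intro continuous_intros cy) (use t0 in auto)
  show "phi (x, s) <= u (x, s)" if x: "x \<in> cball x0 R" and s: "t0 <= s" "s <= T" and b: "x \<notin> ball x0 R \<or> s = t0" for x s
  proof (cases "s = t0")
   case True
   have "0 <= m * exp (L (x, s))" using m0 by simp
   then have "phi (x, s) <= - eps" by (simp add: phi_def)
   then show ?thesis using st[OF x] True by simp
  next
   case False
   then have nx: "norm (x - x0) = R" using b x by (simp add: dist_norm norm_minus_commute)
   define Y where "Y = R\<^sup>2 / (2 * kappa * s)"
   have Y0: "0 <= Y" using kp s t0 by (simp add: Y_def)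
   have "yy (x, s) = Y\<^sup>2" unfolding Y_def yy_def fst_conv snd_conv nx by (simp add: power_divide power_mult_distrib power2_eq_square)
   then have "Y\<^sup>2 <= (ss (x, s))\<^sup>2" using ss(2)[of "(x, s)"] sg by simp
   then have "Y <= ss (x, s)" by (rule power2_le_imp_le) (use ss(1)[of "(x, s)"] sg in simp)
   then have b': "R\<^sup>2 / (2 * kappa * s) - n <= ss (x, s)" using n0 unfolding Y_def by linarith
   have "0 < s" using t0 s by simp
   then have "(- m) * exp (L (x, s)) <= - M" using low[OF x _ s(2) b'] by blast
   then show ?thesis using bd[OF x, of s] s t0 ep unfolding phi_def by simp
  qed
  show "\<exists>a g h. rjet phi x0 x s a g h \<and> a <= 2 * g * (alpha * real CARD('n) + (1 - 2 * alpha)) + 4 * (1 - alpha) * h * (norm (x - x0))\<^sup>2 \<and> (x = x0 \<or> g \<noteq> 0)"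
   if x: "x \<in> ball x0 R" and s: "t0 < s" "s < T" and lt: "u (x, s) < phi (x, s)" for x s
  proof -
   have s0: "0 < s" using s t0 by simp
   define Q where "Q = (norm (x - x0))\<^sup>2"
   define tau where "tau = kappa * s"
   have tau: "0 < tau" using kp s0 by (simp add: tau_def)
   define Y1 where "Y1 = R\<^sup>2 / (4 * tau\<^sup>2)"
   have Y1a: "0 < Y1" unfolding Y1_def using R tau by simp
   have Y1b: "Y1 = (R\<^sup>2 / (4 * kappa\<^sup>2)) / s\<^sup>2" unfolding Y1_def tau_def by (simp add: power_mult_distrib)
   note Y1 = Y1a Y1b
   define y where "y = yy (x, s)"
   have yQ: "y = Q * Y1" by (simp add: y_def yy_def Q_def Y1(2))
   have y0: "0 <= y" by (simp add: y_def yy0)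
   define i where "i = 1 / sqrt (A + y)"
   have S: "sg <= sqrt (A + y)" using ss(1)[of "(x, s)"] by (simp add: ss_def y_def)
   have i: "0 < i" "sg * i <= 1" 
   proof -
    have "0 < sqrt (A + y)" using S sg by linarith
    moreover have "0 < w ==> sg <= w ==> 0 < 1 / w \<and> sg * (1 / w) <= 1" for w :: real by simp
    ultimately show "0 < i" "sg * i <= 1" using S unfolding i_def by blast+
   qed
   define l1 where "l1 = i / 2 - n * i\<^sup>2 / 4"
   define l2 where "l2 = n * i ^ 4 / 4 - i ^ 3 / 4"
   have pl: "peano2 (\<lambda>y. sqrt (A + y) - n / 4 * ln (A + y)) (yy (x, s)) l1 l2"
    using peano2_log_bessel[OF sg(2) y0, of n] by (simp add: l1_def l2_def i_def y_def)
   obtain k3 where i3: "peano2 (\<lambda>t. (1 / (4 * kappa)) / t) s (- ((1 / (4 * kappa)) / s\<^sup>2)) k3" using peano2_inverse_c[OF s0] by blast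
   obtain k4 where i4: "peano2 (\<lambda>t. (R\<^sup>2 / (4 * kappa\<^sup>2)) / t\<^sup>2) s (- 2 * (R\<^sup>2 / (4 * kappa\<^sup>2)) / s ^ 3) k4" using peano2_inverse_square[OF s0] by blast
   have jy: "rjet yy x0 x s (- 2 * y / s) Y1 0"
    unfolding yy_def
    by (rule rjet_cong[OF rjet_mult[OF rjet_dist[of x0 x s] rjet_time[OF i4]]]) (use s0 kp in \<open>auto simp: yQ Q_def Y1(2) field_simps power2_eq_square power3_eq_cube\<close>)
   define aL where "aL = l1 * (- 2 * y / s) + (- (n / 2) / s + (R\<^sup>2 + Q) * ((1 / (4 * kappa)) / s\<^sup>2))"
   define gL where "gL = l1 * Y1 - (1 / (4 * kappa)) / s"
   define hL where "hL = l2 * Y1\<^sup>2"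
   have jL: "rjet L x0 x s aL gL hL"
    unfolding L_def
    by (rule rjet_cong[OF rjet_add[OF rjet_comp[OF jy pl] rjet_add[OF rjet_cmult[OF rjet_time[OF peano2_ln[OF s0]], of "- (n / 2)"]
      rjet_cmult[OF rjet_mult[OF rjet_add[OF rjet_const[of "R\<^sup>2"] rjet_dist[of x0 x s]] rjet_time[OF i3]], of "- 1"]]]])
     (simp_all add: aL_def gL_def hL_def Q_def add_divide_distrib diff_divide_distrib)
   define E where "E = exp (L (x, s))"
   have E: "0 < E" by (simp add: E_def)
   have j: "rjet phi x0 x s (- m * (E * aL)) (- m * (E * gL)) (- m * (E * hL + E * gL\<^sup>2))"
    unfolding phi_def E_def
    by (rule rjet_cong[OF rjet_add[OF rjet_cmult[OF rjet_comp[OF jL peano2_exp], of "- m"] rjet_const[of "- eps"]]]) auto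
   have key: "kappa * (2 * n * gL + 4 * Q * (hL + gL\<^sup>2)) <= aL"
   proof -
    have yi: "y * i\<^sup>2 = 1 - A * i\<^sup>2"
    proof -
     have "(A + y) * i\<^sup>2 = 1" unfolding i_def using sg y0 by (simp add: power_divide)
     then show ?thesis by (simp add: algebra_simps)
    qed
    have "4 * y * (l2 + l1\<^sup>2) = 4 * (y * i\<^sup>2) * (1/4 - (1 + n) / 4 * i + (n / 4 + n\<^sup>2 / 16) * i\<^sup>2)"
     by (simp add: l1_def l2_def field_simps power2_eq_square power3_eq_cube power4_eq_xxxx)
    then have B: "2 * n * l1 + 4 * y * (l2 + l1\<^sup>2) <= 1"
     using bessel_super[of n i] n0 i unfolding yi l1_def A_def sg_def by simp
    have g2: "gL = l1 * Y1 - 1 / (4 * tau)" by (simp add: gL_def tau_def)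
    have "aL = kappa * (- n / (2 * tau) + (R\<^sup>2 + Q) / (4 * tau\<^sup>2) - 2 * y * l1 / tau)"
     unfolding aL_def tau_def using kp s0 by (simp add: field_simps power2_eq_square)
    moreover have "- n / (2 * tau) + (R\<^sup>2 + Q) / (4 * tau\<^sup>2) - 2 * y * l1 / tau - (2 * n * gL + 4 * Q * (hL + gL\<^sup>2)) = Y1 * (1 - (2 * n * l1 + 4 * y * (l2 + l1\<^sup>2)))"
    proof -
     have R: "R\<^sup>2 / (4 * tau\<^sup>2) = Y1" by (simp add: Y1_def)
     define b where "b = 1 / tau"
     have c: "n / (2 * tau) = n * b / 2" "(R\<^sup>2 + Q) / (4 * tau\<^sup>2) = Y1 + Q * b\<^sup>2 / 4" "2 * y * l1 / tau = 2 * y * l1 * b" "gL = l1 * Y1 - b / 4"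
      using R unfolding g2 b_def by (simp_all add: add_divide_distrib power_divide)
     show ?thesis unfolding minus_divide_left[symmetric] c hL_def unfolding yQ by (simp add: field_simps power2_eq_square)
    qed
    moreover have "0 <= Y1 * (1 - (2 * n * l1 + 4 * y * (l2 + l1\<^sup>2)))" using Y1(1) B by simp
    ultimately show ?thesis using kp by simp
   qed
   have "m * E * (kappa * (2 * n * gL + 4 * Q * (hL + gL\<^sup>2))) <= m * E * aL" using key m0 E by (intro mult_left_mono) auto
   then have ineq: "- m * (E * aL) <= 2 * (- m * (E * gL)) * (kappa * n) + 4 * kappa * (- m * (E * hL + E * gL\<^sup>2)) * Q"
    by (simp add: algebra_simps)
   have xc: "x \<in> cball x0 R" using x by simp
   have nM: "- M < (- m) * exp (L (x, s))" using lt bd[OF xc, of s] s s0 ep unfolding phi_def by simp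
   have mpos: "m \<noteq> 0"
   proof
    assume m: "m = 0"
    then have "M = 0" by (simp add: m_def)
    then show False using nM m by simp
   qed
   have "gL \<noteq> 0"
   proof
    assume "gL = 0"
    then have "l1 * Y1 = 1 / (4 * tau)" by (simp add: gL_def tau_def)
    then have e: "4 * tau * (l1 * Y1) = 1" using tau by simp
    define S1 where "S1 = sqrt (A + y)"
    have S1: "n + 2 <= S1" using S by (simp add: S1_def sg_def)
    define Y where "Y = R\<^sup>2 / (2 * kappa * s)"
    have YY: "4 * tau * Y1 = 2 * Y" unfolding Y1_def Y_def tau_def using kp s0 by (simp add: field_simps power2_eq_square)
    have "Y * (2 * S1 - n) = 2 * S1\<^sup>2"
    proof -
     have "2 * Y * l1 = 1" using e unfolding YY[symmetric] by (simp add: mult_ac)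
     moreover have "l1 * (4 * S1\<^sup>2) = 2 * S1 - n" unfolding l1_def i_def S1_def[symmetric] using S1 n0 by (simp add: field_simps power2_eq_square)
     moreover have "2 * Y * (l1 * (4 * S1\<^sup>2)) = (2 * Y * l1) * (4 * S1\<^sup>2)" by simp
     ultimately have "2 * Y * (2 * S1 - n) = 4 * S1\<^sup>2" by (simp only: mult_1)
     then show ?thesis by simp
    qed
    then have "(Y - n - S1) * (2 * S1 - n) = 2 * S1\<^sup>2 - (n + S1) * (2 * S1 - n)" by (simp add: algebra_simps)
    also have "\<dots> = n * (n - S1)" by (simp add: algebra_simps power2_eq_square)
    also have "\<dots> <= 0" using n0 S1 by (simp add: mult_nonneg_nonpos)
    finally have "Y - n - S1 <= 0" using S1 n0 by (auto simp: mult_le_0_iff)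
    then have "Y - n <= ss (x, s)" by (simp add: S1_def ss_def y_def)
    then show False using low[OF xc s0] s nM unfolding Y_def by simp
   qed
   then have "- m * (E * gL) \<noteq> 0" using mpos E by simp
   then show ?thesis using j ineq unfolding k[symmetric] kappa_def[symmetric] Q_def[symmetric] by blast
  qed
 qed (use sup t0 t R in auto)
 moreover have "m * exp (L (x0, t)) = M * exp (2 * n + 2 + n / 2 * (ln D - ln (kappa * t) - ln sg) - R\<^sup>2 / (4 * kappa * t))"
 proof -
  have "sqrt A = sg" "ln A = 2 * ln sg" using sg by (simp_all add: A_def ln_realpow)
  then have "L (x0, t) = sg - n / 2 * ln sg + (- (n / 2) * ln t - R\<^sup>2 / (4 * kappa * t))" by (simp add: L_def yy_def)
  moreover have "ln (kappa * t) = ln kappa + ln t" using kp t by (simp add: ln_mult)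
  ultimately have "n + n / 2 * (ln D - ln kappa) + L (x0, t) = 2 * n + 2 + n / 2 * (ln D - ln (kappa * t) - ln sg) - R\<^sup>2 / (4 * kappa * t)"
   by (simp add: sg_def algebra_simps diff_divide_distrib add_divide_distrib)
  then show ?thesis unfolding m_def by (simp only: mult.assoc exp_add[symmetric])
 qed
 moreover have "phi (x0, t) = - (m * exp (L (x0, t))) - eps" by (simp add: phi_def)
 ultimately have "- (M * exp (2 * n + 2 + n / 2 * (ln D - ln (kappa * t) - ln sg) - R\<^sup>2 / (4 * kappa * t))) - eps <= u (x0, t)" by simp
 then show "- (M * exp (2 * n + 2 + n / 2 * (ln ((1 - alpha) * T * (n + 2) + R\<^sup>2 / 2) - ln ((1 - alpha) * t) - ln (n + 2)) - R\<^sup>2 / (4 * (1 - alpha) * t))) <= u (x0, t) + eps"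
  unfolding D_def kappa_def sg_def by (simp only: diff_le_eq)
qed

text \<open>
 For \<open>p = \<infinity>\<close> the operator acts on radial functions as the second derivative in the radius, and \<open>exp (- sqrt Y - Y / 4)\<close> with \<open>Y = rho\<^sup>2 / (t - b)\<close> is a subsolution with the value \<open>1\<close> at the boundary
 point.  Starting at the positive time \<open>b\<close> avoids the corner: there the barrier starts from its lower bound \<open>- M\<close>.
\<close>

lemma near_boundary_inf:
 fixes w :: "(real^'n) \<times> real => real"
 assumes O: "open Om" and M: "0 <= M" and cw: "continuous_on (closure Om \<times> {0<..}) w"
  and sup: "\<And>x t. x \<in> Om ==> 0 < t ==> super_at 0 w x t"
  and bd: "\<And>x t. x \<in> closure Om ==> 0 < t ==> t < T ==> - M <= w (x, t)"
  and fr: "\<And>x t. x \<in> frontier Om ==> 0 < t ==> 0 <= w (x, t)"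
  and y: "y \<in> frontier Om" and x: "x \<in> Om" and t: "0 < b" "b < t" "t < T"
 shows "M * exp (- sqrt ((norm (x - y))\<^sup>2 / (t - b)) - (norm (x - y))\<^sup>2 / (t - b) / 4) - M <= w (x, t)"
proof (rule field_le_epsilon)
 fix e0 :: real assume e0: "0 < e0"
 define eps where "eps = e0 / ((norm (x - y))\<^sup>2 + 1 + 3 * (t - b))"
 have den: "0 < (norm (x - y))\<^sup>2 + 1 + 3 * (t - b)" using t by (intro add_nonneg_pos add_pos_nonneg) auto
 have ep: "0 < eps" using e0 den by (simp add: eps_def)
 have yc: "y \<in> closure Om" "y \<notin> Om" using y O by (auto simp: frontier_def interior_open)
 define f where "f = (\<lambda>z :: (real^'n) \<times> real. exp ((\<lambda>Y. - sqrt Y - Y / 4) ((norm (fst z - y))\<^sup>2 * (1 / (snd z - b)))))"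
 have f1: "f z <= 1" if "b <= snd z" for z
 proof -
  have yp: "0 <= (norm (fst z - y))\<^sup>2 * (1 / (snd z - b))" using that by simp
  then have "- sqrt ((norm (fst z - y))\<^sup>2 * (1 / (snd z - b))) - (norm (fst z - y))\<^sup>2 * (1 / (snd z - b)) / 4 <= 0"

  proof -
   have "0 <= a ==> 0 <= q ==> - q - a / 4 <= 0" for a q :: real by simp
   then show ?thesis using yp real_sqrt_ge_zero[OF yp] by blast
  qed
  then show ?thesis unfolding f_def by simp
 qed
 define phi where "phi = (\<lambda>z. (M * f z + (- M)) + (- eps) * (((norm (fst z - y))\<^sup>2 + 1) + 3 * (snd z + (- b))))"
 obtain d where d: "0 < d" "\<And>x s. x \<in> closure Om ==> 0 < s ==> norm (x - y) < d ==> \<bar>s - b\<bar> < d ==> - eps < w (x, s)"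
 proof -
  have "(y, b) \<in> closure Om \<times> {0<..}" using yc t by simp
  then obtain d where "0 < d" and dd: "\<And>z. z \<in> closure Om \<times> {0<..} ==> dist z (y, b) < d ==> dist (w z) (w (y, b)) < eps"
   using cw ep unfolding continuous_on_iff by metis
  show ?thesis
  proof (rule that[of "d / 2"])
   fix x s assume a: "x \<in> closure Om" "0 < s" "norm (x - y) < d / 2" "\<bar>s - b\<bar> < d / 2"
   have "dist (x, s) (y, b) <= norm (x - y) + \<bar>s - b\<bar>" unfolding dist_norm using norm_Pair_le[of "x - y" "s - b"] by simp
   then have "dist (w (x, s)) (w (y, b)) < eps" using a by (intro dd) auto
   then show "- eps < w (x, s)" using fr[OF y t(1)] by (simp add: dist_real_def abs_less_iff)
  qed (use \<open>0 < d\<close> in simp)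
 qed
 define s0 where "s0 = min (min (d / 2) ((t - b) / 2)) (eps * d\<^sup>2 / (4 * (M + 1)))"
 have s0: "0 < s0" "s0 < d" "s0 < t - b" "s0 <= eps * d\<^sup>2 / (4 * (M + 1))"
 proof -
  show "0 < s0" using d(1) t ep M by (simp add: s0_def)
  have "s0 <= d / 2" "s0 <= (t - b) / 2" unfolding s0_def by linarith+
  moreover have "d / 2 < d" "(t - b) / 2 < t - b" using d(1) t by simp_all
  ultimately show "s0 < d" "s0 < t - b" by (blast intro: le_less_trans)+
  show "s0 <= eps * d\<^sup>2 / (4 * (M + 1))" by (simp add: s0_def)
 qed
 define t0 where "t0 = b + s0"
 have t0: "b < t0" "t0 < t" using s0 by (auto simp: t0_def)
 define T1 where "T1 = (t + T) / 2"
 have T1: "t < T1" "T1 < T" using t by (auto simp: T1_def)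
 define R where "R = norm (x - y) + sqrt (M / eps) + 1"
 have R: "M <= eps * R\<^sup>2" "norm (x - y) < R"
 proof -
  have "sqrt (M / eps) <= R" by (simp add: R_def)
  then have "(sqrt (M / eps))\<^sup>2 <= R\<^sup>2" using M ep by (intro power_mono) auto
  then have "M / eps <= R\<^sup>2" using M ep by simp
  then show "M <= eps * R\<^sup>2" using ep by (simp add: pos_divide_le_eq mult.commute)
  have "0 <= sqrt (M / eps)" using M ep by simp
  then show "norm (x - y) < R" unfolding R_def by linarith
 qed
 define S where "S = closure Om \<inter> cball y R"
 have ph: "phi (x', s) = M * f (x', s) - M - eps * (norm (x' - y))\<^sup>2 - eps - 3 * eps * (s - b)" for x' s by (simp add: phi_def algebra_simps)
 have phle: "phi (x', s) <= M * f (x', s) - M - eps" if "b <= s" for x' s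
 proof -
  have "0 <= eps * (norm (x' - y))\<^sup>2" "0 <= 3 * eps * (s - b)" using ep that by auto
  then show ?thesis unfolding ph by linarith
 qed
 have Mf: "M * f (x', s) <= M" if "b <= s" for x' s using f1[of "(x', s)"] that M by (simp add: mult_left_le)
 have "phi (x, t) <= w (x, t)"
 proof (rule cmp_radial[where S = S and U = "Om \<inter> ball y R" and ?t0.0 = t0 and T = T1 and c = y and alpha = 0])
  show "compact S" unfolding S_def by (intro closed_Int_compact) auto
  show "open (Om \<inter> ball y R)" using O by auto
  show "Om \<inter> ball y R \<subseteq> S" unfolding S_def using closure_subset by fastforce
  show "t0 < T1" "t0 <= t" "t < T1" using t0 T1 by auto
  show "continuous_on (S \<times> {t0..T1}) w" by (rule continuous_on_subset[OF cw]) (use t0 t in \<open>auto simp: S_def\<close>)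
  show "continuous_on (S \<times> {t0..T1}) phi" unfolding phi_def f_def by (intro continuous_intros) (use t0 in auto)
  show "super_at 0 w x' s" if "x' \<in> Om \<inter> ball y R" "t0 < s" "s < T1" for x' s by (rule sup) (use that t0 t in auto)
  show "x \<in> S" using x R closure_subset by (auto simp: S_def dist_norm norm_minus_commute)
  show "phi (x', s) <= w (x', s)" if xS: "x' \<in> S" and s: "t0 <= s" "s <= T1" and bb: "x' \<notin> Om \<inter> ball y R \<or> s = t0" for x' s
  proof -
   have xc: "x' \<in> closure Om" using xS by (simp add: S_def)
   have sb: "b <= s" "0 < s" "s < T" using s t0 t T1 by auto
   consider "s = t0" "norm (x' - y) < d" | "s = t0" "d <= norm (x' - y)" | "x' \<notin> Om" | "x' \<in> Om" "x' \<notin> ball y R" using bb by fastforce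
   then show ?thesis
   proof cases
    case 1
    have "\<bar>s - b\<bar> < d" using 1(1) s0 by (simp add: t0_def)
    then show ?thesis using d(2)[OF xc sb(2) 1(2)] phle[OF sb(1), of x'] Mf[OF sb(1), of x'] by linarith
   next
    case 2
    define a where "a = d\<^sup>2 / (4 * s0)"
    have a: "0 < a" using d(1) s0 by (simp add: a_def)
    have "d\<^sup>2 <= (norm (x' - y))\<^sup>2" using 2 d(1) by (intro power_mono) auto
    then have "d\<^sup>2 / (4 * s0) <= (norm (x' - y))\<^sup>2 / (4 * s0)" using s0(1) by (simp add: divide_right_mono)
    moreover have "s - b = s0" using 2 by (simp add: t0_def)
    moreover have "(norm (x' - y))\<^sup>2 / (4 * s0) = (norm (x' - y))\<^sup>2 * (1 / s0) / 4" by simp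
    ultimately have "a <= (norm (x' - y))\<^sup>2 * (1 / (s - b)) / 4" unfolding a_def by simp
    moreover have "0 <= sqrt ((norm (x' - y))\<^sup>2 * (1 / (s - b)))" using sb by simp
    moreover have "a <= p ==> 0 <= q ==> - q - p <= - a" for p q :: real by simp
    ultimately have "f (x', s) <= exp (- a)" unfolding f_def fst_conv snd_conv exp_le_cancel_iff by blast
    also have "\<dots> <= 1 / a"
    proof -
     have "a <= exp a" using exp_ge_add_one_self[of a] by linarith
     then show ?thesis using a by (simp add: exp_minus inverse_eq_divide frac_le)
    qed
    finally have "M * f (x', s) <= M * (1 / a)" using M by (intro mult_left_mono)
    also have "\<dots> <= eps"
    proof -
     have "4 * (M + 1) * s0 <= eps * d\<^sup>2" using s0(4) M by (simp add: pos_le_divide_eq mult.commute)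
     moreover have "4 * M * s0 <= 4 * (M + 1) * s0" using s0(1) by simp
     ultimately have "4 * M * s0 <= eps * d\<^sup>2" by linarith
     then show ?thesis unfolding a_def using d(1) s0(1) by (simp add: pos_divide_le_eq mult_ac)
    qed
    finally show ?thesis using phle[OF sb(1), of x'] bd[OF xc sb(2,3)] by linarith
   next
    case 3
    then have "x' \<in> frontier Om" using xc O by (simp add: frontier_def interior_open)
    then show ?thesis using fr[of x' s] sb phle[OF sb(1), of x'] Mf[OF sb(1), of x'] ep by linarith
   next
    case 4
    then have "R <= norm (x' - y)" by (simp add: dist_norm norm_minus_commute)
    then have "R\<^sup>2 <= (norm (x' - y))\<^sup>2" by (rule power_mono) (use R(2) norm_ge_zero[of "x - y"] in linarith)
    then have "eps * R\<^sup>2 <= eps * (norm (x' - y))\<^sup>2" using ep by simp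
    moreover have "0 <= 3 * eps * (s - b)" using ep sb by simp
    ultimately show ?thesis using R(1) Mf[OF sb(1), of x'] bd[OF xc sb(2,3)] ep unfolding ph by linarith
   qed
  qed
  show "\<exists>a g h. rjet phi y x' s a g h \<and> a <= 2 * g * (0 * real CARD('n) + (1 - 2 * 0)) + 4 * (1 - 0) * h * (norm (x' - y))\<^sup>2 \<and> (x' = y \<or> g \<noteq> 0)"
   if x': "x' \<in> Om \<inter> ball y R" and ts: "t0 < s" "s < T1" for x' s
  proof -
   have xy: "x' \<noteq> y" using x' yc by auto
   define q where "q = s - b"
   have q: "0 < q" using ts t0 by (simp add: q_def)
   define Q where "Q = (norm (x' - y))\<^sup>2"
   define Y where "Y = Q * (1 / q)"
   have Q: "0 < Q" using xy by (simp add: Q_def)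
   have Y: "0 < Y" using Q q by (simp add: Y_def)
   define r where "r = sqrt Y"
   have r: "0 < r" "Y = r\<^sup>2" using Y by (auto simp: r_def)
   define l1 where "l1 = - (1 / (2 * r)) - 1 / 4"
   define l2 where "l2 = 1 / (4 * r ^ 3)"
   have pl: "peano2 (\<lambda>Y. - sqrt Y - Y / 4) Y l1 l2"
   proof -
    have "peano2 (\<lambda>Y. - sqrt Y - Y / 4) Y (- (1 / (2 * sqrt Y)) - 1 / 4) l2"
    proof (rule peano2I[of Y _ _ "\<lambda>Y. - (1 / (2 * sqrt Y)) - 1 / 4"])
     show "((\<lambda>Y. - sqrt Y - Y / 4) has_real_derivative - (1 / (2 * sqrt z)) - 1 / 4) (at z)" if "\<bar>z - Y\<bar> < Y" for z

     proof -
      have z: "0 < z" using that by (simp add: abs_less_iff)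
      have "((\<lambda>Y. Y / 4) has_real_derivative 1 / 4) (at z)" by (auto intro!: derivative_eq_intros)
      from DERIV_diff[OF DERIV_minus[OF DERIV_real_sqrt[OF z]] this]
      show ?thesis by (simp add: inverse_eq_divide mult.commute)
     qed
     have "((\<lambda>Y. - (1 / (2 * sqrt Y)) - 1 / 4) has_real_derivative - ((0 * (2 * sqrt Y) - 1 * (2 * (inverse (sqrt Y) / 2))) / ((2 * sqrt Y) * (2 * sqrt Y))) - 0) (at Y)"
      using Y by (intro DERIV_diff DERIV_minus DERIV_divide DERIV_const DERIV_cmult DERIV_real_sqrt) auto
     moreover have "- ((0 * (2 * sqrt Y) - 1 * (2 * (inverse (sqrt Y) / 2))) / ((2 * sqrt Y) * (2 * sqrt Y))) - 0 = l2"
      unfolding l2_def r_def[symmetric] using r(1) by (simp add: field_simps power3_eq_cube)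
     ultimately show "((\<lambda>Y. - (1 / (2 * sqrt Y)) - 1 / 4) has_real_derivative l2) (at Y)" by simp
    qed (rule Y)
    then show ?thesis by (simp add: l1_def r_def)
   qed
   obtain k3 where i3: "peano2 (\<lambda>t. 1 / (t - b)) s (- (1 / (s - b)\<^sup>2)) k3" using peano2_inverse_shift[of b s 1] q by (auto simp: q_def)
   have jY: "rjet (\<lambda>z. (norm (fst z - y))\<^sup>2 * (1 / (snd z - b))) y x' s (- (Y / q)) (1 / q) 0"
    by (rule rjet_cong[OF rjet_mult[OF rjet_dist[of y x' s] rjet_time[OF i3]]]) (auto simp: Y_def Q_def q_def power2_eq_square)
   define E where "E = exp (- sqrt Y - Y / 4)"
   have E: "0 < E" by (simp add: E_def)
   have pl': "peano2 (\<lambda>Y. - sqrt Y - Y / 4) ((norm (fst (x', s) - y))\<^sup>2 * (1 / (snd (x', s) - b))) l1 l2"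
    using pl by (simp add: Y_def Q_def q_def)
   have jf: "rjet f y x' s (E * (l1 * (- (Y / q)))) (E * (l1 * (1 / q))) (E * (l2 * (1 / q)\<^sup>2) + E * (l1 * (1 / q))\<^sup>2)"
    unfolding f_def
    by (rule rjet_cong[OF rjet_comp[OF rjet_comp[OF jY pl'] peano2_exp]]) (auto simp: E_def Y_def Q_def q_def)
   have jp: "rjet phi y x' s (M * (E * (l1 * (- (Y / q)))) - 3 * eps) (M * (E * (l1 * (1 / q))) - eps) (M * (E * (l2 * (1 / q)\<^sup>2) + E * (l1 * (1 / q))\<^sup>2))"
    unfolding phi_def
    by (rule rjet_cong[OF rjet_add[OF rjet_add[OF rjet_cmult[OF jf, of M] rjet_const[of "- M"]]
      rjet_cmult[OF rjet_add[OF rjet_add[OF rjet_dist rjet_const[of 1]] rjet_cmult[OF rjet_add[OF rjet_snd rjet_const[of "- b"]], of 3]], of "- eps"]]]) auto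
   have l10: "l1 < 0" 
   proof -
    have "0 < a ==> - a - 1 / 4 < 0" for a :: real by simp
    moreover have "0 < 1 / (2 * r)" using r by simp
    ultimately show ?thesis unfolding l1_def by blast
   qed
   have gneg: "M * (E * (l1 * (1 / q))) - eps < 0"
   proof -
    have "l1 * (1 / q) <= 0" using l10 q by (simp add: divide_nonpos_pos)
    moreover have "u <= 0 ==> M * (E * u) <= 0" for u using M E by (simp add: mult_nonneg_nonpos)
    ultimately have "M * (E * (l1 * (1 / q))) <= 0" by blast
    moreover have "a <= 0 ==> a - eps < 0" for a using ep by linarith
    ultimately show ?thesis by blast
   qed
   have alg: "0 <= 2 * l1 + 4 * Y * (l2 + l1\<^sup>2) + l1 * Y"
   proof -
    have "2 * l1 + 4 * Y * (l2 + l1\<^sup>2) + l1 * Y = 1/2 + r / 2"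
     unfolding l1_def l2_def r(2) using r(1) by (simp add: field_simps power2_eq_square power3_eq_cube)
    then show ?thesis using r by simp
   qed
   have "M * (E * (l1 * (- (Y / q)))) - 3 * eps <= 2 * (M * (E * (l1 * (1 / q))) - eps) + 4 * (M * (E * (l2 * (1 / q)\<^sup>2) + E * (l1 * (1 / q))\<^sup>2)) * Q"
   proof -
    have QY: "Q = Y * q" using q by (simp add: Y_def)
    have "2 * (M * (E * (l1 * (1 / q))) - eps) + 4 * (M * (E * (l2 * (1 / q)\<^sup>2) + E * (l1 * (1 / q))\<^sup>2)) * Q - (M * (E * (l1 * (- (Y / q)))) - 3 * eps)
     = M * E / q * (2 * l1 + 4 * Y * (l2 + l1\<^sup>2) + l1 * Y) + eps"
     unfolding QY using q by (simp add: field_simps power2_eq_square)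
    moreover have "0 <= M * E / q * (2 * l1 + 4 * Y * (l2 + l1\<^sup>2) + l1 * Y)" using M E q alg by simp
    moreover have "b' - a = c + eps ==> 0 <= c ==> a <= b'" for a b' c :: real using ep by simp
    ultimately show ?thesis by blast
   qed
   then have "M * (E * (l1 * (- (Y / q)))) - 3 * eps <= 2 * (M * (E * (l1 * (1 / q))) - eps) * (0 * real CARD('n) + (1 - 2 * 0)) + 4 * (1 - 0) * (M * (E * (l2 * (1 / q)\<^sup>2) + E * (l1 * (1 / q))\<^sup>2)) * Q"
    by (simp only: mult_zero_left mult_zero_right diff_zero add_0 mult_1_right)
   moreover have "M * (E * (l1 * (1 / q))) - eps \<noteq> 0" using gneg by (rule less_imp_neq)
   ultimately show ?thesis using jp unfolding Q_def[symmetric] by blast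
  qed
 qed
 moreover have "eps * (norm (x - y))\<^sup>2 + eps + 3 * eps * (t - b) = e0"
 proof -
  have "eps * ((norm (x - y))\<^sup>2 + 1 + 3 * (t - b)) = e0" using den by (simp add: eps_def)
  then show ?thesis by (simp add: algebra_simps)
 qed
 ultimately have "M * f (x, t) - M <= w (x, t) + e0" using ph[of x t] by linarith
 then show "M * exp (- sqrt ((norm (x - y))\<^sup>2 / (t - b)) - (norm (x - y))\<^sup>2 / (t - b) / 4) - M <= w (x, t) + e0"
  by (simp add: f_def)
qed

section \<open>Geometry of the domain, positivity, and the asymptotic formula\<close>

lemma psi_le:
 assumes "s \<in> {0..r}" shows "psi \<omega> r t <= sqrt (s\<^sup>2 + (t - \<omega> s)\<^sup>2)"
 unfolding psi_def by (rule cINF_lower[OF _ assms]) (auto intro!: bdd_belowI[of _ 0])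

lemma modulus_small:
 assumes "modulus_of_continuity \<omega>" "0 < t"
 obtains a where "0 < a" "\<And>s. 0 < s ==> s < a ==> \<omega> s < t"
proof -
 have "(\<omega> \<longlongrightarrow> 0) (at_right 0)" using assms(1) by (simp add: modulus_of_continuity_def)
 then have "\<forall>\<^sub>F s in at_right 0. \<omega> s < t" using assms(2) by (rule order_tendstoD)
 then show thesis using that unfolding eventually_at_right_field by blast
qed

lemma psi_pos:
 assumes m: "modulus_of_continuity \<omega>" and t: "0 < t" and r: "0 < r" shows "0 < psi \<omega> r t"
proof -
 obtain a where a: "0 < a" "\<And>s. 0 < s ==> s < a ==> \<omega> s < t / 2" using modulus_small[OF m, of "t / 2"] t by auto
 have w0: "\<omega> 0 = 0" using m by (simp add: modulus_of_continuity_def)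
 have "min (t / 2) a <= psi \<omega> r t" unfolding psi_def
 proof (rule cINF_greatest)
  fix s assume s: "s \<in> {0..r}"
  show "min (t / 2) a <= sqrt (s\<^sup>2 + (t - \<omega> s)\<^sup>2)"
  proof (cases "s < a")
   case True
   then have "\<omega> s < t / 2" using a(2)[of s] s w0 t by (cases "s = 0") auto
   then have "t <= 2 * (t - \<omega> s)" by simp
   moreover have "2 * (t - \<omega> s) <= 2 * \<bar>t - \<omega> s\<bar>" by (rule mult_left_mono[OF abs_ge_self]) simp
   ultimately have "t <= 2 * \<bar>t - \<omega> s\<bar>" by (rule order_trans)
   then have "t / 2 <= \<bar>t - \<omega> s\<bar>" by simp
   also have "\<dots> <= sqrt (s\<^sup>2 + (t - \<omega> s)\<^sup>2)" by (simp add: real_le_rsqrt)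
   finally show ?thesis by simp
  next
   case False
   have "a <= \<bar>s\<bar>" using False by simp
   also have "\<dots> <= sqrt (s\<^sup>2 + (t - \<omega> s)\<^sup>2)" by (simp add: real_le_rsqrt)
   finally show ?thesis by simp
  qed
 qed (use r in auto)
 moreover have "0 < min (t / 2) a" using a t by simp
 ultimately show ?thesis by linarith
qed

lemma psi_le_self:
 assumes "modulus_of_continuity \<omega>" "0 < t" "0 < r" shows "psi \<omega> r t <= t"
 using psi_le[of 0 r \<omega> t] assms by (simp add: modulus_of_continuity_def)

text \<open>
 If a boundary point \<open>q\<close> were closer than \<open>psi(t)\<close>, its horizontal distance \<open>sg\<close> from \<open>y\<close> and its height, at most \<open>\<omega>(sg)\<close>, would contradict the
 definition of \<open>psi\<close>; when \<open>\<omega>(sg) > t\<close> one uses a smaller horizontal distance with \<open>\<omega>(s) = t\<close>.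
\<close>

lemma exterior_point:
 fixes Om :: "(real^'n) set"
 assumes m: "modulus_of_continuity \<omega>" and c: "class_C0 \<omega> r Om" and O: "open Om" and y: "y \<in> frontier Om" and t: "0 < t" "2 * t < r"
 shows "\<exists>e. norm e = 1 \<and> (\<forall>q\<in>closure Om. psi \<omega> r t <= norm (q - (y + t *\<^sub>R e)))"
proof -
 obtain e phi where e: "norm e = 1" and in1: "ball y r \<inter> Om = {x \<in> ball y r. x \<bullet> e < phi (horizontal e x)}"
  and in2: "ball y r \<inter> frontier Om = {x \<in> ball y r. x \<bullet> e = phi (horizontal e x)}"
  and lip: "\<And>y' z'. y' \<bullet> e = 0 ==> z' \<bullet> e = 0 ==> y' + phi y' *\<^sub>R e \<in> ball y r \<inter> frontier Om ==>
      z' + phi z' *\<^sub>R e \<in> ball y r \<inter> frontier Om ==> \<bar>phi y' - phi z'\<bar> <= \<omega> (norm (y' - z'))"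
  using c y unfolding class_C0_def by blast
 have ee: "e \<bullet> e = 1" using e by (simp add: dot_square_norm)
 have w0: "\<omega> 0 = 0" and cw: "continuous_on {0<..} \<omega>" using m by (auto simp: modulus_of_continuity_def)
 have r: "0 < r" "t < r" using t by auto
 define z where "z = y + t *\<^sub>R e"
 have yb: "y \<bullet> e = phi (horizontal e y)" 
 proof -
  have "y \<in> ball y r \<inter> frontier Om" using y r by simp
  then show ?thesis unfolding in2 by (simp only: mem_Collect_eq)
 qed
 have ze: "z \<bullet> e = y \<bullet> e + t" by (simp add: z_def inner_add_left ee)
 have hz: "horizontal e z = horizontal e y" unfolding horizontal_def ze by (simp add: z_def scaleR_left_distrib)
 have zb: "z \<in> ball y r" using r t e by (simp add: z_def dist_norm)
 have zO: "z \<notin> Om"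
 proof
  assume "z \<in> Om"
  then have "z \<in> ball y r \<inter> Om" using zb by simp
  then have "z \<bullet> e < phi (horizontal e z)" unfolding in1 by (simp only: mem_Collect_eq)
  then show False using t(1) unfolding hz ze yb[symmetric] by simp
 qed
 have fr: "psi \<omega> r t <= norm (q - z)" if q: "q \<in> frontier Om" for q
 proof (rule ccontr)
  assume n: "\<not> psi \<omega> r t <= norm (q - z)"
  have qt: "norm (q - z) < t" using n psi_le_self[OF m t(1) r(1)] by linarith
  have "norm (q - y) <= norm (q - z) + norm (z - y)" using norm_triangle_ineq[of "q - z" "z - y"] by simp
  also have "norm (z - y) = t" using e t by (simp add: z_def)
  finally have qb: "q \<in> ball y r" using qt t by (simp add: dist_norm norm_minus_commute)
  have qe: "q \<bullet> e = phi (horizontal e q)" 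
  proof -
   have "q \<in> ball y r \<inter> frontier Om" using q qb by simp
   then show ?thesis unfolding in2 by (simp only: mem_Collect_eq)
  qed
  have ho: "horizontal e x \<bullet> e = 0" for x by (simp add: horizontal_def inner_diff_left ee)
  have rec: "horizontal e x + (x \<bullet> e) *\<^sub>R e = x" for x by (simp add: horizontal_def)
  define sg where "sg = norm (horizontal e q - horizontal e y)"
  have l: "\<bar>q \<bullet> e - y \<bullet> e\<bar> <= \<omega> sg"
   unfolding qe yb sg_def
  proof (rule lip[OF ho ho])
   show "horizontal e q + phi (horizontal e q) *\<^sub>R e \<in> ball y r \<inter> frontier Om" using rec[of q] q qb unfolding qe[symmetric] by simp
   show "horizontal e y + phi (horizontal e y) *\<^sub>R e \<in> ball y r \<inter> frontier Om" using rec[of y] y r unfolding yb[symmetric] by simp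
  qed
  define b where "b = q \<bullet> e - y \<bullet> e - t"
  have dec: "q - z = (horizontal e q - horizontal e y) + b *\<^sub>R e"
   by (simp add: horizontal_def b_def z_def scaleR_left_diff_distrib)
  have nn: "(norm (q - z))\<^sup>2 = sg\<^sup>2 + b\<^sup>2"
  proof -
   have "(horizontal e q - horizontal e y) \<bullet> e = 0" by (simp add: inner_diff_left ho)
   then show ?thesis unfolding dec sg_def power2_norm_eq_inner
    by (simp add: inner_add_left inner_add_right inner_commute ee power2_eq_square)
  qed
  have sq: "norm (q - z) = sqrt (sg\<^sup>2 + b\<^sup>2)" using nn by (metis norm_ge_zero real_sqrt_unique)
  have s0: "0 <= sg" by (simp add: sg_def)
  have sle: "sg <= norm (q - z)" unfolding sq by (simp add: real_le_rsqrt)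
  then have sr: "sg \<in> {0..r}" using s0 qt r by auto
  show False
  proof (cases "\<omega> sg <= t")
   case True
   have "(t - \<omega> sg)\<^sup>2 <= (- b)\<^sup>2" using True l unfolding b_def by (intro power_mono) auto
   then have "sqrt (sg\<^sup>2 + (t - \<omega> sg)\<^sup>2) <= norm (q - z)" unfolding sq by simp
   then show False using psi_le[OF sr, of \<omega> t] n by linarith
  next
   case False
   have sp: "0 < sg" using False s0 w0 t by (cases "sg = 0") auto
   obtain a where a: "0 < a" "\<And>s. 0 < s ==> s < a ==> \<omega> s < t" using modulus_small[OF m t(1)] by blast
   define a' where "a' = min a sg / 2"
   have a': "0 < a'" "a' < a" "a' <= sg" using a sp by (auto simp: a'_def min_def)
   have "continuous_on {a'..sg} \<omega>" by (rule continuous_on_subset[OF cw]) (use a' in auto)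
   then have "\<exists>s. a' <= s \<and> s <= sg \<and> \<omega> s = t"
    using a(2)[OF a'(1,2)] a' False by (intro IVT') auto
   then obtain s where s: "a' <= s" "s <= sg" "\<omega> s = t" by blast
   have "psi \<omega> r t <= sqrt (s\<^sup>2 + (t - \<omega> s)\<^sup>2)" by (rule psi_le) (use s a' sr in auto)
   also have "\<dots> = s" using s a' by simp
   finally show False using n s sle by linarith
  qed
 qed
 show ?thesis
 proof (intro exI[of _ e] conjI ballI e)
  fix q assume q: "q \<in> closure Om"
  show "psi \<omega> r t <= norm (q - (y + t *\<^sub>R e))"
  proof (cases "q \<in> Om")
   case False
   then have "q \<in> frontier Om" using q O by (simp add: frontier_def interior_open)
   then show ?thesis using fr by (simp add: z_def)
  next
   case True
   have "closed_segment z q \<inter> frontier Om \<noteq> {}"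
    by (rule connected_Int_frontier) (use True zO in auto)
   then obtain q' where q': "q' \<in> closed_segment z q" "q' \<in> frontier Om" by blast
   have "norm (q' - z) <= norm (q - z)" using segment_bound1[OF q'(1)] by (simp add: norm_minus_commute)
   then show ?thesis using fr[OF q'(2)] by (simp add: z_def)
  qed
 qed
qed

lemma Fq_scale: "isqf q ==> c \<noteq> 0 ==> Fq alpha (c *\<^sub>R eta) q = Fq alpha eta q"
 by (simp add: Fq_def isqf_hom power_mult_distrib)

text \<open>
 Scaling by a positive constant and adding a function that is semiconcave and nondecreasing in time preserve supersolutions.
\<close>

lemma super_at_transform:
 fixes u u' :: "(real^'n) \<times> real => real"
 assumes su: "super_at alpha u x t" and c: "0 < c" and b: "0 <= b" and d: "0 < d"
  and le: "\<And>v s. norm v < d ==> \<bar>s\<bar> < d ==> u' (x + v, t + s) - u' (x, t) <= c * (u (x + v, t + s) - u (x, t)) + b * s + C * s\<^sup>2"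
 shows "super_at alpha u' x t"
 unfolding super_at_def
proof (intro allI impI)
 fix phi a xi q m
 assume j: "pjet phi x t a xi q" and q: "isqf q"
  and T: "\<exists>dlt>0. \<forall>v s. norm v < dlt --> \<bar>s\<bar> < dlt --> u' (x, t) - phi (x, t) <= u' (x + v, t + s) - phi (x + v, t + s)"
  and F: "\<exists>rho>0. \<forall>eta. eta \<noteq> 0 --> norm (eta - xi) < rho --> m <= Fq alpha eta q"
 define pf where "pf = (\<lambda>z. inverse c * (phi z + ((- b) * (snd z + - t) + (- C) * (snd z + - t)\<^sup>2)))"
 note s = pjet_add[OF pjet_snd[of x t] pjet_const[of "- t"]]
 have jp: "pjet pf x t (inverse c * (a - b)) (inverse c *\<^sub>R xi) (\<lambda>v. inverse c * q v)"
  unfolding pf_def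
  by (rule pjet_cong[OF pjet_cmult[OF pjet_add[OF j pjet_add[OF pjet_cmult[OF s, of "- b"] pjet_cmult[OF pjet_comp[OF s peano2_square], of "- C"]]], of "inverse c"]]) auto
 obtain dlt where dl: "0 < dlt" "\<And>v s. norm v < dlt ==> \<bar>s\<bar> < dlt ==> u' (x, t) - phi (x, t) <= u' (x + v, t + s) - phi (x + v, t + s)"
  using T by blast
 obtain rho where rho: "0 < rho" "\<And>eta. eta \<noteq> 0 ==> norm (eta - xi) < rho ==> m <= Fq alpha eta q" using F by blast
 have "inverse c * m <= inverse c * (a - b)"
 proof (rule su[unfolded super_at_def, rule_format, OF jp isqf_cmult[OF q]])
  show "\<exists>dlt>0. \<forall>v s. norm v < dlt --> \<bar>s\<bar> < dlt --> u (x, t) - pf (x, t) <= u (x + v, t + s) - pf (x + v, t + s)"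
  proof (intro exI[of _ "min dlt d"] conjI allI impI)
   fix v :: "real^'n" and s assume "norm v < min dlt d" "\<bar>s\<bar> < min dlt d"
   then have "phi (x + v, t + s) - phi (x, t) <= c * (u (x + v, t + s) - u (x, t)) + b * s + C * s\<^sup>2"
    using dl(2)[of v s] le[of v s] by simp
   then have "inverse c * (phi (x + v, t + s) - phi (x, t) - b * s - C * s\<^sup>2) <= inverse c * (c * (u (x + v, t + s) - u (x, t)))"
    using c by (intro mult_left_mono) auto
   then show "u (x, t) - pf (x, t) <= u (x + v, t + s) - pf (x + v, t + s)"
    unfolding pf_def
   proof -
    assume A: "inverse c * (phi (x + v, t + s) - phi (x, t) - b * s - C * s\<^sup>2) <= inverse c * (c * (u (x + v, t + s) - u (x, t)))"
    have ic: "inverse c * (c * X) = X" for X unfolding mult.assoc[symmetric] using c by simp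
    from A have "inverse c * (phi (x + v, t + s) - phi (x, t) - b * s - C * s\<^sup>2) <= u (x + v, t + s) - u (x, t)" unfolding ic .
    then show "u (x, t) - inverse c * (phi (x, t) + (- b * (snd (x, t) + - t) + - C * (snd (x, t) + - t)\<^sup>2))
     <= u (x + v, t + s) - inverse c * (phi (x + v, t + s) + (- b * (snd (x + v, t + s) + - t) + - C * (snd (x + v, t + s) + - t)\<^sup>2))"
     by (simp add: algebra_simps)
   qed
  qed (use dl d in simp)
  show "\<exists>rho>0. \<forall>eta. eta \<noteq> 0 --> norm (eta - inverse c *\<^sub>R xi) < rho --> inverse c * m <= Fq alpha eta (\<lambda>v. inverse c * q v)"
  proof (intro exI[of _ "inverse c * rho"] conjI allI impI)
   fix eta :: "real^'n" assume e: "eta \<noteq> 0" "norm (eta - inverse c *\<^sub>R xi) < inverse c * rho"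
   have "c *\<^sub>R eta - xi = c *\<^sub>R (eta - inverse c *\<^sub>R xi)" using c by (simp add: scaleR_diff_right)
   then have "norm (c *\<^sub>R eta - xi) = c * norm (eta - inverse c *\<^sub>R xi)" using c by simp
   also have "\<dots> < c * (inverse c * rho)" using e(2) c by (intro mult_strict_left_mono) auto
   also have "c * (inverse c * rho) = rho" unfolding mult.assoc[symmetric] using c by simp
   finally have "norm (c *\<^sub>R eta - xi) < rho" .
   then have "m <= Fq alpha (c *\<^sub>R eta) q" using e(1) c by (intro rho(2)) auto
   then show "inverse c * m <= Fq alpha eta (\<lambda>v. inverse c * q v)" unfolding Fq_cmult using c Fq_scale[OF q, of c] by simp
  qed (use rho c in simp)
 qed
 then show "m <= a" using c b by simp
qed

text \<open>
 At a zero of a nonpositive function every test from below has zero gradient and a nonpositive Hessian.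
\<close>

lemma super_at_cut:
 fixes v :: "(real^'n) \<times> real => real"
 assumes al: "0 < alpha" "alpha < 1" and le: "\<And>z. v z <= 0" and z: "v (x, t) = 0"
 shows "super_at alpha v x t"
 unfolding super_at_def
proof (intro allI impI)
 fix phi a xi q m
 assume j: "pjet phi x t a xi q" and q: "isqf q"
  and T: "\<exists>dlt>0. \<forall>w s. norm w < dlt --> \<bar>s\<bar> < dlt --> v (x, t) - phi (x, t) <= v (x + w, t + s) - phi (x + w, t + s)"
  and F: "\<exists>rho>0. \<forall>eta. eta \<noteq> 0 --> norm (eta - xi) < rho --> m <= Fq alpha eta q"
 obtain dlt where dl: "0 < dlt" "\<And>w s. norm w < dlt ==> \<bar>s\<bar> < dlt ==> v (x, t) - phi (x, t) <= v (x + w, t + s) - phi (x + w, t + s)"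
  using T by blast
 have mn: "- phi (x, t) <= - phi (x + w, t + s)" if "norm w < dlt" "\<bar>s\<bar> < dlt" for w s
  using dl(2)[OF that] le[of "(x + w, t + s)"] z by linarith
 note jm = pjet_minus[OF j]
 have "- a = 0" "- xi = 0" using pjet_min2[OF jm dl(1) mn] by auto
 have qn: "q w <= 0" for w
 proof -
  have "0 <= - q w"
  proof (rule pjet_min(2)[OF jm dl(1)])
   show "- phi (x, t) <= - phi (x + w, t + s)" if "norm w < dlt" "- dlt < s" "s <= 0" for w s by (rule mn) (use that dl(1) in auto)
  qed (simp add: isqf_hom[OF q])
  then show ?thesis by simp
 qed
 obtain rho where rho: "0 < rho" "\<And>eta. eta \<noteq> 0 ==> norm (eta - xi) < rho ==> m <= Fq alpha eta q" using F by blast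
 obtain i :: 'n where True by simp
 define eta where "eta = (rho / 2) *\<^sub>R (axis i 1 :: real^'n)"
 have e0: "eta \<noteq> 0" using rho by (simp add: eta_def axis_eq_0_iff)
 have "m <= Fq alpha eta q" by (rule rho(2)[OF e0]) (use \<open>- xi = 0\<close> rho(1) in \<open>simp add: eta_def\<close>)
 also have "\<dots> = (\<Sum>k\<in>UNIV. q (cpl alpha 0 k eta))" by (rule coupl_Fq[OF coupl_cpl[OF al] e0 q, symmetric]) simp
 also have "\<dots> <= 0" by (intro sum_nonpos qn)
 finally show "m <= a" using \<open>- a = 0\<close> by simp
qed

lemma contraction_iterate:
 fixes w :: "'a => real"
 assumes th: "0 < tht" "tht < 1" and M0: "0 < M0" "\<And>z. z \<in> S ==> - M0 <= w z"
  and st: "\<And>M. 0 < M ==> (\<And>z. z \<in> S ==> - M <= w z) ==> (\<And>z. z \<in> S ==> - (tht * M) <= w z)"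
  and z: "z \<in> S"
 shows "0 <= w z"
proof -
 have it: "\<forall>z\<in>S. - (tht ^ k * M0) <= w z" for k
 proof (induction k)
  case (Suc k)
  have "0 < tht ^ k * M0" using th M0 by simp
  from st[OF this] Suc show ?case by (simp add: mult.assoc)
 qed (use M0 in simp)
 have "(\<lambda>k. - (tht ^ k * M0)) \<longlonglongrightarrow> - (0 * M0)"
  by (intro tendsto_minus tendsto_mult tendsto_const LIMSEQ_power_zero) (use th in simp)
 then have "(\<lambda>k. - (tht ^ k * M0)) \<longlonglongrightarrow> 0" by simp
 then show ?thesis by (rule LIMSEQ_le_const2) (use it z in auto)
qed

text \<open>
 To apply the contraction on \<open>(0, Tz)\<close> only, a function of time that vanishes up to the time of interest and then grows quickly is
 added; it restores the lower bound at later times.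
\<close>

lemma positivity_fin:
 fixes Om :: "(real^'n) set"
 assumes al: "0 < alpha" "alpha < 1" and O: "open Om"
  and cw: "continuous_on (closure Om \<times> {0<..}) w"
  and sup: "\<And>x t. x \<in> Om ==> 0 < t ==> super_at alpha w x t"
  and bd: "0 < M0" "\<And>x t. x \<in> closure Om ==> 0 < t ==> - M0 <= w (x, t)"
  and fr: "\<And>x t. x \<in> frontier Om ==> 0 < t ==> 0 <= w (x, t)"
  and ini: "\<And>K e. compact K ==> K \<subseteq> Om ==> 0 < e ==> \<exists>tb>0. \<forall>x\<in>K. \<forall>t. 0 < t --> t <= tb --> - e <= w (x, t)"
 shows "\<exists>Tz>0. \<forall>x\<in>Om. \<forall>t. 0 < t --> t < Tz --> 0 <= w (x, t)"
proof -
 obtain Tz where Tz: "0 < Tz" and con: "\<And>v x t. continuous_on (UNIV \<times> {0<..}) v ==> \<forall>x t. 0 < t --> -1 <= v (x, t) ==>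
   \<forall>x t. 0 < t --> super_at alpha v x t ==>
   \<forall>x0 eta e. 0 < eta --> 0 < e --> (\<exists>tb>0. \<forall>t x. 0 < t --> t <= tb --> -1 <= v (x, t) + v (x, t + eta) + (norm (x - x0))\<^sup>2 + e) ==>
   0 < t ==> t <= Tz ==> -5/8 <= v (x :: real^'n, t)"
  using contraction_fin[OF al, where 'n = 'n] by metis
 have step: "- (5/8 * M) <= w (x1, t1)"
  if M: "0 < M" "\<And>z. z \<in> Om \<times> {0<..<Tz} ==> - M <= w z" and x1: "x1 \<in> Om" "0 < t1" "t1 < Tz" for M x1 t1
 proof -
  define K where "K = M0 / M / (Tz - t1)\<^sup>2"
  have K: "0 < K" using M bd x1 by (simp add: K_def)
  define tht where "tht = (\<lambda>s. K * (max 0 (s - t1))\<^sup>2)"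
  have th0: "0 <= tht s" for s using K by (simp add: tht_def)
  have thb: "M0 / M <= tht s" if "Tz <= s" for s
  proof -
   have "(Tz - t1)\<^sup>2 <= (max 0 (s - t1))\<^sup>2" using that x1 by (intro power_mono) auto
   then have "K * (Tz - t1)\<^sup>2 <= tht s" unfolding tht_def using K by simp
   moreover have "K * (Tz - t1)\<^sup>2 = M0 / M" unfolding K_def using x1 by simp
   ultimately show ?thesis by simp
  qed
  have thq: "tht (s + h) <= tht s + 2 * K * max 0 (s - t1) * h + K * h\<^sup>2" for s h
  proof -
   have "(max 0 (p + h))\<^sup>2 <= (max 0 p)\<^sup>2 + 2 * max 0 p * h + h\<^sup>2" for p :: real
   proof (cases "0 <= p")
    case True
    have "(max 0 (p + h))\<^sup>2 <= \<bar>p + h\<bar>\<^sup>2" by (intro power_mono) auto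
    then show ?thesis using True by (simp add: power2_sum)
   next
    case False
    have "(max 0 (p + h))\<^sup>2 <= \<bar>h\<bar>\<^sup>2" using False by (intro power_mono) auto
    then show ?thesis using False by simp
   qed
   from this[of "s - t1"] have "(max 0 (s + h - t1))\<^sup>2 <= (max 0 (s - t1))\<^sup>2 + 2 * max 0 (s - t1) * h + h\<^sup>2" by (simp add: algebra_simps)
   from mult_left_mono[OF this, of K] show ?thesis using K unfolding tht_def by (simp add: algebra_simps)
  qed
  define v where "v = (\<lambda>z. if fst z \<in> Om then min 0 (w z / M + tht (snd z)) else 0)"
  have vle: "v z <= 0" for z by (simp add: v_def)
  have vge: "- 1 <= v (x, t)" if "0 < t" for x t
  proof (cases "x \<in> Om")
   case True
   have "- 1 <= w (x, t) / M + tht t"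
   proof (cases "t < Tz")
    case True
    then have "- M <= w (x, t)" using M(2) \<open>x \<in> Om\<close> that by simp
    then have "- 1 <= w (x, t) / M" using M(1) by (simp add: pos_le_divide_eq)
    then show ?thesis using th0[of t] by linarith
   next
    case False
    have "- M0 / M <= w (x, t) / M" using bd(2)[of x t] True that closure_subset M(1) by (intro divide_right_mono) auto
    then show ?thesis using thb[of t] False by simp
   qed
   then show ?thesis by (simp add: v_def)
  qed (simp add: v_def)
  have cth: "continuous_on UNIV tht" unfolding tht_def by (intro continuous_intros)
  have cv: "continuous_on (UNIV \<times> {0<..}) v"
  proof -
   have un: "closure Om \<times> {0<..} \<union> (- Om) \<times> {0<..} = (UNIV :: (real^'n) set) \<times> {0 :: real<..}" using closure_subset by auto
   have cl1: "closedin (top_of_set ((UNIV :: (real^'n) set) \<times> {0 :: real<..})) (closure Om \<times> {0<..})"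
    unfolding closedin_closed by (rule exI[of _ "closure Om \<times> UNIV"]) (auto intro: closed_Times)
   have cl2: "closedin (top_of_set ((UNIV :: (real^'n) set) \<times> {0 :: real<..})) ((- Om) \<times> {0<..})"
    unfolding closedin_closed by (rule exI[of _ "(- Om) \<times> UNIV"]) (auto intro!: closed_Times simp: closed_Compl O)
   have "continuous_on (closure Om \<times> {0<..} \<union> (- Om) \<times> {0<..}) (\<lambda>z. if fst z \<in> Om then min 0 (w z / M + tht (snd z)) else 0)"
   proof (rule continuous_on_cases_local)
    show "continuous_on (closure Om \<times> {0<..}) (\<lambda>z. min 0 (w z / M + tht (snd z)))"
     by (intro continuous_intros cw continuous_on_compose2[OF cth]) (use M in auto)
    fix z :: "(real^'n) \<times> real" assume z: "z \<in> closure Om \<times> {0<..} \<and> fst z \<notin> Om \<or> z \<in> (- Om) \<times> {0<..} \<and> fst z \<in> Om"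
    then have "fst z \<in> frontier Om" "0 < snd z" using O by (auto simp: frontier_def interior_open)
    then have "0 <= w z" using fr[of "fst z" "snd z"] by simp
    then have "0 <= w z / M + tht (snd z)" using th0[of "snd z"] M(1) by simp
    then show "min 0 (w z / M + tht (snd z)) = 0" by simp
   qed (use cl1 cl2 un in auto)
   then show ?thesis unfolding un v_def .
  qed
  have sv: "super_at alpha v x t" if t: "0 < t" for x t
  proof (cases "v (x, t) = 0")
   case True then show ?thesis by (rule super_at_cut[OF al vle])
  next
   case False
   then have xO: "x \<in> Om" and ve: "v (x, t) = w (x, t) / M + tht t" by (auto simp: v_def min_def split: if_splits)
   obtain d where d: "0 < d" "ball x d \<subseteq> Om" using O xO unfolding open_contains_ball by blast
   show ?thesis
   proof (rule super_at_transform[OF sup[OF xO t], of "1 / M" "2 * K * max 0 (t - t1)" d])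
    fix y :: "real^'n" and s assume "norm y < d" "\<bar>s\<bar> < d"
    then have "x + y \<in> Om" using d by (auto simp: dist_norm)
    then have "v (x + y, t + s) <= w (x + y, t + s) / M + tht (t + s)" by (simp add: v_def)
    then show "v (x + y, t + s) - v (x, t) <= 1 / M * (w (x + y, t + s) - w (x, t)) + 2 * K * max 0 (t - t1) * s + K * s\<^sup>2"
     using thq[of t s] unfolding ve by (simp add: diff_divide_distrib)
   qed (use M K d in auto)
  qed
  have start: "\<exists>tb>0. \<forall>t x. 0 < t --> t <= tb --> -1 <= v (x, t) + v (x, t + eta) + (norm (x - x0))\<^sup>2 + e" if et: "0 < eta" "0 < e" for x0 eta e
  proof -
   define S where "S = cball x0 1 \<times> {eta..2 * eta}"
   have cS: "compact S" unfolding S_def by (intro compact_Times) auto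
   have cvS: "continuous_on S v" by (rule continuous_on_subset[OF cv]) (use et in \<open>auto simp: S_def\<close>)
   define KK where "KK = {z \<in> S. v z <= - e}"
   have KKe: "KK = S \<inter> (S \<inter> v -` {..- e})" by (auto simp: KK_def)
   have "compact KK" unfolding KKe
    by (rule compact_Int_closed[OF cS continuous_closed_preimage[OF cvS compact_imp_closed[OF cS] closed_atMost]])
   then have cK: "compact (fst ` KK)" by (intro compact_continuous_image continuous_intros)
   have "fst ` KK \<subseteq> Om" using et by (auto simp: KK_def v_def split: if_splits)
   moreover have "0 < e * M" using et M by simp
   ultimately obtain tb where "0 < tb" "\<forall>x\<in>fst ` KK. \<forall>t. 0 < t --> t <= tb --> - (e * M) <= w (x, t)"
    using ini[OF cK] by blast
   note tb = this(1) this(2)[rule_format]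
   show ?thesis
   proof (intro exI[of _ "min tb eta"] conjI allI impI)
    fix t x assume t: "0 < t" "t <= min tb eta"
    have v1: "- 1 <= v (x, t)" "- 1 <= v (x, t + eta)" using vge t et by auto
    have n0: "0 <= (norm (x - x0))\<^sup>2" by simp
    consider "1 <= norm (x - x0)" | "- e < v (x, t + eta)" | "norm (x - x0) < 1" "v (x, t + eta) <= - e" by linarith
    then show "-1 <= v (x, t) + v (x, t + eta) + (norm (x - x0))\<^sup>2 + e"
    proof cases
     case 1
     then have "1 <= (norm (x - x0))\<^sup>2" by simp
     then show ?thesis using v1 et by linarith
    next
     case 2 then show ?thesis using v1 n0 by linarith
    next
     case 3
     then have "(x, t + eta) \<in> KK" using t by (auto simp: KK_def S_def dist_norm norm_minus_commute)
     then have "x \<in> fst ` KK" by force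
     then have "- (e * M) <= w (x, t)" using tb(2) t by simp
     then have "- e <= w (x, t) / M" using M by (simp add: pos_le_divide_eq)
     then have "- e <= v (x, t)" using th0[of t] et by (simp add: v_def)
     then show ?thesis using v1 n0 by linarith
    qed
   qed (use tb et in simp)
  qed
  have "-5/8 <= v (x1, t1)"
   by (rule con[OF cv]) (use vge sv start x1 in auto)
  moreover have "tht t1 = 0" by (simp add: tht_def)
  ultimately have "-5/8 <= w (x1, t1) / M" using x1 by (simp add: v_def)
  then show ?thesis using M by (simp add: pos_le_divide_eq)
 qed
 have "0 <= w (x, t)" if "x \<in> Om" "0 < t" "t < Tz" for x t
 proof (rule contraction_iterate[where tht = "5/8" and S = "Om \<times> {0<..<Tz}" and ?M0.0 = M0])
  show "- (5/8 * M) <= w z" if "0 < M" "\<And>z. z \<in> Om \<times> {0<..<Tz} ==> - M <= w z" "z \<in> Om \<times> {0<..<Tz}" for M z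
   using step[OF that(1,2), of "fst z" "snd z"] that(3) by auto
  show "- M0 <= w z" if "z \<in> Om \<times> {0<..<Tz}" for z using bd(2)[of "fst z" "snd z"] that subsetD[OF closure_subset[of Om], of "fst z"] by auto
 qed (use that bd in auto)
 then show ?thesis using Tz by blast
qed

lemma cball_inside:
 fixes Om :: "(real^'n) set"
 assumes x: "x \<in> Om" and R: "0 <= R" "R < infdist x (frontier Om)"
 shows "cball x R \<subseteq> Om"
proof (rule ccontr)
 assume "\<not> cball x R \<subseteq> Om"
 then have 1: "cball x R - Om \<noteq> {}" by blast
 have "x \<in> cball x R \<inter> Om" using x R by simp
 then have 2: "cball x R \<inter> Om \<noteq> {}" by blast
 have "cball x R \<inter> frontier Om \<noteq> {}"
  by (rule connected_Int_frontier[OF convex_connected[OF convex_cball] 2 1])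
 then obtain q where "q \<in> frontier Om" "dist x q <= R" by auto
 then show False using infdist_le[of q "frontier Om" x] R by linarith
qed

text \<open>
 Near the boundary, at distance at most \<open>8 sqrt t\<close>, the boundary barrier applies, and further inside the ball barrier.
\<close>

lemma positivity_inf:
 fixes Om :: "(real^'n) set"
 assumes O: "open Om" and ne: "frontier Om \<noteq> {}"
  and cw: "continuous_on (closure Om \<times> {0<..}) w"
  and cc: "continuous_on (Om \<times> {0..}) w" and u0: "\<And>x. x \<in> Om ==> w (x, 0) = 0"
  and sup: "\<And>x t. x \<in> Om ==> 0 < t ==> super_at 0 w x t"
  and bd: "0 < M0" "\<And>x t. x \<in> closure Om ==> 0 < t ==> - M0 <= w (x, t)"
  and fr: "\<And>x t. x \<in> frontier Om ==> 0 < t ==> 0 <= w (x, t)"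
  and x: "x \<in> Om" "0 < t"
 shows "0 <= w (x, t)"
proof -
 define T where "T = t + 1"
 define gam where "gam = exp (- sqrt 128 - 128 / 4 :: real)"
 have "- a - 128 / 4 <= 0" if "0 <= a" for a :: real using that by simp
 from this[OF real_sqrt_ge_zero, of 128] have gm: "0 < gam" "gam <= 1" unfolding gam_def by (simp_all only: exp_gt_zero exp_le_one_iff)
 define tht where "tht = max (1/2) (1 - gam)"
 have th: "0 < tht" "tht < 1" "1/2 <= tht" "1 - gam <= tht" using gm by (auto simp: tht_def)
 have step: "- (tht * M) <= w (y1, t1)"
  if M: "0 < M" "\<And>z. z \<in> Om \<times> {0<..<T} ==> - M <= w z" and y1: "y1 \<in> Om" "0 < t1" "t1 < T" for M y1 t1
 proof (cases "(infdist y1 (frontier Om))\<^sup>2 <= 64 * t1")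
  case True
  obtain y where y: "y \<in> frontier Om" "infdist y1 (frontier Om) = dist y1 y"
   using infdist_attains_inf[OF frontier_closed ne] by blast
  define X where "X = (norm (y1 - y))\<^sup>2 / (t1 - t1 / 2)"
  have "M * exp (- sqrt X - X / 4) - M <= w (y1, t1)" unfolding X_def
  proof (rule near_boundary_inf[OF O _ cw sup _ fr y(1) y1(1), where T = T])
   fix z s assume zs: "z \<in> closure Om" "0 < s" "s < T"
   show "- M <= w (z, s)"
   proof (cases "z \<in> Om")
    case True then show ?thesis using M(2)[of "(z, s)"] zs by simp
   next
    case False
    then have "z \<in> frontier Om" using zs O by (simp add: frontier_def interior_open)
    then show ?thesis using fr[of z s] zs M(1) by simp
   qed
  qed (use y1 M in auto)
  moreover have "X <= 128"
  proof -
   have "(norm (y1 - y))\<^sup>2 <= 128 * (t1 / 2)" using True y(2) by (simp add: dist_norm)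
   moreover have "t1 - t1 / 2 = t1 / 2" by simp
   ultimately show ?thesis unfolding X_def using y1(2) by (simp only: pos_divide_le_eq half_gt_zero)
  qed
  moreover have "gam <= exp (- sqrt X - X / 4)"
  proof -
   have "sqrt X <= sqrt 128" "X / 4 <= 128 / 4" using \<open>X <= 128\<close> by simp_all
   moreover have "a <= b ==> c <= d ==> - b - d <= - a - c" for a b c d :: real by simp
   ultimately show ?thesis unfolding gam_def exp_le_cancel_iff by blast
  qed
  then have "M * gam <= M * exp (- sqrt X - X / 4)" using M(1) by (intro mult_left_mono) auto
  moreover have "M * (1 - gam) <= M * tht" using th(4) M(1) by (intro mult_left_mono) auto
  ultimately show ?thesis by (simp add: algebra_simps)
 next
  case False
  define R where "R = sqrt (64 * t1)"
  have R: "0 < R" "R\<^sup>2 = 64 * t1" using y1 by (auto simp: R_def)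
  have "R < infdist y1 (frontier Om)"
   using False infdist_nonneg[of y1 "frontier Om"] by (metis R_def linorder_not_less real_sqrt_le_iff real_sqrt_abs abs_of_nonneg)
  then have sub: "cball y1 R \<subseteq> Om" by (intro cball_inside y1) (use R in auto)
  define T1 where "T1 = min (2 * t1) ((t1 + T) / 2)"
  have "t1 < (t1 + T) / 2" "(t1 + T) / 2 < T" using y1 by simp_all
  then have T1: "t1 < T1" "T1 <= 2 * t1" "T1 < T" unfolding T1_def using y1 by (simp_all add: min_less_iff_disj)
  define X where "X = 2 * 1 + 2 + 1 / 2 * (ln ((1 - 0) * T1 * (1 + 2) + R\<^sup>2 / 2) - ln ((1 - 0) * t1) - ln (1 + 2)) - R\<^sup>2 / (4 * (1 - 0) * t1)"
  have F1: "- (M * exp X) <= w (y1, t1)" unfolding X_def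
  proof (rule ball_lower[where alpha = 0 and n = 1])
   show "continuous_on (cball y1 R \<times> {0..T1}) w" by (rule continuous_on_subset[OF cc]) (use sub in auto)
   show "w (x, 0) = 0" if "x \<in> cball y1 R" for x using u0 sub that by auto
   show "super_at 0 w x s" if "x \<in> ball y1 R" "0 < s" "s < T1" for x s using sup sub that ball_subset_cball by blast
   show "- M <= w (x, s)" if a: "x \<in> cball y1 R" "0 <= s" "s <= T1" for x s
   proof (cases "s = 0")
    case True then show ?thesis using u0 sub a M(1) by auto
   next
    case False then show ?thesis using M(2)[of "(x, s)"] sub a T1 by auto
   qed
  qed (use R y1 T1 M in auto)
  have "X <= - 6"
  proof -
   have "ln (T1 * 3 + 32 * t1) <= ln (38 / 3 * (3 * t1))" using T1 y1 by (subst ln_le_cancel_iff) auto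
   also have "\<dots> = ln (38 / 3) + (ln 3 + ln t1)" 
   proof -
    have "ln (38 / 3 * (3 * t1)) = ln (38 / 3) + ln (3 * t1)" by (rule ln_mult_pos) (use y1 in auto)
    moreover have "ln (3 * t1) = ln 3 + ln t1" by (rule ln_mult_pos) (use y1 in auto)
    ultimately show ?thesis by simp
   qed
   also have "ln (38 / 3) <= (38 / 3 - 1 :: real)" by (rule ln_le_minus_one) simp
   finally have l: "ln (T1 * 3 + 32 * t1) - ln t1 - ln 3 <= 12" by simp
   have e: "R\<^sup>2 / (4 * (1 - 0) * t1) = 16" using R y1 by simp
   have e': "(1 - 0) * T1 * 3 + R\<^sup>2 / 2 = T1 * 3 + 32 * t1" using R(2) by simp
   have e3: "(1 - 0) * t1 = t1" "(1 + 2 :: real) = 3" by simp_all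
   have "a <= 12 ==> 2 * 1 + 2 + 1 / 2 * a - 16 <= - 6" for a :: real by simp
   from this[OF l] show ?thesis unfolding X_def e e' e3 .
  qed
  then have "exp X <= exp (- 6)" by simp
  also have "exp (- 6 :: real) <= 1 / 2"
  proof -
   have "2 <= exp (6 :: real)" using exp_ge_add_one_self[of 6] by linarith
   then show ?thesis by (simp add: exp_minus inverse_eq_divide field_simps)
  qed
  also have "1 / 2 <= tht" by (rule th(3))
  finally have "M * exp X <= M * tht" using M(1) by (intro mult_left_mono) auto
  then show ?thesis using F1 by (simp add: mult.commute)
 qed
 show ?thesis
 proof (rule contraction_iterate[OF th(1,2) bd(1), where S = "Om \<times> {0<..<T}"])
  show "- (tht * M) <= w z" if "0 < M" "\<And>z. z \<in> Om \<times> {0<..<T} ==> - M <= w z" "z \<in> Om \<times> {0<..<T}" for M z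
   using step[OF that(1,2), of "fst z" "snd z"] that(3) by auto
  show "- M0 <= w z" if "z \<in> Om \<times> {0<..<T}" for z using bd(2)[of "fst z" "snd z"] that subsetD[OF closure_subset[of Om], of "fst z"] by auto
 qed (use x in \<open>auto simp: T_def\<close>)
qed

lemma log_upper_arith:
 fixes lw lM G lk lt ls d t kappa n g Dm :: real
 assumes t: "0 < t" and kp: "0 < kappa" and n: "0 <= n" and d: "0 <= d" "d <= Dm" and G: "G <= \<bar>g\<bar>"
  and lw: "lw <= lM + (2 * n + 2 + n / 2 * (G - (lk + lt) - ls) - (d - t)\<^sup>2 / (4 * kappa * t))"
 shows "4 * t * lw + d\<^sup>2 / kappa <= t * (4 * \<bar>lM\<bar> + 8 * n + 8 + 2 * n * (\<bar>g\<bar> + \<bar>lk\<bar> + \<bar>ls\<bar>) + 2 * Dm / kappa + 2 * n * \<bar>lt\<bar>)"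
proof -
 have "G - (lk + lt) - ls <= \<bar>g\<bar> + \<bar>lk\<bar> + \<bar>ls\<bar> + \<bar>lt\<bar>" using G abs_ge_minus_self[of lk] abs_ge_minus_self[of lt] abs_ge_minus_self[of ls] by linarith
 then have "n / 2 * (G - (lk + lt) - ls) <= n / 2 * (\<bar>g\<bar> + \<bar>lk\<bar> + \<bar>ls\<bar> + \<bar>lt\<bar>)" using n by (intro mult_left_mono) auto
 then have "lw <= \<bar>lM\<bar> + (2 * n + 2 + n / 2 * (\<bar>g\<bar> + \<bar>lk\<bar> + \<bar>ls\<bar> + \<bar>lt\<bar>) - (d - t)\<^sup>2 / (4 * kappa * t))"
  using lw abs_ge_self[of lM] by (meson add_mono diff_right_mono add_left_mono order_trans)
 then have "4 * t * lw <= 4 * t * (\<bar>lM\<bar> + (2 * n + 2 + n / 2 * (\<bar>g\<bar> + \<bar>lk\<bar> + \<bar>ls\<bar> + \<bar>lt\<bar>) - (d - t)\<^sup>2 / (4 * kappa * t)))"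
  using t by (intro mult_left_mono) auto
 also have "\<dots> = t * (4 * \<bar>lM\<bar> + 8 * n + 8 + 2 * n * (\<bar>g\<bar> + \<bar>lk\<bar> + \<bar>ls\<bar>) + 2 * n * \<bar>lt\<bar>) - (d - t)\<^sup>2 / kappa"
  using t kp by (simp add: field_simps)
 finally have 1: "4 * t * lw <= t * (4 * \<bar>lM\<bar> + 8 * n + 8 + 2 * n * (\<bar>g\<bar> + \<bar>lk\<bar> + \<bar>ls\<bar>) + 2 * n * \<bar>lt\<bar>) - (d - t)\<^sup>2 / kappa" .
 have "d\<^sup>2 - 2 * Dm * t <= (d - t)\<^sup>2"
 proof -
  have "2 * d * t <= 2 * Dm * t" using d t by (intro mult_right_mono) auto
  moreover have "(d - t)\<^sup>2 = d\<^sup>2 - 2 * d * t + t\<^sup>2" by (simp add: power2_diff)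
  moreover have "0 <= t\<^sup>2" by simp
  ultimately show ?thesis by linarith
 qed
 then have "(d\<^sup>2 - 2 * Dm * t) / kappa <= (d - t)\<^sup>2 / kappa" using kp by (intro divide_right_mono) auto
 then have 2: "d\<^sup>2 / kappa - t * (2 * Dm / kappa) <= (d - t)\<^sup>2 / kappa" by (simp add: diff_divide_distrib mult.commute)
 have 3: "t * (a + b + c) = t * (a + c) + t * b" for a b c by (simp add: algebra_simps)
 have "x <= u - v ==> y - z <= v ==> x + y <= u + z" for x y z u v :: real by linarith
 from this[OF 1 2] show ?thesis unfolding 3 .
qed

lemma log_lower_arith:
 fixes lw lh lc ld lt s d t kappa k Dm :: real
 assumes t: "0 < t" "t < 1" and kp: "0 < kappa" and k: "0 <= k" and d: "0 <= d" "d <= Dm" and s: "0 <= s" "s <= d + t" and lt: "lt <= 0"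
  and lw: "lh + (- k * (lc - 2 * ld) - k * lt - s\<^sup>2 / (4 * kappa * t)) <= lw"
 shows "- (t * (4 * \<bar>lh\<bar> + 4 * k * \<bar>lc\<bar> + (2 * Dm + 1) / kappa + 8 * k * \<bar>ld\<bar>)) <= 4 * t * lw + d\<^sup>2 / kappa"
proof -
 have a: "- \<bar>lh\<bar> <= lh" by simp
 have b: "- (k * \<bar>lc\<bar>) <= - k * lc" "- (2 * k * \<bar>ld\<bar>) <= 2 * k * ld" using k by (auto simp: abs_le_iff intro!: mult_left_mono) (metis abs_ge_minus_self minus_le_iff mult_left_mono mult_minus_right)
 have c: "0 <= - k * lt" using k lt by (simp add: mult_nonneg_nonpos)
 have "s\<^sup>2 <= (d + t)\<^sup>2" using s by (intro power_mono) auto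
 also have "\<dots> = d\<^sup>2 + t * (2 * d + t)" by (simp add: power2_eq_square algebra_simps)
 also have "\<dots> <= d\<^sup>2 + t * (2 * Dm + 1)" using t d by (intro add_left_mono mult_left_mono) auto
 finally have s2: "s\<^sup>2 / (4 * kappa * t) <= (d\<^sup>2 + t * (2 * Dm + 1)) / (4 * kappa * t)" using kp t by (intro divide_right_mono) auto
 have "- \<bar>lh\<bar> - k * \<bar>lc\<bar> - 2 * k * \<bar>ld\<bar> - (d\<^sup>2 + t * (2 * Dm + 1)) / (4 * kappa * t) <= lw"
 proof -
  have e: "- k * (lc - 2 * ld) = - k * lc + 2 * k * ld" by (simp add: algebra_simps)
  have "a1 <= lh ==> b1 <= b2 ==> c1 <= c2 ==> 0 <= - k * lt ==> q <= q' ==> lh + (b2 + c2 - k * lt - q) <= lw ==> a1 + b1 + c1 - q' <= lw" for a1 b1 b2 c1 c2 q q' :: real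
   by linarith
  from this[OF a b(1) b(2) c s2 lw[unfolded e]] show ?thesis by simp
 qed
 then have "4 * t * (- \<bar>lh\<bar> - k * \<bar>lc\<bar> - 2 * k * \<bar>ld\<bar> - (d\<^sup>2 + t * (2 * Dm + 1)) / (4 * kappa * t)) <= 4 * t * lw"
  using t by (intro mult_left_mono) auto
 moreover have "4 * t * (- \<bar>lh\<bar> - k * \<bar>lc\<bar> - 2 * k * \<bar>ld\<bar> - (d\<^sup>2 + t * (2 * Dm + 1)) / (4 * kappa * t))
  = - (t * (4 * \<bar>lh\<bar> + 4 * k * \<bar>lc\<bar> + (2 * Dm + 1) / kappa + 8 * k * \<bar>ld\<bar>)) - d\<^sup>2 / kappa"
  using t kp by (simp add: field_simps)
 ultimately show ?thesis by simp
qed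

theorem corollary2p13:
  fixes \<Omega> :: "(real^'n) set"
    and p :: ereal
    and \<omega> :: "real \<Rightarrow> real"
    and r h_lower h_upper :: real
    and h w :: "(real^'n) \<times> real \<Rightarrow> real"
  assumes "2 \<le> CARD('n)"
    and "1 < p"
    and "open \<Omega>" and "connected \<Omega>" and "\<Omega> \<noteq> {}" and "frontier \<Omega> \<noteq> {}"
    and "modulus_of_continuity \<omega>" and "0 < r" and "class_C0 \<omega> r \<Omega>"
    and "0 < h_lower" and "0 < h_upper"
    and "\<And>x t. x \<in> frontier \<Omega> \<Longrightarrow> 0 < t \<Longrightarrow> h_lower \<le> h (x, t) \<and> h (x, t) \<le> h_upper"
    and "bounded_IBVP_solution p \<Omega> h w"
  shows "\<forall>K. compact K \<and> K \<subseteq> closure \<Omega> \<longrightarrow>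
           (\<exists>C. \<forall>\<^sub>F t in at_right 0. \<forall>x\<in>K.
              0 < w (x, t) \<and>
              \<bar>4 * t * ln (w (x, t)) - (- conj_exponent p * (infdist x (frontier \<Omega>))\<^sup>2)\<bar>
                \<le> C * \<bar>t * ln (psi \<omega> r t)\<bar>)"
proof (intro allI impI)
  fix K :: "(real^'n) set" assume K: "compact K \<and> K \<subseteq> closure \<Omega>"
  note O = assms(3) and fne = assms(6) and md = assms(7) and r0 = assms(8) and cls = assms(9) and hl = assms(10) and hb = assms(12)
  define \<alpha> where "\<alpha> = real_of_ereal (1 / p)"
  have al: "0 \<le> \<alpha>" "\<alpha> < 1" and cj: "conj_exponent p = 1 / (1 - \<alpha>)"
  proof -
    have "0 \<le> \<alpha> \<and> \<alpha> < 1 \<and> conj_exponent p = 1 / (1 - \<alpha>)"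
    proof (cases p)
      case (real q)
      then have q: "1 < q" using assms(2) by simp
      have "\<alpha> = 1 / q" using q unfolding \<alpha>_def real by (simp add: one_ereal_def)
      moreover have "conj_exponent p = q / (q - 1)" using real by (simp add: conj_exponent_def)
      moreover have "1 - 1 / q = (q - 1) / q" using q by (simp add: diff_divide_distrib)
      ultimately show ?thesis using q by simp
    qed (use assms(2) in \<open>auto simp: \<alpha>_def conj_exponent_def\<close>)
    then show "0 \<le> \<alpha>" "\<alpha> < 1" "conj_exponent p = 1 / (1 - \<alpha>)" by auto
  qed
  have sol: "game_viscosity_solution p \<Omega> w" and bdd: "bounded (w ` (\<Omega> \<times> {0<..}))"
    and cont: "continuous_on (closure \<Omega> \<times> {0..} - frontier \<Omega> \<times> {0}) w" and ini0: "\<And>x. x \<in> \<Omega> \<Longrightarrow> w (x, 0) = 0"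
    and bnd: "\<And>x t. x \<in> frontier \<Omega> \<Longrightarrow> 0 < t \<Longrightarrow> w (x, t) = h (x, t)"
    using assms(13) unfolding bounded_IBVP_solution_def by auto
  have Ofr: "x \<notin> frontier \<Omega>" if "x \<in> \<Omega>" for x using that O by (simp add: frontier_def interior_open)
  have clf: "x \<in> \<Omega> \<or> x \<in> frontier \<Omega>" if "x \<in> closure \<Omega>" for x using that O by (simp add: frontier_def interior_open)
  have cw: "continuous_on (closure \<Omega> \<times> {0<..}) w" by (rule continuous_on_subset[OF cont]) auto
  have cc: "continuous_on (\<Omega> \<times> {0..}) w" by (rule continuous_on_subset[OF cont]) (use Ofr closure_subset in auto)
  obtain B where B: "\<And>z. z \<in> \<Omega> \<times> {0<..} \<Longrightarrow> \<bar>w z\<bar> \<le> B" using bdd unfolding bounded_iff by auto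
  define M0 where "M0 = \<bar>B\<bar> + h_upper + 1"
  have M0: "0 < M0" using assms(11) by (simp add: M0_def)
  have frb: "h_lower \<le> w (x, t)" "w (x, t) \<le> h_upper" if "x \<in> frontier \<Omega>" "0 < t" for x t using hb[OF that] bnd[OF that] by auto
  have wb: "\<bar>w (x, t)\<bar> \<le> M0" if "x \<in> closure \<Omega>" "0 < t" for x t
    using clf[OF that(1)]
  proof
    assume "x \<in> \<Omega>"
    then have "\<bar>w (x, t)\<bar> \<le> B" using B[of "(x, t)"] that by simp
    then show ?thesis using abs_ge_self[of B] assms(11) unfolding M0_def by linarith
  next
    assume "x \<in> frontier \<Omega>"
    then show ?thesis using frb[of x t] that hl unfolding M0_def by simp
  qed
  have sup: "super_at \<alpha> w x t" "super_at \<alpha> (\<lambda>z. - w z) x t" if "x \<in> \<Omega>" "0 < t" for x t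
    using viscosity_super_at[OF sol that B] unfolding \<alpha>_def by auto
  have "\<exists>Tz>0. \<forall>x\<in>\<Omega>. \<forall>t. 0 < t \<longrightarrow> t < Tz \<longrightarrow> 0 \<le> w (x, t)"
  proof (cases "\<alpha> = 0")
    case True
    have "0 \<le> w (x, t)" if "x \<in> \<Omega>" "0 < t" for x t

    proof (rule positivity_inf[OF O fne cw cc ini0 _ M0 _ _ that])
      show "super_at 0 w x t" if "x \<in> \<Omega>" "0 < t" for x t using sup(1)[OF that] True by simp
      show "- M0 \<le> w (x, t)" if "x \<in> closure \<Omega>" "0 < t" for x t using wb[OF that] by (simp add: abs_le_iff)
      show "0 \<le> w (x, t)" if "x \<in> frontier \<Omega>" "0 < t" for x t using frb(1)[OF that] hl by simp
    qed
    then show ?thesis by (intro exI[of _ 1]) simp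
  next
    case False
    show ?thesis
    proof (rule positivity_fin[OF _ al(2) O cw sup(1) M0])
      show "0 < \<alpha>" using False al by simp
      show "- M0 \<le> w (x, t)" if "x \<in> closure \<Omega>" "0 < t" for x t using wb[OF that] by (simp add: abs_le_iff)
      show "0 \<le> w (x, t)" if "x \<in> frontier \<Omega>" "0 < t" for x t using frb(1)[OF that] hl by simp
      fix K' e assume K': "compact K'" "K' \<subseteq> \<Omega>" and e: "0 < (e :: real)"
      have "continuous_on (K' \<times> {0..1}) w" by (rule continuous_on_subset[OF cc]) (use K' in auto)
      then have "uniformly_continuous_on (K' \<times> {0..1}) w" by (intro compact_uniformly_continuous compact_Times K') auto
      then obtain d where d: "0 < d" "\<And>z z'. z \<in> K' \<times> {0..1} \<Longrightarrow> z' \<in> K' \<times> {0..1} \<Longrightarrow> dist z' z < d \<Longrightarrow> dist (w z') (w z) < e"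
        using e unfolding uniformly_continuous_on_def by metis
      show "\<exists>tb>0. \<forall>x\<in>K'. \<forall>t. 0 < t \<longrightarrow> t \<le> tb \<longrightarrow> - e \<le> w (x, t)"
      proof (intro exI[of _ "min 1 (d / 2)"] conjI ballI allI impI)
        fix x t assume x: "x \<in> K'" "0 < t" "t \<le> min 1 (d / 2)"
        have "dist (w (x, t)) (w (x, 0)) < e" by (rule d(2)) (use x d(1) in \<open>auto simp: dist_Pair_Pair\<close>)
        then show "- e \<le> w (x, t)" using ini0[of x] x K' by (auto simp: dist_real_def abs_less_iff)
      qed (use d in simp)
    qed
  qed
  then obtain Tz where Tz: "0 < Tz" "\<And>x t. x \<in> \<Omega> \<Longrightarrow> 0 < t \<Longrightarrow> t < Tz \<Longrightarrow> 0 \<le> w (x, t)" by blast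
  have pos: "0 \<le> w (x, t)" if "x \<in> closure \<Omega>" "0 < t" "t < Tz" for x t
    using clf[OF that(1)]
  proof
    assume "x \<in> \<Omega>" then show ?thesis using Tz(2) that by blast
  next
    assume "x \<in> frontier \<Omega>" then show ?thesis using frb(1)[of x t] hl that by simp
  qed
  define \<kappa> where "\<kappa> = 1 - \<alpha>"
  have kp: "0 < \<kappa>" using al by (simp add: \<kappa>_def)
  define n where "n = (\<alpha> * real CARD('n) + (1 - 2 * \<alpha>)) / \<kappa>"
  have nk: "(1 - \<alpha>) * n = \<alpha> * real CARD('n) + (1 - 2 * \<alpha>)" unfolding n_def \<kappa>_def using al by simp
  have n0: "0 < n"
  proof -
    have "\<alpha> * 1 \<le> \<alpha> * real CARD('n)" using al by (intro mult_left_mono) (auto simp: Suc_le_eq)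
    then show ?thesis unfolding n_def using al kp by (intro divide_pos_pos) linarith+
  qed
  define d where "d = (\<lambda>x. infdist x (frontier \<Omega>))"
  have "bounded (d ` K)" unfolding d_def by (intro compact_imp_bounded compact_continuous_image continuous_intros) (use K in auto)
  then obtain D1 where "\<forall>x\<in>K. \<bar>d x\<bar> \<le> D1" unfolding bounded_iff by auto
  then obtain Dm where Dm: "\<And>x. x \<in> K \<Longrightarrow> d x \<le> Dm" "0 \<le> Dm"
    by (metis abs_ge_self abs_ge_zero order_trans max.cobounded1 max.cobounded2)
  have d0: "0 \<le> d x" for x by (simp add: d_def infdist_nonneg)
  define g where "g = ln (\<kappa> * 1 * (n + 2) + Dm\<^sup>2 / 2)"
  define c1 where "c1 = 4 * \<bar>ln M0\<bar> + 8 * n + 8 + 2 * n * (\<bar>g\<bar> + \<bar>ln \<kappa>\<bar> + \<bar>ln (n + 2)\<bar>) + 2 * Dm / \<kappa> + 1 / \<kappa>"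
  have upper: "4 * t * ln (w (x, t)) + (d x)\<^sup>2 / \<kappa> \<le> t * (c1 + 2 * n * \<bar>ln t\<bar>)" if x: "x \<in> K" and t: "0 < t" "t < 1" and wp: "0 < w (x, t)" for x t
  proof (cases "d x \<le> t")
    case True
    have xc: "x \<in> closure \<Omega>" using K x by auto
    have "w (x, t) \<le> M0" using wb[OF xc t(1)] by simp
    then have "ln (w (x, t)) \<le> ln M0" using wp M0 by simp
    then have "4 * t * ln (w (x, t)) \<le> 4 * t * \<bar>ln M0\<bar>" using t by (intro mult_left_mono) auto
    moreover have "(d x)\<^sup>2 / \<kappa> \<le> t * (1 / \<kappa>)"
    proof -
      have "d x * d x \<le> t * 1" using True t d0 by (intro mult_mono) auto
      then show ?thesis using kp by (simp add: power2_eq_square divide_right_mono)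
    qed
    moreover have "t * (4 * \<bar>ln M0\<bar> + 1 / \<kappa>) \<le> t * (c1 + 2 * n * \<bar>ln t\<bar>)"

    proof (rule mult_left_mono)
      have "0 \<le> 2 * n * (\<bar>g\<bar> + \<bar>ln \<kappa>\<bar> + \<bar>ln (n + 2)\<bar>)" "0 \<le> 2 * Dm / \<kappa>" "0 \<le> 2 * n * \<bar>ln t\<bar>" "0 \<le> 8 * n" using n0 kp Dm(2) by auto
      then show "4 * \<bar>ln M0\<bar> + 1 / \<kappa> \<le> c1 + 2 * n * \<bar>ln t\<bar>" unfolding c1_def by linarith
    qed (use t in simp)
    moreover have "t * (4 * \<bar>ln M0\<bar> + 1 / \<kappa>) = 4 * t * \<bar>ln M0\<bar> + t * (1 / \<kappa>)" by (simp add: algebra_simps)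
    moreover have "a \<le> a' \<Longrightarrow> b \<le> b' \<Longrightarrow> c = a' + b' \<Longrightarrow> c \<le> e \<Longrightarrow> a + b \<le> e" for a a' b b' c e :: real by linarith
    ultimately show ?thesis by blast
  next
    case False
    define R where "R = d x - t"
    have R: "0 < R" "R < d x" using False t by (auto simp: R_def)
    have xO: "x \<in> \<Omega>"
    proof -
      have "x \<notin> frontier \<Omega>" using False t by (auto simp: d_def)
      then show ?thesis using clf[of x] K x by auto
    qed
    have sub: "cball x R \<subseteq> \<Omega>" by (rule cball_inside[OF xO]) (use R in \<open>auto simp: d_def\<close>)
    have "- (M0 * exp (2 * n + 2 + n / 2 * (ln ((1 - \<alpha>) * 1 * (n + 2) + R\<^sup>2 / 2) - ln ((1 - \<alpha>) * t) - ln (n + 2)) - R\<^sup>2 / (4 * (1 - \<alpha>) * t))) \<le> - w (x, t)"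
    proof (rule ball_lower[where u = "\<lambda>z. - w z", OF al R(1) _ less_imp_le[OF M0] _ _ _ _ nk t])
      show "continuous_on (cball x R \<times> {0..1}) (\<lambda>z. - w z)"
        by (intro continuous_intros continuous_on_subset[OF cc]) (use sub in auto)
      show "- w (z, 0) = 0" if "z \<in> cball x R" for z using ini0 sub that by auto
      show "super_at \<alpha> (\<lambda>z. - w z) z s" if "z \<in> ball x R" "0 < s" "s < 1" for z s using sup(2) sub that ball_subset_cball by blast
      show "- M0 \<le> - w (z, s)" if a: "z \<in> cball x R" "0 \<le> s" "s \<le> 1" for z s
      proof (cases "s = 0")
        case True then show ?thesis using ini0 sub a M0 by auto
      next
        case False
        have "z \<in> closure \<Omega>" using sub a closure_subset by blast
        then show ?thesis using wb[of z s] False a by (simp add: abs_le_iff)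
      qed
    qed simp
    then have le: "w (x, t) \<le> M0 * exp (2 * n + 2 + n / 2 * (ln (\<kappa> * 1 * (n + 2) + R\<^sup>2 / 2) - ln (\<kappa> * t) - ln (n + 2)) - R\<^sup>2 / (4 * \<kappa> * t))"
      unfolding \<kappa>_def by simp
    have lnl: "ln (w (x, t)) \<le> ln M0 + (2 * n + 2 + n / 2 * (ln (\<kappa> * 1 * (n + 2) + R\<^sup>2 / 2) - (ln \<kappa> + ln t) - ln (n + 2)) - (d x - t)\<^sup>2 / (4 * \<kappa> * t))"
    proof -
      have "ln (w (x, t)) \<le> ln (M0 * exp (2 * n + 2 + n / 2 * (ln (\<kappa> * 1 * (n + 2) + R\<^sup>2 / 2) - ln (\<kappa> * t) - ln (n + 2)) - R\<^sup>2 / (4 * \<kappa> * t)))"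
        using le wp M0 by (subst ln_le_cancel_iff) auto
      also have "\<dots> = ln M0 + (2 * n + 2 + n / 2 * (ln (\<kappa> * 1 * (n + 2) + R\<^sup>2 / 2) - ln (\<kappa> * t) - ln (n + 2)) - R\<^sup>2 / (4 * \<kappa> * t))"
        using M0 by (subst ln_mult_pos) (auto simp only: exp_gt_zero ln_exp)
      also have "ln (\<kappa> * t) = ln \<kappa> + ln t" using kp t by (simp add: ln_mult)
      finally show ?thesis unfolding R_def .
    qed
    have G: "ln (\<kappa> * 1 * (n + 2) + R\<^sup>2 / 2) \<le> \<bar>g\<bar>"
    proof -
      have "R\<^sup>2 \<le> Dm\<^sup>2" using R Dm(1)[OF x] by (intro power_mono) auto
      then have "ln (\<kappa> * 1 * (n + 2) + R\<^sup>2 / 2) \<le> g" unfolding g_def using kp n0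
        by (subst ln_le_cancel_iff) (auto intro!: add_pos_nonneg)
      then show ?thesis by linarith
    qed
    have "4 * t * ln (w (x, t)) + (d x)\<^sup>2 / \<kappa> \<le> t * (4 * \<bar>ln M0\<bar> + 8 * n + 8 + 2 * n * (\<bar>g\<bar> + \<bar>ln \<kappa>\<bar> + \<bar>ln (n + 2)\<bar>) + 2 * Dm / \<kappa> + 2 * n * \<bar>ln t\<bar>)"
      by (rule log_upper_arith[OF t(1) kp less_imp_le[OF n0] d0 Dm(1)[OF x] G lnl])
    also have "\<dots> \<le> t * (c1 + 2 * n * \<bar>ln t\<bar>)" unfolding c1_def using t kp by (intro mult_left_mono) auto
    finally show ?thesis .
  qed
  define k where "k = n / 2"
  have k0: "0 < k" and kk: "2 * (1 - \<alpha>) * k = \<alpha> * real CARD('n) + (1 - 2 * \<alpha>)"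
  proof -
    show "0 < k" using n0 by (simp add: k_def)
    have "2 * (1 - \<alpha>) * k = (1 - \<alpha>) * n" by (simp add: k_def)
    then show "2 * (1 - \<alpha>) * k = \<alpha> * real CARD('n) + (1 - 2 * \<alpha>)" unfolding nk .
  qed
  define c2 where "c2 = 4 * \<bar>ln h_lower\<bar> + 4 * k * \<bar>ln (4 * \<kappa> * k)\<bar> + (2 * Dm + 1) / \<kappa>"
  have lower: "0 < w (x, t) \<and> - (t * (c2 + 8 * k * \<bar>ln (psi \<omega> r t)\<bar>)) \<le> 4 * t * ln (w (x, t)) + (d x)\<^sup>2 / \<kappa>"
    if x: "x \<in> K" and t: "0 < t" "t < 1" "t < Tz" "2 * t < r" for x t
  proof -
    have xc: "x \<in> closure \<Omega>" using K x by auto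
    obtain y where y: "y \<in> frontier \<Omega>" "d x = dist x y"
      unfolding d_def using infdist_attains_inf[OF frontier_closed fne] by blast
    obtain e where e: "norm e = 1" "\<And>q. q \<in> closure \<Omega> \<Longrightarrow> psi \<omega> r t \<le> norm (q - (y + t *\<^sub>R e))"
      using exterior_point[OF md cls O y(1) t(1,4)] by blast
    define z where "z = y + t *\<^sub>R e"
    define \<delta> where "\<delta> = psi \<omega> r t"
    have dl: "0 < \<delta>" unfolding \<delta>_def by (rule psi_pos[OF md t(1) r0])
    have le: "h_lower * exp (- k * ln (4 * (1 - \<alpha>) * k / \<delta>\<^sup>2) - k * ln t - (norm (x - z))\<^sup>2 / (4 * (1 - \<alpha>) * t)) \<le> w (x, t)"
      by (rule exterior_lower[OF al O Tz(1) cw sup(1) pos frb(1) hl dl _ kk xc t(1,3)])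
        (use e(2) in \<open>auto simp: z_def \<delta>_def\<close>)
    have "0 < h_lower * exp (- k * ln (4 * (1 - \<alpha>) * k / \<delta>\<^sup>2) - k * ln t - (norm (x - z))\<^sup>2 / (4 * (1 - \<alpha>) * t))" using hl by simp
    then have wp: "0 < w (x, t)" using le by linarith
    have "ln (h_lower * exp (- k * ln (4 * (1 - \<alpha>) * k / \<delta>\<^sup>2) - k * ln t - (norm (x - z))\<^sup>2 / (4 * (1 - \<alpha>) * t))) \<le> ln (w (x, t))"
      using le wp hl by (subst ln_le_cancel_iff) auto
    then have "ln h_lower + (- k * ln (4 * (1 - \<alpha>) * k / \<delta>\<^sup>2) - k * ln t - (norm (x - z))\<^sup>2 / (4 * (1 - \<alpha>) * t)) \<le> ln (w (x, t))"
      using hl by (subst (asm) ln_mult_pos) (auto simp only: exp_gt_zero ln_exp)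
    moreover have "ln (4 * (1 - \<alpha>) * k / \<delta>\<^sup>2) = ln (4 * \<kappa> * k) - 2 * ln \<delta>"
      using kp k0 dl unfolding \<kappa>_def[symmetric] by (subst ln_div) (auto simp: ln_realpow)
    ultimately have lnw: "ln h_lower + (- k * (ln (4 * \<kappa> * k) - 2 * ln \<delta>) - k * ln t - (norm (x - z))\<^sup>2 / (4 * \<kappa> * t)) \<le> ln (w (x, t))"
      unfolding \<kappa>_def[symmetric] by (simp only:)
    have "norm (x - z) \<le> norm (x - y) + norm (t *\<^sub>R e)" using norm_triangle_ineq4[of "x - y" "t *\<^sub>R e"] by (simp add: z_def diff_diff_eq)
    then have s: "norm (x - z) \<le> d x + t" using y(2) e(1) t by (simp add: dist_norm)
    have lt: "ln t \<le> 0" using t by simp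
    show ?thesis using wp log_lower_arith[OF t(1,2) kp less_imp_le[OF k0] d0 Dm(1)[OF x] norm_ge_zero s lt lnw]
      unfolding c2_def \<delta>_def by simp
  qed
  define C where "C = c1 + 2 * n + c2 + 8 * k"
  define b where "b = min (min 1 Tz) (min (r / 2) (exp (- 1)))"
  have b: "0 < b" using Tz r0 by (simp add: b_def)
  have c12: "0 \<le> c1" "0 \<le> c2"
  proof -
    have "0 \<le> 2 * n * (\<bar>g\<bar> + \<bar>ln \<kappa>\<bar> + \<bar>ln (n + 2)\<bar>)" "0 \<le> 2 * Dm / \<kappa>" "0 \<le> 1 / \<kappa>" "0 \<le> 8 * n" using n0 kp Dm(2) by auto
    then show "0 \<le> c1" unfolding c1_def by linarith
    have "0 \<le> 4 * k * \<bar>ln (4 * \<kappa> * k)\<bar>" "0 \<le> (2 * Dm + 1) / \<kappa>" using k0 kp Dm(2) by auto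
    then show "0 \<le> c2" unfolding c2_def by linarith
  qed
  show "\<exists>C. \<forall>\<^sub>F t in at_right 0. \<forall>x\<in>K. 0 < w (x, t) \<and>
              \<bar>4 * t * ln (w (x, t)) - (- conj_exponent p * (infdist x (frontier \<Omega>))\<^sup>2)\<bar> \<le> C * \<bar>t * ln (psi \<omega> r t)\<bar>"
    unfolding eventually_at_right_field
  proof (rule exI[of _ C], rule exI[of _ b], intro conjI b allI impI ballI)
    fix t x assume t: "0 < t" "t < b" and x: "x \<in> K"
    have tt: "t < 1" "t < Tz" "t < r / 2" "t < exp (- 1)" using t(2) unfolding b_def by simp_all
    define l where "l = \<bar>ln (psi \<omega> r t)\<bar>"
    have ps: "0 < psi \<omega> r t" "psi \<omega> r t \<le> t" using psi_pos[OF md t(1) r0] psi_le_self[OF md t(1) r0] by auto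
    have l1: "ln (psi \<omega> r t) \<le> ln t" using ps t by simp
    have "ln t < ln (exp (- 1))" using tt(4) t(1) by (subst ln_less_cancel_iff) auto
    then have l2: "ln t < - 1" by simp
    have l: "1 \<le> l" "\<bar>ln t\<bar> \<le> l" using l1 l2 unfolding l_def by linarith+
    have lo: "0 < w (x, t)" "- (t * (c2 + 8 * k * l)) \<le> 4 * t * ln (w (x, t)) + (d x)\<^sup>2 / \<kappa>"
      using lower[OF x t(1) tt(1,2)] tt(3) unfolding l_def by auto
    show "0 < w (x, t)" by (rule lo(1))
    have up: "4 * t * ln (w (x, t)) + (d x)\<^sup>2 / \<kappa> \<le> t * (c1 + 2 * n * \<bar>ln t\<bar>)" by (rule upper[OF x t(1) tt(1) lo(1)])
    have "c1 * 1 \<le> c1 * l" by (rule mult_left_mono[OF l(1) c12(1)])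
    moreover have "c2 * 1 \<le> c2 * l" by (rule mult_left_mono[OF l(1) c12(2)])
    moreover have "2 * n * \<bar>ln t\<bar> \<le> 2 * n * l" by (rule mult_left_mono[OF l(2)]) (use n0 in simp)
    moreover have "0 \<le> c1 * l" "0 \<le> c2 * l" "0 \<le> 2 * n * l" "0 \<le> 8 * k * l" using c12 l n0 k0 by auto
    moreover have "C * l = c1 * l + 2 * n * l + c2 * l + 8 * k * l" by (simp add: C_def algebra_simps)
    ultimately have "c1 + 2 * n * \<bar>ln t\<bar> \<le> C * l" "c2 + 8 * k * l \<le> C * l" by linarith+
    then have "t * (c1 + 2 * n * \<bar>ln t\<bar>) \<le> t * (C * l)" "t * (c2 + 8 * k * l) \<le> t * (C * l)" using t by (auto intro!: mult_left_mono)
    then have "\<bar>4 * t * ln (w (x, t)) + (d x)\<^sup>2 / \<kappa>\<bar> \<le> t * (C * l)" using up lo(2) unfolding abs_le_iff by linarith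
    moreover have "t * (C * l) = C * \<bar>t * ln (psi \<omega> r t)\<bar>" unfolding l_def abs_mult using t by simp
    moreover have "4 * t * ln (w (x, t)) - (- conj_exponent p * (infdist x (frontier \<Omega>))\<^sup>2) = 4 * t * ln (w (x, t)) + (d x)\<^sup>2 / \<kappa>"
      unfolding cj d_def \<kappa>_def by simp
    ultimately show "\<bar>4 * t * ln (w (x, t)) - (- conj_exponent p * (infdist x (frontier \<Omega>))\<^sup>2)\<bar> \<le> C * \<bar>t * ln (psi \<omega> r t)\<bar>"
      by (simp only:)
  qed
qed

end
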